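(* Let $\mathcal{C}$ be a category of Brauer type with parity sign $\epsilon$ whose parameters satisfy $f=f'=0$, $\lambda'\neq\lambda$ and $\varsigma\neq0$. Then $e^2=-\epsilon$ and $$\lambda'=-\lambda,\ \delta=0,\ a=\lambda^2,\ b=0,\ c=0,\ \varsigma'=\epsilon\varsigma,\ \rho=\epsilon\varsigma e\lambda,\ e'=-\epsilon e,\ d=d'=f=f'=0,\ D=E=D'=E'=0,\ F=-\epsilon e\lambda^2,\ F'=e\lambda^2 .$$ Conversely, for all $\lambda,\varsigma\in\mathbb{K}\setminus\{0\}$ and $e\in\mathbb{K}$ with $e^2=-\epsilon$ (so $\lambda,\varsigma$ are independent), the monoidal supercategory presented by the defining relations with these parameter values is a category of Brauer type, denoted $\mathcal{C}^{0,0}_{-\lambda,\varsigma}(\epsilon,e,-\epsilon e)$.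
   Context: $\mathbb{K}$ is a field of characteristic different from 2; everything is $\mathbb{K}$-linear. A strict monoidal supercategory is a strict monoidal category enriched over $\mathbb{Z}/2$-graded vector spaces, with interchange law $(f\otimes g)\circ(h\otimes k)=(-1)^{|g||h|}(f\circ h)\otimes(g\circ k)$. A category of Brauer type is a strict monoidal supercategory whose objects are generated by one object $\bullet$ ($m\in\mathbb{N}$ denotes $\bullet^{\otimes m}$, $1_m$ its identity, $I=1_1$), whose morphisms are generated by an even $H\in\mathrm{Hom}(2,2)$ and $A\in\mathrm{Hom}(2,0)$, $U\in\mathrm{Hom}(0,2)$ which are both even ($\epsilon=1$) or both odd ($\epsilon=-1$), such that $H$ is an isomorphism satisfying the braid relation $(H\otimes I)(I\otimes H)(H\otimes I)=(I\otimes H)(H\otimes I)(I\otimes H)$, and such that for all $m,n$ the standard expressions of $(m,n)$-Brauer diagrams form a basis of $\mathrm{Hom}(m,n)$. Parameters. In a category of Brauer type there are unique scalars with (the defining relations, together with the braid relation): $HU=\lambda U$, $AH=\lambda'A$; $AU=\delta$; $(A\otimes I)(I\otimes U)=\varsigma I$, $(I\otimes A)(U\otimes I)=\varsigma' I$; $(A\otimes I)(I\otimes H)(U\otimes I)=\rho I$; $H^2=a1_2+bH+cUA$; $(H\otimes I)(I\otimes U)=d(U\otimes I)+e(I\otimes H)(U\otimes I)+f(I\otimes U)$; $(H\otimes I)(I\otimes H)(U\otimes I)=D(U\otimes I)+E(I\otimes H)(U\otimes I)+F(I\otimes U)$; $(I\otimes A)(H\otimes I)=d'(A\otimes I)+e'(A\otimes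 I)(I\otimes H)+f'(I\otimes A)$; $(A\otimes I)(I\otimes H)(H\otimes I)=D'(A\otimes I)+E'(A\otimes I)(I\otimes H)+F'(I\otimes A)$. Standard expressions: $s_i^n=1_{i-1}\otimes H\otimes 1_{n-i-1}$, $u_i^n=1_{i-1}\otimes U\otimes 1_{n-i+1}$, $\mathsf{a}_i^n=1_{i-1}\otimes A\otimes 1_{n-i+1}$; for $p\ge1$, $s\ge0$, $p+s\le n+1$ put $I_s^{n,p}=s_{p+s}^{n+2}\cdots s_{p+1}^{n+2}u_p^n$ and $J_s^{n,p}=\mathsf{a}_p^ns_{p+1}^{n+2}\cdots s_{p+s}^{n+2}$. For $n-r=2k\ge0$, $I(r,n)$ is the set of products $I_{s_1}^{n-2,p_1}\cdots I_{s_k}^{r,p_k}$ with $p_1>\dots>p_k$, $J(n,r)$ the set of products $J_{s_1}^{r,p_1}\cdots J_{s_k}^{n-2,p_k}$ with $p_1<\dots<p_k$, and $H(r)$ a fixed set of words in the $s_i^r$ with exactly one reduced expression for each element of $S_r$, none containing a consecutive subword $s_is_{i+1}s_i$. The standard expressions are the products $UXA$ with $U\in I(r,n)$, $X\in H(r)$, $A\in J(m,r)$, $r\ge0$. *)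

theory Defs
  imports
    "Jordan_Normal_Form.VS_Connect"
    "HOL-Combinatorics.Permutations"
    "HOL-Library.Sublist"
    "HOL-Library.Z2"
begin

section \<open>Strict monoidal supercategories\<close>

text \<open>Degrees live in the two-element ring \<^typ>\<open>bit\<close>, that is in \<open>\<int>/2\<close>; \<open>Part C p X Y\<close> is the
  degree-\<open>p\<close> component of \<open>Hom C X Y\<close>.  As usual for categories whose morphisms determine their
  source and target, composition and the tensor product of morphisms take no object arguments; their
  values matter only on composable morphisms, respectively on actual morphisms.\<close>

record ('o, 'm, 'k) supercat =
  Ob :: "'o monoid"
  Hom :: "'o \<Rightarrow> 'o \<Rightarrow> ('k, 'm) module"
  Part :: "bit \<Rightarrow> 'o \<Rightarrow> 'o \<Rightarrow> 'm set"
  Idn :: "'o \<Rightarrow> 'm"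
  Cmp :: "'m \<Rightarrow> 'm \<Rightarrow> 'm"  (infixr \<open>\<cdot>\<index>\<close> 70)
  Tns :: "'m \<Rightarrow> 'm \<Rightarrow> 'm"  (infixr \<open>\<boxtimes>\<index>\<close> 75)

definition koszul :: "bit \<Rightarrow> bit \<Rightarrow> 'k::field"
  where "koszul p q = (if p = 1 \<and> q = 1 then - 1 else 1)"

text \<open>Linearity of \<open>g \<mapsto> g \<cdot> f\<close> between Hom spaces includes that composites of composable
  morphisms lie in the expected Hom space.\<close>

locale strict_monoidal_supercategory =
  fixes C :: "('o, 'm, 'k::field) supercat" (structure)
  assumes ob_monoid: "monoid (Ob C)"
    and hom_vectorspace:
      "\<lbrakk>X \<in> carrier (Ob C); Y \<in> carrier (Ob C)\<rbrakk> \<Longrightarrow> vectorspace class_ring (Hom C X Y)"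
    and part_subspace:
      "\<lbrakk>X \<in> carrier (Ob C); Y \<in> carrier (Ob C)\<rbrakk>
        \<Longrightarrow> subspace class_ring (Part C p X Y) (Hom C X Y)"
    and part_direct_sum:
      "\<lbrakk>X \<in> carrier (Ob C); Y \<in> carrier (Ob C); f \<in> carrier (Hom C X Y)\<rbrakk>
        \<Longrightarrow> \<exists>!z. fst z \<in> Part C 0 X Y \<and> snd z \<in> Part C 1 X Y \<and> f = fst z \<oplus>\<^bsub>Hom C X Y\<^esub> snd z"
    and id_part: "X \<in> carrier (Ob C) \<Longrightarrow> Idn C X \<in> Part C 0 X X"
    and comp_part:
      "\<lbrakk>X \<in> carrier (Ob C); Y \<in> carrier (Ob C); Z \<in> carrier (Ob C);
        g \<in> Part C p Y Z; f \<in> Part C q X Y\<rbrakk> \<Longrightarrow> g \<cdot> f \<in> Part C (p + q) X Z"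
    and comp_linear_left:
      "\<lbrakk>X \<in> carrier (Ob C); Y \<in> carrier (Ob C); Z \<in> carrier (Ob C); f \<in> carrier (Hom C X Y)\<rbrakk>
        \<Longrightarrow> linear_map class_ring (Hom C Y Z) (Hom C X Z) (\<lambda>g. g \<cdot> f)"
    and comp_linear_right:
      "\<lbrakk>X \<in> carrier (Ob C); Y \<in> carrier (Ob C); Z \<in> carrier (Ob C); g \<in> carrier (Hom C Y Z)\<rbrakk>
        \<Longrightarrow> linear_map class_ring (Hom C X Y) (Hom C X Z) (\<lambda>f. g \<cdot> f)"
    and comp_assoc:
      "\<lbrakk>X \<in> carrier (Ob C); Y \<in> carrier (Ob C); Z \<in> carrier (Ob C); W \<in> carrier (Ob C);
        h \<in> carrier (Hom C Z W); g \<in> carrier (Hom C Y Z); f \<in> carrier (Hom C X Y)\<rbrakk>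
        \<Longrightarrow> (h \<cdot> g) \<cdot> f = h \<cdot> (g \<cdot> f)"
    and comp_id_left:
      "\<lbrakk>X \<in> carrier (Ob C); Y \<in> carrier (Ob C); f \<in> carrier (Hom C X Y)\<rbrakk> \<Longrightarrow> Idn C Y \<cdot> f = f"
    and comp_id_right:
      "\<lbrakk>X \<in> carrier (Ob C); Y \<in> carrier (Ob C); f \<in> carrier (Hom C X Y)\<rbrakk> \<Longrightarrow> f \<cdot> Idn C X = f"
    and tensor_part:
      "\<lbrakk>X \<in> carrier (Ob C); Y \<in> carrier (Ob C); X' \<in> carrier (Ob C); Y' \<in> carrier (Ob C);
        f \<in> Part C p X Y; g \<in> Part C q X' Y'\<rbrakk>
        \<Longrightarrow> f \<boxtimes> g \<in> Part C (p + q) (X \<otimes>\<^bsub>Ob C\<^esub> X') (Y \<otimes>\<^bsub>Ob C\<^esub> Y')"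
    and tensor_linear_left:
      "\<lbrakk>X \<in> carrier (Ob C); Y \<in> carrier (Ob C); X' \<in> carrier (Ob C); Y' \<in> carrier (Ob C);
        g \<in> carrier (Hom C X' Y')\<rbrakk>
        \<Longrightarrow> linear_map class_ring (Hom C X Y) (Hom C (X \<otimes>\<^bsub>Ob C\<^esub> X') (Y \<otimes>\<^bsub>Ob C\<^esub> Y')) (\<lambda>f. f \<boxtimes> g)"
    and tensor_linear_right:
      "\<lbrakk>X \<in> carrier (Ob C); Y \<in> carrier (Ob C); X' \<in> carrier (Ob C); Y' \<in> carrier (Ob C);
        f \<in> carrier (Hom C X Y)\<rbrakk>
        \<Longrightarrow> linear_map class_ring (Hom C X' Y') (Hom C (X \<otimes>\<^bsub>Ob C\<^esub> X') (Y \<otimes>\<^bsub>Ob C\<^esub> Y')) (\<lambda>g. f \<boxtimes> g)"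
    and tensor_assoc:
      "\<lbrakk>X \<in> carrier (Ob C); Y \<in> carrier (Ob C); X' \<in> carrier (Ob C); Y' \<in> carrier (Ob C);
        X'' \<in> carrier (Ob C); Y'' \<in> carrier (Ob C);
        f \<in> carrier (Hom C X Y); g \<in> carrier (Hom C X' Y'); h \<in> carrier (Hom C X'' Y'')\<rbrakk>
        \<Longrightarrow> (f \<boxtimes> g) \<boxtimes> h = f \<boxtimes> (g \<boxtimes> h)"
    and tensor_unit_left:
      "\<lbrakk>X \<in> carrier (Ob C); Y \<in> carrier (Ob C); f \<in> carrier (Hom C X Y)\<rbrakk>
        \<Longrightarrow> Idn C \<one>\<^bsub>Ob C\<^esub> \<boxtimes> f = f"
    and tensor_unit_right:
      "\<lbrakk>X \<in> carrier (Ob C); Y \<in> carrier (Ob C); f \<in> carrier (Hom C X Y)\<rbrakk>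
        \<Longrightarrow> f \<boxtimes> Idn C \<one>\<^bsub>Ob C\<^esub> = f"
    and tensor_id:
      "\<lbrakk>X \<in> carrier (Ob C); Y \<in> carrier (Ob C)\<rbrakk>
        \<Longrightarrow> Idn C X \<boxtimes> Idn C Y = Idn C (X \<otimes>\<^bsub>Ob C\<^esub> Y)"
    and super_interchange:
      "\<lbrakk>X \<in> carrier (Ob C); Y \<in> carrier (Ob C); Z \<in> carrier (Ob C);
        X' \<in> carrier (Ob C); Y' \<in> carrier (Ob C); Z' \<in> carrier (Ob C);
        f \<in> carrier (Hom C Y Z); g \<in> Part C p Y' Z';
        h \<in> Part C q X Y; k \<in> carrier (Hom C X' Y')\<rbrakk>
        \<Longrightarrow> (f \<boxtimes> g) \<cdot> (h \<boxtimes> k)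
          = koszul p q \<odot>\<^bsub>Hom C (X \<otimes>\<^bsub>Ob C\<^esub> X') (Z \<otimes>\<^bsub>Ob C\<^esub> Z')\<^esub> ((f \<cdot> h) \<boxtimes> (g \<cdot> k))"


section \<open>Formal expressions in the generators\<close>

text \<open>Formal \<open>\<bbbK>\<close>-linear expressions in the generators \<open>H \<in> Hom(2,2)\<close>, \<open>A \<in> Hom(2,0)\<close>,
  \<open>U \<in> Hom(0,2)\<close>; objects are tensor powers of one object and are represented by their
  exponents.\<close>

datatype 'k bexp =
    Ident nat
  | GenH
  | GenA
  | GenU
  | Null nat nat
  | Add "'k bexp" "'k bexp"  (infixl \<open>+\<^sub>e\<close> 65)
  | Scale 'k "'k bexp"  (infixr \<open>*\<^sub>e\<close> 68)
  | Comp "'k bexp" "'k bexp"  (infixr \<open>\<circ>\<^sub>e\<close> 70)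
  | Tens "'k bexp" "'k bexp"  (infixr \<open>\<otimes>\<^sub>e\<close> 75)

primrec bsrc :: "'k bexp \<Rightarrow> nat" where
  "bsrc (Ident n) = n"
| "bsrc GenH = 2"
| "bsrc GenA = 2"
| "bsrc GenU = 0"
| "bsrc (Null m n) = m"
| "bsrc (s +\<^sub>e t) = bsrc s"
| "bsrc (c *\<^sub>e t) = bsrc t"
| "bsrc (s \<circ>\<^sub>e t) = bsrc t"
| "bsrc (s \<otimes>\<^sub>e t) = bsrc s + bsrc t"

primrec btgt :: "'k bexp \<Rightarrow> nat" where
  "btgt (Ident n) = n"
| "btgt GenH = 2"
| "btgt GenA = 0"
| "btgt GenU = 2"
| "btgt (Null m n) = n"
| "btgt (s +\<^sub>e t) = btgt s"
| "btgt (c *\<^sub>e t) = btgt t"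
| "btgt (s \<circ>\<^sub>e t) = btgt s"
| "btgt (s \<otimes>\<^sub>e t) = btgt s + btgt t"

primrec bwt :: "'k bexp \<Rightarrow> bool" where
  "bwt (Ident n) \<longleftrightarrow> True"
| "bwt GenH \<longleftrightarrow> True"
| "bwt GenA \<longleftrightarrow> True"
| "bwt GenU \<longleftrightarrow> True"
| "bwt (Null m n) \<longleftrightarrow> True"
| "bwt (s +\<^sub>e t) \<longleftrightarrow> bwt s \<and> bwt t \<and> bsrc s = bsrc t \<and> btgt s = btgt t"
| "bwt (c *\<^sub>e t) \<longleftrightarrow> bwt t"
| "bwt (s \<circ>\<^sub>e t) \<longleftrightarrow> bwt s \<and> bwt t \<and> bsrc s = btgt t"
| "bwt (s \<otimes>\<^sub>e t) \<longleftrightarrow> bwt s \<and> bwt t"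

definition bexps :: "nat \<Rightarrow> nat \<Rightarrow> 'k bexp set"
  where "bexps m n = {t. bwt t \<and> bsrc t = m \<and> btgt t = n}"

text \<open>Homogeneity of an expression in degree \<open>p\<close>, where \<open>\<pi>\<close> is the common degree of \<open>A\<close> and \<open>U\<close>.
  The null expression is homogeneous in both degrees.\<close>

primrec bhomog :: "bit \<Rightarrow> 'k bexp \<Rightarrow> bit \<Rightarrow> bool" where
  "bhomog \<pi> (Ident n) p \<longleftrightarrow> p = 0"
| "bhomog \<pi> GenH p \<longleftrightarrow> p = 0"
| "bhomog \<pi> GenA p \<longleftrightarrow> p = \<pi>"
| "bhomog \<pi> GenU p \<longleftrightarrow> p = \<pi>"
| "bhomog \<pi> (Null m n) p \<longleftrightarrow> True"
| "bhomog \<pi> (s +\<^sub>e t) p \<longleftrightarrow> bhomog \<pi> s p \<and> bhomog \<pi> t p"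
| "bhomog \<pi> (c *\<^sub>e t) p \<longleftrightarrow> bhomog \<pi> t p"
| "bhomog \<pi> (s \<circ>\<^sub>e t) p \<longleftrightarrow> (\<exists>q r. p = q + r \<and> bhomog \<pi> s q \<and> bhomog \<pi> t r)"
| "bhomog \<pi> (s \<otimes>\<^sub>e t) p \<longleftrightarrow> (\<exists>q r. p = q + r \<and> bhomog \<pi> s q \<and> bhomog \<pi> t r)"

definition gen_parity :: "'k::field \<Rightarrow> bit"
  where "gen_parity \<epsilon> = (if \<epsilon> = 1 then 0 else 1)"

definition homn :: "('o, 'm, 'k) supercat \<Rightarrow> 'o \<Rightarrow> nat \<Rightarrow> nat \<Rightarrow> ('k, 'm) module"
  where "homn C X m n = Hom C (X [^]\<^bsub>Ob C\<^esub> m) (X [^]\<^bsub>Ob C\<^esub> n)"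

definition partn :: "('o, 'm, 'k) supercat \<Rightarrow> 'o \<Rightarrow> bit \<Rightarrow> nat \<Rightarrow> nat \<Rightarrow> 'm set"
  where "partn C X p m n = Part C p (X [^]\<^bsub>Ob C\<^esub> m) (X [^]\<^bsub>Ob C\<^esub> n)"

text \<open>Value of an expression in \<open>C\<close> when the generating object is \<open>X\<close> and \<open>H, A, U\<close> are
  interpreted by \<open>h, a, u\<close>.\<close>

primrec bval :: "('o, 'm, 'k) supercat \<Rightarrow> 'o \<Rightarrow> 'm \<Rightarrow> 'm \<Rightarrow> 'm \<Rightarrow> 'k bexp \<Rightarrow> 'm" where
  "bval C X h a u (Ident n) = Idn C (X [^]\<^bsub>Ob C\<^esub> n)"
| "bval C X h a u GenH = h"
| "bval C X h a u GenA = a"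
| "bval C X h a u GenU = u"
| "bval C X h a u (Null m n) = \<zero>\<^bsub>homn C X m n\<^esub>"
| "bval C X h a u (s +\<^sub>e t)
    = bval C X h a u s \<oplus>\<^bsub>homn C X (bsrc s) (btgt s)\<^esub> bval C X h a u t"
| "bval C X h a u (c *\<^sub>e t) = c \<odot>\<^bsub>homn C X (bsrc t) (btgt t)\<^esub> bval C X h a u t"
| "bval C X h a u (s \<circ>\<^sub>e t) = bval C X h a u s \<cdot>\<^bsub>C\<^esub> bval C X h a u t"
| "bval C X h a u (s \<otimes>\<^sub>e t) = bval C X h a u s \<boxtimes>\<^bsub>C\<^esub> bval C X h a u t"


section \<open>Parameters and defining relations\<close>

record 'k brauer_params =
  par_lambda :: 'k
  par_lambda' :: 'k
  par_delta :: 'k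
  par_sigma :: 'k
  par_sigma' :: 'k
  par_rho :: 'k
  par_a :: 'k
  par_b :: 'k
  par_c :: 'k
  par_d :: 'k
  par_e :: 'k
  par_f :: 'k
  par_D :: 'k
  par_E :: 'k
  par_F :: 'k
  par_d' :: 'k
  par_e' :: 'k
  par_f' :: 'k
  par_D' :: 'k
  par_E' :: 'k
  par_F' :: 'k

abbreviation (input) IdI :: "'k bexp"
  where "IdI \<equiv> Ident 1"

definition braid_relation :: "'k bexp \<times> 'k bexp"
  where "braid_relation =
    ((GenH \<otimes>\<^sub>e IdI) \<circ>\<^sub>e (IdI \<otimes>\<^sub>e GenH) \<circ>\<^sub>e (GenH \<otimes>\<^sub>e IdI),
     (IdI \<otimes>\<^sub>e GenH) \<circ>\<^sub>e (GenH \<otimes>\<^sub>e IdI) \<circ>\<^sub>e (IdI \<otimes>\<^sub>e GenH))"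

definition parameter_relations :: "'k brauer_params \<Rightarrow> ('k bexp \<times> 'k bexp) set"
  where "parameter_relations P = {
    (GenH \<circ>\<^sub>e GenU, par_lambda P *\<^sub>e GenU),
    (GenA \<circ>\<^sub>e GenH, par_lambda' P *\<^sub>e GenA),
    (GenA \<circ>\<^sub>e GenU, par_delta P *\<^sub>e Ident 0),
    ((GenA \<otimes>\<^sub>e IdI) \<circ>\<^sub>e (IdI \<otimes>\<^sub>e GenU), par_sigma P *\<^sub>e IdI),
    ((IdI \<otimes>\<^sub>e GenA) \<circ>\<^sub>e (GenU \<otimes>\<^sub>e IdI), par_sigma' P *\<^sub>e IdI),
    ((GenA \<otimes>\<^sub>e IdI) \<circ>\<^sub>e (IdI \<otimes>\<^sub>e GenH) \<circ>\<^sub>e (GenU \<otimes>\<^sub>e IdI), par_rho P *\<^sub>e IdI),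
    (GenH \<circ>\<^sub>e GenH,
       par_a P *\<^sub>e Ident 2 +\<^sub>e par_b P *\<^sub>e GenH +\<^sub>e par_c P *\<^sub>e (GenU \<circ>\<^sub>e GenA)),
    ((GenH \<otimes>\<^sub>e IdI) \<circ>\<^sub>e (IdI \<otimes>\<^sub>e GenU),
       par_d P *\<^sub>e (GenU \<otimes>\<^sub>e IdI) +\<^sub>e par_e P *\<^sub>e ((IdI \<otimes>\<^sub>e GenH) \<circ>\<^sub>e (GenU \<otimes>\<^sub>e IdI))
         +\<^sub>e par_f P *\<^sub>e (IdI \<otimes>\<^sub>e GenU)),
    ((GenH \<otimes>\<^sub>e IdI) \<circ>\<^sub>e (IdI \<otimes>\<^sub>e GenH) \<circ>\<^sub>e (GenU \<otimes>\<^sub>e IdI),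
       par_D P *\<^sub>e (GenU \<otimes>\<^sub>e IdI) +\<^sub>e par_E P *\<^sub>e ((IdI \<otimes>\<^sub>e GenH) \<circ>\<^sub>e (GenU \<otimes>\<^sub>e IdI))
         +\<^sub>e par_F P *\<^sub>e (IdI \<otimes>\<^sub>e GenU)),
    ((IdI \<otimes>\<^sub>e GenA) \<circ>\<^sub>e (GenH \<otimes>\<^sub>e IdI),
       par_d' P *\<^sub>e (GenA \<otimes>\<^sub>e IdI) +\<^sub>e par_e' P *\<^sub>e ((GenA \<otimes>\<^sub>e IdI) \<circ>\<^sub>e (IdI \<otimes>\<^sub>e GenH))
         +\<^sub>e par_f' P *\<^sub>e (IdI \<otimes>\<^sub>e GenA)),
    ((GenA \<otimes>\<^sub>e IdI) \<circ>\<^sub>e (IdI \<otimes>\<^sub>e GenH) \<circ>\<^sub>e (GenH \<otimes>\<^sub>e IdI),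
       par_D' P *\<^sub>e (GenA \<otimes>\<^sub>e IdI) +\<^sub>e par_E' P *\<^sub>e ((GenA \<otimes>\<^sub>e IdI) \<circ>\<^sub>e (IdI \<otimes>\<^sub>e GenH))
         +\<^sub>e par_F' P *\<^sub>e (IdI \<otimes>\<^sub>e GenA))}"

definition defining_relations :: "'k brauer_params \<Rightarrow> ('k bexp \<times> 'k bexp) set"
  where "defining_relations P = insert braid_relation (parameter_relations P)"

definition has_parameters ::
    "('o, 'm, 'k) supercat \<Rightarrow> 'o \<Rightarrow> 'm \<Rightarrow> 'm \<Rightarrow> 'm \<Rightarrow> 'k brauer_params \<Rightarrow> bool"
  where "has_parameters C X h a u P \<longleftrightarrow>
    (\<forall>(s, t) \<in> parameter_relations P. bval C X h a u s = bval C X h a u t)"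


section \<open>Standard expressions\<close>

text \<open>For \<open>i = n + 1\<close> the right-hand identity in \<open>u\<^sub>i\<^sup>n\<close> and \<open>a\<^sub>i\<^sup>n\<close> has to be \<open>1\<^sub>0\<close>; hence
  \<open>n + 1 - i\<close> rather than \<open>n - i + 1\<close> in truncated subtraction.\<close>

definition s_exp :: "nat \<Rightarrow> nat \<Rightarrow> 'k bexp"
  where "s_exp n i = Ident (i - 1) \<otimes>\<^sub>e GenH \<otimes>\<^sub>e Ident (n - (i + 1))"

definition u_exp :: "nat \<Rightarrow> nat \<Rightarrow> 'k bexp"
  where "u_exp n i = Ident (i - 1) \<otimes>\<^sub>e GenU \<otimes>\<^sub>e Ident (n + 1 - i)"

definition a_exp :: "nat \<Rightarrow> nat \<Rightarrow> 'k bexp"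
  where "a_exp n i = Ident (i - 1) \<otimes>\<^sub>e GenA \<otimes>\<^sub>e Ident (n + 1 - i)"

text \<open>Product of a list of composable expressions, the last of which has source \<open>n\<close>.\<close>

definition prod_exp :: "nat \<Rightarrow> 'k bexp list \<Rightarrow> 'k bexp"
  where "prod_exp n ts = foldr Comp ts (Ident n)"

text \<open>\<open>I_exp n (p, s)\<close> is \<open>I\<^sub>s\<^sup>n\<^sup>,\<^sup>p\<close> and \<open>J_exp n (p, s)\<close> is \<open>J\<^sub>s\<^sup>n\<^sup>,\<^sup>p\<close>.\<close>

definition I_exp :: "nat \<Rightarrow> nat \<times> nat \<Rightarrow> 'k bexp"
  where "I_exp n = (\<lambda>(p, s).
    prod_exp n (map (s_exp (n + 2)) (rev [p + 1..<p + s + 1]) @ [u_exp n p]))"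

definition J_exp :: "nat \<Rightarrow> nat \<times> nat \<Rightarrow> 'k bexp"
  where "J_exp n = (\<lambda>(p, s).
    prod_exp (n + 2) (a_exp n p # map (s_exp (n + 2)) [p + 1..<p + s + 1]))"

text \<open>For a list \<open>[(p\<^sub>1, s\<^sub>1), \<dots>, (p\<^sub>k, s\<^sub>k)]\<close>, the \<open>j\<close>-th factor counted from 0 has superscript
  \<open>n - 2 - 2j\<close> in the elements of \<open>I(r, n)\<close> and \<open>r + 2j\<close> in the elements of \<open>J(n, r)\<close>.\<close>

primrec I_prod :: "nat \<Rightarrow> (nat \<times> nat) list \<Rightarrow> 'k bexp" where
  "I_prod r [] = Ident r"
| "I_prod r (q # qs) = I_exp (r + 2 * length qs) q \<circ>\<^sub>e I_prod r qs"

primrec J_prod :: "nat \<Rightarrow> (nat \<times> nat) list \<Rightarrow> 'k bexp" where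
  "J_prod r [] = Ident r"
| "J_prod r (q # qs) = J_exp r q \<circ>\<^sub>e J_prod (r + 2) qs"

definition I_set :: "nat \<Rightarrow> nat \<Rightarrow> 'k bexp set"
  where "I_set r n = {I_prod r qs | qs.
    n = r + 2 * length qs
    \<and> (\<forall>j < length qs. 1 \<le> fst (qs ! j) \<and> fst (qs ! j) + snd (qs ! j) \<le> (n - 2 - 2 * j) + 1)
    \<and> sorted_wrt (>) (map fst qs)}"

definition J_set :: "nat \<Rightarrow> nat \<Rightarrow> 'k bexp set"
  where "J_set n r = {J_prod r qs | qs.
    n = r + 2 * length qs
    \<and> (\<forall>j < length qs. 1 \<le> fst (qs ! j) \<and> fst (qs ! j) + snd (qs ! j) \<le> (r + 2 * j) + 1)
    \<and> sorted_wrt (<) (map fst qs)}"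

text \<open>A word \<open>[i\<^sub>1, \<dots>, i\<^sub>l]\<close> in the simple transpositions of \<open>S\<^sub>r\<close>, acting on \<open>{1..r}\<close>.\<close>

definition word_perm :: "nat list \<Rightarrow> nat \<Rightarrow> nat"
  where "word_perm w = foldr (\<lambda>i \<sigma>. transpose i (i + 1) \<circ> \<sigma>) w id"

definition reduced_word :: "nat \<Rightarrow> nat list \<Rightarrow> bool"
  where "reduced_word r w \<longleftrightarrow> set w \<subseteq> {1..<r} \<and>
    (\<forall>v. set v \<subseteq> {1..<r} \<and> word_perm v = word_perm w \<longrightarrow> length w \<le> length v)"

text \<open>The admissible choices of the sets \<open>H(r)\<close> used to define standard expressions.\<close>

definition word_choice :: "(nat \<Rightarrow> nat list set) \<Rightarrow> bool"
  where "word_choice W \<longleftrightarrow> (\<forall>r.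
    (\<forall>w \<in> W r. reduced_word r w \<and> (\<forall>i. \<not> sublist [i, i + 1, i] w))
    \<and> (\<forall>\<sigma>. \<sigma> permutes {1..r} \<longrightarrow> (\<exists>!w. w \<in> W r \<and> word_perm w = \<sigma>)))"

definition standard_exps :: "(nat \<Rightarrow> nat list set) \<Rightarrow> nat \<Rightarrow> nat \<Rightarrow> 'k bexp set"
  where "standard_exps W m n = {S \<circ>\<^sub>e prod_exp r (map (s_exp r) w) \<circ>\<^sub>e T | r S w T.
    S \<in> I_set r n \<and> w \<in> W r \<and> T \<in> J_set m r}"


section \<open>Categories of Brauer type\<close>

text \<open>That the standard expressions form a basis is meant as a statement about a family: distinct
  standard expressions have distinct values, and these values are a basis.\<close>

definition category_of_Brauer_type ::
    "(nat \<Rightarrow> nat list set) \<Rightarrow> 'k::field \<Rightarrow> ('o, 'm, 'k) supercat \<Rightarrow> 'o \<Rightarrow> 'm \<Rightarrow> 'm \<Rightarrow> 'm \<Rightarrow> bool"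
  where "category_of_Brauer_type W \<epsilon> C X h a u \<longleftrightarrow>
    \<epsilon> \<in> {1, - 1}
    \<and> strict_monoidal_supercategory C
    \<and> X \<in> carrier (Ob C)
    \<and> carrier (Ob C) = range (\<lambda>n::nat. X [^]\<^bsub>Ob C\<^esub> n)
    \<and> h \<in> partn C X 0 2 2
    \<and> a \<in> partn C X (gen_parity \<epsilon>) 2 0
    \<and> u \<in> partn C X (gen_parity \<epsilon>) 0 2
    \<and> (\<forall>m n. carrier (homn C X m n) = bval C X h a u ` bexps m n)
    \<and> (\<exists>h' \<in> carrier (homn C X 2 2).
          h \<cdot>\<^bsub>C\<^esub> h' = Idn C (X [^]\<^bsub>Ob C\<^esub> (2::nat)) \<and> h' \<cdot>\<^bsub>C\<^esub> h = Idn C (X [^]\<^bsub>Ob C\<^esub> (2::nat)))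
    \<and> bval C X h a u (fst braid_relation) = bval C X h a u (snd braid_relation)
    \<and> (\<forall>m n. inj_on (bval C X h a u) (standard_exps W m n)
          \<and> vectorspace.basis class_ring (homn C X m n) (bval C X h a u ` standard_exps W m n))"


section \<open>Monoidal supercategories presented by generators and relations\<close>

text \<open>The smallest equivalence relation on well-typed expressions that contains the relations in
  \<open>R\<close>, is compatible with all operations, and satisfies the axioms of a strict monoidal
  supercategory.  Congruent expressions always have the same source and target, provided this holds
  for the pairs in \<open>R\<close>.\<close>

inductive bcong :: "bit \<Rightarrow> ('k::field bexp \<times> 'k bexp) set \<Rightarrow> 'k bexp \<Rightarrow> 'k bexp \<Rightarrow> bool"
  for \<pi> R where
  rel: "(s, t) \<in> R \<Longrightarrow> bcong \<pi> R s t"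
| refl: "bwt t \<Longrightarrow> bcong \<pi> R t t"
| sym: "bcong \<pi> R s t \<Longrightarrow> bcong \<pi> R t s"
| trans: "bcong \<pi> R s t \<Longrightarrow> bcong \<pi> R t v \<Longrightarrow> bcong \<pi> R s v"
| add_cong: "\<lbrakk>bcong \<pi> R s s'; bcong \<pi> R t t'; bwt (s +\<^sub>e t)\<rbrakk> \<Longrightarrow> bcong \<pi> R (s +\<^sub>e t) (s' +\<^sub>e t')"
| scale_cong: "bcong \<pi> R t t' \<Longrightarrow> bcong \<pi> R (c *\<^sub>e t) (c *\<^sub>e t')"
| comp_cong: "\<lbrakk>bcong \<pi> R s s'; bcong \<pi> R t t'; bwt (s \<circ>\<^sub>e t)\<rbrakk> \<Longrightarrow> bcong \<pi> R (s \<circ>\<^sub>e t) (s' \<circ>\<^sub>e t')"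
| tens_cong: "\<lbrakk>bcong \<pi> R s s'; bcong \<pi> R t t'\<rbrakk> \<Longrightarrow> bcong \<pi> R (s \<otimes>\<^sub>e t) (s' \<otimes>\<^sub>e t')"
| add_assoc: "bwt ((s +\<^sub>e t) +\<^sub>e v) \<Longrightarrow> bcong \<pi> R ((s +\<^sub>e t) +\<^sub>e v) (s +\<^sub>e (t +\<^sub>e v))"
| add_comm: "bwt (s +\<^sub>e t) \<Longrightarrow> bcong \<pi> R (s +\<^sub>e t) (t +\<^sub>e s)"
| add_null: "bwt t \<Longrightarrow> bcong \<pi> R (Null (bsrc t) (btgt t) +\<^sub>e t) t"
| add_neg: "bwt t \<Longrightarrow> bcong \<pi> R (t +\<^sub>e (- 1) *\<^sub>e t) (Null (bsrc t) (btgt t))"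
| scale_add: "bwt (s +\<^sub>e t) \<Longrightarrow> bcong \<pi> R (c *\<^sub>e (s +\<^sub>e t)) (c *\<^sub>e s +\<^sub>e c *\<^sub>e t)"
| add_scale: "bwt t \<Longrightarrow> bcong \<pi> R ((c + d) *\<^sub>e t) (c *\<^sub>e t +\<^sub>e d *\<^sub>e t)"
| scale_scale: "bwt t \<Longrightarrow> bcong \<pi> R ((c * d) *\<^sub>e t) (c *\<^sub>e (d *\<^sub>e t))"
| scale_one: "bwt t \<Longrightarrow> bcong \<pi> R (1 *\<^sub>e t) t"
| comp_add_left: "bwt ((s +\<^sub>e t) \<circ>\<^sub>e v) \<Longrightarrow> bcong \<pi> R ((s +\<^sub>e t) \<circ>\<^sub>e v) (s \<circ>\<^sub>e v +\<^sub>e t \<circ>\<^sub>e v)"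
| comp_add_right: "bwt (v \<circ>\<^sub>e (s +\<^sub>e t)) \<Longrightarrow> bcong \<pi> R (v \<circ>\<^sub>e (s +\<^sub>e t)) (v \<circ>\<^sub>e s +\<^sub>e v \<circ>\<^sub>e t)"
| comp_scale_left: "bwt (s \<circ>\<^sub>e t) \<Longrightarrow> bcong \<pi> R ((c *\<^sub>e s) \<circ>\<^sub>e t) (c *\<^sub>e (s \<circ>\<^sub>e t))"
| comp_scale_right: "bwt (s \<circ>\<^sub>e t) \<Longrightarrow> bcong \<pi> R (s \<circ>\<^sub>e (c *\<^sub>e t)) (c *\<^sub>e (s \<circ>\<^sub>e t))"
| tens_add_left: "bwt ((s +\<^sub>e t) \<otimes>\<^sub>e v) \<Longrightarrow> bcong \<pi> R ((s +\<^sub>e t) \<otimes>\<^sub>e v) (s \<otimes>\<^sub>e v +\<^sub>e t \<otimes>\<^sub>e v)"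
| tens_add_right: "bwt (v \<otimes>\<^sub>e (s +\<^sub>e t)) \<Longrightarrow> bcong \<pi> R (v \<otimes>\<^sub>e (s +\<^sub>e t)) (v \<otimes>\<^sub>e s +\<^sub>e v \<otimes>\<^sub>e t)"
| tens_scale_left: "bwt (s \<otimes>\<^sub>e t) \<Longrightarrow> bcong \<pi> R ((c *\<^sub>e s) \<otimes>\<^sub>e t) (c *\<^sub>e (s \<otimes>\<^sub>e t))"
| tens_scale_right: "bwt (s \<otimes>\<^sub>e t) \<Longrightarrow> bcong \<pi> R (s \<otimes>\<^sub>e (c *\<^sub>e t)) (c *\<^sub>e (s \<otimes>\<^sub>e t))"
| comp_assoc: "bwt ((s \<circ>\<^sub>e t) \<circ>\<^sub>e v) \<Longrightarrow> bcong \<pi> R ((s \<circ>\<^sub>e t) \<circ>\<^sub>e v) (s \<circ>\<^sub>e (t \<circ>\<^sub>e v))"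
| comp_id_left: "bwt t \<Longrightarrow> bcong \<pi> R (Ident (btgt t) \<circ>\<^sub>e t) t"
| comp_id_right: "bwt t \<Longrightarrow> bcong \<pi> R (t \<circ>\<^sub>e Ident (bsrc t)) t"
| tens_assoc: "bwt ((s \<otimes>\<^sub>e t) \<otimes>\<^sub>e v) \<Longrightarrow> bcong \<pi> R ((s \<otimes>\<^sub>e t) \<otimes>\<^sub>e v) (s \<otimes>\<^sub>e (t \<otimes>\<^sub>e v))"
| tens_unit_left: "bwt t \<Longrightarrow> bcong \<pi> R (Ident 0 \<otimes>\<^sub>e t) t"
| tens_unit_right: "bwt t \<Longrightarrow> bcong \<pi> R (t \<otimes>\<^sub>e Ident 0) t"
| tens_id: "bcong \<pi> R (Ident m \<otimes>\<^sub>e Ident n) (Ident (m + n))"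
| interchange: "\<lbrakk>bwt (f \<circ>\<^sub>e h); bwt (g \<circ>\<^sub>e k); bhomog \<pi> g p; bhomog \<pi> h q\<rbrakk>
    \<Longrightarrow> bcong \<pi> R ((f \<otimes>\<^sub>e g) \<circ>\<^sub>e (h \<otimes>\<^sub>e k)) (koszul p q *\<^sub>e ((f \<circ>\<^sub>e h) \<otimes>\<^sub>e (g \<circ>\<^sub>e k)))"

definition bclass :: "bit \<Rightarrow> ('k::field bexp \<times> 'k bexp) set \<Rightarrow> 'k bexp \<Rightarrow> 'k bexp set"
  where "bclass \<pi> R t = {s. bcong \<pi> R t s}"

text \<open>The multiplicative fields of the module records carry no information.\<close>

definition presented ::
    "bit \<Rightarrow> ('k::field bexp \<times> 'k bexp) set \<Rightarrow> (nat, 'k bexp set, 'k) supercat"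
  where "presented \<pi> R = \<lparr>
    Ob = \<lparr>carrier = UNIV, monoid.mult = (+), one = 0\<rparr>,
    Hom = (\<lambda>m n. \<lparr>carrier = bclass \<pi> R ` bexps m n,
      monoid.mult = undefined, one = undefined,
      zero = bclass \<pi> R (Null m n),
      add = (\<lambda>F G. \<Union>f\<in>F. \<Union>g\<in>G. bclass \<pi> R (f +\<^sub>e g)),
      smult = (\<lambda>c F. \<Union>f\<in>F. bclass \<pi> R (c *\<^sub>e f))\<rparr>),
    Part = (\<lambda>p m n. bclass \<pi> R ` {t \<in> bexps m n. bhomog \<pi> t p}),
    Idn = (\<lambda>n. bclass \<pi> R (Ident n)),
    Cmp = (\<lambda>F G. \<Union>f\<in>F. \<Union>g\<in>G. bclass \<pi> R (f \<circ>\<^sub>e g)),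
    Tns = (\<lambda>F G. \<Union>f\<in>F. \<Union>g\<in>G. bclass \<pi> R (f \<otimes>\<^sub>e g))\<rparr>"

text \<open>The category \<open>\<C>\<^sup>0\<^sup>,\<^sup>0\<close> with indices \<open>- \<lambda>, \<varsigma>\<close> and arguments \<open>(\<epsilon>, e, - \<epsilon> e)\<close>.\<close>

definition params00 :: "'k::field \<Rightarrow> 'k \<Rightarrow> 'k \<Rightarrow> 'k \<Rightarrow> 'k brauer_params"
  where "params00 \<epsilon> lam sig e = \<lparr>
    par_lambda = lam, par_lambda' = - lam, par_delta = 0,
    par_sigma = sig, par_sigma' = \<epsilon> * sig, par_rho = \<epsilon> * sig * e * lam,
    par_a = lam\<^sup>2, par_b = 0, par_c = 0,
    par_d = 0, par_e = e, par_f = 0,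
    par_D = 0, par_E = 0, par_F = - \<epsilon> * e * lam\<^sup>2,
    par_d' = 0, par_e' = - \<epsilon> * e, par_f' = 0,
    par_D' = 0, par_E' = 0, par_F' = e * lam\<^sup>2\<rparr>"

definition cat00 :: "'k::field \<Rightarrow> 'k \<Rightarrow> 'k \<Rightarrow> 'k \<Rightarrow> (nat, 'k bexp set, 'k) supercat"
  where "cat00 \<epsilon> lam sig e =
    presented (gen_parity \<epsilon>) (defining_relations (params00 \<epsilon> lam sig e))"

definition cat00_gen :: "'k::field \<Rightarrow> 'k \<Rightarrow> 'k \<Rightarrow> 'k \<Rightarrow> 'k bexp \<Rightarrow> 'k bexp set"
  where "cat00_gen \<epsilon> lam sig e =
    bclass (gen_parity \<epsilon>) (defining_relations (params00 \<epsilon> lam sig e))"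

end

theory Submission
  imports Defs
begin

text \<open>For the first part, each word such as \<open>A\<^sub>1 H\<^sub>1 U\<^sub>2\<close>, \<open>H\<^sub>1 H\<^sub>1 U\<^sub>2\<close>, \<open>A A\<^sub>1 U\<^sub>2\<close>, \<open>A\<^sub>1 H\<^sub>2 U\<^sub>3\<close> or
  \<open>H\<^sub>2 H\<^sub>1 H\<^sub>2 U\<^sub>1\<close> (the index is the position of the generator) is reduced to a combination of
  standard expressions in two ways; comparing coefficients gives equations that determine the
  parameters.

  For the second part, up to a scalar, an expression without sums with source 0 is a composite
  of cups, one for each pairing of the target points, because such composites are stable under
  \<open>H\<close>, \<open>A\<close> and \<open>U\<close>; bending source points to the target extends this to all Hom spaces.
  Since \<open>a = \<lambda>\<^sup>2\<close>, \<open>b = c = 0\<close> and \<open>\<delta> = 0\<close>, every relation equates multiples of two diagrams, and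
  the presented category acts on a vector superspace with basis \<open>e\<^sub>c\<close>, \<open>c\<close> running through labels
  that come in dual pairs of an even and a second label of the degree of \<open>A\<close>: \<open>H\<close> is a scaled
  flip, and \<open>A\<close>, \<open>U\<close> are scaled pairings between dual labels.  At a pair of words in which every
  label occurs once together with its dual, exactly one standard expression has a nonzero
  matrix entry.  Hence the standard expressions are linearly independent, and every normal form
  is a multiple of a bent standard expression, so that they also span.\<close>

section \<open>Calculus in a presented supercategory\<close>

text \<open>Both halves share one calculus, the congruence \<open>bcong\<close>. For a given
  category of Brauer type its relations are all pairs of expressions with equal value, so
  coefficients are compared in a presented category there as well.

  In the first part \<lambda>' \<noteq> \<lambda> makes \<delta> vanish and turns \<lambda>,
  \<lambda>' into the two roots of t^2 = a + b t, while \<varsigma> \<noteq> 0 makes e and e'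
  inverse to each other. A nonzero b would propagate to E, c and D and contradict the invertibility
  of H.

  In the second part the reduction to cups holds only up to a scalar that may be 0, since AU = 0.
  Scalars are therefore not tracked; a matrix entry decides afterwards whether one is nonzero.

  The weights of the model are forced by normalisation: if H has weight \<lambda> on two even labels
  and U has weight 1 at an even label, the relations for H U, for (H I)(I U) and for (A I)(I U) give
  all others, as functions of the kinds of labels. AU = 0 is then a cancellation within each dual
  pair.\<close>

lemma koszul_0 [simp]: "koszul 0 q = 1" "koszul p 0 = 1"
  by (simp_all add: koszul_def)

lemma koszul_nonzero [simp]: "koszul p q \<noteq> 0"
  by (simp add: koszul_def)

lemma koszul_sq [simp]: "koszul p q * koszul p q = 1"
  by (simp add: koszul_def)

text \<open>Each \<open>GenU\<close> raises target minus source by 2 and each \<open>GenA\<close>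
  lowers it by 2, both with degree \<open>\<pi>\<close>; hence half the difference, taken modulo 2,
  counts the factors \<open>\<pi>\<close>. The value matters only when source and target have equal
  parity.\<close>

definition degb :: "bit \<Rightarrow> nat \<Rightarrow> nat \<Rightarrow> bit"
  where "degb \<pi> m n = \<pi> * of_int ((int n - int m) div 2)"

lemma degb_add:
  assumes "even (m + n)" "even (m' + n')"
  shows "degb \<pi> m n + degb \<pi> m' n' = degb \<pi> (m + m') (n + n')"
proof -
  have "(int n - int m) div 2 + (int n' - int m') div 2 = (int (n + n') - int (m + m')) div 2"
    using assms by presburger
  thus ?thesis unfolding degb_def by (metis distrib_left of_int_add)
qed

lemma degb_comp:
  assumes "even (m + n)" "even (n + k)"
  shows "degb \<pi> n k + degb \<pi> m n = degb \<pi> m k"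
proof -
  have "(int k - int n) div 2 + (int n - int m) div 2 = (int k - int m) div 2"
    using assms by presburger
  thus ?thesis unfolding degb_def by (metis distrib_left of_int_add)
qed

lemma degb_simps [simp]: "degb \<pi> n n = 0" "degb \<pi> 2 0 = \<pi>" "degb \<pi> 0 2 = \<pi>"
  by (simp_all add: degb_def)

lemma bhomog_Comp: "bhomog \<pi> s q \<Longrightarrow> bhomog \<pi> t r \<Longrightarrow> bhomog \<pi> (s \<circ>\<^sub>e t) (q + r)"
  unfolding bhomog.simps by blast

lemma bhomog_Tens: "bhomog \<pi> s q \<Longrightarrow> bhomog \<pi> t r \<Longrightarrow> bhomog \<pi> (s \<otimes>\<^sub>e t) (q + r)"
  unfolding bhomog.simps by blast

text \<open>The type of an expression determines its degree, except that an expression of odd type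
  contains a null subexpression and is therefore homogeneous in both degrees.\<close>

lemma bhomog_bwt:
  assumes "bwt t"
  shows "(odd (bsrc t + btgt t) \<longrightarrow> (\<forall>p. bhomog \<pi> t p))
    \<and> (even (bsrc t + btgt t) \<longrightarrow> bhomog \<pi> t (degb \<pi> (bsrc t) (btgt t)))"
  using assms
proof (induction t)
  case (Comp s t)
  show ?case
  proof (cases "odd (bsrc s + btgt s) \<or> odd (bsrc t + btgt t)")
    case True
    obtain q r where qr: "bhomog \<pi> s q" "bhomog \<pi> t r" using Comp by auto
    \<comment> \<open>A factor of odd type is homogeneous in every degree, so it can absorb the
      difference between \<open>p\<close> and the degree of the other factor.\<close>
    have "bhomog \<pi> (s \<circ>\<^sub>e t) p" for p
      using True
    proof
      assume "odd (bsrc s + btgt s)"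
      hence "bhomog \<pi> s (p - r)" using Comp by auto
      hence "bhomog \<pi> (s \<circ>\<^sub>e t) ((p - r) + r)" using qr by (intro bhomog_Comp)
      thus ?thesis by (simp only: diff_add_cancel)
    next
      assume "odd (bsrc t + btgt t)"
      hence "bhomog \<pi> t (p - q)" using Comp by auto
      hence "bhomog \<pi> (s \<circ>\<^sub>e t) (q + (p - q))" using qr by (intro bhomog_Comp)
      thus ?thesis by (simp only: add.commute[of q] diff_add_cancel)
    qed
    thus ?thesis by blast
  next
    case False
    hence "bhomog \<pi> (s \<circ>\<^sub>e t) (degb \<pi> (bsrc s) (btgt s) + degb \<pi> (bsrc t) (btgt t))"
      using Comp by (intro bhomog_Comp) auto
    moreover have "degb \<pi> (bsrc s) (btgt s) + degb \<pi> (bsrc t) (btgt t)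
        = degb \<pi> (bsrc (s \<circ>\<^sub>e t)) (btgt (s \<circ>\<^sub>e t))"
      using False Comp.prems degb_comp[of "bsrc t" "btgt t" "btgt s" \<pi>] by simp
    moreover have "even (bsrc (s \<circ>\<^sub>e t) + btgt (s \<circ>\<^sub>e t))"
      using False Comp.prems by auto
    ultimately show ?thesis by metis
  qed
next
  case (Tens s t)
  show ?case
  proof (cases "odd (bsrc s + btgt s) \<or> odd (bsrc t + btgt t)")
    case True
    obtain q r where qr: "bhomog \<pi> s q" "bhomog \<pi> t r" using Tens by auto
    have "bhomog \<pi> (s \<otimes>\<^sub>e t) p" for p
      using True
    proof
      assume "odd (bsrc s + btgt s)"
      hence "bhomog \<pi> s (p - r)" using Tens by auto
      hence "bhomog \<pi> (s \<otimes>\<^sub>e t) ((p - r) + r)" using qr by (intro bhomog_Tens)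
      thus ?thesis by (simp only: diff_add_cancel)
    next
      assume "odd (bsrc t + btgt t)"
      hence "bhomog \<pi> t (p - q)" using Tens by auto
      hence "bhomog \<pi> (s \<otimes>\<^sub>e t) (q + (p - q))" using qr by (intro bhomog_Tens)
      thus ?thesis by (simp only: add.commute[of q] diff_add_cancel)
    qed
    thus ?thesis by blast
  next
    case False
    hence "bhomog \<pi> (s \<otimes>\<^sub>e t) (degb \<pi> (bsrc s) (btgt s) + degb \<pi> (bsrc t) (btgt t))"
      using Tens by (intro bhomog_Tens) auto
    moreover have "degb \<pi> (bsrc s) (btgt s) + degb \<pi> (bsrc t) (btgt t)
        = degb \<pi> (bsrc (s \<otimes>\<^sub>e t)) (btgt (s \<otimes>\<^sub>e t))"
      using False Tens.prems degb_add by simp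
    moreover have "even (bsrc (s \<otimes>\<^sub>e t) + btgt (s \<otimes>\<^sub>e t))"
      using False Tens.prems by auto
    ultimately show ?thesis by metis
  qed
qed auto

lemma bhomog_exists: "bwt t \<Longrightarrow> \<exists>p. bhomog \<pi> t p"
  using bhomog_bwt by blast

definition lay :: "nat \<Rightarrow> 'k bexp \<Rightarrow> nat \<Rightarrow> 'k bexp"
  where "lay i t k = Ident i \<otimes>\<^sub>e t \<otimes>\<^sub>e Ident k"

lemma lay_type [simp]:
  "bwt (lay i t k) \<longleftrightarrow> bwt t" "bsrc (lay i t k) = i + (bsrc t + k)" "btgt (lay i t k) = i + (btgt t + k)"
  by (simp_all add: lay_def)

text \<open>The calculus asks only that relations preserve types, so it serves the concrete
  presentation and also \<open>kernel\<close>, the set of all relations valid in a given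
  category.\<close>

locale typed_relations =
  fixes \<pi> :: bit and R :: "('k::field bexp \<times> 'k bexp) set"
  assumes typed: "(s, t) \<in> R \<Longrightarrow> bwt s \<and> bwt t \<and> bsrc s = bsrc t \<and> btgt s = btgt t"
begin

abbreviation cong_exp (infix \<open>\<approx>\<close> 50)
  where "s \<approx> t \<equiv> bcong \<pi> R s t"

lemma bcong_typed: "s \<approx> t \<Longrightarrow> bwt s \<and> bwt t \<and> bsrc s = bsrc t \<and> btgt s = btgt t"
  by (induction rule: bcong.induct) (auto dest: typed)

lemma cong_trans [trans]: "s \<approx> t \<Longrightarrow> t \<approx> v \<Longrightarrow> s \<approx> v"
  by (rule bcong.trans)

lemma comp_left: "t \<approx> t' \<Longrightarrow> bwt (s \<circ>\<^sub>e t) \<Longrightarrow> s \<circ>\<^sub>e t \<approx> s \<circ>\<^sub>e t'"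
  by (rule bcong.comp_cong) (auto intro: bcong.refl)

lemma comp_right: "s \<approx> s' \<Longrightarrow> bwt (s \<circ>\<^sub>e t) \<Longrightarrow> s \<circ>\<^sub>e t \<approx> s' \<circ>\<^sub>e t"
  by (rule bcong.comp_cong) (auto intro: bcong.refl)

lemma comp_assoc': "bwt ((s \<circ>\<^sub>e t) \<circ>\<^sub>e v) \<Longrightarrow> s \<circ>\<^sub>e (t \<circ>\<^sub>e v) \<approx> (s \<circ>\<^sub>e t) \<circ>\<^sub>e v"
  by (rule bcong.sym, rule bcong.comp_assoc)

lemma tens_left: "t \<approx> t' \<Longrightarrow> bwt s \<Longrightarrow> s \<otimes>\<^sub>e t \<approx> s \<otimes>\<^sub>e t'"
  by (rule bcong.tens_cong) (auto intro: bcong.refl)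

lemma tens_right: "s \<approx> s' \<Longrightarrow> bwt t \<Longrightarrow> s \<otimes>\<^sub>e t \<approx> s' \<otimes>\<^sub>e t"
  by (rule bcong.tens_cong) (auto intro: bcong.refl)

text \<open>With z for \<open>0 *\<^sub>e t\<close>, the rule \<open>add_scale\<close> gives z = z +
  z, and adding the negative of z leaves the null expression: the usual vector space argument,
  carried out inside the congruence.\<close>

lemma scale_zero: assumes "bwt t" shows "0 *\<^sub>e t \<approx> Null (bsrc t) (btgt t)"
proof -
  let ?N = "Null (bsrc t) (btgt t)"
  let ?z = "0 *\<^sub>e t"
  have "?z \<approx> ?z +\<^sub>e ?z" using bcong.add_scale[OF assms, of \<pi> R 0 0] by simp
  hence a: "?z +\<^sub>e (- 1) *\<^sub>e ?z \<approx> (?z +\<^sub>e ?z) +\<^sub>e (- 1) *\<^sub>e ?z"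
    by (rule bcong.add_cong) (auto intro!: bcong.refl simp: assms)
  have n: "?z +\<^sub>e (- 1) *\<^sub>e ?z \<approx> ?N" using bcong.add_neg[of ?z] assms by simp
  have "?z \<approx> ?N +\<^sub>e ?z" using bcong.add_null[of ?z] assms by (auto intro: bcong.sym)
  also have "\<dots> \<approx> ?z +\<^sub>e ?N" using assms by (intro bcong.add_comm) auto
  also have "\<dots> \<approx> ?z +\<^sub>e (?z +\<^sub>e (- 1) *\<^sub>e ?z)"
    using assms n by (intro bcong.add_cong bcong.refl) (auto intro: bcong.sym)
  also have "\<dots> \<approx> (?z +\<^sub>e ?z) +\<^sub>e (- 1) *\<^sub>e ?z"
    using assms by (intro bcong.sym[OF bcong.add_assoc]) auto
  also have "\<dots> \<approx> ?z +\<^sub>e (- 1) *\<^sub>e ?z" using a by (rule bcong.sym)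
  also have "\<dots> \<approx> ?N" by (rule n)
  finally show ?thesis .
qed

lemma scale_null: "c *\<^sub>e Null m n \<approx> Null m n"
proof -
  have z: "Null m n \<approx> 0 *\<^sub>e Null m n" using scale_zero[of "Null m n"] by (auto intro: bcong.sym)
  have "c *\<^sub>e Null m n \<approx> c *\<^sub>e (0 *\<^sub>e Null m n)" using z by (rule bcong.scale_cong)
  also have "\<dots> \<approx> (c * 0) *\<^sub>e Null m n" by (rule bcong.sym[OF bcong.scale_scale]) simp
  also have "\<dots> \<approx> Null m n" using z by (simp add: bcong.sym)
  finally show ?thesis .
qed

lemma comp_null_left: assumes "bwt t" "btgt t = m" shows "Null m n \<circ>\<^sub>e t \<approx> Null (bsrc t) n"
proof -
  have "Null m n \<circ>\<^sub>e t \<approx> (0 *\<^sub>e Null m n) \<circ>\<^sub>e t"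
    using scale_zero[of "Null m n"] assms by (intro comp_right) (auto intro: bcong.sym)
  also have "\<dots> \<approx> 0 *\<^sub>e (Null m n \<circ>\<^sub>e t)" using assms by (intro bcong.comp_scale_left) auto
  also have "\<dots> \<approx> Null (bsrc t) n" using scale_zero[of "Null m n \<circ>\<^sub>e t"] assms by auto
  finally show ?thesis .
qed

lemma comp_null_right: assumes "bwt t" "bsrc t = n" shows "t \<circ>\<^sub>e Null m n \<approx> Null m (btgt t)"
proof -
  have "t \<circ>\<^sub>e Null m n \<approx> t \<circ>\<^sub>e (0 *\<^sub>e Null m n)"
    using scale_zero[of "Null m n"] assms by (intro comp_left) (auto intro: bcong.sym)
  also have "\<dots> \<approx> 0 *\<^sub>e (t \<circ>\<^sub>e Null m n)" using assms by (intro bcong.comp_scale_right) auto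
  also have "\<dots> \<approx> Null m (btgt t)" using scale_zero[of "t \<circ>\<^sub>e Null m n"] assms by auto
  finally show ?thesis .
qed

lemma tens_null_left: assumes "bwt t" shows "Null m n \<otimes>\<^sub>e t \<approx> Null (m + bsrc t) (n + btgt t)"
proof -
  have "Null m n \<otimes>\<^sub>e t \<approx> (0 *\<^sub>e Null m n) \<otimes>\<^sub>e t"
    using scale_zero[of "Null m n"] assms by (intro tens_right) (auto intro: bcong.sym)
  also have "\<dots> \<approx> 0 *\<^sub>e (Null m n \<otimes>\<^sub>e t)" using assms by (intro bcong.tens_scale_left) auto
  also have "\<dots> \<approx> Null (m + bsrc t) (n + btgt t)" using scale_zero[of "Null m n \<otimes>\<^sub>e t"] assms by auto
  finally show ?thesis .
qed

lemma tens_null_right: assumes "bwt t" shows "t \<otimes>\<^sub>e Null m n \<approx> Null (bsrc t + m) (btgt t + n)"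
proof -
  have "t \<otimes>\<^sub>e Null m n \<approx> t \<otimes>\<^sub>e (0 *\<^sub>e Null m n)"
    using scale_zero[of "Null m n"] assms by (intro tens_left) (auto intro: bcong.sym)
  also have "\<dots> \<approx> 0 *\<^sub>e (t \<otimes>\<^sub>e Null m n)" using assms by (intro bcong.tens_scale_right) auto
  also have "\<dots> \<approx> Null (bsrc t + m) (btgt t + n)" using scale_zero[of "t \<otimes>\<^sub>e Null m n"] assms by auto
  finally show ?thesis .
qed

text \<open>Generators and identities have source and target of equal parity, so an odd type can
  only come from a \<open>Null\<close>. In a composite or tensor product of odd type one factor has
  odd type, is null by induction and annihilates the other.\<close>

lemma odd_type_null:
  "bwt t \<Longrightarrow> odd (bsrc t + btgt t) \<Longrightarrow> t \<approx> Null (bsrc t) (btgt t)"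
proof (induction t)
  case (Add s t)
  have "s +\<^sub>e t \<approx> Null (bsrc s) (btgt s) +\<^sub>e Null (bsrc s) (btgt s)"
    using Add by (intro bcong.add_cong) auto
  also have "\<dots> \<approx> Null (bsrc s) (btgt s)"
    using bcong.add_null[of "Null (bsrc s) (btgt s)"] by simp
  finally show ?case by simp
next
  case (Scale c t)
  have "c *\<^sub>e t \<approx> c *\<^sub>e Null (bsrc t) (btgt t)" using Scale by (intro bcong.scale_cong) auto
  also have "\<dots> \<approx> Null (bsrc t) (btgt t)" by (rule scale_null)
  finally show ?case by simp
next
  case (Comp s t)
  show ?case
  proof (cases "odd (bsrc s + btgt s)")
    case True
    have "s \<circ>\<^sub>e t \<approx> Null (bsrc s) (btgt s) \<circ>\<^sub>e t" using Comp True by (intro comp_right) auto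
    also have "\<dots> \<approx> Null (bsrc t) (btgt s)" using Comp by (intro comp_null_left) auto
    finally show ?thesis by simp
  next
    case False
    have "s \<circ>\<^sub>e t \<approx> s \<circ>\<^sub>e Null (bsrc t) (btgt t)" using Comp False by (intro comp_left) auto
    also have "\<dots> \<approx> Null (bsrc t) (btgt s)" using Comp by (intro comp_null_right) auto
    finally show ?thesis by simp
  qed
next
  case (Tens s t)
  show ?case
  proof (cases "odd (bsrc s + btgt s)")
    case True
    have "s \<otimes>\<^sub>e t \<approx> Null (bsrc s) (btgt s) \<otimes>\<^sub>e t" using Tens True by (intro tens_right) auto
    also have "\<dots> \<approx> Null (bsrc s + bsrc t) (btgt s + btgt t)" using Tens by (intro tens_null_left) auto
    finally show ?thesis by simp
  next
    case False
    have "s \<otimes>\<^sub>e t \<approx> s \<otimes>\<^sub>e Null (bsrc t) (btgt t)" using Tens False by (intro tens_left) auto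
    also have "\<dots> \<approx> Null (bsrc s + bsrc t) (btgt s + btgt t)" using Tens by (intro tens_null_right) auto
    finally show ?thesis by simp
  qed
qed (auto intro: bcong.refl)

text \<open>Apart from null factors the degree is dictated by the type. In a composite or tensor
  product a wrong total degree forces one factor to have a wrong degree or an odd type, hence to be
  null. As a result every Hom space sits in a single degree.\<close>

lemma wrong_degree_null:
  "bwt t \<Longrightarrow> bhomog \<pi> t p \<Longrightarrow> p \<noteq> degb \<pi> (bsrc t) (btgt t) \<Longrightarrow> t \<approx> Null (bsrc t) (btgt t)"
proof (induction t arbitrary: p)
  case (Add s t)
  have "s +\<^sub>e t \<approx> Null (bsrc s) (btgt s) +\<^sub>e Null (bsrc s) (btgt s)"
    using Add by (intro bcong.add_cong) auto
  also have "\<dots> \<approx> Null (bsrc s) (btgt s)"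
    using bcong.add_null[of "Null (bsrc s) (btgt s)"] by simp
  finally show ?case by simp
next
  case (Scale c t)
  have "c *\<^sub>e t \<approx> c *\<^sub>e Null (bsrc t) (btgt t)" using Scale by (intro bcong.scale_cong) auto
  also have "\<dots> \<approx> Null (bsrc t) (btgt t)" by (rule scale_null)
  finally show ?case by simp
next
  case (Comp s t)
  from Comp.prems obtain q r where qr: "p = q + r" "bhomog \<pi> s q" "bhomog \<pi> t r" by auto
  show ?case
  proof (cases "odd (bsrc s + btgt s) \<or> q \<noteq> degb \<pi> (bsrc s) (btgt s)")
    case True
    hence "s \<approx> Null (bsrc s) (btgt s)" using Comp.prems(1) Comp.IH(1)[of q] qr odd_type_null[of s] by fastforce
    hence "s \<circ>\<^sub>e t \<approx> Null (bsrc s) (btgt s) \<circ>\<^sub>e t" using Comp.prems by (intro comp_right) auto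
    also have "\<dots> \<approx> Null (bsrc t) (btgt s)" using Comp by (intro comp_null_left) auto
    finally show ?thesis by simp
  next
    case False
    hence "odd (bsrc t + btgt t) \<or> r \<noteq> degb \<pi> (bsrc t) (btgt t)"
      using Comp.prems(1,3) qr(1) degb_comp[of "bsrc t" "btgt t" "btgt s" \<pi>]
      by (metis add.commute bsrc.simps(8) btgt.simps(8) bwt.simps(8))
    hence "t \<approx> Null (bsrc t) (btgt t)" using Comp.prems(1) Comp.IH(2)[of r] qr odd_type_null[of t] by fastforce
    hence "s \<circ>\<^sub>e t \<approx> s \<circ>\<^sub>e Null (bsrc t) (btgt t)" using Comp.prems by (intro comp_left) auto
    also have "\<dots> \<approx> Null (bsrc t) (btgt s)" using Comp by (intro comp_null_right) auto
    finally show ?thesis by simp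
  qed
next
  case (Tens s t)
  from Tens.prems obtain q r where qr: "p = q + r" "bhomog \<pi> s q" "bhomog \<pi> t r" by auto
  show ?case
  proof (cases "odd (bsrc s + btgt s) \<or> q \<noteq> degb \<pi> (bsrc s) (btgt s)")
    case True
    hence "s \<approx> Null (bsrc s) (btgt s)" using Tens.prems(1) Tens.IH(1)[of q] qr odd_type_null[of s] by fastforce
    hence "s \<otimes>\<^sub>e t \<approx> Null (bsrc s) (btgt s) \<otimes>\<^sub>e t" using Tens.prems by (intro tens_right) auto
    also have "\<dots> \<approx> Null (bsrc s + bsrc t) (btgt s + btgt t)" using Tens by (intro tens_null_left) auto
    finally show ?thesis by simp
  next
    case False
    hence "odd (bsrc t + btgt t) \<or> r \<noteq> degb \<pi> (bsrc t) (btgt t)"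
      using Tens.prems(1,3) qr(1) degb_add[of "bsrc s" "btgt s" "bsrc t" "btgt t" \<pi>]
      by (metis bsrc.simps(9) btgt.simps(9))
    hence "t \<approx> Null (bsrc t) (btgt t)" using Tens.prems(1) Tens.IH(2)[of r] qr odd_type_null[of t] by fastforce
    hence "s \<otimes>\<^sub>e t \<approx> s \<otimes>\<^sub>e Null (bsrc t) (btgt t)" using Tens.prems by (intro tens_left) auto
    also have "\<dots> \<approx> Null (bsrc s + bsrc t) (btgt s + btgt t)" using Tens by (intro tens_null_right) auto
    finally show ?thesis by simp
  qed
qed (auto intro: bcong.refl)

end

section \<open>The presented strict monoidal supercategory\<close>

context typed_relations
begin

abbreviation cls where "cls \<equiv> bclass \<pi> R"
abbreviation PC where "PC \<equiv> presented \<pi> R"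

lemma cls_eqI: "s \<approx> t \<Longrightarrow> cls s = cls t"
  unfolding bclass_def by (blast intro: bcong.sym bcong.trans)

lemma mem_cls: "t' \<in> cls t \<longleftrightarrow> t \<approx> t'"
  by (simp add: bclass_def)

lemma self_cls: "bwt t \<Longrightarrow> t \<in> cls t"
  by (simp add: mem_cls bcong.refl)

lemma cls_eq: "bwt t \<Longrightarrow> cls s = cls t \<longleftrightarrow> s \<approx> t"
  using self_cls mem_cls cls_eqI by metis

text \<open>The operations of \<open>presented\<close> are unions over all representatives. A
  nonempty union of equal classes is that class, so each operation reduces to one on chosen
  representatives.\<close>

lemma Un_cls1:
  assumes "bwt s" "\<And>s'. s \<approx> s' \<Longrightarrow> F s' = F s"
  shows "(\<Union>s'\<in>cls s. F s') = F s"
proof -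
  have "(\<Union>s'\<in>cls s. F s') = (\<Union>s'\<in>cls s. F s)"
    by (rule SUP_cong) (use assms(2) in \<open>simp_all only: mem_cls\<close>)
  thus ?thesis using self_cls[OF assms(1)] by auto
qed

lemma Un_cls2:
  assumes "bwt s" "bwt t" "\<And>s' t'. s \<approx> s' \<Longrightarrow> t \<approx> t' \<Longrightarrow> F s' t' = F s t"
  shows "(\<Union>s'\<in>cls s. \<Union>t'\<in>cls t. F s' t') = F s t"
proof -
  have "(\<Union>s'\<in>cls s. \<Union>t'\<in>cls t. F s' t') = (\<Union>s'\<in>cls s. \<Union>t'\<in>cls t. F s t)"
    by (intro SUP_cong) (use assms(3) in \<open>simp_all only: mem_cls\<close>)
  thus ?thesis using self_cls[OF assms(1)] self_cls[OF assms(2)] by auto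
qed

lemma Cmp_cls: "bwt (s \<circ>\<^sub>e t) \<Longrightarrow> cls s \<cdot>\<^bsub>PC\<^esub> cls t = cls (s \<circ>\<^sub>e t)"
  unfolding presented_def supercat.simps
  by (rule Un_cls2) (auto simp: cls_eqI[OF bcong.sym[OF bcong.comp_cong]])

lemma Tns_cls: "bwt s \<Longrightarrow> bwt t \<Longrightarrow> cls s \<boxtimes>\<^bsub>PC\<^esub> cls t = cls (s \<otimes>\<^sub>e t)"
  unfolding presented_def supercat.simps
  by (rule Un_cls2) (auto simp: cls_eqI[OF bcong.sym[OF bcong.tens_cong]])

lemma add_cls: "bwt (s +\<^sub>e t) \<Longrightarrow> cls s \<oplus>\<^bsub>Hom PC m n\<^esub> cls t = cls (s +\<^sub>e t)"
  unfolding presented_def supercat.simps ring.simps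
  by (rule Un_cls2) (auto simp: cls_eqI[OF bcong.sym[OF bcong.add_cong]])

lemma smult_cls: "bwt t \<Longrightarrow> c \<odot>\<^bsub>Hom PC m n\<^esub> cls t = cls (c *\<^sub>e t)"
  unfolding presented_def supercat.simps module.simps
  by (rule Un_cls1) (auto simp: cls_eqI[OF bcong.sym[OF bcong.scale_cong]])

lemma Idn_cls: "Idn PC n = cls (Ident n)"
  by (simp add: presented_def)

lemma zero_cls: "\<zero>\<^bsub>Hom PC m n\<^esub> = cls (Null m n)"
  by (simp add: presented_def)

lemma carrier_cls: "carrier (Hom PC m n) = cls ` bexps m n"
  by (simp add: presented_def)

lemma Part_cls: "Part PC p m n = cls ` {t \<in> bexps m n. bhomog \<pi> t p}"
  by (simp add: presented_def)

lemma Ob_PC: "carrier (Ob PC) = UNIV" "m \<otimes>\<^bsub>Ob PC\<^esub> n = m + n" "\<one>\<^bsub>Ob PC\<^esub> = 0"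
  by (simp_all add: presented_def)

lemmas PC_cls = Cmp_cls Tns_cls add_cls smult_cls Idn_cls zero_cls carrier_cls Part_cls Ob_PC

lemma cls_carrier: "bwt t \<Longrightarrow> bsrc t = m \<Longrightarrow> btgt t = n \<Longrightarrow> cls t \<in> carrier (Hom PC m n)"
  by (simp add: carrier_cls bexps_def)

lemma cls_Part:
  "bwt t \<Longrightarrow> bsrc t = m \<Longrightarrow> btgt t = n \<Longrightarrow> bhomog \<pi> t p \<Longrightarrow> cls t \<in> Part PC p m n"
  by (simp add: Part_cls bexps_def)

lemma carrierE:
  assumes "x \<in> carrier (Hom PC m n)"
  obtains t where "x = cls t" "bwt t" "bsrc t = m" "btgt t = n"
  using assms by (auto simp: carrier_cls bexps_def)

lemma PartE:
  assumes "x \<in> Part PC p m n"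
  obtains t where "x = cls t" "bwt t" "bsrc t = m" "btgt t = n" "bhomog \<pi> t p"
  using assms by (auto simp: Part_cls bexps_def)

lemma hom_abelian_group: "abelian_group (Hom PC m n)"
proof (rule abelian_groupI)
  show "\<zero>\<^bsub>Hom PC m n\<^esub> \<in> carrier (Hom PC m n)" by (simp add: zero_cls cls_carrier)
next
  fix x y assume "x \<in> carrier (Hom PC m n)" "y \<in> carrier (Hom PC m n)"
  then obtain s t where st: "x = cls s" "y = cls t" "bwt s" "bsrc s = m" "btgt s = n"
    "bwt t" "bsrc t = m" "btgt t = n" by (elim carrierE) blast
  show "x \<oplus>\<^bsub>Hom PC m n\<^esub> y \<in> carrier (Hom PC m n)"
    using st by (simp add: add_cls cls_carrier)
  show "x \<oplus>\<^bsub>Hom PC m n\<^esub> y = y \<oplus>\<^bsub>Hom PC m n\<^esub> x"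
    using st by (simp add: add_cls cls_eqI[OF bcong.add_comm])
  fix z assume "z \<in> carrier (Hom PC m n)"
  then obtain r where "z = cls r" "bwt r" "bsrc r = m" "btgt r = n" by (elim carrierE)
  thus "x \<oplus>\<^bsub>Hom PC m n\<^esub> y \<oplus>\<^bsub>Hom PC m n\<^esub> z = x \<oplus>\<^bsub>Hom PC m n\<^esub> (y \<oplus>\<^bsub>Hom PC m n\<^esub> z)"
    using st by (simp add: add_cls cls_eqI[OF bcong.add_assoc])
next
  fix x assume "x \<in> carrier (Hom PC m n)"
  then obtain t where t: "x = cls t" "bwt t" "bsrc t = m" "btgt t = n" by (elim carrierE)
  show "\<zero>\<^bsub>Hom PC m n\<^esub> \<oplus>\<^bsub>Hom PC m n\<^esub> x = x"
    using t bcong.add_null[of t \<pi> R] by (simp add: zero_cls add_cls cls_eqI)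
  have "(- 1) *\<^sub>e t +\<^sub>e t \<approx> t +\<^sub>e (- 1) *\<^sub>e t"
    using t by (intro bcong.add_comm) simp
  also have "\<dots> \<approx> Null m n" using t bcong.add_neg[of t \<pi> R] by simp
  finally have "cls ((- 1) *\<^sub>e t) \<oplus>\<^bsub>Hom PC m n\<^esub> x = \<zero>\<^bsub>Hom PC m n\<^esub>"
    using t by (simp add: zero_cls add_cls cls_eqI)
  moreover have "cls ((- 1) *\<^sub>e t) \<in> carrier (Hom PC m n)"
    using t by (simp add: cls_carrier)
  ultimately show "\<exists>y\<in>carrier (Hom PC m n). y \<oplus>\<^bsub>Hom PC m n\<^esub> x = \<zero>\<^bsub>Hom PC m n\<^esub>" by blast
qed

lemma hom_module: "module class_ring (Hom PC m n)"
proof (rule moduleI)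
  show "cring (class_ring :: 'k ring)" using class_field.field_axioms[where 'a = 'k] by (simp add: field_def domain_def)
next
  fix a b :: 'k and x y
  assume "x \<in> carrier (Hom PC m n)" "y \<in> carrier (Hom PC m n)"
  then obtain s t where st: "x = cls s" "y = cls t" "bwt s" "bsrc s = m" "btgt s = n"
    "bwt t" "bsrc t = m" "btgt t = n" by (elim carrierE) blast
  show "(a \<oplus>\<^bsub>class_ring\<^esub> b) \<odot>\<^bsub>Hom PC m n\<^esub> x = a \<odot>\<^bsub>Hom PC m n\<^esub> x \<oplus>\<^bsub>Hom PC m n\<^esub> b \<odot>\<^bsub>Hom PC m n\<^esub> x"
    using st by (simp add: PC_cls bexps_def cls_eqI[OF bcong.add_scale])
  show "a \<odot>\<^bsub>Hom PC m n\<^esub> (x \<oplus>\<^bsub>Hom PC m n\<^esub> y) = a \<odot>\<^bsub>Hom PC m n\<^esub> x \<oplus>\<^bsub>Hom PC m n\<^esub> a \<odot>\<^bsub>Hom PC m n\<^esub> y"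
    using st by (simp add: PC_cls bexps_def cls_eqI[OF bcong.scale_add])
  show "(a \<otimes>\<^bsub>class_ring\<^esub> b) \<odot>\<^bsub>Hom PC m n\<^esub> x = a \<odot>\<^bsub>Hom PC m n\<^esub> (b \<odot>\<^bsub>Hom PC m n\<^esub> x)"
    using st by (simp add: PC_cls bexps_def cls_eqI[OF bcong.scale_scale])
  show "\<one>\<^bsub>class_ring\<^esub> \<odot>\<^bsub>Hom PC m n\<^esub> x = x"
    using st by (simp add: PC_cls bexps_def cls_eqI[OF bcong.scale_one])
  show "a \<odot>\<^bsub>Hom PC m n\<^esub> x \<in> carrier (Hom PC m n)"
    using st by (simp add: smult_cls cls_carrier)
qed (rule hom_abelian_group)

lemma hom_vectorspace: "vectorspace class_ring (Hom PC m n)"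
  unfolding vectorspace_def using hom_module class_field.field_axioms by blast

text \<open>One criterion for composition and tensor product in either argument: \<open>f\<close> is
  the operation on expressions, \<open>T\<close> the operation it induces on classes.\<close>

lemma linear_cls:
  assumes "\<And>t. t \<in> bexps m n \<Longrightarrow> T (cls t) = cls (f t)"
    and "\<And>t. t \<in> bexps m n \<Longrightarrow> f t \<in> bexps m' n'"
    and "\<And>s t. s \<in> bexps m n \<Longrightarrow> t \<in> bexps m n \<Longrightarrow> f (s +\<^sub>e t) \<approx> f s +\<^sub>e f t"
    and "\<And>c t. t \<in> bexps m n \<Longrightarrow> f (c *\<^sub>e t) \<approx> c *\<^sub>e f t"
  shows "linear_map class_ring (Hom PC m n) (Hom PC m' n') T"
proof -
  have 1: "T x \<in> carrier (Hom PC m' n')" if "x \<in> carrier (Hom PC m n)" for x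
    using that assms(1,2) by (auto simp: carrier_cls)
  have 2: "T (c \<odot>\<^bsub>Hom PC m n\<^esub> x) = c \<odot>\<^bsub>Hom PC m' n'\<^esub> T x" if x: "x \<in> carrier (Hom PC m n)" for c x
  proof -
    obtain s where s: "x = cls s" "s \<in> bexps m n" using x by (auto simp: carrier_cls)
    hence "c *\<^sub>e s \<in> bexps m n" "bwt s" "bwt (f s)" using assms(2)[of s] by (auto simp: bexps_def)
    thus ?thesis using s assms(1,4) by (simp add: smult_cls cls_eqI)
  qed
  have 3: "T (x \<oplus>\<^bsub>Hom PC m n\<^esub> y) = T x \<oplus>\<^bsub>Hom PC m' n'\<^esub> T y"
    if xy: "x \<in> carrier (Hom PC m n)" "y \<in> carrier (Hom PC m n)" for x y
  proof -
    obtain s t where st: "x = cls s" "s \<in> bexps m n" "y = cls t" "t \<in> bexps m n"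
      using xy by (auto simp: carrier_cls)
    hence "s +\<^sub>e t \<in> bexps m n" "bwt (s +\<^sub>e t)" "bwt (f s +\<^sub>e f t)"
      using assms(2)[of s] assms(2)[of t] by (auto simp: bexps_def)
    thus ?thesis using st assms(1,3) by (simp add: add_cls cls_eqI del: bwt.simps)
  qed
  have "T \<in> LinearCombinations.module_hom class_ring (Hom PC m n) (Hom PC m' n')"
    unfolding LinearCombinations.module_hom_def using 1 2 3 by simp
  thus ?thesis
    unfolding linear_map_def mod_hom_def mod_hom_axioms_def
    using hom_vectorspace hom_module by blast
qed

lemma part_subspace: "subspace class_ring (Part PC p m n) (Hom PC m n)"
  unfolding VectorSpace.subspace_def LinearCombinations.submodule_def
proof (intro conjI allI impI)
  show "vectorspace class_ring (Hom PC m n)" by (rule hom_vectorspace)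
  show "module class_ring (Hom PC m n)" by (rule hom_module)
  show "Part PC p m n \<subseteq> carrier (Hom PC m n)" by (auto elim!: PartE intro: cls_carrier)
  show "\<zero>\<^bsub>Hom PC m n\<^esub> \<in> Part PC p m n" by (simp add: zero_cls cls_Part)
next
  fix v and c :: 'k assume "v \<in> Part PC p m n"
  then obtain t where "v = cls t" "bwt t" "bsrc t = m" "btgt t = n" "bhomog \<pi> t p" by (elim PartE)
  thus "c \<odot>\<^bsub>Hom PC m n\<^esub> v \<in> Part PC p m n" by (simp add: smult_cls cls_Part)
next
  fix v w assume "v \<in> Part PC p m n" "w \<in> Part PC p m n"
  then obtain s t where "v = cls s" "bwt s" "bsrc s = m" "btgt s = n" "bhomog \<pi> s p"
    "w = cls t" "bwt t" "bsrc t = m" "btgt t = n" "bhomog \<pi> t p" by (elim PartE) blast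
  thus "v \<oplus>\<^bsub>Hom PC m n\<^esub> w \<in> Part PC p m n" by (simp add: add_cls cls_Part)
qed

lemma part_trivial:
  assumes "odd (m + n) \<or> p \<noteq> degb \<pi> m n"
  shows "Part PC p m n = {\<zero>\<^bsub>Hom PC m n\<^esub>}"
proof -
  have "cls t = cls (Null m n)" if "t \<in> bexps m n" "bhomog \<pi> t p" for t
    using that assms odd_type_null[of t] wrong_degree_null[of t p]
    by (auto simp: bexps_def intro!: cls_eqI)
  moreover have "cls (Null m n) \<in> Part PC p m n" by (simp add: cls_Part)
  ultimately show ?thesis unfolding zero_cls by (auto simp: Part_cls)
qed

lemma part_full:
  assumes "even (m + n)"
  shows "Part PC (degb \<pi> m n) m n = carrier (Hom PC m n)"
proof
  show "carrier (Hom PC m n) \<subseteq> Part PC (degb \<pi> m n) m n"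
    using assms bhomog_bwt by (auto elim!: carrierE intro!: cls_Part)
qed (auto elim!: PartE intro: cls_carrier)

lemma carrier_odd:
  assumes "odd (m + n)"
  shows "carrier (Hom PC m n) = {\<zero>\<^bsub>Hom PC m n\<^esub>}"
proof -
  have "cls t = cls (Null m n)" if "t \<in> bexps m n" for t
    using that assms odd_type_null[of t] by (auto simp: bexps_def intro!: cls_eqI)
  moreover have "cls (Null m n) \<in> carrier (Hom PC m n)" by (simp add: cls_carrier)
  ultimately show ?thesis unfolding zero_cls by (auto simp: carrier_cls)
qed

text \<open>For an odd type the Hom space is zero; otherwise the part of degree
  \<open>degb \<pi> m n\<close> is everything and the other part is zero. In each case the
  decomposition is forced.\<close>

lemma part_direct_sum:
  assumes "f \<in> carrier (Hom PC m n)"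
  shows "\<exists>!z. fst z \<in> Part PC 0 m n \<and> snd z \<in> Part PC 1 m n \<and> f = fst z \<oplus>\<^bsub>Hom PC m n\<^esub> snd z"
proof -
  interpret abelian_group "Hom PC m n" by (rule hom_abelian_group)
  let ?z = "\<zero>\<^bsub>Hom PC m n\<^esub>"
  consider "odd (m + n)" | "even (m + n)" "degb \<pi> m n = 0" | "even (m + n)" "degb \<pi> m n = 1"
    by (cases "degb \<pi> m n") auto
  thus ?thesis
  proof cases
    case 1
    hence "Part PC 0 m n = {?z}" "Part PC 1 m n = {?z}" "f = ?z"
      using part_trivial[of m n] carrier_odd assms by auto
    thus ?thesis by (intro ex1I[of _ "(?z, ?z)"]) (auto simp: prod_eq_iff)
  next
    case 2
    hence "Part PC 0 m n = carrier (Hom PC m n)" "Part PC 1 m n = {?z}"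
      using part_trivial[of m n 1] part_full[of m n] by auto
    thus ?thesis using assms by (intro ex1I[of _ "(f, ?z)"]) (auto simp: prod_eq_iff)
  next
    case 3
    hence "Part PC 1 m n = carrier (Hom PC m n)" "Part PC 0 m n = {?z}"
      using part_trivial[of m n 0] part_full[of m n] by auto
    thus ?thesis using assms by (intro ex1I[of _ "(?z, f)"]) (auto simp: prod_eq_iff)
  qed
qed

theorem presented_supercategory: "strict_monoidal_supercategory PC"
proof (rule strict_monoidal_supercategory.intro, goal_cases)
  case 1 show ?case by (unfold_locales) (auto simp: PC_cls Units_def)
next
  case 2 show ?case by (rule hom_vectorspace)
next
  case 3 show ?case by (rule part_subspace)
next
  case (4 X Y f) thus ?case by (intro part_direct_sum)
next
  case (5 X) show ?case by (simp add: Idn_cls cls_Part)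
next
  case (6 X Y Z g p f q)
  then obtain s t where "g = cls s" "bwt s" "bsrc s = Y" "btgt s = Z" "bhomog \<pi> s p"
    "f = cls t" "bwt t" "bsrc t = X" "btgt t = Y" "bhomog \<pi> t q" by (elim PartE) blast
  thus ?case by (simp add: Cmp_cls cls_Part bhomog_Comp del: bhomog.simps add_bit_eq_xor)
next
  case (7 X Y Z f)
  then obtain t where t: "f = cls t" "t \<in> bexps X Y" by (auto simp: carrier_cls)
  show ?case
    by (rule linear_cls[where f = "\<lambda>s. s \<circ>\<^sub>e t"])
      (use t in \<open>auto simp: Cmp_cls Tns_cls Ob_PC bexps_def intro: bcong.comp_add_left bcong.comp_scale_left\<close>)
next
  case (8 X Y Z g)
  then obtain s where s: "g = cls s" "s \<in> bexps Y Z" by (auto simp: carrier_cls)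
  show ?case
    by (rule linear_cls[where f = "\<lambda>t. s \<circ>\<^sub>e t"])
      (use s in \<open>auto simp: Cmp_cls Tns_cls Ob_PC bexps_def intro: bcong.comp_add_right bcong.comp_scale_right\<close>)
next
  case (9 X Y Z W h g f)
  then obtain r s t where "h = cls r" "g = cls s" "f = cls t"
    "r \<in> bexps Z W" "s \<in> bexps Y Z" "t \<in> bexps X Y" by (auto simp: carrier_cls)
  thus ?case by (simp add: Cmp_cls bexps_def cls_eqI[OF bcong.comp_assoc])
next
  case (10 X Y f)
  then obtain t where "f = cls t" "t \<in> bexps X Y" by (auto simp: carrier_cls)
  thus ?case using bcong.comp_id_left[of t \<pi> R] by (simp add: Idn_cls Ob_PC Cmp_cls Tns_cls bexps_def cls_eqI)
next
  case (11 X Y f)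
  then obtain t where "f = cls t" "t \<in> bexps X Y" by (auto simp: carrier_cls)
  thus ?case using bcong.comp_id_right[of t \<pi> R] by (simp add: Idn_cls Ob_PC Cmp_cls Tns_cls bexps_def cls_eqI)
next
  case (12 X Y X' Y' f p g q)
  then obtain s t where "f = cls s" "bwt s" "bsrc s = X" "btgt s = Y" "bhomog \<pi> s p"
    "g = cls t" "bwt t" "bsrc t = X'" "btgt t = Y'" "bhomog \<pi> t q" by (elim PartE) blast
  thus ?case by (simp add: Tns_cls Ob_PC cls_Part bhomog_Tens del: bhomog.simps add_bit_eq_xor)
next
  case (13 X Y X' Y' g)
  then obtain t where t: "g = cls t" "t \<in> bexps X' Y'" by (auto simp: carrier_cls)
  show ?case
    by (rule linear_cls[where f = "\<lambda>s. s \<otimes>\<^sub>e t"])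
      (use t in \<open>auto simp: Cmp_cls Tns_cls Ob_PC bexps_def intro: bcong.tens_add_left bcong.tens_scale_left\<close>)
next
  case (14 X Y X' Y' f)
  then obtain s where s: "f = cls s" "s \<in> bexps X Y" by (auto simp: carrier_cls)
  show ?case
    by (rule linear_cls[where f = "\<lambda>t. s \<otimes>\<^sub>e t"])
      (use s in \<open>auto simp: Cmp_cls Tns_cls Ob_PC bexps_def intro: bcong.tens_add_right bcong.tens_scale_right\<close>)
next
  case (15 X Y X' Y' X'' Y'' f g h)
  then obtain r s t where "f = cls r" "g = cls s" "h = cls t"
    "r \<in> bexps X Y" "s \<in> bexps X' Y'" "t \<in> bexps X'' Y''" by (auto simp: carrier_cls)
  thus ?case by (simp add: Tns_cls bexps_def cls_eqI[OF bcong.tens_assoc])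
next
  case (16 X Y f)
  then obtain t where "f = cls t" "t \<in> bexps X Y" by (auto simp: carrier_cls)
  thus ?case using bcong.tens_unit_left[of t \<pi> R] by (simp add: Idn_cls Ob_PC Cmp_cls Tns_cls bexps_def cls_eqI)
next
  case (17 X Y f)
  then obtain t where "f = cls t" "t \<in> bexps X Y" by (auto simp: carrier_cls)
  thus ?case using bcong.tens_unit_right[of t \<pi> R] by (simp add: Idn_cls Ob_PC Cmp_cls Tns_cls bexps_def cls_eqI)
next
  case (18 X Y)
  show ?case by (simp add: Idn_cls Tns_cls Ob_PC cls_eqI[OF bcong.tens_id])
next
  case (19 X Y Z X' Y' Z' f g p h q k)
  then obtain r s t v where "f = cls r" "g = cls s" "h = cls t" "k = cls v"
    "r \<in> bexps Y Z" "s \<in> bexps Y' Z'" "bhomog \<pi> s p" "t \<in> bexps X Y" "bhomog \<pi> t q" "v \<in> bexps X' Y'"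
    by (auto simp: carrier_cls Part_cls)
  thus ?case by (simp add: Cmp_cls Tns_cls smult_cls bexps_def cls_eqI[OF bcong.interchange])
qed

lemma pow_PC: "(1::nat) [^]\<^bsub>Ob PC\<^esub> (n::nat) = n"
  by (induction n) (simp_all add: nat_pow_def Ob_PC)

lemma homn_PC: "homn PC 1 m n = Hom PC m n"
  by (simp only: homn_def pow_PC)

lemma partn_PC: "partn PC 1 p m n = Part PC p m n"
  by (simp only: partn_def pow_PC)

text \<open>Translates the conditions on a category of Brauer type, which speak of
  \<open>bval\<close>, into statements about classes.\<close>

lemma bval_PC: "bwt t \<Longrightarrow> bval PC 1 (cls GenH) (cls GenA) (cls GenU) t = cls t"
  by (induction t) (simp_all add: PC_cls homn_PC pow_PC del: One_nat_def)

end

section \<open>The matrix model\<close>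

text \<open>Degrees are rearranged below by the laws of an abelian group, which rewriting sums of
  bits into exclusive or would hide.\<close>

declare add_bit_eq_xor [simp del]

type_synonym label = "nat \<times> bool"

fun dual :: "label \<Rightarrow> label" where "dual (i, b) = (i, \<not> b)"

lemma dual_dual [simp]: "dual (dual c) = c"
  by (cases c) simp

lemma snd_dual [simp]: "snd (dual c) = (\<not> snd c)"
  by (cases c) simp

lemma fst_dual [simp]: "fst (dual c) = fst c"
  by (cases c) simp

lemma dual_neq [simp]: "dual c \<noteq> c" "c \<noteq> dual c"
  by (cases c, simp)+

lemma dual_eq_iff: "dual c = d \<longleftrightarrow> c = dual d"
  by auto

lemma dual_inj [simp]: "dual c = dual d \<longleftrightarrow> c = d"
  by (metis dual_dual)

lemma koszul_add_left: "koszul (p + q) r = koszul p r * (koszul q r :: 'k::field)"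
  by (cases p; cases q; cases r) (simp_all add: koszul_def)

lemma koszul_commute: "koszul p q = koszul q p"
  by (auto simp: koszul_def)

lemma koszul_add_right: "koszul r (p + q) = koszul r p * (koszul r q :: 'k::field)"
  by (simp only: koszul_commute[of r] koszul_add_left)

lemma koszul_cancel: "koszul p q * (koszul p q * c) = (c :: 'k::field)"
  by (simp flip: mult.assoc)

lemma bit_add_self: "p + p = (0::bit)"
  by (cases p) simp_all

locale cat00_params =
  fixes \<epsilon> lam sig e :: "'k::field"
  assumes eps: "\<epsilon> \<in> {1, - 1}" and e2: "e\<^sup>2 = - \<epsilon>"
    and lam_nz [simp]: "lam \<noteq> 0" and sig_nz [simp]: "sig \<noteq> 0"
begin

abbreviation \<pi> where "\<pi> \<equiv> gen_parity \<epsilon>"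

abbreviation Rel where "Rel \<equiv> defining_relations (params00 \<epsilon> lam sig e)"

lemma eps_nz [simp]: "\<epsilon> \<noteq> 0"
  using eps by auto

lemma e_nz [simp]: "e \<noteq> 0"
  using e2 eps by auto

end

text \<open>Finitely many dual pairs keep matrix products finite sums. The number \<open>N\<close>
  stays free and is later set to \<open>m + n\<close>, which leaves a separate dual pair for every
  strand of a diagram.\<close>

locale label_model = cat00_params \<epsilon> lam sig e for \<epsilon> lam sig e :: "'k::field" +
  fixes N :: nat
begin

definition L :: "label set" where "L = {..<N} \<times> UNIV"

definition wd :: "nat \<Rightarrow> label list set" where "wd n = {w. length w = n \<and> set w \<subseteq> L}"

fun par :: "label list \<Rightarrow> bit" where
  "par [] = 0"
| "par (c # w) = (if snd c then \<pi> else 0) + par w"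

text \<open>The weights \<open>hh\<close>, \<open>uu\<close>, \<open>aa\<close> solve the defining relations entrywise; the sign in the tensor
  product is the one of the action on a tensor power, where the matrix entry of \<open>t\<close> has degree
  \<open>par y + par x\<close>.\<close>

definition hh :: "label \<Rightarrow> label \<Rightarrow> 'k" where
  "hh c d = (if snd c then (if snd d then - lam else - \<epsilon> * e * lam) else (if snd d then e * lam else lam))"

definition uu :: "label \<Rightarrow> 'k" where "uu c = (if snd c then e else 1)"

definition aa :: "label \<Rightarrow> 'k" where "aa c = (if snd c then \<epsilon> * sig else - \<epsilon> * sig * e)"

primrec M :: "'k bexp \<Rightarrow> label list \<Rightarrow> label list \<Rightarrow> 'k" where
  "M (Ident n) y x = (if y = x then 1 else 0)"
| "M GenH y x = (if y = rev x then hh (x ! 0) (x ! 1) else 0)"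
| "M GenA y x = (if x ! 1 = dual (x ! 0) then aa (x ! 0) else 0)"
| "M GenU y x = (if y ! 1 = dual (y ! 0) then uu (y ! 0) else 0)"
| "M (Null m n) y x = 0"
| "M (s +\<^sub>e t) y x = M s y x + M t y x"
| "M (c *\<^sub>e t) y x = c * M t y x"
| "M (s \<circ>\<^sub>e t) y x = (\<Sum>z\<in>wd (btgt t). M s y z * M t z x)"
| "M (s \<otimes>\<^sub>e t) y x =
    koszul (par (take (bsrc s) x)) (par (drop (btgt s) y) + par (drop (bsrc s) x))
    * M s (take (btgt s) y) (take (bsrc s) x) * M t (drop (btgt s) y) (drop (bsrc s) x)"

lemma finite_L [simp]: "finite L"
  by (simp add: L_def)

lemma dual_L [simp]: "dual c \<in> L \<longleftrightarrow> c \<in> L"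
  by (cases c) (simp add: L_def)

lemma finite_wd [simp]: "finite (wd n)"
  unfolding wd_def using finite_lists_length_eq[OF finite_L, of n] by (simp add: conj_commute)

lemma eps_sq [simp]: "\<epsilon> * \<epsilon> = 1" "\<epsilon> * (\<epsilon> * c) = c"
  using eps by (auto simp: algebra_simps)

lemma e_sq: "e * e = - \<epsilon>" "e * (e * c) = - \<epsilon> * c"
  using e2 by (auto simp: power2_eq_square simp flip: mult.assoc)

lemma par_append [simp]: "par (x @ y) = par x + par y"
  by (induction x) (simp_all add: add.assoc del: add_bit_eq_xor)

lemma par_dual: "par [c, dual c] = \<pi>"
  by simp

lemma koszul_\<pi>: "koszul \<pi> \<pi> = \<epsilon>"
  using eps by (auto simp: koszul_def gen_parity_def)

lemma koszul_par1: "koszul (par [c]) \<pi> = (if snd c then \<epsilon> else 1)"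
  by (cases "snd c") (simp_all only: par.simps if_True if_False add_0_right koszul_\<pi> koszul_0)

lemma wd_0 [simp]: "wd 0 = {[]}"
  by (auto simp: wd_def)

lemma wd_Cons [simp]: "c # w \<in> wd n \<longleftrightarrow> c \<in> L \<and> (\<exists>m. n = Suc m \<and> w \<in> wd m)"
  by (auto simp: wd_def)

lemma wd_Nil [simp]: "[] \<in> wd n \<longleftrightarrow> n = 0"
  by (auto simp: wd_def)

lemma wd_length: "w \<in> wd n \<Longrightarrow> length w = n"
  by (simp add: wd_def)

lemma wd_append: "length u = m \<Longrightarrow> u @ v \<in> wd (m + n) \<longleftrightarrow> u \<in> wd m \<and> v \<in> wd n"
  by (auto simp: wd_def)

lemma wd_append_image: "wd (m + n) = (\<lambda>(u, v). u @ v) ` (wd m \<times> wd n)"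
proof
  show "wd (m + n) \<subseteq> (\<lambda>(u, v). u @ v) ` (wd m \<times> wd n)"
  proof
    fix w assume w: "w \<in> wd (m + n)"
    hence "take m w @ drop m w \<in> wd (m + n)" by simp
    moreover have "length (take m w) = m" using w by (simp add: wd_def)
    ultimately have "take m w \<in> wd m \<and> drop m w \<in> wd n" using wd_append by metis
    thus "w \<in> (\<lambda>(u, v). u @ v) ` (wd m \<times> wd n)"
      by (intro image_eqI[of _ _ "(take m w, drop m w)"]) auto
  qed
qed (auto simp: wd_def)

lemma wd_split: "w \<in> wd (m + n) \<Longrightarrow> \<exists>u v. w = u @ v \<and> u \<in> wd m \<and> v \<in> wd n"
  unfolding wd_append_image by auto

lemma sum_wd_add: "(\<Sum>w\<in>wd (m + n). F w) = (\<Sum>u\<in>wd m. \<Sum>v\<in>wd n. F (u @ v) :: 'k)"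
proof -
  have inj: "inj_on (\<lambda>(u, v). u @ v) (wd m \<times> wd n)"
    by (auto simp: inj_on_def wd_def)
  show ?thesis
    unfolding wd_append_image sum.reindex[OF inj] sum.cartesian_product
    by (simp add: case_prod_unfold)
qed

lemma sum_wd_1: "(\<Sum>w\<in>wd (Suc 0). F w) = (\<Sum>c\<in>L. F [c] :: 'k)"
proof -
  have "wd (Suc 0) = (\<lambda>c. [c]) ` L" by (auto simp: wd_def length_Suc_conv)
  thus ?thesis by (simp add: sum.reindex inj_on_def)
qed

lemma sum_wd_Suc: "(\<Sum>w\<in>wd (Suc n). F w) = (\<Sum>c\<in>L. \<Sum>w\<in>wd n. F (c # w) :: 'k)"
  using sum_wd_add[of F 1 n] by (simp add: sum_wd_1)

lemma M_tens:
  assumes "length y1 = btgt s" "length x1 = bsrc s"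
  shows "M (s \<otimes>\<^sub>e t) (y1 @ y2) (x1 @ x2)
    = koszul (par x1) (par y2 + par x2) * M s y1 x1 * M t y2 x2"
  using assms by (simp del: add_bit_eq_xor)

text \<open>The signs in \<open>M\<close> refer to parities of labels, those of the interchange law
  to degrees of expressions. At nonzero entries the two agree, which is what
  \<open>M_interchange\<close> needs.\<close>

lemma M_parity:
  assumes "bwt t" "y \<in> wd (btgt t)" "x \<in> wd (bsrc t)" "bhomog \<pi> t p" "M t y x \<noteq> 0"
  shows "p = par y + par x"
  using assms
proof (induction t arbitrary: y x p)
  case (Ident n)
  thus ?case by (simp add: bit_add_self split: if_splits del: add_bit_eq_xor)
next
  case GenH
  then obtain c d where "x = [c, d]" by (auto simp: wd_def length_Suc_conv numeral_2_eq_2)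
  moreover have "y = rev x" using GenH by (simp split: if_splits)
  ultimately show ?case using GenH by auto
next
  case GenA
  then obtain c d where "x = [c, d]" by (auto simp: wd_def length_Suc_conv numeral_2_eq_2)
  moreover have "y = []" "x ! 1 = dual (x ! 0)" using GenA by (auto split: if_splits)
  ultimately show ?case using GenA by auto
next
  case GenU
  then obtain c d where "y = [c, d]" by (auto simp: wd_def length_Suc_conv numeral_2_eq_2)
  moreover have "x = []" "y ! 1 = dual (y ! 0)" using GenU by (auto split: if_splits)
  ultimately show ?case using GenU by auto
next
  case (Add s t)
  hence "M s y x \<noteq> 0 \<or> M t y x \<noteq> 0" by auto
  thus ?case using Add.IH[of y x p] Add.prems by auto
next
  case (Scale c t)
  thus ?case by auto
next
  case (Comp s t)
  obtain q r where qr: "p = q + r" "bhomog \<pi> s q" "bhomog \<pi> t r" using Comp.prems by auto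
  \<comment> \<open>Some intermediate word \<open>z\<close> contributes to the sum; its parity
    occurs twice in the total degree and cancels.\<close>
  have "\<exists>z\<in>wd (btgt t). M s y z * M t z x \<noteq> 0"
    using Comp.prems(5) by (auto intro: sum.neutral)
  then obtain z where z: "z \<in> wd (btgt t)" "M s y z \<noteq> 0" "M t z x \<noteq> 0" by auto
  have "q = par y + par z" "r = par z + par x"
    using Comp.IH(1)[of y z q] Comp.IH(2)[of z x r] Comp.prems z qr by auto
  hence "p = par y + (par z + par z) + par x" using qr(1) by (simp only: add.assoc)
  thus ?case by (simp only: bit_add_self add_0_right)
next
  case (Tens s t)
  obtain q r where qr: "p = q + r" "bhomog \<pi> s q" "bhomog \<pi> t r" using Tens.prems by auto
  obtain y1 y2 where y: "y = y1 @ y2" "y1 \<in> wd (btgt s)" "y2 \<in> wd (btgt t)"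
    using Tens.prems wd_split[of y "btgt s" "btgt t"] by auto
  obtain x1 x2 where x: "x = x1 @ x2" "x1 \<in> wd (bsrc s)" "x2 \<in> wd (bsrc t)"
    using Tens.prems wd_split[of x "bsrc s" "bsrc t"] by auto
  have "M s y1 x1 \<noteq> 0" "M t y2 x2 \<noteq> 0"
    using Tens.prems(5) x y by (auto simp: wd_def)
  hence "q = par y1 + par x1" "r = par y2 + par x2"
    using Tens.IH(1)[of y1 x1 q] Tens.IH(2)[of y2 x2 r] Tens.prems x y qr by auto
  thus ?case using qr(1) x y by (simp only: par_append ac_simps)
qed auto

declare M.simps(9) [simp del]

lemma M_comp_assoc: "M ((s \<circ>\<^sub>e t) \<circ>\<^sub>e v) y x = M (s \<circ>\<^sub>e (t \<circ>\<^sub>e v)) y x"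
proof -
  have "M ((s \<circ>\<^sub>e t) \<circ>\<^sub>e v) y x
      = (\<Sum>z\<in>wd (btgt v). \<Sum>z'\<in>wd (btgt t). M s y z' * M t z' z * M v z x)"
    by (simp add: sum_distrib_right)
  also have "\<dots> = (\<Sum>z'\<in>wd (btgt t). \<Sum>z\<in>wd (btgt v). M s y z' * M t z' z * M v z x)"
    by (rule sum.swap)
  also have "\<dots> = M (s \<circ>\<^sub>e (t \<circ>\<^sub>e v)) y x" by (simp add: sum_distrib_left mult.assoc)
  finally show ?thesis .
qed

text \<open>If the entry of \<open>g\<close> or of \<open>h\<close> vanishes, both terms vanish.
  Otherwise \<open>M_parity\<close> expresses \<open>p\<close> and \<open>q\<close> by parities of
  words, and the signs agree because \<open>koszul\<close> is multiplicative in each argument and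
  squares to 1.\<close>

lemma M_interchange:
  assumes "bwt (f \<circ>\<^sub>e h)" "bwt (g \<circ>\<^sub>e k)" "bhomog \<pi> g p" "bhomog \<pi> h q"
    and "y \<in> wd (btgt f + btgt g)" "x \<in> wd (bsrc h + bsrc k)"
  shows "M ((f \<otimes>\<^sub>e g) \<circ>\<^sub>e (h \<otimes>\<^sub>e k)) y x = M (koszul p q *\<^sub>e ((f \<circ>\<^sub>e h) \<otimes>\<^sub>e (g \<circ>\<^sub>e k))) y x"
proof -
  obtain y1 y2 where y: "y = y1 @ y2" "y1 \<in> wd (btgt f)" "y2 \<in> wd (btgt g)"
    using assms wd_split by blast
  obtain x1 x2 where x: "x = x1 @ x2" "x1 \<in> wd (bsrc h)" "x2 \<in> wd (bsrc k)"
    using assms wd_split by blast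
  have len: "length y1 = btgt f" "length x1 = bsrc h" using x y by (auto simp: wd_def)
  let ?K = "koszul p q * koszul (par x1) (par y2 + par x2)"
  have "M ((f \<otimes>\<^sub>e g) \<circ>\<^sub>e (h \<otimes>\<^sub>e k)) y x
      = (\<Sum>z1\<in>wd (btgt h). \<Sum>z2\<in>wd (btgt k).
          M (f \<otimes>\<^sub>e g) (y1 @ y2) (z1 @ z2) * M (h \<otimes>\<^sub>e k) (z1 @ z2) (x1 @ x2))"
    using x y by (simp add: sum_wd_add)
  also have "\<dots> = (\<Sum>z1\<in>wd (btgt h). \<Sum>z2\<in>wd (btgt k).
          ?K * ((M f y1 z1 * M h z1 x1) * (M g y2 z2 * M k z2 x2)))"
  proof (intro sum.cong HOL.refl)
    fix z1 z2 assume z: "z1 \<in> wd (btgt h)" "z2 \<in> wd (btgt k)"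
    have M1: "M (f \<otimes>\<^sub>e g) (y1 @ y2) (z1 @ z2) = koszul (par z1) (par y2 + par z2) * M f y1 z1 * M g y2 z2"
      using assms z len by (intro M_tens) (auto simp: wd_def)
    have M2: "M (h \<otimes>\<^sub>e k) (z1 @ z2) (x1 @ x2) = koszul (par x1) (par z2 + par x2) * M h z1 x1 * M k z2 x2"
      using assms z len by (intro M_tens) (auto simp: wd_def)
    show "M (f \<otimes>\<^sub>e g) (y1 @ y2) (z1 @ z2) * M (h \<otimes>\<^sub>e k) (z1 @ z2) (x1 @ x2)
      = ?K * ((M f y1 z1 * M h z1 x1) * (M g y2 z2 * M k z2 x2))"
    proof (cases "M g y2 z2 = 0 \<or> M h z1 x1 = 0")
      case False
      have p: "p = par y2 + par z2" using False assms y z by (intro M_parity[of g]) auto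
      have q: "q = par z1 + par x1" using False assms x z by (intro M_parity[of h]) auto
      have yx: "par y2 + par x2 = p + (par z2 + par x2)"
      proof -
        have "p + (par z2 + par x2) = par y2 + (par z2 + par z2) + par x2"
          unfolding p by (simp only: add.assoc)
        thus ?thesis by (simp only: bit_add_self add_0_right)
      qed
      have "koszul (par z1) p * koszul (par x1) (par z2 + par x2) = (?K :: 'k)"
        unfolding yx q koszul_add_right koszul_add_left
        by (simp add: koszul_commute[of p] koszul_cancel mult.assoc)
      note K = this
      have "M (f \<otimes>\<^sub>e g) (y1 @ y2) (z1 @ z2) * M (h \<otimes>\<^sub>e k) (z1 @ z2) (x1 @ x2)
          = (koszul (par z1) p * koszul (par x1) (par z2 + par x2))
            * ((M f y1 z1 * M h z1 x1) * (M g y2 z2 * M k z2 x2))"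
        unfolding M1 M2 p[symmetric] by (simp only: mult_ac)
      thus ?thesis unfolding K .
    qed (auto simp: M1 M2)
  qed
  also have "\<dots> = ?K * ((\<Sum>z1\<in>wd (btgt h). M f y1 z1 * M h z1 x1) * (\<Sum>z2\<in>wd (btgt k). M g y2 z2 * M k z2 x2))"
    by (subst sum_product) (simp only: sum_distrib_left)
  also have "\<dots> = M (koszul p q *\<^sub>e ((f \<circ>\<^sub>e h) \<otimes>\<^sub>e (g \<circ>\<^sub>e k))) y x"
    using M_tens[of y1 "f \<circ>\<^sub>e h" x1 "g \<circ>\<^sub>e k" y2 x2] len x y by (simp add: mult.assoc)
  finally show ?thesis .
qed

text \<open>The parity of the strands to the right enters the sign twice and cancels; only the
  strands to the left, past which \<open>t\<close> is moved, leave a sign.\<close>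

lemma M_lay:
  assumes "length y1 = i" "length y2 = btgt t" "length x1 = i" "length x2 = bsrc t"
  shows "M (lay i t k) (y1 @ y2 @ y3) (x1 @ x2 @ x3)
    = (if y1 = x1 \<and> y3 = x3 then koszul (par y1) (par y2 + par x2) * M t y2 x2 else 0)"
proof (cases "y3 = x3")
  case True
  have "par y2 + par x3 + (par x2 + par x3) = par y2 + par x2 + (par x3 + par x3)"
    by (simp only: ac_simps)
  thus ?thesis using assms True
    by (simp add: lay_def M_tens bit_add_self)
qed (use assms in \<open>simp add: lay_def M_tens\<close>)

lemma lay_left:
  assumes "y1 \<in> wd i" "y2 \<in> wd (btgt t)" "y3 \<in> wd k"
  shows "(\<Sum>z\<in>wd (i + (bsrc t + k)). M (lay i t k) (y1 @ y2 @ y3) z * F z)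
    = (\<Sum>v\<in>wd (bsrc t). koszul (par y1) (par y2 + par v) * M t y2 v * F (y1 @ v @ y3))"
proof -
  have len: "length y1 = i" "length y2 = btgt t" using assms by (auto simp: wd_def)
  define K where "K v = koszul (par y1) (par y2 + par v) * M t y2 v * F (y1 @ v @ y3)" for v
  have "(\<Sum>z\<in>wd (i + (bsrc t + k)). M (lay i t k) (y1 @ y2 @ y3) z * F z)
    = (\<Sum>z1\<in>wd i. \<Sum>v\<in>wd (bsrc t). \<Sum>z3\<in>wd k. M (lay i t k) (y1 @ y2 @ y3) (z1 @ v @ z3) * F (z1 @ v @ z3))"
    by (simp only: sum_wd_add)
  also have "\<dots> = (\<Sum>z1\<in>wd i. \<Sum>v\<in>wd (bsrc t). \<Sum>z3\<in>wd k.
      if z3 = y3 then if z1 = y1 then K v else 0 else 0)"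
  proof (intro sum.cong HOL.refl)
    fix z1 v z3 assume z: "z1 \<in> wd i" "v \<in> wd (bsrc t)" "z3 \<in> wd k"
    have "M (lay i t k) (y1 @ y2 @ y3) (z1 @ v @ z3)
        = (if y1 = z1 \<and> y3 = z3 then koszul (par y1) (par y2 + par v) * M t y2 v else 0)"
      using len z by (intro M_lay) (auto simp: wd_length)
    thus "M (lay i t k) (y1 @ y2 @ y3) (z1 @ v @ z3) * F (z1 @ v @ z3)
        = (if z3 = y3 then if z1 = y1 then K v else 0 else 0)"
      by (auto simp: K_def)
  qed
  also have "\<dots> = (\<Sum>z1\<in>wd i. \<Sum>v\<in>wd (bsrc t). if z1 = y1 then K v else 0)"
    using assms by simp
  also have "\<dots> = (\<Sum>v\<in>wd (bsrc t). \<Sum>z1\<in>wd i. if z1 = y1 then K v else 0)"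
    by (rule sum.swap)
  also have "\<dots> = (\<Sum>v\<in>wd (bsrc t). K v)"
    using assms by simp
  finally show ?thesis by (simp only: K_def)
qed

lemma sum_wd_2: "(\<Sum>w\<in>wd 2. F w) = (\<Sum>c\<in>L. \<Sum>d\<in>L. F [c, d] :: 'k)"
  by (simp add: numeral_2_eq_2 sum_wd_Suc)

lemma sum_H:
  assumes "a \<in> L" "b \<in> L"
  shows "(\<Sum>v\<in>wd 2. M GenH [a, b] v * F v) = hh b a * F [b, a]"
proof -
  have eq: "M GenH [a, b] [c, d] * F [c, d] = (if d = a then if c = b then hh b a * F [b, a] else 0 else 0)"
    for c d by auto
  show ?thesis unfolding sum_wd_2 eq using assms by simp
qed

lemma sum_A: "(\<Sum>v\<in>wd 2. M GenA [] v * F v) = (\<Sum>c\<in>L. aa c * F [c, dual c])"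
proof -
  have eq: "M GenA [] [c, d] * F [c, d] = (if d = dual c then aa c * F [c, dual c] else 0)" for c d
    by auto
  show ?thesis unfolding sum_wd_2 eq by simp
qed

lemma H_left:
  assumes "y1 \<in> wd i" "a \<in> L" "b \<in> L" "y3 \<in> wd k"
  shows "(\<Sum>z\<in>wd (i + (2 + k)). M (lay i GenH k) (y1 @ [a, b] @ y3) z * F z)
    = hh b a * F (y1 @ [b, a] @ y3)"
proof -
  \<comment> \<open>A flip keeps the total parity of the two labels, so the sign is 1 wherever the
    entry of \<open>GenH\<close> is nonzero.\<close>
  have s: "koszul (par y1) (par [a, b] + par v) * M GenH [a, b] v = M GenH [a, b] v" for v
  proof (cases "v = [b, a]")
    case True
    have "par [a, b] = par [b, a]" by (simp add: add.commute)
    thus ?thesis using True by (simp only: bit_add_self koszul_0 mult_1)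
  next
    case False
    hence "[a, b] \<noteq> rev v" by (metis rev.simps(2) rev_rev_ident rev_singleton_conv append_Cons append_Nil)
    thus ?thesis by simp
  qed
  have "[a, b] \<in> wd (btgt GenH)" using assms by (simp add: wd_def)
  from lay_left[OF assms(1) this assms(4), of F] show ?thesis
    by (simp only: s sum_H[OF assms(2,3)] bsrc.simps)
qed

lemma U_left:
  assumes "y1 \<in> wd i" "a \<in> L" "b \<in> L" "y3 \<in> wd k"
  shows "(\<Sum>z\<in>wd (i + (0 + k)). M (lay i GenU k) (y1 @ [a, b] @ y3) z * F z)
    = (if b = dual a then koszul (par y1) \<pi> * uu a * F (y1 @ y3) else 0)"
proof -
  have ab: "[a, b] \<in> wd (btgt GenU)" using assms by (simp add: wd_def)
  note l = lay_left[OF assms(1) ab assms(4), of F, unfolded bsrc.simps wd_0]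
  show ?thesis
  proof (cases "b = dual a")
    case True
    show ?thesis unfolding l unfolding True par_dual by simp
  next
    case False
    hence "\<not> [a, b] ! 1 = dual ([a, b] ! 0)" by simp
    thus ?thesis unfolding l using False by simp
  qed
qed

lemma A_left:
  assumes "y1 \<in> wd i" "y3 \<in> wd k"
  shows "(\<Sum>z\<in>wd (i + (2 + k)). M (lay i GenA k) (y1 @ y3) z * F z)
    = koszul (par y1) \<pi> * (\<Sum>c\<in>L. aa c * F (y1 @ [c, dual c] @ y3))"
proof -
  have s: "koszul (par y1) (par [] + par v) * M GenA [] v * F' = M GenA [] v * (koszul (par y1) (par v) * F')"
    for v F' by (simp only: par.simps add_0_left mult_ac)
  have "(\<Sum>z\<in>wd (i + (2 + k)). M (lay i GenA k) (y1 @ y3) z * F z)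
    = (\<Sum>v\<in>wd 2. M GenA [] v * (koszul (par y1) (par v) * F (y1 @ v @ y3)))"
    using lay_left[of y1 i "[]" GenA y3 k F] assms unfolding s by simp
  also have "\<dots> = (\<Sum>c\<in>L. aa c * (koszul (par y1) (par [c, dual c]) * F (y1 @ [c, dual c] @ y3)))"
    by (rule sum_A)
  also have "\<dots> = koszul (par y1) \<pi> * (\<Sum>c\<in>L. aa c * F (y1 @ [c, dual c] @ y3))"
    unfolding par_dual sum_distrib_left by (simp only: mult_ac)
  finally show ?thesis .
qed

end

section \<open>The weights satisfy the defining relations\<close>

context label_model
begin

declare M.simps(2-4) [simp del]

lemma M_gens:
  "M GenH [a, b] [c, d] = (if a = d \<and> b = c then hh b a else 0)"
  "M GenU [a, b] [] = (if b = dual a then uu a else 0)"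
  "M GenA [] [a, b] = (if b = dual a then aa a else 0)"
  by (auto simp: M.simps)

lemma wd_Suc [simp]: "wd (Suc (Suc 0)) = wd 2" "wd (Suc (Suc (Suc 0))) = wd 3"
  by (simp_all add: numeral_2_eq_2 numeral_3_eq_3)

lemma wd_expand:
  "w \<in> wd (Suc 0) \<Longrightarrow> \<exists>a\<in>L. w = [a]"
  "w \<in> wd 2 \<Longrightarrow> \<exists>a\<in>L. \<exists>b\<in>L. w = [a, b]"
  "w \<in> wd 3 \<Longrightarrow> \<exists>a\<in>L. \<exists>b\<in>L. \<exists>c\<in>L. w = [a, b, c]"
  by (auto simp: wd_def length_Suc_conv numeral_2_eq_2 numeral_3_eq_3)

lemma M_tens_I: "M (t \<otimes>\<^sub>e Ident k) y z = M (lay 0 t k) y z"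
  by (simp add: lay_def M.simps(9))

lemma M_I_tens: "length y = i + btgt t \<Longrightarrow> length z = i + bsrc t \<Longrightarrow> M (Ident i \<otimes>\<^sub>e t) y z = M (lay i t 0) y z"
  by (simp add: lay_def M.simps(9))

lemma HI_left: "a \<in> L \<Longrightarrow> b \<in> L \<Longrightarrow> c \<in> L \<Longrightarrow>
    (\<Sum>z\<in>wd 3. M (GenH \<otimes>\<^sub>e Ident (Suc 0)) [a, b, c] z * F z) = hh b a * F [b, a, c]"
  using H_left[of "[]" 0 a b "[c]" "Suc 0" F] by (simp add: M_tens_I wd_def del: M.simps)

lemma IH_left:
  assumes "a \<in> L" "b \<in> L" "c \<in> L"
  shows "(\<Sum>z\<in>wd 3. M (Ident (Suc 0) \<otimes>\<^sub>e GenH) [a, b, c] z * F z) = hh c b * F [a, c, b]"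
proof -
  have "(\<Sum>z\<in>wd 3. M (Ident (Suc 0) \<otimes>\<^sub>e GenH) [a, b, c] z * F z)
      = (\<Sum>z\<in>wd (Suc 0 + (2 + 0)). M (lay (Suc 0) GenH 0) ([a] @ [b, c] @ []) z * F z)"
    by (intro sum.cong) (auto simp: M_I_tens wd_def numeral_3_eq_3)
  also have "\<dots> = hh c b * F ([a] @ [c, b] @ [])"
    using assms by (intro H_left) (auto simp: wd_def)
  finally show ?thesis by simp
qed

lemma AI_left: "a \<in> L \<Longrightarrow>
    (\<Sum>z\<in>wd 3. M (GenA \<otimes>\<^sub>e Ident (Suc 0)) [a] z * F z) = (\<Sum>c\<in>L. aa c * F [c, dual c, a])"
  using A_left[of "[]" 0 "[a]" "Suc 0" F] by (simp add: M_tens_I wd_def del: M.simps)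

lemma IA_left:
  assumes "a \<in> L"
  shows "(\<Sum>z\<in>wd 3. M (Ident (Suc 0) \<otimes>\<^sub>e GenA) [a] z * F z)
    = (if snd a then \<epsilon> else 1) * (\<Sum>c\<in>L. aa c * F [a, c, dual c])"
proof -
  have "(\<Sum>z\<in>wd 3. M (Ident (Suc 0) \<otimes>\<^sub>e GenA) [a] z * F z)
      = (\<Sum>z\<in>wd (Suc 0 + (2 + 0)). M (lay (Suc 0) GenA 0) ([a] @ []) z * F z)"
    by (intro sum.cong) (auto simp: M_I_tens wd_def numeral_3_eq_3)
  also have "\<dots> = koszul (par [a]) \<pi> * (\<Sum>c\<in>L. aa c * F ([a] @ [c, dual c] @ []))"
    using assms by (intro A_left) (auto simp: wd_def)
  finally show ?thesis unfolding koszul_par1 by simp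
qed

lemma M_UI: "M (GenU \<otimes>\<^sub>e Ident (Suc 0)) [a, b, c] [d] = (if b = dual a \<and> c = d then uu a else 0)"
  by (auto simp: M.simps(9) M_gens bit_add_self)

lemma M_IU: "M (Ident (Suc 0) \<otimes>\<^sub>e GenU) [a, b, c] [d]
    = (if c = dual b \<and> a = d then (if snd a then \<epsilon> else 1) * uu b else 0)"
  using koszul_par1[of a] par_dual[of b] by (auto simp: M.simps(9) M_gens bit_add_self simp del: par.simps(2))

lemma M_AI: "M (GenA \<otimes>\<^sub>e Ident (Suc 0)) [d] [a, b, c] = (if b = dual a \<and> c = d then aa a else 0)"
  by (auto simp: M.simps(9) M_gens bit_add_self)

lemma M_IA: "M (Ident (Suc 0) \<otimes>\<^sub>e GenA) [d] [a, b, c]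
    = (if c = dual b \<and> a = d then (if snd a then \<epsilon> else 1) * aa b else 0)"
  using koszul_par1[of a] par_dual[of b] by (auto simp: M.simps(9) M_gens bit_add_self simp del: par.simps(2))

lemma M_HI: "M (GenH \<otimes>\<^sub>e Ident (Suc 0)) [a, b, c] [a', b', c']
    = (if a = b' \<and> b = a' \<and> c = c' then hh b a else 0)"
  by (auto simp: M.simps(9) M_gens bit_add_self)

lemma M_IH: "M (Ident (Suc 0) \<otimes>\<^sub>e GenH) [a, b, c] [a', b', c']
    = (if a = a' \<and> b = c' \<and> c = b' then hh c b else 0)"
  by (auto simp: M.simps(9) M_gens bit_add_self add.commute)

lemmas M3 = HI_left IH_left AI_left IA_left M_UI M_IU M_AI M_IA M_HI M_IH

lemma sum_L: "(\<Sum>c\<in>L. F c) = (\<Sum>i<N. F (i, False) + F (i, True) :: 'k)"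
proof -
  have "(\<Sum>c\<in>L. F c) = (\<Sum>i<N. \<Sum>b\<in>UNIV. F (i, b))"
    by (simp add: L_def sum.cartesian_product)
  thus ?thesis by (simp add: UNIV_bool)
qed

text \<open>Both sides reverse the word and collect the weights of the same three pairs of labels;
  any scaled flip has this property.\<close>

lemma M_braid:
  assumes "y \<in> wd 3" "x \<in> wd 3"
  shows "M (fst braid_relation) y x = M (snd braid_relation) y x"
proof -
  obtain a b c where y: "a \<in> L" "b \<in> L" "c \<in> L" "y = [a, b, c]" using wd_expand(3)[OF assms(1)] by auto
  obtain a' b' c' where x: "x = [a', b', c']" using wd_expand(3)[OF assms(2)] by auto
  show ?thesis using y by (simp add: braid_relation_def x M3)
qed

lemma sum_L_delta: "x \<in> L \<Longrightarrow> (\<Sum>c\<in>L. F c * (if c = x then G c else 0)) = (F x * G x :: 'k)"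
proof -
  assume "x \<in> L"
  have "F c * (if c = x then G c else 0) = (if c = x then F x * G x else 0)" for c by simp
  thus ?thesis using \<open>x \<in> L\<close> by simp
qed

lemma M_HU: "a \<in> L \<Longrightarrow> b \<in> L \<Longrightarrow> M (GenH \<circ>\<^sub>e GenU) [a, b] [] = lam * M GenU [a, b] []"
  by (simp add: M3 sum_H M_gens, cases "snd a"; cases "snd b"; auto simp: hh_def uu_def e_sq mult_ac power2_eq_square)

lemma M_AH: "a \<in> L \<Longrightarrow> b \<in> L \<Longrightarrow> M (GenA \<circ>\<^sub>e GenH) [] [a, b] = - lam * M GenA [] [a, b]"
  proof -
  assume ab: "a \<in> L" "b \<in> L"
  have "M (GenA \<circ>\<^sub>e GenH) [] [a, b] = (\<Sum>c\<in>L. aa c * (if c = b then if a = dual c then hh a b else 0 else 0))"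
    unfolding M.simps(8) btgt.simps sum_A M_gens by (auto intro!: sum.cong)
  also have "\<dots> = aa b * (if a = dual b then hh a b else 0)"
    using ab by (rule_tac sum_L_delta)
  also have "\<dots> = - lam * M GenA [] [a, b]"
    by (cases "snd a") (auto simp: M_gens hh_def aa_def e_sq mult_ac)
  finally show ?thesis .
qed

text \<open>The two labels of a dual pair contribute opposite terms to the sum.\<close>

lemma M_AU: "M (GenA \<circ>\<^sub>e GenU) [] [] = 0"
  proof -
  have "M (GenA \<circ>\<^sub>e GenU) [] [] = (\<Sum>c\<in>L. aa c * uu c)"
    unfolding M.simps(8) btgt.simps sum_A M_gens by simp
  also have "\<dots> = 0" unfolding sum_L by (simp add: aa_def uu_def)
  finally show ?thesis .
qed

lemma M_AIIU: "a \<in> L \<Longrightarrow> d \<in> L \<Longrightarrow> M ((GenA \<otimes>\<^sub>e Ident (Suc 0)) \<circ>\<^sub>e (Ident (Suc 0) \<otimes>\<^sub>e GenU)) [d] [a] = sig * M (Ident 1) [d] [a]"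
  proof -
  assume ad: "a \<in> L" "d \<in> L"
  have "M ((GenA \<otimes>\<^sub>e Ident (Suc 0)) \<circ>\<^sub>e (Ident (Suc 0) \<otimes>\<^sub>e GenU)) [d] [a] = (\<Sum>c\<in>L. aa c * (if c = a then if a = d then (if snd c then \<epsilon> else 1) * uu (dual c) else 0 else 0))"
    using ad by (auto simp: M3 dual_eq_iff intro!: sum.cong arg_cong2[where f = "(*)"])
  also have "\<dots> = sig * M (Ident 1) [d] [a]" using ad
    by (subst sum_L_delta) (auto simp: hh_def uu_def aa_def e_sq mult_ac)
  finally show ?thesis .
qed

lemma M_IAUI: "a \<in> L \<Longrightarrow> d \<in> L \<Longrightarrow> M ((Ident (Suc 0) \<otimes>\<^sub>e GenA) \<circ>\<^sub>e (GenU \<otimes>\<^sub>e Ident (Suc 0))) [d] [a] = \<epsilon> * sig * M (Ident 1) [d] [a]"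
  proof -
  assume ad: "a \<in> L" "d \<in> L"
  have "M ((Ident (Suc 0) \<otimes>\<^sub>e GenA) \<circ>\<^sub>e (GenU \<otimes>\<^sub>e Ident (Suc 0))) [d] [a] = (if snd d then \<epsilon> else 1) * (\<Sum>c\<in>L. aa c * (if c = dual d then if dual c = a then uu d else 0 else 0))"
    using ad by (auto simp: M3 dual_eq_iff intro!: sum.cong arg_cong2[where f = "(*)"])
  also have "\<dots> = \<epsilon> * sig * M (Ident 1) [d] [a]" using ad
    by (subst sum_L_delta) (auto simp: hh_def uu_def aa_def e_sq mult_ac)
  finally show ?thesis .
qed

lemma M_AIIHUI: "a \<in> L \<Longrightarrow> d \<in> L \<Longrightarrow> M ((GenA \<otimes>\<^sub>e Ident (Suc 0)) \<circ>\<^sub>e (Ident (Suc 0) \<otimes>\<^sub>e GenH) \<circ>\<^sub>e (GenU \<otimes>\<^sub>e Ident (Suc 0))) [d] [a] = \<epsilon> * sig * e * lam * M (Ident 1) [d] [a]"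
  proof -
  assume ad: "a \<in> L" "d \<in> L"
  have "M ((GenA \<otimes>\<^sub>e Ident (Suc 0)) \<circ>\<^sub>e (Ident (Suc 0) \<otimes>\<^sub>e GenH) \<circ>\<^sub>e (GenU \<otimes>\<^sub>e Ident (Suc 0))) [d] [a] = (\<Sum>c\<in>L. aa c * (if c = dual a then if a = d then hh d (dual c) * uu c else 0 else 0))"
  proof -
    have "aa c * (hh d (dual c) * (if d = dual c \<and> dual c = a then uu c else 0))
        = aa c * (if c = dual a then if a = d then hh d (dual c) * uu c else 0 else 0)" for c
      by (cases "c = dual a") auto
    hence "(\<Sum>c\<in>L. aa c * (hh d (dual c) * (if d = dual c \<and> dual c = a then uu c else 0)))
        = (\<Sum>c\<in>L. aa c * (if c = dual a then if a = d then hh d (dual c) * uu c else 0 else 0))"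
      by (rule sum.cong[OF HOL.refl])
    thus ?thesis using ad by (simp add: M3)
  qed
  also have "\<dots> = \<epsilon> * sig * e * lam * M (Ident 1) [d] [a]" using ad
    by (subst sum_L_delta) (auto simp: hh_def uu_def aa_def e_sq mult_ac)
  finally show ?thesis .
qed

lemma M_HH: "a \<in> L \<Longrightarrow> b \<in> L \<Longrightarrow> c \<in> L \<Longrightarrow> d \<in> L \<Longrightarrow> M (GenH \<circ>\<^sub>e GenH) [a, b] [c, d] = lam\<^sup>2 * M (Ident 2) [a, b] [c, d]"
  by (simp add: M3 sum_H M_gens, cases "snd a"; cases "snd b"; auto simp: hh_def uu_def e_sq mult_ac power2_eq_square)

lemma M_HIIU: "a \<in> L \<Longrightarrow> b \<in> L \<Longrightarrow> c \<in> L \<Longrightarrow> d \<in> L \<Longrightarrow> M ((GenH \<otimes>\<^sub>e Ident (Suc 0)) \<circ>\<^sub>e (Ident (Suc 0) \<otimes>\<^sub>e GenU)) [a, b, c] [d] = e * M ((Ident (Suc 0) \<otimes>\<^sub>e GenH) \<circ>\<^sub>e (GenU \<otimes>\<^sub>e Ident (Suc 0))) [a, b, c] [d]"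
  by (simp add: M3 sum_H M_gens, cases "snd a"; cases "snd b"; auto simp: hh_def uu_def e_sq mult_ac power2_eq_square)

lemma M_HIIHUI: "a \<in> L \<Longrightarrow> b \<in> L \<Longrightarrow> c \<in> L \<Longrightarrow> d \<in> L \<Longrightarrow> M ((GenH \<otimes>\<^sub>e Ident (Suc 0)) \<circ>\<^sub>e (Ident (Suc 0) \<otimes>\<^sub>e GenH) \<circ>\<^sub>e (GenU \<otimes>\<^sub>e Ident (Suc 0))) [a, b, c] [d] = - \<epsilon> * e * lam\<^sup>2 * M (Ident (Suc 0) \<otimes>\<^sub>e GenU) [a, b, c] [d]"
  by (simp add: M3 sum_H M_gens, cases "snd a"; cases "snd b"; auto simp: hh_def uu_def e_sq mult_ac power2_eq_square)

lemma M_IAHI: "a \<in> L \<Longrightarrow> b \<in> L \<Longrightarrow> c \<in> L \<Longrightarrow> d \<in> L \<Longrightarrow> M ((Ident (Suc 0) \<otimes>\<^sub>e GenA) \<circ>\<^sub>e (GenH \<otimes>\<^sub>e Ident (Suc 0))) [d] [a, b, c] = - \<epsilon> * e * M ((GenA \<otimes>\<^sub>e Ident (Suc 0)) \<circ>\<^sub>e (Ident (Suc 0) \<otimes>\<^sub>e GenH)) [d] [a, b, c]"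
  proof -
  assume L: "a \<in> L" "b \<in> L" "c \<in> L" "d \<in> L"
  have "M ((Ident (Suc 0) \<otimes>\<^sub>e GenA) \<circ>\<^sub>e (GenH \<otimes>\<^sub>e Ident (Suc 0))) [d] [a, b, c]
      = (if snd d then \<epsilon> else 1) * (\<Sum>x\<in>L. aa x * (if x = a then if b = d \<and> dual x = c then hh x d else 0 else 0))"
    using L by (auto simp: M3 intro!: sum.cong)
  also have "\<dots> = (if snd d then \<epsilon> else 1) * (aa a * (if b = d \<and> dual a = c then hh a d else 0))"
    using L by (subst sum_L_delta) auto
  finally have 1: "M ((Ident (Suc 0) \<otimes>\<^sub>e GenA) \<circ>\<^sub>e (GenH \<otimes>\<^sub>e Ident (Suc 0))) [d] [a, b, c] = \<dots>" .
  have "M ((GenA \<otimes>\<^sub>e Ident (Suc 0)) \<circ>\<^sub>e (Ident (Suc 0) \<otimes>\<^sub>e GenH)) [d] [a, b, c] = (\<Sum>x\<in>L. aa x * (if x = a then if b = d \<and> dual x = c then hh d (dual x) else 0 else 0))"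
    using L by (auto simp: M3 intro!: sum.cong)
  also have "\<dots> = aa a * (if b = d \<and> dual a = c then hh d (dual a) else 0)"
    using L by (subst sum_L_delta) auto
  finally have 2: "M ((GenA \<otimes>\<^sub>e Ident (Suc 0)) \<circ>\<^sub>e (Ident (Suc 0) \<otimes>\<^sub>e GenH)) [d] [a, b, c] = \<dots>" .
  show ?thesis unfolding 1 2 by (cases "snd a"; cases "snd d") (auto simp: hh_def aa_def e_sq mult_ac)
qed

lemma M_AIIHHI: "a \<in> L \<Longrightarrow> b \<in> L \<Longrightarrow> c \<in> L \<Longrightarrow> d \<in> L \<Longrightarrow> M ((GenA \<otimes>\<^sub>e Ident (Suc 0)) \<circ>\<^sub>e (Ident (Suc 0) \<otimes>\<^sub>e GenH) \<circ>\<^sub>e (GenH \<otimes>\<^sub>e Ident (Suc 0))) [d] [a, b, c] = e * lam\<^sup>2 * M (Ident (Suc 0) \<otimes>\<^sub>e GenA) [d] [a, b, c]"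
  proof -
  assume L: "a \<in> L" "b \<in> L" "c \<in> L" "d \<in> L"
  have "M ((GenA \<otimes>\<^sub>e Ident (Suc 0)) \<circ>\<^sub>e (Ident (Suc 0) \<otimes>\<^sub>e GenH) \<circ>\<^sub>e (GenH \<otimes>\<^sub>e Ident (Suc 0))) [d] [a, b, c]
      = (\<Sum>x\<in>L. aa x * (if x = b then if a = d \<and> dual x = c then hh d (dual x) * hh d x else 0 else 0))"
    using L by (auto simp: M3 intro!: sum.cong)
  also have "\<dots> = aa b * (if a = d \<and> dual b = c then hh d (dual b) * hh d b else 0)"
    using L by (subst sum_L_delta) auto
  also have "\<dots> = e * lam\<^sup>2 * M (Ident (Suc 0) \<otimes>\<^sub>e GenA) [d] [a, b, c]"
    by (cases "snd b"; cases "snd d") (auto simp: M3 hh_def aa_def e_sq mult_ac power2_eq_square)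
  finally show ?thesis .
qed

lemma M_relations:
  assumes "(s, t) \<in> parameter_relations (params00 \<epsilon> lam sig e)" "y \<in> wd (btgt s)" "x \<in> wd (bsrc s)"
  shows "M s y x = M t y x"
proof -
  show ?thesis
    using assms(1) unfolding parameter_relations_def
    apply (elim insertE emptyE)
    using assms(2,3)
    by (auto simp: params00_def M_HU M_AH M_AU M_AIIU M_IAUI M_AIIHUI M_HH M_HIIU M_HIIHUI M_IAHI M_AIIHHI
        simp del: M.simps(8) dest!: wd_expand split: if_splits)
qed

text \<open>Types are part of the induction, because the range of summation in a composite and the
  cutting of words in a tensor product are read off from them.\<close>

lemma M_sound:
  assumes "bcong \<pi> Rel s t"
  shows "bwt s \<and> bwt t \<and> bsrc s = bsrc t \<and> btgt s = btgt t
    \<and> (\<forall>y\<in>wd (btgt s). \<forall>x\<in>wd (bsrc s). M s y x = M t y x)"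
  using assms
proof (induction rule: bcong.induct)
  case (rel s t)
  show ?case
  proof (cases "(s, t) = braid_relation")
    case True
    thus ?thesis using M_braid by (auto simp: braid_relation_def simp del: M.simps)
  next
    case False
    hence "(s, t) \<in> parameter_relations (params00 \<epsilon> lam sig e)"
      using rel by (auto simp: defining_relations_def)
    thus ?thesis using M_relations[of s t] by (auto simp: parameter_relations_def simp del: M.simps)
  qed
next
  case (comp_cong s s' t t')
  thus ?case by (auto intro!: sum.cong)
next
  case (tens_cong s s' t t')
  have "M (s \<otimes>\<^sub>e t) y x = M (s' \<otimes>\<^sub>e t') y x"
    if y: "y \<in> wd (btgt s + btgt t)" and x: "x \<in> wd (bsrc s + bsrc t)" for y x
  proof -
    obtain y1 y2 where "y = y1 @ y2" "y1 \<in> wd (btgt s)" "y2 \<in> wd (btgt t)" using wd_split[OF y] by auto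
    moreover obtain x1 x2 where "x = x1 @ x2" "x1 \<in> wd (bsrc s)" "x2 \<in> wd (bsrc t)" using wd_split[OF x] by auto
    ultimately show ?thesis using tens_cong.IH by (auto simp: M_tens wd_length)
  qed
  thus ?case using tens_cong.IH by auto
next
  case (comp_add_left s t v)
  thus ?case by (auto simp: algebra_simps sum.distrib)
next
  case (comp_add_right s t v)
  thus ?case by (auto simp: algebra_simps sum.distrib)
next
  case (comp_scale_left s t c)
  thus ?case by (auto simp: sum_distrib_left mult.assoc)
next
  case (comp_scale_right s t c)
  thus ?case by (auto simp: sum_distrib_left mult.left_commute)
next
  case (comp_assoc s t v)
  thus ?case using M_comp_assoc[of s t v] by (auto simp del: M.simps)
next
  case (tens_assoc s t v)
  have "M ((s \<otimes>\<^sub>e t) \<otimes>\<^sub>e v) y x = M (s \<otimes>\<^sub>e (t \<otimes>\<^sub>e v)) y x"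
    if y: "y \<in> wd (btgt s + btgt t + btgt v)" and x: "x \<in> wd (bsrc s + bsrc t + bsrc v)" for y x
  proof -
    obtain y1 y2 y3 where y: "y = (y1 @ y2) @ y3" "y1 \<in> wd (btgt s)" "y2 \<in> wd (btgt t)" "y3 \<in> wd (btgt v)"
      using wd_split[OF y] wd_split by metis
    obtain x1 x2 x3 where x: "x = (x1 @ x2) @ x3" "x1 \<in> wd (bsrc s)" "x2 \<in> wd (bsrc t)" "x3 \<in> wd (bsrc v)"
      using wd_split[OF x] wd_split by metis
    note len = x(2-4)[THEN wd_length] y(2-4)[THEN wd_length]
    have "M ((s \<otimes>\<^sub>e t) \<otimes>\<^sub>e v) ((y1 @ y2) @ y3) ((x1 @ x2) @ x3)
        = koszul (par (x1 @ x2)) (par y3 + par x3) * M (s \<otimes>\<^sub>e t) (y1 @ y2) (x1 @ x2) * M v y3 x3"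
      using len by (intro M_tens) auto
    also have "\<dots> = koszul (par x1) (par (y2 @ y3) + par (x2 @ x3)) * M s y1 x1
        * (koszul (par x2) (par y3 + par x3) * M t y2 x2 * M v y3 x3)"
      using len by (simp add: M_tens koszul_add_left koszul_add_right mult_ac)
    also have "\<dots> = M (s \<otimes>\<^sub>e (t \<otimes>\<^sub>e v)) (y1 @ (y2 @ y3)) (x1 @ (x2 @ x3))"
      using len by (simp add: M_tens)
    finally show ?thesis using x y by simp
  qed
  thus ?case using tens_assoc by (auto simp: add.assoc)
next
  case (interchange f h g k p q)
  thus ?case using M_interchange[OF interchange] by (auto simp del: M.simps)
next
  case (comp_id_left t)
  thus ?case by (auto simp: if_distribR sum.delta if_distrib[of "\<lambda>z. z * _"] cong: if_cong)
next
  case (comp_id_right t)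
  have "M t y z * (if z = x then 1 else 0) = (if z = x then M t y x else 0)" for y z x by simp
  thus ?case using comp_id_right by auto
next
  case (tens_unit_right t)
  thus ?case by (auto simp: M.simps(9) wd_length)
next
  case (tens_id m n)
  have "M (Ident m \<otimes>\<^sub>e Ident n) y x = M (Ident (m + n)) y x"
    if y: "y \<in> wd (m + n)" and x: "x \<in> wd (m + n)" for y x
  proof -
    obtain y1 y2 where "y = y1 @ y2" "y1 \<in> wd m" "y2 \<in> wd n" using wd_split[OF y] by auto
    moreover obtain x1 x2 where "x = x1 @ x2" "x1 \<in> wd m" "x2 \<in> wd n" using wd_split[OF x] by auto
    ultimately show ?thesis by (auto simp: M_tens wd_length bit_add_self)
  qed
  thus ?case by auto
qed (auto simp: algebra_simps M.simps(9))

end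

section \<open>Normal forms of morphisms from the unit object\<close>

context typed_relations
begin

text \<open>A degree of \<open>t\<close> is chosen only to invoke the interchange law: identities
  are even, so the sign is 1 for any choice.\<close>

lemma tens_Ident_comp: "bwt (s \<circ>\<^sub>e t) \<Longrightarrow> (s \<circ>\<^sub>e t) \<otimes>\<^sub>e Ident k \<approx> (s \<otimes>\<^sub>e Ident k) \<circ>\<^sub>e (t \<otimes>\<^sub>e Ident k)"
proof -
  assume wt: "bwt (s \<circ>\<^sub>e t)"
  obtain q where q: "bhomog \<pi> t q" using bhomog_exists[of t \<pi>] wt by auto
  have "(s \<otimes>\<^sub>e Ident k) \<circ>\<^sub>e (t \<otimes>\<^sub>e Ident k) \<approx> koszul 0 q *\<^sub>e ((s \<circ>\<^sub>e t) \<otimes>\<^sub>e (Ident k \<circ>\<^sub>e Ident k))"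
    using wt q by (intro bcong.interchange) auto
  also have "\<dots> \<approx> (s \<circ>\<^sub>e t) \<otimes>\<^sub>e (Ident k \<circ>\<^sub>e Ident k)"
    using wt by (simp add: bcong.scale_one)
  also have "\<dots> \<approx> (s \<circ>\<^sub>e t) \<otimes>\<^sub>e Ident k"
    using wt bcong.comp_id_left[of "Ident k" \<pi> R] by (intro tens_left) auto
  finally show ?thesis by (rule bcong.sym)
qed

lemma Ident_tens_comp: "bwt (s \<circ>\<^sub>e t) \<Longrightarrow> Ident k \<otimes>\<^sub>e (s \<circ>\<^sub>e t) \<approx> (Ident k \<otimes>\<^sub>e s) \<circ>\<^sub>e (Ident k \<otimes>\<^sub>e t)"
proof -
  assume wt: "bwt (s \<circ>\<^sub>e t)"
  obtain q where q: "bhomog \<pi> s q" using bhomog_exists[of s \<pi>] wt by auto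
  have "(Ident k \<otimes>\<^sub>e s) \<circ>\<^sub>e (Ident k \<otimes>\<^sub>e t) \<approx> koszul q 0 *\<^sub>e ((Ident k \<circ>\<^sub>e Ident k) \<otimes>\<^sub>e (s \<circ>\<^sub>e t))"
    using wt q by (intro bcong.interchange) auto
  also have "\<dots> \<approx> (Ident k \<circ>\<^sub>e Ident k) \<otimes>\<^sub>e (s \<circ>\<^sub>e t)"
    using wt by (simp add: bcong.scale_one)
  also have "\<dots> \<approx> Ident k \<otimes>\<^sub>e (s \<circ>\<^sub>e t)"
    using wt bcong.comp_id_left[of "Ident k" \<pi> R] by (intro tens_right) auto
  finally show ?thesis by (rule bcong.sym)
qed

lemma lay_cong: "t \<approx> t' \<Longrightarrow> lay i t k \<approx> lay i t' k"
  unfolding lay_def by (intro tens_left tens_right) auto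

lemma lay_comp: assumes "bwt (s \<circ>\<^sub>e t)" shows "lay i (s \<circ>\<^sub>e t) k \<approx> lay i s k \<circ>\<^sub>e lay i t k"
proof -
  have "lay i (s \<circ>\<^sub>e t) k \<approx> Ident i \<otimes>\<^sub>e ((s \<otimes>\<^sub>e Ident k) \<circ>\<^sub>e (t \<otimes>\<^sub>e Ident k))"
    unfolding lay_def using assms by (intro tens_left tens_Ident_comp) auto
  also have "\<dots> \<approx> lay i s k \<circ>\<^sub>e lay i t k"
    unfolding lay_def using assms by (intro Ident_tens_comp) auto
  finally show ?thesis .
qed

lemma lay_scale: assumes "bwt t" shows "lay i (c *\<^sub>e t) k \<approx> c *\<^sub>e lay i t k"
proof -
  have "lay i (c *\<^sub>e t) k \<approx> Ident i \<otimes>\<^sub>e (c *\<^sub>e (t \<otimes>\<^sub>e Ident k))"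
    unfolding lay_def using assms by (intro tens_left bcong.tens_scale_left) auto
  also have "\<dots> \<approx> c *\<^sub>e lay i t k"
    unfolding lay_def using assms by (intro bcong.tens_scale_right) auto
  finally show ?thesis .
qed

lemma lay_add: assumes "bwt (s +\<^sub>e t)" shows "lay i (s +\<^sub>e t) k \<approx> lay i s k +\<^sub>e lay i t k"
proof -
  have "lay i (s +\<^sub>e t) k \<approx> Ident i \<otimes>\<^sub>e (s \<otimes>\<^sub>e Ident k +\<^sub>e t \<otimes>\<^sub>e Ident k)"
    unfolding lay_def using assms by (intro tens_left bcong.tens_add_left) auto
  also have "\<dots> \<approx> lay i s k +\<^sub>e lay i t k"
    unfolding lay_def using assms by (intro bcong.tens_add_right) auto
  finally show ?thesis .
qed

lemma Ident_tens_Ident: assumes "bwt t" shows "Ident i \<otimes>\<^sub>e (Ident j \<otimes>\<^sub>e t) \<approx> Ident (i + j) \<otimes>\<^sub>e t"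
proof -
  have "Ident i \<otimes>\<^sub>e (Ident j \<otimes>\<^sub>e t) \<approx> (Ident i \<otimes>\<^sub>e Ident j) \<otimes>\<^sub>e t"
    using assms by (intro bcong.sym[OF bcong.tens_assoc]) auto
  also have "\<dots> \<approx> Ident (i + j) \<otimes>\<^sub>e t"
    using assms by (intro tens_right bcong.tens_id)
  finally show ?thesis .
qed

lemma lay_lay: assumes "bwt t" shows "lay i (lay j t l) k \<approx> lay (i + j) t (l + k)"
proof -
  have "lay j t l \<otimes>\<^sub>e Ident k \<approx> Ident j \<otimes>\<^sub>e ((t \<otimes>\<^sub>e Ident l) \<otimes>\<^sub>e Ident k)"
    unfolding lay_def using assms by (intro bcong.tens_assoc) auto
  also have "\<dots> \<approx> Ident j \<otimes>\<^sub>e (t \<otimes>\<^sub>e (Ident l \<otimes>\<^sub>e Ident k))"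
    using assms by (intro tens_left bcong.tens_assoc) auto
  also have "\<dots> \<approx> Ident j \<otimes>\<^sub>e (t \<otimes>\<^sub>e Ident (l + k))"
    using assms by (intro tens_left bcong.tens_id) auto
  finally have "lay i (lay j t l) k \<approx> Ident i \<otimes>\<^sub>e (Ident j \<otimes>\<^sub>e (t \<otimes>\<^sub>e Ident (l + k)))"
    unfolding lay_def[of i] by (intro tens_left) auto
  also have "\<dots> \<approx> lay (i + j) t (l + k)"
    unfolding lay_def using assms by (intro Ident_tens_Ident) auto
  finally show ?thesis .
qed

lemma tens_Ident_lay: "bwt t \<Longrightarrow> t \<otimes>\<^sub>e Ident k \<approx> lay 0 t k"
  unfolding lay_def by (rule bcong.sym, rule bcong.tens_unit_left) simp

lemma Ident_tens_lay: "bwt t \<Longrightarrow> Ident i \<otimes>\<^sub>e t \<approx> lay i t 0"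
  unfolding lay_def by (intro tens_left bcong.sym[OF bcong.tens_unit_right]) auto

lemma lay_0_0: "bwt t \<Longrightarrow> lay 0 t 0 \<approx> t"
  using cong_trans[OF bcong.sym[OF tens_Ident_lay] bcong.tens_unit_right] .

lemma lay_Ident: "lay i (Ident n) k \<approx> Ident (i + n + k)"
proof -
  have "lay i (Ident n) k \<approx> Ident i \<otimes>\<^sub>e Ident (n + k)"
    unfolding lay_def by (intro tens_left bcong.tens_id) auto
  also have "\<dots> \<approx> Ident (i + (n + k))" by (rule bcong.tens_id)
  finally show ?thesis by (simp add: add.assoc)
qed

text \<open>The two orders of layers on disjoint strands are compared through the single layer
  carrying \<open>s\<close>, then \<open>g\<close> strands, then \<open>t\<close>. With
  \<open>s\<close> composed last only identities are interchanged, so no sign arises; the opposite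
  order in \<open>lay_far2\<close> produces one.\<close>

lemma lay_far1:
  assumes "bwt s" "bwt t" "bsrc s = a" "btgt t = d"
  shows "lay i s (g + d + k) \<circ>\<^sub>e lay (i + a + g) t k \<approx> lay i (s \<otimes>\<^sub>e (Ident g \<otimes>\<^sub>e t)) k"
proof -
  let ?t = "Ident g \<otimes>\<^sub>e t"
  have s: "lay i s (g + d + k) \<approx> lay i (s \<otimes>\<^sub>e Ident (g + d)) k"
    using assms lay_lay[of s i 0 "g + d" k] tens_Ident_lay[of s "g + d"]
    by (auto intro: bcong.sym cong_trans[OF bcong.sym] lay_cong)
  have "lay (i + a + g) t k \<approx> lay i (lay (a + g) t 0) k"
    using assms lay_lay[of t i "a + g" 0 k] by (simp add: add.assoc bcong.sym)
  also have "\<dots> \<approx> lay i (Ident (a + g) \<otimes>\<^sub>e t) k"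
    using assms by (intro lay_cong bcong.sym[OF Ident_tens_lay])
  also have "\<dots> \<approx> lay i (Ident a \<otimes>\<^sub>e ?t) k"
    using assms by (intro lay_cong bcong.sym[OF Ident_tens_Ident])
  finally have t: "lay (i + a + g) t k \<approx> lay i (Ident a \<otimes>\<^sub>e ?t) k" .
  obtain q where q: "bhomog \<pi> ?t q" using bhomog_exists[of ?t \<pi>] assms by auto
  have "(s \<otimes>\<^sub>e Ident (g + d)) \<circ>\<^sub>e (Ident a \<otimes>\<^sub>e ?t)
      \<approx> koszul 0 0 *\<^sub>e ((s \<circ>\<^sub>e Ident a) \<otimes>\<^sub>e (Ident (g + d) \<circ>\<^sub>e ?t))"
    using assms by (intro bcong.interchange) auto
  also have "\<dots> \<approx> (s \<circ>\<^sub>e Ident a) \<otimes>\<^sub>e (Ident (g + d) \<circ>\<^sub>e ?t)"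
    using assms by (simp add: bcong.scale_one)
  also have "\<dots> \<approx> s \<otimes>\<^sub>e ?t"
    using assms bcong.comp_id_right[of s \<pi> R] bcong.comp_id_left[of ?t \<pi> R]
    by (intro bcong.tens_cong) auto
  finally have st: "(s \<otimes>\<^sub>e Ident (g + d)) \<circ>\<^sub>e (Ident a \<otimes>\<^sub>e ?t) \<approx> s \<otimes>\<^sub>e ?t" .
  have "lay i s (g + d + k) \<circ>\<^sub>e lay (i + a + g) t k
      \<approx> lay i (s \<otimes>\<^sub>e Ident (g + d)) k \<circ>\<^sub>e lay i (Ident a \<otimes>\<^sub>e ?t) k"
    using s t assms by (intro bcong.comp_cong) auto
  also have "\<dots> \<approx> lay i ((s \<otimes>\<^sub>e Ident (g + d)) \<circ>\<^sub>e (Ident a \<otimes>\<^sub>e ?t)) k"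
    using assms by (intro bcong.sym[OF lay_comp]) auto
  also have "\<dots> \<approx> lay i (s \<otimes>\<^sub>e ?t) k" by (intro lay_cong st)
  finally show ?thesis .
qed

lemma lay_far2:
  assumes "bwt s" "bwt t" "btgt s = b" "bsrc t = c" "bhomog \<pi> s p" "bhomog \<pi> t q"
  shows "lay (i + b + g) t k \<circ>\<^sub>e lay i s (g + c + k) \<approx> koszul q p *\<^sub>e lay i (s \<otimes>\<^sub>e (Ident g \<otimes>\<^sub>e t)) k"
proof -
  let ?t = "Ident g \<otimes>\<^sub>e t"
  have s: "lay i s (g + c + k) \<approx> lay i (s \<otimes>\<^sub>e Ident (g + c)) k"
    using assms lay_lay[of s i 0 "g + c" k] tens_Ident_lay[of s "g + c"]
    by (auto intro: bcong.sym cong_trans[OF bcong.sym] lay_cong)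
  have "lay (i + b + g) t k \<approx> lay i (lay (b + g) t 0) k"
    using assms lay_lay[of t i "b + g" 0 k] by (simp add: add.assoc bcong.sym)
  also have "\<dots> \<approx> lay i (Ident (b + g) \<otimes>\<^sub>e t) k"
    using assms by (intro lay_cong bcong.sym[OF Ident_tens_lay])
  also have "\<dots> \<approx> lay i (Ident b \<otimes>\<^sub>e ?t) k"
    using assms by (intro lay_cong bcong.sym[OF Ident_tens_Ident])
  finally have t: "lay (i + b + g) t k \<approx> lay i (Ident b \<otimes>\<^sub>e ?t) k" .
  have "bhomog \<pi> ?t q" using assms by auto
  hence "(Ident b \<otimes>\<^sub>e ?t) \<circ>\<^sub>e (s \<otimes>\<^sub>e Ident (g + c))
      \<approx> koszul q p *\<^sub>e ((Ident b \<circ>\<^sub>e s) \<otimes>\<^sub>e (?t \<circ>\<^sub>e Ident (g + c)))"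
    using assms by (intro bcong.interchange) auto
  also have "\<dots> \<approx> koszul q p *\<^sub>e (s \<otimes>\<^sub>e ?t)"
    using assms bcong.comp_id_left[of s \<pi> R] bcong.comp_id_right[of ?t \<pi> R]
    by (intro bcong.scale_cong bcong.tens_cong) auto
  finally have st: "(Ident b \<otimes>\<^sub>e ?t) \<circ>\<^sub>e (s \<otimes>\<^sub>e Ident (g + c)) \<approx> koszul q p *\<^sub>e (s \<otimes>\<^sub>e ?t)" .
  have "lay (i + b + g) t k \<circ>\<^sub>e lay i s (g + c + k)
      \<approx> lay i (Ident b \<otimes>\<^sub>e ?t) k \<circ>\<^sub>e lay i (s \<otimes>\<^sub>e Ident (g + c)) k"
    using s t assms by (intro bcong.comp_cong) auto
  also have "\<dots> \<approx> lay i ((Ident b \<otimes>\<^sub>e ?t) \<circ>\<^sub>e (s \<otimes>\<^sub>e Ident (g + c))) k"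
    using assms by (intro bcong.sym[OF lay_comp]) auto
  also have "\<dots> \<approx> lay i (koszul q p *\<^sub>e (s \<otimes>\<^sub>e ?t)) k" by (intro lay_cong st)
  also have "\<dots> \<approx> koszul q p *\<^sub>e lay i (s \<otimes>\<^sub>e ?t) k" using assms by (intro lay_scale) auto
  finally show ?thesis .
qed

text \<open>The scalar may be 0, so the relation is not symmetric. It is enough for the reduction to
  normal forms, and \<open>below_flip\<close> reverses it once the scalar is known to be
  nonzero.\<close>

definition below (infix \<open>\<sqsubseteq>\<close> 50) where "s \<sqsubseteq> t \<longleftrightarrow> (\<exists>c. s \<approx> c *\<^sub>e t)"

lemma belowI: "s \<approx> c *\<^sub>e t \<Longrightarrow> s \<sqsubseteq> t"
  by (auto simp: below_def)

lemma below_typed: "s \<sqsubseteq> t \<Longrightarrow> bwt s \<and> bwt t \<and> bsrc s = bsrc t \<and> btgt s = btgt t"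
  by (auto simp: below_def dest: bcong_typed)

lemma scale_one': "s \<approx> t \<Longrightarrow> s \<approx> 1 *\<^sub>e t"
  by (rule cong_trans[OF _ bcong.sym[OF bcong.scale_one]]) (auto dest: bcong_typed)

lemma cong_below: "s \<approx> t \<Longrightarrow> s \<sqsubseteq> t"
  by (rule belowI, rule scale_one')

lemma below_refl: "bwt t \<Longrightarrow> t \<sqsubseteq> t"
  by (intro cong_below bcong.refl)

lemma scale_scale': "s \<approx> c *\<^sub>e t \<Longrightarrow> t \<approx> d *\<^sub>e v \<Longrightarrow> s \<approx> (c * d) *\<^sub>e v"
proof -
  assume s: "s \<approx> c *\<^sub>e t" and t: "t \<approx> d *\<^sub>e v"
  note s
  also have "c *\<^sub>e t \<approx> c *\<^sub>e (d *\<^sub>e v)" using t by (rule bcong.scale_cong)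
  also have "\<dots> \<approx> (c * d) *\<^sub>e v"
    using bcong_typed[OF t] by (intro bcong.sym[OF bcong.scale_scale]) simp
  finally show ?thesis .
qed

lemma below_trans [trans]: "s \<sqsubseteq> t \<Longrightarrow> t \<sqsubseteq> v \<Longrightarrow> s \<sqsubseteq> v"
  unfolding below_def using scale_scale' by blast

lemma cong_below_trans [trans]: "s \<approx> t \<Longrightarrow> t \<sqsubseteq> v \<Longrightarrow> s \<sqsubseteq> v"
  using cong_below below_trans by blast

lemma below_cong_trans [trans]: "s \<sqsubseteq> t \<Longrightarrow> t \<approx> v \<Longrightarrow> s \<sqsubseteq> v"
  using cong_below below_trans by blast

lemma scale_flip: assumes "s \<approx> c *\<^sub>e t" "c \<noteq> 0" shows "t \<approx> inverse c *\<^sub>e s"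
proof -
  have "bwt t" using bcong_typed[OF assms(1)] by simp
  have "inverse c *\<^sub>e s \<approx> (inverse c * c) *\<^sub>e t"
    using assms bcong_typed[OF assms(1)] by (intro scale_scale'[of _ _ s]) (auto intro: bcong.refl)
  hence "inverse c *\<^sub>e s \<approx> 1 *\<^sub>e t" using assms by simp
  thus ?thesis using bcong.scale_one[OF \<open>bwt t\<close>] bcong.sym bcong.trans by blast
qed

lemma below_flip: "s \<approx> c *\<^sub>e t \<Longrightarrow> c \<noteq> 0 \<Longrightarrow> t \<sqsubseteq> s"
  by (rule belowI, rule scale_flip)

lemma below_comp: assumes "s \<sqsubseteq> s'" "t \<sqsubseteq> t'" "bwt (s \<circ>\<^sub>e t)" shows "s \<circ>\<^sub>e t \<sqsubseteq> s' \<circ>\<^sub>e t'"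
proof -
  obtain c d where cd: "s \<approx> c *\<^sub>e s'" "t \<approx> d *\<^sub>e t'" using assms by (auto simp: below_def)
  note ty = below_typed[OF assms(1)] below_typed[OF assms(2)]
  have "s \<circ>\<^sub>e t \<approx> (c *\<^sub>e s') \<circ>\<^sub>e (d *\<^sub>e t')" using cd assms by (intro bcong.comp_cong)
  also have "\<dots> \<approx> c *\<^sub>e (s' \<circ>\<^sub>e (d *\<^sub>e t'))" using ty assms by (intro bcong.comp_scale_left) auto
  finally have "s \<circ>\<^sub>e t \<sqsubseteq> s' \<circ>\<^sub>e (d *\<^sub>e t')" by (rule belowI)
  also have "s' \<circ>\<^sub>e (d *\<^sub>e t') \<sqsubseteq> s' \<circ>\<^sub>e t'"
    using ty assms by (intro belowI[OF bcong.comp_scale_right]) auto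
  finally show ?thesis .
qed

lemma below_comp_left: "t \<sqsubseteq> t' \<Longrightarrow> bwt (s \<circ>\<^sub>e t) \<Longrightarrow> s \<circ>\<^sub>e t \<sqsubseteq> s \<circ>\<^sub>e t'"
  by (intro below_comp below_refl) auto

lemma below_comp_right: "s \<sqsubseteq> s' \<Longrightarrow> bwt (s \<circ>\<^sub>e t) \<Longrightarrow> s \<circ>\<^sub>e t \<sqsubseteq> s' \<circ>\<^sub>e t"
  by (intro below_comp below_refl) auto

lemma below_assoc: "bwt ((s \<circ>\<^sub>e t) \<circ>\<^sub>e v) \<Longrightarrow> (s \<circ>\<^sub>e t) \<circ>\<^sub>e v \<sqsubseteq> s \<circ>\<^sub>e (t \<circ>\<^sub>e v)"
  by (intro cong_below bcong.comp_assoc)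

lemma below_front: assumes "s \<circ>\<^sub>e t \<sqsubseteq> w" "bwt (s \<circ>\<^sub>e t \<circ>\<^sub>e v)" shows "s \<circ>\<^sub>e t \<circ>\<^sub>e v \<sqsubseteq> w \<circ>\<^sub>e v"
proof -
  have "s \<circ>\<^sub>e t \<circ>\<^sub>e v \<approx> (s \<circ>\<^sub>e t) \<circ>\<^sub>e v" using assms by (intro comp_assoc') auto
  also have "\<dots> \<sqsubseteq> w \<circ>\<^sub>e v" using assms by (intro below_comp_right) auto
  finally show ?thesis .
qed

lemma below_front2: assumes "s \<circ>\<^sub>e t \<sqsubseteq> s' \<circ>\<^sub>e t'" "bwt (s \<circ>\<^sub>e t \<circ>\<^sub>e v)"
  shows "s \<circ>\<^sub>e t \<circ>\<^sub>e v \<sqsubseteq> s' \<circ>\<^sub>e t' \<circ>\<^sub>e v"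
  by (rule below_trans[OF below_front[OF assms] below_assoc])
    (use assms below_typed[OF assms(1)] in auto)

lemma below_lay: "s \<sqsubseteq> t \<Longrightarrow> lay i s k \<sqsubseteq> lay i t k"
proof -
  assume st: "s \<sqsubseteq> t"
  then obtain c where "s \<approx> c *\<^sub>e t" by (auto simp: below_def)
  hence "lay i s k \<approx> lay i (c *\<^sub>e t) k" by (rule lay_cong)
  also have "\<dots> \<approx> c *\<^sub>e lay i t k" using below_typed[OF st] by (intro lay_scale) auto
  finally show ?thesis by (rule belowI)
qed

lemma lay_far:
  assumes "bwt s" "bwt t" "bsrc s = a" "btgt s = b" "bsrc t = c" "btgt t = d"
  shows "lay i s (g + d + k) \<circ>\<^sub>e lay (i + a + g) t k \<sqsubseteq> lay (i + b + g) t k \<circ>\<^sub>e lay i s (g + c + k)"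
    and "lay (i + b + g) t k \<circ>\<^sub>e lay i s (g + c + k) \<sqsubseteq> lay i s (g + d + k) \<circ>\<^sub>e lay (i + a + g) t k"
proof -
  obtain p q where pq: "bhomog \<pi> s p" "bhomog \<pi> t q" using assms bhomog_exists by blast
  note 1 = lay_far1[OF assms(1,2,3,6), of i g k]
  note 2 = lay_far2[OF assms(1,2,4,5) pq, of i g k]
  show "lay i s (g + d + k) \<circ>\<^sub>e lay (i + a + g) t k \<sqsubseteq> lay (i + b + g) t k \<circ>\<^sub>e lay i s (g + c + k)"
    using 1 below_flip[OF 2] by (rule cong_below_trans) simp
  show "lay (i + b + g) t k \<circ>\<^sub>e lay i s (g + c + k) \<sqsubseteq> lay i s (g + d + k) \<circ>\<^sub>e lay (i + a + g) t k"
    using belowI[OF 2] bcong.sym[OF 1] by (rule below_cong_trans)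
qed

end

sublocale cat00_params \<subseteq> typed_relations "gen_parity \<epsilon>" "defining_relations (params00 \<epsilon> lam sig e)"
  by unfold_locales (auto simp: defining_relations_def parameter_relations_def braid_relation_def)

abbreviation "HI \<equiv> GenH \<otimes>\<^sub>e Ident 1"
abbreviation "IH \<equiv> Ident 1 \<otimes>\<^sub>e GenH"
abbreviation "AI \<equiv> GenA \<otimes>\<^sub>e Ident 1"
abbreviation "IA \<equiv> Ident 1 \<otimes>\<^sub>e GenA"
abbreviation "UI \<equiv> GenU \<otimes>\<^sub>e Ident 1"
abbreviation "IU \<equiv> Ident 1 \<otimes>\<^sub>e GenU"

context typed_relations
begin

text \<open>The right-hand sides in \<open>parameter_relations\<close> always list every term; this
  removes those whose coefficient is 0.\<close>

lemma add_zero_scale: assumes "t \<approx> s +\<^sub>e 0 *\<^sub>e v" shows "t \<approx> s"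
proof -
  note ty = bcong_typed[OF assms]
  note assms
  also have "s +\<^sub>e 0 *\<^sub>e v \<approx> 0 *\<^sub>e v +\<^sub>e s" using ty by (intro bcong.add_comm) auto
  also have "\<dots> \<approx> Null (bsrc s) (btgt s) +\<^sub>e s"
    using ty scale_zero[of v] by (intro bcong.add_cong bcong.refl) auto
  also have "\<dots> \<approx> s" using ty by (intro bcong.add_null) auto
  finally show ?thesis .
qed

end

context cat00_params
begin

notation cong_exp (infix \<open>\<approx>\<close> 50) and below (infix \<open>\<sqsubseteq>\<close> 50)

lemma rel_param: "(s, t) \<in> parameter_relations (params00 \<epsilon> lam sig e) \<Longrightarrow> s \<approx> t"
  by (rule bcong.rel) (simp add: defining_relations_def)

lemma rels:
  "GenH \<circ>\<^sub>e GenU \<approx> lam *\<^sub>e GenU"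
  "GenA \<circ>\<^sub>e GenU \<approx> 0 *\<^sub>e Ident 0"
  "AI \<circ>\<^sub>e IH \<circ>\<^sub>e UI \<approx> (\<epsilon> * sig * e * lam) *\<^sub>e Ident 1"
  "IA \<circ>\<^sub>e UI \<approx> (\<epsilon> * sig) *\<^sub>e Ident 1"
  by (rule rel_param, simp add: parameter_relations_def params00_def)+

lemma rel_HH: "GenH \<circ>\<^sub>e GenH \<approx> lam\<^sup>2 *\<^sub>e Ident 2"
proof -
  have "GenH \<circ>\<^sub>e GenH \<approx> (lam\<^sup>2 *\<^sub>e Ident 2 +\<^sub>e 0 *\<^sub>e GenH) +\<^sub>e 0 *\<^sub>e (GenU \<circ>\<^sub>e GenA)"
    by (rule rel_param) (simp add: parameter_relations_def params00_def)
  from add_zero_scale[OF add_zero_scale[OF this]] show ?thesis .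
qed

lemma rel_HIIHUI: "HI \<circ>\<^sub>e IH \<circ>\<^sub>e UI \<approx> (- \<epsilon> * e * lam\<^sup>2) *\<^sub>e IU"
proof -
  have "HI \<circ>\<^sub>e IH \<circ>\<^sub>e UI \<approx> (0 *\<^sub>e UI +\<^sub>e 0 *\<^sub>e (IH \<circ>\<^sub>e UI)) +\<^sub>e (- \<epsilon> * e * lam\<^sup>2) *\<^sub>e IU"
    by (rule rel_param) (simp add: parameter_relations_def params00_def)
  hence "HI \<circ>\<^sub>e IH \<circ>\<^sub>e UI \<approx> (- \<epsilon> * e * lam\<^sup>2) *\<^sub>e IU +\<^sub>e (0 *\<^sub>e UI +\<^sub>e 0 *\<^sub>e (IH \<circ>\<^sub>e UI))"
    by (rule cong_trans) (rule bcong.add_comm, simp)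
  hence "HI \<circ>\<^sub>e IH \<circ>\<^sub>e UI \<approx> ((- \<epsilon> * e * lam\<^sup>2) *\<^sub>e IU +\<^sub>e 0 *\<^sub>e UI) +\<^sub>e 0 *\<^sub>e (IH \<circ>\<^sub>e UI)"
    by (rule cong_trans) (rule bcong.sym[OF bcong.add_assoc], simp)
  from add_zero_scale[OF add_zero_scale[OF this]] show ?thesis .
qed

lemma rel_AIIHHI: "AI \<circ>\<^sub>e IH \<circ>\<^sub>e HI \<approx> (e * lam\<^sup>2) *\<^sub>e IA"
proof -
  have "AI \<circ>\<^sub>e IH \<circ>\<^sub>e HI \<approx> (0 *\<^sub>e AI +\<^sub>e 0 *\<^sub>e (AI \<circ>\<^sub>e IH)) +\<^sub>e (e * lam\<^sup>2) *\<^sub>e IA"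
    by (rule rel_param) (simp add: parameter_relations_def params00_def)
  hence "AI \<circ>\<^sub>e IH \<circ>\<^sub>e HI \<approx> (e * lam\<^sup>2) *\<^sub>e IA +\<^sub>e (0 *\<^sub>e AI +\<^sub>e 0 *\<^sub>e (AI \<circ>\<^sub>e IH))"
    by (rule cong_trans) (rule bcong.add_comm, simp)
  hence "AI \<circ>\<^sub>e IH \<circ>\<^sub>e HI \<approx> ((e * lam\<^sup>2) *\<^sub>e IA +\<^sub>e 0 *\<^sub>e AI) +\<^sub>e 0 *\<^sub>e (AI \<circ>\<^sub>e IH)"
    by (rule cong_trans) (rule bcong.sym[OF bcong.add_assoc], simp)
  from add_zero_scale[OF add_zero_scale[OF this]] show ?thesis .
qed

end

text \<open>The layers \<open>S n i\<close>, \<open>U n i\<close>, \<open>A n i\<close> carry a generator at position \<open>i\<close>, counted from 0, on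
  \<open>n + 2\<close>, respectively \<open>n\<close>, strands.\<close>

abbreviation S where "S n i \<equiv> lay i GenH (n - i)"
abbreviation U where "U n i \<equiv> lay i GenU (n - i)"
abbreviation A where "A n i \<equiv> lay i GenA (n - i)"

context typed_relations
begin

lemma tens_I_lay: "bwt t \<Longrightarrow> lay i (t \<otimes>\<^sub>e Ident l) k \<approx> lay i t (l + k)"
  using lay_lay[of t i 0 l k] by (auto intro: cong_trans[OF lay_cong[OF tens_Ident_lay]])

lemma I_tens_lay: "bwt t \<Longrightarrow> lay i (Ident j \<otimes>\<^sub>e t) k \<approx> lay (i + j) t k"
  using lay_lay[of t i j 0 k] by (auto intro: cong_trans[OF lay_cong[OF Ident_tens_lay]])

lemma lay_three:
  "lay i HI k \<approx> lay i GenH (Suc k)" "lay i IH k \<approx> lay (Suc i) GenH k"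
  "lay i UI k \<approx> lay i GenU (Suc k)" "lay i IU k \<approx> lay (Suc i) GenU k"
  "lay i AI k \<approx> lay i GenA (Suc k)" "lay i IA k \<approx> lay (Suc i) GenA k"
  using tens_I_lay[of GenH i 1 k] tens_I_lay[of GenU i 1 k] tens_I_lay[of GenA i 1 k]
    I_tens_lay[of GenH i 1 k] I_tens_lay[of GenU i 1 k] I_tens_lay[of GenA i 1 k]
  by simp_all

lemma lay_comp_I:
  assumes "lay i s k \<approx> s'" "lay i t k \<approx> t'" "bwt (s \<circ>\<^sub>e t)"
  shows "lay i (s \<circ>\<^sub>e t) k \<approx> s' \<circ>\<^sub>e t'"
  using assms by (intro cong_trans[OF lay_comp] bcong.comp_cong) auto

lemma below_lay_left: "lay i s k \<approx> s' \<Longrightarrow> s \<sqsubseteq> t \<Longrightarrow> lay i t k \<approx> t' \<Longrightarrow> s' \<sqsubseteq> t'"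
  using below_lay bcong.sym cong_below_trans below_cong_trans by blast

end

section \<open>Exchange rules for layers up to scalars\<close>

context cat00_params
begin

lemma S_S: "i \<le> n \<Longrightarrow> S n i \<circ>\<^sub>e S n i \<sqsubseteq> Ident (n + 2)"
  by (rule below_lay_left[OF lay_comp belowI[OF rel_HH]])
    (use lay_Ident[of i 2 "n - i"] in simp_all)

lemma S_U: "i \<le> n \<Longrightarrow> S n i \<circ>\<^sub>e U n i \<sqsubseteq> U n i"
  by (rule below_lay_left[OF lay_comp belowI[OF rels(1)]]) (simp_all add: bcong.refl)

lemma A_U: "i \<le> n \<Longrightarrow> A n i \<circ>\<^sub>e U n i \<sqsubseteq> Ident n"
  by (rule below_lay_left[OF lay_comp belowI[OF rels(2)]])
    (use lay_Ident[of i 0 "n - i"] in simp_all)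

lemma A_S_U: "Suc i \<le> n \<Longrightarrow> A n i \<circ>\<^sub>e S n (Suc i) \<circ>\<^sub>e U n i \<sqsubseteq> Ident n"
  using below_lay_left[OF lay_comp_I[OF lay_three(5) lay_comp_I[OF lay_three(2) lay_three(3)]]
      belowI[OF rels(3)] lay_Ident, of i "n - Suc i"]
  by (simp add: Suc_diff_Suc)

lemma braid_below: "Suc i \<le> n \<Longrightarrow>
    S n i \<circ>\<^sub>e S n (Suc i) \<circ>\<^sub>e S n i \<sqsubseteq> S n (Suc i) \<circ>\<^sub>e S n i \<circ>\<^sub>e S n (Suc i)"
proof -
  assume i: "Suc i \<le> n"
  have "HI \<circ>\<^sub>e IH \<circ>\<^sub>e HI \<approx> IH \<circ>\<^sub>e HI \<circ>\<^sub>e IH"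
    by (rule bcong.rel) (simp add: defining_relations_def braid_relation_def)
  from below_lay_left[OF lay_comp_I[OF lay_three(1) lay_comp_I[OF lay_three(2) lay_three(1)]]
      cong_below[OF this] lay_comp_I[OF lay_three(2) lay_comp_I[OF lay_three(1) lay_three(2)]],
      of i "n - Suc i"]
  show ?thesis using i by (simp add: Suc_diff_Suc)
qed

text \<open>The coefficient \<open>- \<epsilon> * e * lam\<^sup>2\<close> is nonzero, so the
  relation can also be read backwards: a cup at position i + 1 is a cup at i followed by two
  crossings. In this way all cups are reduced to position 0.\<close>

lemma S_S_U: assumes "Suc i \<le> n"
  shows "S n i \<circ>\<^sub>e S n (Suc i) \<circ>\<^sub>e U n i \<sqsubseteq> U n (Suc i)"
    and "U n (Suc i) \<sqsubseteq> S n i \<circ>\<^sub>e S n (Suc i) \<circ>\<^sub>e U n i"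
proof -
  note l = lay_comp_I[OF lay_three(1) lay_comp_I[OF lay_three(2) lay_three(3)], of i "n - Suc i"]
  show "S n i \<circ>\<^sub>e S n (Suc i) \<circ>\<^sub>e U n i \<sqsubseteq> U n (Suc i)"
    using below_lay_left[OF l belowI[OF rel_HIIHUI] lay_three(4)] assms by (simp add: Suc_diff_Suc)
  show "U n (Suc i) \<sqsubseteq> S n i \<circ>\<^sub>e S n (Suc i) \<circ>\<^sub>e U n i"
    using below_lay_left[OF lay_three(4) below_flip[OF rel_HIIHUI] l] assms by (simp add: Suc_diff_Suc)
qed

text \<open>The counterpart for caps: the coefficient \<open>e * lam\<^sup>2\<close> is nonzero, so
  a cap can be moved one position to the left at the cost of two crossings.\<close>

lemma A_Suc: "Suc i \<le> n \<Longrightarrow> A n (Suc i) \<sqsubseteq> A n i \<circ>\<^sub>e S n (Suc i) \<circ>\<^sub>e S n i"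
  using below_lay_left[OF lay_three(6) below_flip[OF rel_AIIHHI]
      lay_comp_I[OF lay_three(5) lay_comp_I[OF lay_three(2) lay_three(1)]], of i "n - Suc i"]
  by (simp add: Suc_diff_Suc)

lemma S_far:
  assumes "i + 2 \<le> j" "j \<le> n"
  shows "S n i \<circ>\<^sub>e S n j \<sqsubseteq> S n j \<circ>\<^sub>e S n i" "S n j \<circ>\<^sub>e S n i \<sqsubseteq> S n i \<circ>\<^sub>e S n j"
proof -
  obtain g k where gk: "j = i + 2 + g" "n = i + 2 + g + k"
    using assms by (metis le_Suc_ex)
  have 1: "n - i = g + 2 + k" "n - j = k" using gk by auto
  show "S n i \<circ>\<^sub>e S n j \<sqsubseteq> S n j \<circ>\<^sub>e S n i" "S n j \<circ>\<^sub>e S n i \<sqsubseteq> S n i \<circ>\<^sub>e S n j"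
    unfolding 1 unfolding gk by (rule lay_far; simp)+
qed

lemma S_U_far:
  assumes "i \<le> j" "j \<le> n"
  shows "S (n + 2) (j + 2) \<circ>\<^sub>e U (n + 2) i \<sqsubseteq> U (n + 2) i \<circ>\<^sub>e S n j"
    "U (n + 2) i \<circ>\<^sub>e S n j \<sqsubseteq> S (n + 2) (j + 2) \<circ>\<^sub>e U (n + 2) i"
proof -
  obtain g k where gk: "j = i + g" "n = i + g + k"
    using assms by (metis le_Suc_ex)
  have 1: "n + 2 - i = g + 2 + k" "n + 2 - (j + 2) = k" "n - j = k" "j + 2 = i + 2 + g" "j = i + 0 + g"
    using gk by auto
  show "S (n + 2) (j + 2) \<circ>\<^sub>e U (n + 2) i \<sqsubseteq> U (n + 2) i \<circ>\<^sub>e S n j"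
    "U (n + 2) i \<circ>\<^sub>e S n j \<sqsubseteq> S (n + 2) (j + 2) \<circ>\<^sub>e U (n + 2) i"
    using lay_far[of GenU GenH 0 2 2 2 i g k] unfolding 1(1-4) unfolding gk by simp_all
qed

lemma U_U: "U (n + 2) 0 \<circ>\<^sub>e U n 0 \<sqsubseteq> U (n + 2) 2 \<circ>\<^sub>e U n 0" "U (n + 2) 2 \<circ>\<^sub>e U n 0 \<sqsubseteq> U (n + 2) 0 \<circ>\<^sub>e U n 0"
  using lay_far[of GenU GenU 0 2 0 2 0 0 n] by (simp_all add: numeral_2_eq_2)

lemma A_S_far:
  assumes "j \<le> n"
  shows "A (n + 2) 0 \<circ>\<^sub>e S (n + 2) (j + 2) \<sqsubseteq> S n j \<circ>\<^sub>e A (n + 2) 0"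
proof -
  obtain k where k: "n = j + k" using assms by (metis le_Suc_ex)
  show ?thesis using lay_far(1)[of GenA GenH 2 0 2 2 0 j k] unfolding k by (simp add: add.commute add.left_commute)
qed

end

text \<open>\<open>cup n q\<close> joins the points 0 and \<open>q + 1\<close> of the target; the normal form of a list records
  the partner of the first point, then the partner of the first remaining point, and so on.\<close>

primrec cup :: "nat \<Rightarrow> nat \<Rightarrow> 'k bexp" where
  "cup n 0 = U n 0"
| "cup n (Suc q) = S n (Suc q) \<circ>\<^sub>e cup n q"

primrec cups :: "nat list \<Rightarrow> 'k bexp" where
  "cups [] = Ident 0"
| "cups (q # qs) = cup (2 * length qs) q \<circ>\<^sub>e cups qs"

primrec cup_list :: "nat list \<Rightarrow> bool" where
  "cup_list [] \<longleftrightarrow> True"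
| "cup_list (q # qs) \<longleftrightarrow> q \<le> 2 * length qs \<and> cup_list qs"

lemma cup_type:
  "q \<le> n \<Longrightarrow> bwt (cup n q :: 'k bexp) \<and> bsrc (cup n q :: 'k bexp) = n \<and> btgt (cup n q :: 'k bexp) = n + 2"
  by (induction q) auto

lemma cup_type_simps [simp]:
  "q \<le> n \<Longrightarrow> bwt (cup n q)" "q \<le> n \<Longrightarrow> bsrc (cup n q) = n" "q \<le> n \<Longrightarrow> btgt (cup n q) = n + 2"
  using cup_type by auto

lemma cups_type:
  "cup_list qs \<Longrightarrow> bwt (cups qs :: 'k bexp) \<and> bsrc (cups qs :: 'k bexp) = 0
    \<and> btgt (cups qs :: 'k bexp) = 2 * length qs"
  by (induction qs) auto

lemma cups_type_simps [simp]:
  "cup_list qs \<Longrightarrow> bwt (cups qs)" "cup_list qs \<Longrightarrow> bsrc (cups qs) = 0"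
  "cup_list qs \<Longrightarrow> btgt (cups qs) = 2 * length qs"
  using cups_type by auto

section \<open>Reduction of monomials to composites of cups\<close>

context cat00_params
begin

definition norm :: "nat \<Rightarrow> 'k bexp \<Rightarrow> bool"
  where "norm k t \<longleftrightarrow> (\<exists>qs. cup_list qs \<and> length qs = k \<and> t \<sqsubseteq> cups qs)"

lemma normI: "cup_list qs \<Longrightarrow> length qs = k \<Longrightarrow> t \<sqsubseteq> cups qs \<Longrightarrow> norm k t"
  by (auto simp: norm_def)

lemma norm_cups: "cup_list qs \<Longrightarrow> length qs = k \<Longrightarrow> norm k (cups qs)"
  by (rule normI, assumption+, rule below_refl) simp

lemma norm_below: "s \<sqsubseteq> t \<Longrightarrow> norm k t \<Longrightarrow> norm k s"
  unfolding norm_def using below_trans by blast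

lemma norm_cong: "s \<approx> t \<Longrightarrow> norm k t \<Longrightarrow> norm k s"
  by (rule norm_below[OF cong_below])

lemma norm_typed: "norm k t \<Longrightarrow> bwt t \<and> bsrc t = 0 \<and> btgt t = 2 * k"
  unfolding norm_def using below_typed cups_type by metis

lemma norm_comp:
  assumes "norm k t" "bwt s" "bsrc s = 2 * k"
    and "\<And>qs. cup_list qs \<Longrightarrow> length qs = k \<Longrightarrow> norm l (s \<circ>\<^sub>e cups qs)"
  shows "norm l (s \<circ>\<^sub>e t)"
proof -
  obtain qs where qs: "cup_list qs" "length qs = k" "t \<sqsubseteq> cups qs" using assms by (auto simp: norm_def)
  have "s \<circ>\<^sub>e t \<sqsubseteq> s \<circ>\<^sub>e cups qs" using qs assms norm_typed by (intro below_comp_left) auto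
  thus ?thesis using assms(4) qs norm_below by blast
qed

text \<open>The crossed points \<open>i\<close> and \<open>i + 1\<close> lie to the right of both
  ends of the arc, so in the source their strands are shifted by 2. The crossing is far from the cup
  and from each crossing of the arc.\<close>

lemma S_cup_above: "q + 2 \<le> i \<Longrightarrow> i \<le> n + 2 \<Longrightarrow> S (n + 2) i \<circ>\<^sub>e cup (n + 2) q \<sqsubseteq> cup (n + 2) q \<circ>\<^sub>e S n (i - 2)"
proof (induction q)
  case 0
  thus ?case using S_U_far(1)[of 0 "i - 2" n] by (simp add: le_diff_conv Suc_diff_Suc numeral_2_eq_2)
next
  case (Suc q)
  have "S (n + 2) i \<circ>\<^sub>e S (n + 2) (Suc q) \<circ>\<^sub>e cup (n + 2) q
      \<sqsubseteq> S (n + 2) (Suc q) \<circ>\<^sub>e S (n + 2) i \<circ>\<^sub>e cup (n + 2) q"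
    using Suc.prems by (intro below_front2 S_far) auto
  also have "\<dots> \<sqsubseteq> S (n + 2) (Suc q) \<circ>\<^sub>e cup (n + 2) q \<circ>\<^sub>e S n (i - 2)"
    using Suc by (intro below_comp_left) auto
  also have "\<dots> \<approx> (S (n + 2) (Suc q) \<circ>\<^sub>e cup (n + 2) q) \<circ>\<^sub>e S n (i - 2)"
    using Suc.prems by (intro comp_assoc') auto
  finally show ?case by simp
qed

lemma assoc3: "bwt ((s \<circ>\<^sub>e t \<circ>\<^sub>e v) \<circ>\<^sub>e w) \<Longrightarrow> (s \<circ>\<^sub>e t \<circ>\<^sub>e v) \<circ>\<^sub>e w \<approx> s \<circ>\<^sub>e t \<circ>\<^sub>e v \<circ>\<^sub>e w"
  by (rule cong_trans[OF bcong.comp_assoc comp_left[OF bcong.comp_assoc]]) auto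

text \<open>The crossed points lie between the ends of the arc, one of which is to their left, hence
  the shift by 1. The braid relation is needed where the right end of the arc passes exactly these
  two strands; beyond that place the crossing lies to the right of the shorter arc, and
  \<open>S_cup_above\<close> applies.\<close>

lemma S_cup_inside:
  "1 \<le> i \<Longrightarrow> i < q \<Longrightarrow> q \<le> n + 2 \<Longrightarrow> S (n + 2) i \<circ>\<^sub>e cup (n + 2) q \<sqsubseteq> cup (n + 2) q \<circ>\<^sub>e S n (i - 1)"
proof (induction q)
  case (Suc q)
  show ?case
  proof (cases "i = q")
    case True
    then obtain r where r: "i = Suc r" "q = Suc r" using Suc.prems by (cases i) auto
    let ?S = "S (n + 2)" and ?c = "cup (n + 2) r"
    have le: "Suc (Suc r) \<le> n + 2" using Suc.prems r by simp
    have "?S (Suc r) \<circ>\<^sub>e ?S (Suc (Suc r)) \<circ>\<^sub>e ?S (Suc r) \<circ>\<^sub>e ?c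
        \<approx> (?S (Suc r) \<circ>\<^sub>e ?S (Suc (Suc r)) \<circ>\<^sub>e ?S (Suc r)) \<circ>\<^sub>e ?c"
      using le by (intro bcong.sym[OF assoc3]) auto
    also have "\<dots> \<sqsubseteq> (?S (Suc (Suc r)) \<circ>\<^sub>e ?S (Suc r) \<circ>\<^sub>e ?S (Suc (Suc r))) \<circ>\<^sub>e ?c"
      using le by (intro below_comp_right braid_below) auto
    also have "\<dots> \<approx> ?S (Suc (Suc r)) \<circ>\<^sub>e ?S (Suc r) \<circ>\<^sub>e ?S (Suc (Suc r)) \<circ>\<^sub>e ?c"
      using le by (intro assoc3) auto
    also have "\<dots> \<sqsubseteq> ?S (Suc (Suc r)) \<circ>\<^sub>e ?S (Suc r) \<circ>\<^sub>e ?c \<circ>\<^sub>e S n r"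
      using le S_cup_above[of r "Suc (Suc r)" n] by (intro below_comp_left) auto
    also have "\<dots> \<approx> (?S (Suc (Suc r)) \<circ>\<^sub>e ?S (Suc r) \<circ>\<^sub>e ?c) \<circ>\<^sub>e S n r"
      using le by (intro bcong.sym[OF assoc3]) auto
    finally show ?thesis using r by simp
  next
    case False
    hence i: "i < q" "q \<le> n + 2" using Suc.prems by auto
    have "S (n + 2) i \<circ>\<^sub>e S (n + 2) (Suc q) \<circ>\<^sub>e cup (n + 2) q
        \<sqsubseteq> S (n + 2) (Suc q) \<circ>\<^sub>e S (n + 2) i \<circ>\<^sub>e cup (n + 2) q"
      using Suc.prems i by (intro below_front2 S_far) auto
    also have "\<dots> \<sqsubseteq> S (n + 2) (Suc q) \<circ>\<^sub>e cup (n + 2) q \<circ>\<^sub>e S n (i - 1)"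
      using Suc i by (intro below_comp_left) auto
    also have "\<dots> \<approx> (S (n + 2) (Suc q) \<circ>\<^sub>e cup (n + 2) q) \<circ>\<^sub>e S n (i - 1)"
      using Suc.prems i by (intro comp_assoc') auto
    finally show ?thesis by simp
  qed
qed simp

lemma norm_cup: "norm k t \<Longrightarrow> q \<le> 2 * k \<Longrightarrow> norm (Suc k) (cup (2 * k) q \<circ>\<^sub>e t)"
  by (rule norm_comp) (use norm_cups[of "q # _" "Suc k"] in auto)

text \<open>A crossing away from position 0 either moves the right end of the first arc by one point
  or slides through that arc and acts on the remaining cups. The second case needs the result for
  fewer cups, which enters as the assumption \<open>IH\<close> because \<open>norm_S\<close> uses
  this lemma inside its own induction.\<close>

lemma norm_S_pos:
  assumes IH: "\<And>qs i n. cup_list qs \<Longrightarrow> length qs = k \<Longrightarrow> 2 * k = n + 2 \<Longrightarrow> i \<le> n \<Longrightarrow> norm k (S n i \<circ>\<^sub>e cups qs)"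
    and qs: "cup_list qs" "length qs = Suc k" and i: "1 \<le> i" "i \<le> 2 * k"
  shows "norm (Suc k) (S (2 * k) i \<circ>\<^sub>e cups qs)"
proof -
  obtain q ps where q: "qs = q # ps" "q \<le> 2 * k" "cup_list ps" "length ps = k"
    using qs by (cases qs) auto
  consider "i = Suc q" | "i = q" | "i \<ge> q + 2" | "i < q" by linarith
  thus ?thesis
  proof cases
    case 1
    have "S (2 * k) i \<circ>\<^sub>e cups qs \<approx> cups (i # ps)"
      using q i 1 by (auto intro!: comp_assoc')
    thus ?thesis by (rule norm_cong[OF _ norm_cups]) (use q i 1 in auto)
  next
    case 2
    then obtain r where r: "q = Suc r" using i by (cases q) auto
    have "S (2 * k) q \<circ>\<^sub>e S (2 * k) q \<circ>\<^sub>e cups (r # ps) \<sqsubseteq> Ident (2 * k + 2) \<circ>\<^sub>e cups (r # ps)"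
      using q r by (intro below_front S_S) auto
    also have "\<dots> \<approx> cups (r # ps)" using bcong.comp_id_left[of "cups (r # ps)" \<pi> Rel] q r by simp
    finally have *: "S (2 * k) q \<circ>\<^sub>e S (2 * k) q \<circ>\<^sub>e cups (r # ps) \<sqsubseteq> cups (r # ps)" .
    have "S (2 * k) i \<circ>\<^sub>e cups qs \<approx> S (2 * k) q \<circ>\<^sub>e S (2 * k) q \<circ>\<^sub>e cups (r # ps)"
      using q r 2 by (auto intro!: comp_left bcong.comp_assoc)
    from cong_below_trans[OF this *] show ?thesis
      by (rule norm_below[OF _ norm_cups]) (use q r in auto)
  next
    case 3
    then obtain n where n: "2 * k = n + 2" using i by (metis add.commute le_Suc_ex le_trans le_add2)
    have "S (2 * k) i \<circ>\<^sub>e cup (2 * k) q \<circ>\<^sub>e cups ps \<sqsubseteq> cup (2 * k) q \<circ>\<^sub>e S n (i - 2) \<circ>\<^sub>e cups ps"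
      using q i 3 S_cup_above[of q i n] unfolding n by (intro below_front2) (auto simp: n)
    moreover have "norm (Suc k) (cup (2 * k) q \<circ>\<^sub>e S n (i - 2) \<circ>\<^sub>e cups ps)"
      using q i n 3 by (intro norm_cup IH) auto
    ultimately show ?thesis using q norm_below by simp
  next
    case 4
    hence "2 \<le> 2 * k" using i q by linarith
    then obtain n where n: "2 * k = n + 2" by (metis add.commute le_Suc_ex)
    have "S (2 * k) i \<circ>\<^sub>e cup (2 * k) q \<circ>\<^sub>e cups ps \<sqsubseteq> cup (2 * k) q \<circ>\<^sub>e S n (i - 1) \<circ>\<^sub>e cups ps"
      using q i 4 S_cup_inside[of i q n] unfolding n by (intro below_front2) (auto simp: n)
    moreover have "norm (Suc k) (cup (2 * k) q \<circ>\<^sub>e S n (i - 1) \<circ>\<^sub>e cups ps)"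
      using q i n 4 by (intro norm_cup IH) auto
    ultimately show ?thesis using q norm_below by simp
  qed
qed

text \<open>Pulling \<open>S n 0\<close> through \<open>cup n (q + 1)\<close> leaves \<open>vee n q\<close>, which joins the points 1 and
  \<open>q + 2\<close>.\<close>

primrec vee :: "nat \<Rightarrow> nat \<Rightarrow> 'k bexp" where
  "vee n 0 = U n 1"
| "vee n (Suc q) = S n (Suc (Suc q)) \<circ>\<^sub>e vee n q"

lemma vee_type: "Suc q \<le> n \<Longrightarrow> bwt (vee n q) \<and> bsrc (vee n q) = n \<and> btgt (vee n q) = n + 2"
  by (induction q) auto

lemma vee_type_simps [simp]:
  "Suc q \<le> n \<Longrightarrow> bwt (vee n q)" "Suc q \<le> n \<Longrightarrow> bsrc (vee n q) = n" "Suc q \<le> n \<Longrightarrow> btgt (vee n q) = n + 2"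
  using vee_type by auto

lemma S0_cup: "Suc q \<le> n \<Longrightarrow> S n 0 \<circ>\<^sub>e cup n (Suc q) \<sqsubseteq> vee n q"
proof (induction q)
  case 0
  thus ?case using S_S_U(1)[of 0 n] by simp
next
  case (Suc q)
  have "S n 0 \<circ>\<^sub>e S n (Suc (Suc q)) \<circ>\<^sub>e cup n (Suc q) \<sqsubseteq> S n (Suc (Suc q)) \<circ>\<^sub>e S n 0 \<circ>\<^sub>e cup n (Suc q)"
    using Suc.prems by (intro below_front2 S_far) auto
  also have "\<dots> \<sqsubseteq> S n (Suc (Suc q)) \<circ>\<^sub>e vee n q" using Suc by (intro below_comp_left) auto
  finally show ?case by simp
qed

lemma S_S_inv:
  assumes "bwt t" "btgt t = n + 2" "i \<le> n"
  shows "t \<sqsubseteq> S n i \<circ>\<^sub>e S n i \<circ>\<^sub>e t"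
proof -
  have "Ident (n + 2) \<sqsubseteq> S n i \<circ>\<^sub>e S n i"
    by (rule below_lay_left[OF _ below_flip[OF rel_HH] lay_comp])
      (use lay_Ident[of i 2 "n - i"] assms in simp_all)
  hence "Ident (n + 2) \<circ>\<^sub>e t \<sqsubseteq> (S n i \<circ>\<^sub>e S n i) \<circ>\<^sub>e t" using assms by (intro below_comp_right) auto
  also have "\<dots> \<approx> S n i \<circ>\<^sub>e S n i \<circ>\<^sub>e t" using assms by (intro bcong.comp_assoc) auto
  finally have "Ident (btgt t) \<circ>\<^sub>e t \<sqsubseteq> S n i \<circ>\<^sub>e S n i \<circ>\<^sub>e t" using assms by simp
  with bcong.sym[OF bcong.comp_id_left[OF assms(1)]] show ?thesis by (rule cong_below_trans)
qed

text \<open>Two nested arcs, 1-2 inside 0-3: the right side is the normal form of the list 2, 0. The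
  cup at 1 is rewritten as two crossings after a cup at 2, and next to another cup at 0 a cup at 2
  may be exchanged for one at 0.\<close>

lemma U1_U0: "U (n + 2) 1 \<circ>\<^sub>e U n 0 \<sqsubseteq> cup (n + 2) 2 \<circ>\<^sub>e U n 0"
proof -
  let ?S = "S (n + 2)" and ?U = "U (n + 2)"
  have "?U 1 \<sqsubseteq> ?S 2 \<circ>\<^sub>e ?S 2 \<circ>\<^sub>e ?U 1" by (rule S_S_inv) auto
  also have "\<dots> \<sqsubseteq> ?S 2 \<circ>\<^sub>e ?S 1 \<circ>\<^sub>e ?S 1 \<circ>\<^sub>e ?S 2 \<circ>\<^sub>e ?U 1"
    by (rule below_comp_left[OF S_S_inv]) auto
  also have "\<dots> \<sqsubseteq> ?S 2 \<circ>\<^sub>e ?S 1 \<circ>\<^sub>e ?U 2"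
    using S_S_U(1)[of 1 "n + 2"] by (intro below_comp_left) (auto simp: numeral_2_eq_2)
  finally have "?U 1 \<circ>\<^sub>e U n 0 \<sqsubseteq> (?S 2 \<circ>\<^sub>e ?S 1 \<circ>\<^sub>e ?U 2) \<circ>\<^sub>e U n 0"
    by (rule below_comp_right) auto
  also have "\<dots> \<approx> ?S 2 \<circ>\<^sub>e ?S 1 \<circ>\<^sub>e ?U 2 \<circ>\<^sub>e U n 0" by (rule assoc3) auto
  also have "\<dots> \<sqsubseteq> ?S 2 \<circ>\<^sub>e ?S 1 \<circ>\<^sub>e ?U 0 \<circ>\<^sub>e U n 0"
    using U_U(2)[of n] by (intro below_comp_left) auto
  also have "\<dots> \<approx> (?S 2 \<circ>\<^sub>e ?S 1 \<circ>\<^sub>e ?U 0) \<circ>\<^sub>e U n 0" by (rule bcong.sym[OF assoc3]) auto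
  finally show ?thesis by (simp add: numeral_2_eq_2)
qed

end

primrec monomial :: "'k bexp \<Rightarrow> bool" where
  "monomial (Ident n) \<longleftrightarrow> True"
| "monomial GenH \<longleftrightarrow> True"
| "monomial GenA \<longleftrightarrow> True"
| "monomial GenU \<longleftrightarrow> True"
| "monomial (Null m n) \<longleftrightarrow> False"
| "monomial (s +\<^sub>e t) \<longleftrightarrow> False"
| "monomial (c *\<^sub>e t) \<longleftrightarrow> False"
| "monomial (s \<circ>\<^sub>e t) \<longleftrightarrow> monomial s \<and> monomial t"
| "monomial (s \<otimes>\<^sub>e t) \<longleftrightarrow> monomial s \<and> monomial t"

context cat00_params
begin

text \<open>The hard case is position 0 with a first arc that ends beyond point 1. Afterwards that
  arc starts at point 1, and the arc of point 0 is hidden in the remaining cups. The crossings of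
  the second arc are pulled out until its cup meets the shifted first cup, where
  \<open>U1_U0\<close> applies.\<close>

lemma norm_S: "cup_list qs \<Longrightarrow> length qs = k \<Longrightarrow> 2 * k = n + 2 \<Longrightarrow> i \<le> n \<Longrightarrow> norm k (S n i \<circ>\<^sub>e cups qs)"
proof (induction k arbitrary: qs i n)
  case (Suc k)
  note pos = norm_S_pos[OF Suc.IH]
  have n: "n = 2 * k" using Suc.prems by simp
  obtain q ps where q: "qs = q # ps" "q \<le> 2 * k" "cup_list ps" "length ps = k"
    using Suc.prems by (cases qs) auto
  have S_pos: "norm (Suc k) (S (2 * k) j \<circ>\<^sub>e t)" if "norm (Suc k) t" "1 \<le> j" "j \<le> 2 * k" for j t
    by (rule norm_comp[OF that(1)]) (use pos that in auto)
  show ?case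
  proof (cases "i = 0")
    case False
    thus ?thesis using pos Suc.prems n by auto
  next
    case i: True
    show ?thesis
    proof (cases q)
      case 0
      have "S (2 * k) 0 \<circ>\<^sub>e U (2 * k) 0 \<circ>\<^sub>e cups ps \<sqsubseteq> U (2 * k) 0 \<circ>\<^sub>e cups ps"
        by (rule below_front[OF S_U]) (use q in auto)
      moreover have "norm (Suc k) (U (2 * k) 0 \<circ>\<^sub>e cups ps)"
        using norm_cups[of "0 # ps" "Suc k"] q by simp
      ultimately show ?thesis using norm_below q 0 i n by simp
    next
      case r: (Suc r)
      then obtain q' ps' where ps: "ps = q' # ps'" using q by (cases ps) auto
      define l where "l = length ps'"
      have k: "k = Suc l" "q' \<le> 2 * l" "cup_list ps'" using q ps l_def by auto
      \<comment> \<open>Each crossing of the second arc slides out past \<open>U (2 * k) 1\<close>,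
        its position raised by 2, until only the bare cup is left.\<close>
      have U1: "norm (Suc k) (U (2 * k) 1 \<circ>\<^sub>e cup (2 * l) p \<circ>\<^sub>e cups ps')" if "p \<le> 2 * l" for p
        using that
      proof (induction p)
        case 0
        have "U (2 * k) 1 \<circ>\<^sub>e U (2 * l) 0 \<circ>\<^sub>e cups ps' \<sqsubseteq> cup (2 * k) 2 \<circ>\<^sub>e U (2 * l) 0 \<circ>\<^sub>e cups ps'"
          by (rule below_front2) (use U1_U0[of "2 * l"] k in \<open>auto simp: l_def\<close>)
        moreover have "norm (Suc k) (cup (2 * k) 2 \<circ>\<^sub>e U (2 * l) 0 \<circ>\<^sub>e cups ps')"
          using norm_cups[of "2 # 0 # ps'" "Suc k"] k l_def by (simp del: cup.simps(2))
        ultimately show ?case using norm_below by simp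
      next
        case (Suc p)
        have "U (2 * k) 1 \<circ>\<^sub>e S (2 * l) (Suc p) \<circ>\<^sub>e cup (2 * l) p \<circ>\<^sub>e cups ps'
            \<sqsubseteq> S (2 * k) (Suc p + 2) \<circ>\<^sub>e U (2 * k) 1 \<circ>\<^sub>e cup (2 * l) p \<circ>\<^sub>e cups ps'"
          by (rule below_front2) (use S_U_far(2)[of 1 "Suc p" "2 * l"] Suc.prems k in \<open>auto simp: l_def\<close>)
        moreover have "norm (Suc k) (S (2 * k) (Suc p + 2) \<circ>\<^sub>e U (2 * k) 1 \<circ>\<^sub>e cup (2 * l) p \<circ>\<^sub>e cups ps')"
          by (rule S_pos) (use Suc k in auto)
        moreover have "U (2 * k) 1 \<circ>\<^sub>e cup (2 * l) (Suc p) \<circ>\<^sub>e cups ps'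
            \<approx> U (2 * k) 1 \<circ>\<^sub>e S (2 * l) (Suc p) \<circ>\<^sub>e cup (2 * l) p \<circ>\<^sub>e cups ps'"
          unfolding cup.simps by (rule comp_left[OF bcong.comp_assoc]) (use Suc.prems k in \<open>auto simp: l_def\<close>)
        ultimately show ?case using norm_below norm_cong by blast
      qed
      have V: "norm (Suc k) (vee (2 * k) p \<circ>\<^sub>e cups ps)" if "Suc p \<le> 2 * k" for p
        using that
      proof (induction p)
        case 0
        show ?case using U1[of q'] k ps l_def by simp
      next
        case (Suc p)
        have "vee (2 * k) (Suc p) \<circ>\<^sub>e cups ps \<approx> S (2 * k) (Suc (Suc p)) \<circ>\<^sub>e vee (2 * k) p \<circ>\<^sub>e cups ps"
          unfolding vee.simps by (rule bcong.comp_assoc) (use Suc.prems q in auto)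
        moreover have "norm (Suc k) (S (2 * k) (Suc (Suc p)) \<circ>\<^sub>e vee (2 * k) p \<circ>\<^sub>e cups ps)"
          by (rule S_pos) (use Suc in auto)
        ultimately show ?case by (rule norm_cong)
      qed
      have "S (2 * k) 0 \<circ>\<^sub>e cup (2 * k) (Suc r) \<circ>\<^sub>e cups ps \<sqsubseteq> vee (2 * k) r \<circ>\<^sub>e cups ps"
        by (rule below_front[OF S0_cup]) (use q r in auto)
      moreover have "norm (Suc k) (vee (2 * k) r \<circ>\<^sub>e cups ps)" using V[of r] q r by simp
      ultimately show ?thesis using norm_below q r i n by simp
    qed
  qed
qed simp

lemma norm_S': "norm k t \<Longrightarrow> 2 * k = n + 2 \<Longrightarrow> i \<le> n \<Longrightarrow> norm k (S n i \<circ>\<^sub>e t)"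
  by (rule norm_comp) (auto intro: norm_S)

lemma norm_U: "norm k t \<Longrightarrow> i \<le> 2 * k \<Longrightarrow> norm (Suc k) (U (2 * k) i \<circ>\<^sub>e t)"
proof (induction i)
  case 0
  thus ?case using norm_cup[of k t 0] by simp
next
  case (Suc i)
  note ty = norm_typed[OF Suc.prems(1)]
  have "U (2 * k) (Suc i) \<circ>\<^sub>e t \<sqsubseteq> (S (2 * k) i \<circ>\<^sub>e S (2 * k) (Suc i) \<circ>\<^sub>e U (2 * k) i) \<circ>\<^sub>e t"
    by (rule below_comp_right[OF S_S_U(2)]) (use Suc.prems ty in auto)
  also have "\<dots> \<approx> S (2 * k) i \<circ>\<^sub>e S (2 * k) (Suc i) \<circ>\<^sub>e U (2 * k) i \<circ>\<^sub>e t"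
    by (rule assoc3) (use Suc.prems ty in auto)
  finally have "U (2 * k) (Suc i) \<circ>\<^sub>e t \<sqsubseteq> S (2 * k) i \<circ>\<^sub>e S (2 * k) (Suc i) \<circ>\<^sub>e U (2 * k) i \<circ>\<^sub>e t" .
  moreover have "norm (Suc k) (S (2 * k) i \<circ>\<^sub>e S (2 * k) (Suc i) \<circ>\<^sub>e U (2 * k) i \<circ>\<^sub>e t)"
    by (rule norm_S', rule norm_S') (use Suc in auto)
  ultimately show ?case by (rule norm_below)
qed

text \<open>For q = 0 the cap closes a circle, for q = 1 \<open>A_S_U\<close> straightens the
  strand, and from q = 2 on the last crossing of the arc misses the capped points and slides off,
  which shortens the arc.\<close>

lemma norm_A0_cup:
  "cup_list qs \<Longrightarrow> length qs = k \<Longrightarrow> q \<le> 2 * k \<Longrightarrow> norm k (A (2 * k) 0 \<circ>\<^sub>e cup (2 * k) q \<circ>\<^sub>e cups qs)"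
proof (induction q)
  case 0
  have "A (2 * k) 0 \<circ>\<^sub>e U (2 * k) 0 \<circ>\<^sub>e cups qs \<sqsubseteq> Ident (2 * k) \<circ>\<^sub>e cups qs"
    by (rule below_front[OF A_U]) (use 0 in auto)
  also have "\<dots> \<approx> cups qs" using 0 bcong.comp_id_left[of "cups qs" \<pi> Rel] by auto
  finally show ?case using norm_below[OF _ norm_cups[OF 0(1,2)]] by simp
next
  case (Suc q)
  show ?case
  proof (cases q)
    case 0
    have "A (2 * k) 0 \<circ>\<^sub>e (S (2 * k) 1 \<circ>\<^sub>e U (2 * k) 0) \<circ>\<^sub>e cups qs \<sqsubseteq> Ident (2 * k) \<circ>\<^sub>e cups qs"
      by (rule below_front) (use Suc.prems A_S_U[of 0 "2 * k"] in auto)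
    also have "\<dots> \<approx> cups qs" using Suc.prems bcong.comp_id_left[of "cups qs" \<pi> Rel] by auto
    finally show ?thesis using norm_below[OF _ norm_cups[OF Suc.prems(1,2)]] 0 by simp
  next
    case r: (Suc r)
    hence "2 \<le> 2 * k" using Suc.prems by linarith
    then obtain n where n: "2 * k = n + 2" by (metis add.commute le_Suc_ex)
    have "A (2 * k) 0 \<circ>\<^sub>e cup (2 * k) (Suc q) \<circ>\<^sub>e cups qs
        \<approx> A (2 * k) 0 \<circ>\<^sub>e S (2 * k) (Suc q) \<circ>\<^sub>e cup (2 * k) q \<circ>\<^sub>e cups qs"
      unfolding cup.simps by (rule comp_left[OF bcong.comp_assoc]) (use Suc.prems in auto)
    also have "\<dots> \<sqsubseteq> S n r \<circ>\<^sub>e A (2 * k) 0 \<circ>\<^sub>e cup (2 * k) q \<circ>\<^sub>e cups qs"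
      by (rule below_front2) (use Suc.prems A_S_far[of r n] n r in auto)
    finally have "A (2 * k) 0 \<circ>\<^sub>e cup (2 * k) (Suc q) \<circ>\<^sub>e cups qs
        \<sqsubseteq> S n r \<circ>\<^sub>e A (2 * k) 0 \<circ>\<^sub>e cup (2 * k) q \<circ>\<^sub>e cups qs" .
    moreover have "norm k (S n r \<circ>\<^sub>e A (2 * k) 0 \<circ>\<^sub>e cup (2 * k) q \<circ>\<^sub>e cups qs)"
      by (rule norm_S') (use Suc n r in auto)
    ultimately show ?thesis by (rule norm_below)
  qed
qed

lemma norm_A: "norm (Suc k) t \<Longrightarrow> i \<le> 2 * k \<Longrightarrow> norm k (A (2 * k) i \<circ>\<^sub>e t)"
proof (induction i arbitrary: t)
  case 0
  show ?case
  proof (rule norm_comp[OF 0(1)])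
    fix qs assume "cup_list qs" "length qs = Suc k"
    then obtain q ps where "qs = q # ps" "cup_list ps" "length ps = k" "q \<le> 2 * k" by (cases qs) auto
    thus "norm k (A (2 * k) 0 \<circ>\<^sub>e cups qs)" using norm_A0_cup[of ps k q] by simp
  qed auto
next
  case (Suc i)
  note ty = norm_typed[OF Suc.prems(1)]
  have "A (2 * k) (Suc i) \<circ>\<^sub>e t \<sqsubseteq> (A (2 * k) i \<circ>\<^sub>e S (2 * k) (Suc i) \<circ>\<^sub>e S (2 * k) i) \<circ>\<^sub>e t"
    by (rule below_comp_right[OF A_Suc]) (use Suc.prems ty in auto)
  also have "\<dots> \<approx> A (2 * k) i \<circ>\<^sub>e S (2 * k) (Suc i) \<circ>\<^sub>e S (2 * k) i \<circ>\<^sub>e t"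
    by (rule assoc3) (use Suc.prems ty in auto)
  finally have "A (2 * k) (Suc i) \<circ>\<^sub>e t \<sqsubseteq> A (2 * k) i \<circ>\<^sub>e S (2 * k) (Suc i) \<circ>\<^sub>e S (2 * k) i \<circ>\<^sub>e t" .
  moreover have "norm k (A (2 * k) i \<circ>\<^sub>e S (2 * k) (Suc i) \<circ>\<^sub>e S (2 * k) i \<circ>\<^sub>e t)"
    by (rule Suc.IH, rule norm_S', rule norm_S') (use Suc.prems in auto)
  ultimately show ?case by (rule norm_below)
qed

text \<open>The free strands \<open>i\<close>, \<open>j\<close> and the argument \<open>v\<close>
  are what the induction needs: a tensor product is the composite of two layers, and the outer layer
  acts on an element that is already normal.\<close>

lemma norm_monomial:
  assumes "bwt t" "monomial t" "norm k v" "2 * k = i + bsrc t + j"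
  shows "\<exists>l. 2 * l = i + btgt t + j \<and> norm l (lay i t j \<circ>\<^sub>e v)"
  using assms
proof (induction t arbitrary: i j k v)
  case (Ident n)
  have "lay i (Ident n) j \<circ>\<^sub>e v \<approx> Ident (btgt v) \<circ>\<^sub>e v"
    using lay_Ident[of i n j] Ident norm_typed[OF Ident(3)] by (intro comp_right) auto
  also have "\<dots> \<approx> v" using norm_typed[OF Ident(3)] by (intro bcong.comp_id_left) auto
  finally show ?case using norm_cong Ident by auto
next
  case GenH
  obtain n where "2 * k = n + 2" "i \<le> n" "j = n - i" using GenH by (intro that[of "i + j"]) auto
  thus ?case using norm_S'[of k v n i] GenH by auto
next
  case GenA
  obtain l where "k = Suc l" "2 * l = i + j" using GenA by (cases k) auto
  thus ?case using norm_A[of l v i] GenA by auto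
next
  case GenU
  thus ?case using norm_U[of k v i] by (intro exI[of _ "Suc k"]) auto
next
  case (Comp s t)
  obtain l where l: "2 * l = i + btgt t + j" "norm l (lay i t j \<circ>\<^sub>e v)"
    using Comp.IH(2)[of k v i j] Comp.prems by auto
  obtain l' where l': "2 * l' = i + btgt s + j" "norm l' (lay i s j \<circ>\<^sub>e lay i t j \<circ>\<^sub>e v)"
    using Comp.IH(1)[of l _ i j] l Comp.prems by auto
  have ty: "bwt v" "btgt v = i + (bsrc t + j)" using Comp.prems norm_typed[of k v] by auto
  have "lay i (s \<circ>\<^sub>e t) j \<circ>\<^sub>e v \<approx> (lay i s j \<circ>\<^sub>e lay i t j) \<circ>\<^sub>e v"
    by (rule comp_right[OF lay_comp]) (use Comp.prems ty in auto)
  also have "\<dots> \<approx> lay i s j \<circ>\<^sub>e lay i t j \<circ>\<^sub>e v"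
    by (rule bcong.comp_assoc) (use Comp.prems ty in auto)
  finally show ?case using l' norm_cong by auto
next
  case (Tens s t)
  have ty: "bwt v" "btgt v = i + (bsrc s + bsrc t + j)" using Tens.prems norm_typed[of k v] by auto
  obtain l where l: "2 * l = (i + bsrc s) + btgt t + j" "norm l (lay (i + bsrc s) t j \<circ>\<^sub>e v)"
    using Tens.IH(2)[of k v "i + bsrc s" j] Tens.prems by (auto simp: add.assoc)
  obtain l' where l': "2 * l' = i + btgt s + (btgt t + j)"
    "norm l' (lay i s (btgt t + j) \<circ>\<^sub>e lay (i + bsrc s) t j \<circ>\<^sub>e v)"
    using Tens.IH(1)[of l _ i "btgt t + j"] l Tens.prems by (auto simp: add.assoc)
  have "s \<otimes>\<^sub>e t \<approx> s \<otimes>\<^sub>e (Ident 0 \<otimes>\<^sub>e t)"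
    using Tens.prems by (intro tens_left bcong.sym[OF bcong.tens_unit_left]) auto
  from lay_cong[OF this, of i j]
  have "lay i (s \<otimes>\<^sub>e t) j \<approx> lay i s (btgt t + j) \<circ>\<^sub>e lay (i + bsrc s) t j"
    using bcong.sym[OF lay_far1[of s t "bsrc s" "btgt t" i 0 j]] Tens.prems
    by (auto intro: cong_trans)
  hence "lay i (s \<otimes>\<^sub>e t) j \<circ>\<^sub>e v \<approx> (lay i s (btgt t + j) \<circ>\<^sub>e lay (i + bsrc s) t j) \<circ>\<^sub>e v"
    by (rule comp_right) (use Tens.prems ty in auto)
  also have "\<dots> \<approx> lay i s (btgt t + j) \<circ>\<^sub>e lay (i + bsrc s) t j \<circ>\<^sub>e v"
    by (rule bcong.comp_assoc) (use Tens.prems ty in auto)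
  finally show ?case using l' norm_cong by (intro exI[of _ l']) auto
qed auto

lemma monomial_below_cups:
  assumes "bwt t" "monomial t" "bsrc t = 0"
  shows "\<exists>qs. cup_list qs \<and> 2 * length qs = btgt t \<and> t \<sqsubseteq> cups qs"
proof -
  have "norm 0 (Ident 0)" using norm_cups[of "[]" 0] by simp
  then obtain l where l: "2 * l = btgt t" "norm l (lay 0 t 0 \<circ>\<^sub>e Ident 0)"
    using norm_monomial[of t 0 "Ident 0" 0 0] assms by auto
  have "t \<approx> t \<circ>\<^sub>e Ident 0" using bcong.sym[OF bcong.comp_id_right[OF assms(1), of \<pi> Rel]] assms(3) by simp
  also have "\<dots> \<approx> lay 0 t 0 \<circ>\<^sub>e Ident 0"
    using assms by (intro comp_right bcong.sym[OF lay_0_0]) auto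
  finally show ?thesis using l norm_cong unfolding norm_def by metis
qed

end

section \<open>Spanning by bending\<close>

context typed_relations
begin

text \<open>The linear span at the level of expressions, closed under the congruence. It allows
  induction before the module structure of the Hom spaces is involved.\<close>

inductive lspan :: "'k bexp set \<Rightarrow> nat \<Rightarrow> nat \<Rightarrow> 'k bexp \<Rightarrow> bool" for B m n where
  null: "lspan B m n (Null m n)"
| base: "t \<in> B \<Longrightarrow> t \<in> bexps m n \<Longrightarrow> lspan B m n t"
| add: "lspan B m n s \<Longrightarrow> lspan B m n t \<Longrightarrow> lspan B m n (s +\<^sub>e t)"
| scale: "lspan B m n t \<Longrightarrow> lspan B m n (c *\<^sub>e t)"
| congr: "lspan B m n t \<Longrightarrow> s \<approx> t \<Longrightarrow> lspan B m n s"

lemma lspan_bexps: "lspan B m n t \<Longrightarrow> t \<in> bexps m n"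
  by (induction rule: lspan.induct) (auto simp: bexps_def dest: bcong_typed)

lemma lspan_below: "lspan B m n t \<Longrightarrow> s \<sqsubseteq> t \<Longrightarrow> lspan B m n s"
  unfolding below_def using lspan.scale lspan.congr by blast

text \<open>Operations on expressions that induce linear maps between Hom spaces; the second clause
  makes them well defined on classes.\<close>

definition linear_exp :: "nat \<Rightarrow> nat \<Rightarrow> nat \<Rightarrow> nat \<Rightarrow> ('k bexp \<Rightarrow> 'k bexp) \<Rightarrow> bool"
  where "linear_exp m n m' n' f \<longleftrightarrow>
    (\<forall>t \<in> bexps m n. f t \<in> bexps m' n')
    \<and> (\<forall>s \<in> bexps m n. \<forall>t. s \<approx> t \<longrightarrow> f s \<approx> f t)
    \<and> (\<forall>s \<in> bexps m n. \<forall>t \<in> bexps m n. f (s +\<^sub>e t) \<approx> f s +\<^sub>e f t)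
    \<and> (\<forall>t \<in> bexps m n. \<forall>c. f (c *\<^sub>e t) \<approx> c *\<^sub>e f t)"

lemma bexps_cong: "s \<approx> t \<Longrightarrow> s \<in> bexps m n \<longleftrightarrow> t \<in> bexps m n"
  using bcong_typed[of s t] by (auto simp: bexps_def)

lemma linear_exp_comp:
  assumes f: "linear_exp m n m' n' f" and g: "linear_exp m' n' m'' n'' g"
  shows "linear_exp m n m'' n'' (\<lambda>t. g (f t))"
  unfolding linear_exp_def
proof (intro conjI ballI allI impI)
  fix s t :: "'k bexp" and c :: 'k assume s: "s \<in> bexps m n"
  hence fs: "f s \<in> bexps m' n'" using f by (auto simp: linear_exp_def)
  thus "g (f s) \<in> bexps m'' n''" using g by (auto simp: linear_exp_def)
  {
    assume "s \<approx> t"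
    thus "g (f s) \<approx> g (f t)" using f g s fs by (auto simp: linear_exp_def)
  }
  {
    have "g (f (c *\<^sub>e s)) \<approx> g (c *\<^sub>e f s)"
      using f g s fs by (auto simp: linear_exp_def bexps_def)
    also have "\<dots> \<approx> c *\<^sub>e g (f s)" using g fs by (auto simp: linear_exp_def)
    finally show "g (f (c *\<^sub>e s)) \<approx> c *\<^sub>e g (f s)" .
  }
  assume t: "t \<in> bexps m n"
  hence ft: "f t \<in> bexps m' n'" using f by (auto simp: linear_exp_def)
  have "s +\<^sub>e t \<in> bexps m n" using s t by (auto simp: bexps_def)
  hence "g (f (s +\<^sub>e t)) \<approx> g (f s +\<^sub>e f t)"
    using f g s t by (auto simp: linear_exp_def)
  also have "\<dots> \<approx> g (f s) +\<^sub>e g (f t)" using g fs ft by (auto simp: linear_exp_def)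
  finally show "g (f (s +\<^sub>e t)) \<approx> g (f s) +\<^sub>e g (f t)" .
qed

lemma linear_exp_below:
  assumes "linear_exp m n m' n' f" "s \<in> bexps m n" "s \<sqsubseteq> t"
  shows "f s \<sqsubseteq> f t"
proof -
  obtain c where c: "s \<approx> c *\<^sub>e t" using assms by (auto simp: below_def)
  have "t \<in> bexps m n" using assms(2) bexps_cong[OF c] by (auto simp: bexps_def)
  moreover have "f s \<approx> f (c *\<^sub>e t)" using assms c by (auto simp: linear_exp_def)
  ultimately have "f s \<approx> c *\<^sub>e f t" using assms(1) cong_trans by (auto simp: linear_exp_def)
  thus ?thesis by (rule belowI)
qed

lemma linear_exp_null:
  assumes "linear_exp m n m' n' f"
  shows "f (Null m n) \<approx> Null m' n'"
proof -
  have N: "Null m n \<in> bexps m n" by (simp add: bexps_def)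
  hence fN: "f (Null m n) \<in> bexps m' n'" using assms by (auto simp: linear_exp_def)
  have "Null m n \<approx> 0 *\<^sub>e Null m n" using scale_zero[of "Null m n"] by (auto intro: bcong.sym)
  hence "f (Null m n) \<approx> f (0 *\<^sub>e Null m n)" using assms N by (auto simp: linear_exp_def)
  also have "\<dots> \<approx> 0 *\<^sub>e f (Null m n)" using assms N by (auto simp: linear_exp_def)
  also have "\<dots> \<approx> Null m' n'" using scale_zero[of "f (Null m n)"] fN by (auto simp: bexps_def)
  finally show ?thesis .
qed

lemma lspan_linear:
  assumes f: "linear_exp m n m' n' f" and t: "lspan B m n t"
    and B: "\<And>b. b \<in> B \<Longrightarrow> b \<in> bexps m n \<Longrightarrow> lspan B' m' n' (f b)"
  shows "lspan B' m' n' (f t)"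
  using t
proof (induction rule: lspan.induct)
  case null
  show ?case by (rule lspan.congr[OF lspan.null linear_exp_null[OF f]])
next
  case (base t)
  thus ?case by (rule B)
next
  case (add s t)
  have "f (s +\<^sub>e t) \<approx> f s +\<^sub>e f t"
    using f add.hyps lspan_bexps by (auto simp: linear_exp_def)
  thus ?case using add.IH lspan.add lspan.congr by blast
next
  case (scale t c)
  have "f (c *\<^sub>e t) \<approx> c *\<^sub>e f t" using f scale.hyps lspan_bexps by (auto simp: linear_exp_def)
  thus ?case using scale.IH lspan.scale lspan.congr by blast
next
  case (congr t s)
  have "f s \<approx> f t" using f congr.hyps lspan_bexps bexps_cong by (auto simp: linear_exp_def)
  thus ?case using congr.IH lspan.congr by blast
qed

lemma linear_exp_comp_left: "s \<in> bexps n n' \<Longrightarrow> linear_exp m n m n' (\<lambda>t. s \<circ>\<^sub>e t)"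
  by (auto simp: linear_exp_def bexps_def intro: comp_left bcong.comp_add_right bcong.comp_scale_right)

lemma linear_exp_comp_right: "t \<in> bexps m n \<Longrightarrow> linear_exp n n' m n' (\<lambda>s. s \<circ>\<^sub>e t)"
  by (auto simp: linear_exp_def bexps_def intro: comp_right bcong.comp_add_left bcong.comp_scale_left)

lemma linear_exp_tens_left: "s \<in> bexps m' n' \<Longrightarrow> linear_exp m n (m' + m) (n' + n) (\<lambda>t. s \<otimes>\<^sub>e t)"
  by (auto simp: linear_exp_def bexps_def intro: tens_left bcong.tens_add_right bcong.tens_scale_right)

lemma linear_exp_tens_right: "t \<in> bexps m' n' \<Longrightarrow> linear_exp m n (m + m') (n + n') (\<lambda>s. s \<otimes>\<^sub>e t)"
  by (auto simp: linear_exp_def bexps_def intro: tens_right bcong.tens_add_left bcong.tens_scale_left)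

text \<open>Composition and tensor product are bilinear, so one factor at a time is expanded into
  monomials with the other held fixed.\<close>

lemma lspan_monomial: "bwt t \<Longrightarrow> lspan {s. monomial s} (bsrc t) (btgt t) t"
proof (induction t)
  case (Comp s t)
  have "lspan {s. monomial s} (bsrc t) (btgt s) (s \<circ>\<^sub>e t)"
  proof (rule lspan_linear[OF linear_exp_comp_right])
    show "t \<in> bexps (bsrc t) (btgt t)" using Comp.prems by (simp add: bexps_def)
    show "lspan {s. monomial s} (btgt t) (btgt s) s" using Comp by auto
    fix b :: "'k bexp" assume b: "b \<in> {s. monomial s}" "b \<in> bexps (btgt t) (btgt s)"
    show "lspan {s. monomial s} (bsrc t) (btgt s) (b \<circ>\<^sub>e t)"
    proof (rule lspan_linear[OF linear_exp_comp_left[OF b(2)]])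
      show "lspan {s. monomial s} (bsrc t) (btgt t) t" using Comp by auto
    qed (use b in \<open>auto simp: bexps_def intro: lspan.base\<close>)
  qed
  thus ?case by simp
next
  case (Tens s t)
  have "lspan {s. monomial s} (bsrc s + bsrc t) (btgt s + btgt t) (s \<otimes>\<^sub>e t)"
  proof (rule lspan_linear[OF linear_exp_tens_right])
    show "t \<in> bexps (bsrc t) (btgt t)" using Tens.prems by (simp add: bexps_def)
    show "lspan {s. monomial s} (bsrc s) (btgt s) s" using Tens by auto
    fix b :: "'k bexp" assume b: "b \<in> {s. monomial s}" "b \<in> bexps (bsrc s) (btgt s)"
    show "lspan {s. monomial s} (bsrc s + bsrc t) (btgt s + btgt t) (b \<otimes>\<^sub>e t)"
    proof (rule lspan_linear[OF linear_exp_tens_left[OF b(2)]])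
      show "lspan {s. monomial s} (bsrc t) (btgt t) t" using Tens by auto
    qed (use b in \<open>auto simp: bexps_def intro: lspan.base\<close>)
  qed
  thus ?case by simp
qed (auto simp: bexps_def intro: lspan.intros)

end

text \<open>Bending turns the last source point into a last target point.\<close>

definition bend1 :: "nat \<Rightarrow> 'k bexp \<Rightarrow> 'k bexp"
  where "bend1 m t = (t \<otimes>\<^sub>e Ident 1) \<circ>\<^sub>e (Ident m \<otimes>\<^sub>e GenU)"

definition unbend1 :: "nat \<Rightarrow> 'k bexp \<Rightarrow> 'k bexp"
  where "unbend1 n t = (Ident n \<otimes>\<^sub>e GenA) \<circ>\<^sub>e (t \<otimes>\<^sub>e Ident 1)"

primrec bend :: "nat \<Rightarrow> 'k bexp \<Rightarrow> 'k bexp" where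
  "bend 0 t = t"
| "bend (Suc m) t = bend m (bend1 m t)"

primrec unbend :: "nat \<Rightarrow> nat \<Rightarrow> 'k bexp \<Rightarrow> 'k bexp" where
  "unbend 0 n t = t"
| "unbend (Suc m) n t = unbend1 n (unbend m (Suc n) t)"

lemma bend1_bexps: "t \<in> bexps (Suc m) n \<Longrightarrow> bend1 m t \<in> bexps m (Suc n)"
  by (auto simp: bend1_def bexps_def)

lemma monomial_bend: "monomial t \<Longrightarrow> monomial (bend m t)"
  by (induction m arbitrary: t) (auto simp: bend1_def)

context typed_relations
begin

lemma linear_bend1: "linear_exp (Suc m) n m (Suc n) (bend1 m)"
  unfolding bend1_def
  by (rule linear_exp_comp[where f = "\<lambda>t. t \<otimes>\<^sub>e Ident 1"])
    (use linear_exp_tens_right[of "Ident 1" 1 1 "Suc m" n] linear_exp_comp_right[of _ m "Suc (Suc m)"]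
      in \<open>auto simp: bexps_def\<close>)

lemma linear_unbend1: "linear_exp m (Suc n) (Suc m) n (unbend1 n)"
  unfolding unbend1_def
  by (rule linear_exp_comp[where f = "\<lambda>t. t \<otimes>\<^sub>e Ident 1"])
    (use linear_exp_tens_right[of "Ident 1" 1 1 m "Suc n"] linear_exp_comp_left[of "Ident n \<otimes>\<^sub>e GenA" "Suc (Suc n)" n "Suc m"]
      in \<open>auto simp: bexps_def\<close>)

lemma linear_bend: "linear_exp m n 0 (n + m) (bend m)"
proof (induction m arbitrary: n)
  case 0
  thus ?case by (auto simp: linear_exp_def bexps_def intro: bcong.refl)
next
  case (Suc m)
  show ?case using linear_exp_comp[OF linear_bend1 Suc] by simp
qed

lemma linear_unbend: "linear_exp 0 (n + m) m n (unbend m n)"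
proof (induction m arbitrary: n)
  case 0
  thus ?case by (auto simp: linear_exp_def bexps_def intro: bcong.refl)
next
  case (Suc m)
  show ?case using linear_exp_comp[OF Suc[of "Suc n"] linear_unbend1] by simp
qed

end

context cat00_params
begin

text \<open>Moving the cap past \<open>t\<close> costs a Koszul sign, and the zigzag
  \<open>IA \<circ>\<^sub>e UI\<close> that remains equals \<open>\<epsilon> * sig\<close>. Both
  factors are nonzero, which is all that matters for inverting the bending.\<close>

lemma unbend1_bend1:
  assumes "t \<in> bexps (Suc m) n"
  shows "\<exists>c. c \<noteq> 0 \<and> unbend1 n (bend1 m t) \<approx> c *\<^sub>e t"
proof -
  have t: "bwt t" "bsrc t = Suc m" "btgt t = n" using assms by (auto simp: bexps_def)
  obtain p where p: "bhomog \<pi> t p" using bhomog_exists t by blast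
  have 1: "bend1 m t \<otimes>\<^sub>e Ident 1 \<approx> lay 0 t 2 \<circ>\<^sub>e lay m GenU 1"
  proof -
    have "bend1 m t \<otimes>\<^sub>e Ident 1 \<approx> lay 0 (bend1 m t) 1"
      by (rule tens_Ident_lay) (use t in \<open>auto simp: bend1_def\<close>)
    also have "\<dots> \<approx> lay 0 t (1 + 1) \<circ>\<^sub>e lay (0 + m) GenU 1"
      unfolding bend1_def
      by (rule lay_comp_I[OF tens_I_lay I_tens_lay]) (use t in auto)
    finally show ?thesis by (simp add: numeral_2_eq_2)
  qed
  have 2: "lay n GenA 0 \<circ>\<^sub>e lay 0 t 2 \<approx> koszul \<pi> p *\<^sub>e (lay 0 t 0 \<circ>\<^sub>e lay (Suc m) GenA 0)"
  proof -
    have "lay (0 + n + 0) GenA 0 \<circ>\<^sub>e lay 0 t (0 + 2 + 0)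
        \<approx> koszul \<pi> p *\<^sub>e lay 0 (t \<otimes>\<^sub>e (Ident 0 \<otimes>\<^sub>e GenA)) 0"
      by (rule lay_far2) (use t p in auto)
    also have "\<dots> \<approx> koszul \<pi> p *\<^sub>e (lay 0 t (0 + 0 + 0) \<circ>\<^sub>e lay (0 + Suc m + 0) GenA 0)"
      by (rule bcong.scale_cong, rule bcong.sym, rule lay_far1) (use t in auto)
    finally show ?thesis by (simp add: numeral_2_eq_2)
  qed
  have 3: "lay (Suc m) GenA 0 \<circ>\<^sub>e lay m GenU 1 \<approx> (\<epsilon> * sig) *\<^sub>e Ident (Suc m)"
  proof -
    have "lay (Suc m) GenA 0 \<circ>\<^sub>e lay m GenU 1 \<approx> lay m (IA \<circ>\<^sub>e UI) 0"
      using lay_comp_I[OF lay_three(6) lay_three(3), of m 0] by (auto intro: bcong.sym)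
    also have "\<dots> \<approx> lay m ((\<epsilon> * sig) *\<^sub>e Ident 1) 0" by (rule lay_cong[OF rels(4)])
    also have "\<dots> \<approx> (\<epsilon> * sig) *\<^sub>e lay m (Ident 1) 0" by (rule lay_scale) simp
    also have "\<dots> \<approx> (\<epsilon> * sig) *\<^sub>e Ident (Suc m)"
      using lay_Ident[of m 1 0] by (auto intro: bcong.scale_cong)
    finally show ?thesis .
  qed
  have "unbend1 n (bend1 m t) \<approx> lay n GenA 0 \<circ>\<^sub>e lay 0 t 2 \<circ>\<^sub>e lay m GenU 1"
    unfolding unbend1_def
    by (rule bcong.comp_cong[OF Ident_tens_lay 1]) (use t in \<open>auto simp: bend1_def\<close>)
  also have "\<dots> \<approx> (lay n GenA 0 \<circ>\<^sub>e lay 0 t 2) \<circ>\<^sub>e lay m GenU 1"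
    by (rule comp_assoc') (use t in auto)
  also have "\<dots> \<approx> (koszul \<pi> p *\<^sub>e (lay 0 t 0 \<circ>\<^sub>e lay (Suc m) GenA 0)) \<circ>\<^sub>e lay m GenU 1"
    by (rule comp_right[OF 2]) (use t in auto)
  also have "\<dots> \<approx> koszul \<pi> p *\<^sub>e ((lay 0 t 0 \<circ>\<^sub>e lay (Suc m) GenA 0) \<circ>\<^sub>e lay m GenU 1)"
    by (rule bcong.comp_scale_left) (use t in auto)
  finally have u: "unbend1 n (bend1 m t) \<approx> koszul \<pi> p *\<^sub>e ((lay 0 t 0 \<circ>\<^sub>e lay (Suc m) GenA 0) \<circ>\<^sub>e lay m GenU 1)" .
  have "(lay 0 t 0 \<circ>\<^sub>e lay (Suc m) GenA 0) \<circ>\<^sub>e lay m GenU 1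
      \<approx> lay 0 t 0 \<circ>\<^sub>e lay (Suc m) GenA 0 \<circ>\<^sub>e lay m GenU 1"
    by (rule bcong.comp_assoc) (use t in auto)
  also have "\<dots> \<approx> t \<circ>\<^sub>e ((\<epsilon> * sig) *\<^sub>e Ident (Suc m))"
    by (rule bcong.comp_cong[OF lay_0_0 3]) (use t in auto)
  also have "\<dots> \<approx> (\<epsilon> * sig) *\<^sub>e (t \<circ>\<^sub>e Ident (Suc m))"
    by (rule bcong.comp_scale_right) (use t in auto)
  also have "\<dots> \<approx> (\<epsilon> * sig) *\<^sub>e t"
    using bcong.comp_id_right[OF t(1), of \<pi> Rel] t by (intro bcong.scale_cong) simp
  finally have "unbend1 n (bend1 m t) \<approx> (koszul \<pi> p * (\<epsilon> * sig)) *\<^sub>e t"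
    by (rule scale_scale'[OF u])
  thus ?thesis by (intro exI conjI) auto
qed

lemma unbend_bend:
  assumes "t \<in> bexps m n"
  shows "unbend m n (bend m t) \<sqsubseteq> t" "t \<sqsubseteq> unbend m n (bend m t)"
proof -
  have "unbend m n (bend m t) \<sqsubseteq> t \<and> t \<sqsubseteq> unbend m n (bend m t)"
    using assms
  proof (induction m arbitrary: n t)
    case 0
    thus ?case by (auto simp: bexps_def intro: below_refl)
  next
    case (Suc m)
    let ?b = "bend1 m t"
    have b: "?b \<in> bexps m (Suc n)" using Suc.prems by (rule bend1_bexps)
    let ?u = "unbend m (Suc n) (bend m ?b)"
    have ub: "?u \<sqsubseteq> ?b" "?b \<sqsubseteq> ?u" using Suc.IH[OF b] by auto
    hence u: "?u \<in> bexps m (Suc n)" using b below_typed[OF ub(1)] by (auto simp: bexps_def)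
    obtain c where c: "c \<noteq> 0" "unbend1 n ?b \<approx> c *\<^sub>e t" using unbend1_bend1[OF Suc.prems] by auto
    have "unbend1 n ?u \<sqsubseteq> unbend1 n ?b" by (rule linear_exp_below[OF linear_unbend1 u ub(1)])
    also have "\<dots> \<sqsubseteq> t" using c by (intro belowI)
    finally have 1: "unbend1 n ?u \<sqsubseteq> t" .
    have "t \<sqsubseteq> unbend1 n ?b" using c by (intro below_flip)
    also have "\<dots> \<sqsubseteq> unbend1 n ?u" by (rule linear_exp_below[OF linear_unbend1 b ub(2)])
    finally show ?case using 1 by simp
  qed
  thus "unbend m n (bend m t) \<sqsubseteq> t" "t \<sqsubseteq> unbend m n (bend m t)" by auto
qed

text \<open>It suffices to hit every normal form by a bent element of \<open>B\<close>.\<close>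

lemma lspan_by_bending:
  assumes B: "\<And>qs. cup_list qs \<Longrightarrow> 2 * length qs = n + m \<Longrightarrow> \<exists>X \<in> B. X \<in> bexps m n \<and> cups qs \<sqsubseteq> bend m X"
    and t: "t \<in> bexps m n"
  shows "lspan B m n t"
proof -
  have bt: "bend m t \<in> bexps 0 (n + m)" using t linear_bend[of m n] by (auto simp: linear_exp_def)
  have "lspan {s. monomial s} 0 (n + m) (bend m t)"
    using lspan_monomial[of "bend m t"] bt by (auto simp: bexps_def)
  moreover have "lspan B m n (unbend m n b)" if b: "b \<in> {s. monomial s}" "b \<in> bexps 0 (n + m)" for b :: "'k bexp"
  proof -
    obtain qs where qs: "cup_list qs" "2 * length qs = n + m" "b \<sqsubseteq> cups qs"
      using monomial_below_cups[of b] b by (auto simp: bexps_def)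
    then obtain X where X: "X \<in> B" "X \<in> bexps m n" "cups qs \<sqsubseteq> bend m X" using B by blast
    have "b \<sqsubseteq> bend m X" using qs(3) X(3) by (rule below_trans)
    hence "unbend m n b \<sqsubseteq> unbend m n (bend m X)" using linear_exp_below[OF linear_unbend] b by blast
    also have "\<dots> \<sqsubseteq> X" using X by (intro unbend_bend)
    finally show ?thesis using X by (intro lspan_below[OF lspan.base])
  qed
  ultimately have "lspan B m n (unbend m n (bend m t))"
    by (rule lspan_linear[OF linear_unbend])
  thus ?thesis using unbend_bend[OF t] lspan_below by blast
qed

end

section \<open>Standard expressions in the matrix model\<close>

text \<open>A pair \<open>(p, s)\<close> stands for a cup with left end \<open>p\<close> (counted from 1) and right end \<open>p + s + 1\<close>;
  \<open>pair_at\<close> says that a word carries dual labels there and \<open>del_pair\<close> deletes both.\<close>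

definition pair_at :: "nat \<times> nat \<Rightarrow> label list \<Rightarrow> bool"
  where "pair_at q y \<longleftrightarrow> y ! (fst q + snd q) = dual (y ! (fst q - 1))"

definition del_pair :: "nat \<times> nat \<Rightarrow> label list \<Rightarrow> label list"
  where "del_pair q y = take (fst q - 1) y @ take (snd q) (drop (fst q) y) @ drop (fst q + snd q + 1) y"

primrec pairs_at :: "(nat \<times> nat) list \<Rightarrow> label list \<Rightarrow> bool" where
  "pairs_at [] y \<longleftrightarrow> True"
| "pairs_at (q # qs) y \<longleftrightarrow> pair_at q y \<and> pairs_at qs (del_pair q y)"

primrec del_pairs :: "(nat \<times> nat) list \<Rightarrow> label list \<Rightarrow> label list" where
  "del_pairs [] y = y"
| "del_pairs (q # qs) y = del_pairs qs (del_pair q y)"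

primrec pair_list :: "(nat \<times> nat) list \<Rightarrow> nat \<Rightarrow> bool" where
  "pair_list [] n \<longleftrightarrow> True"
| "pair_list (q # qs) n \<longleftrightarrow> 1 \<le> fst q \<and> fst q + snd q + 1 \<le> n \<and> pair_list qs (n - 2)"

lemma pair_list_length: "pair_list qs n \<Longrightarrow> 2 * length qs \<le> n"
  by (induction qs arbitrary: n) fastforce+

lemma word_decomp:
  assumes "1 \<le> p" "p + s + 1 \<le> length y"
  obtains u c v d w where "y = u @ [c] @ v @ [d] @ w" "length u = p - 1" "length v = s"
proof -
  define u where "u = take (p - 1) y"
  define z where "z = drop (p - 1) y"
  have 1: "y = u @ z" "length u = p - 1" using assms by (auto simp: u_def z_def)
  hence "length z \<ge> s + 2" using assms by (auto simp: z_def)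
  then obtain c z' where z: "z = c # z'" "length z' \<ge> s + 1" by (cases z) auto
  have "length (drop s z') \<ge> 1" using z by simp
  then obtain d w where "drop s z' = d # w" by (cases "drop s z'") auto
  hence "z' = take s z' @ d # w" by (metis append_take_drop_id)
  thus ?thesis using that[of u c "take s z'" d w] 1 z by simp
qed

lemma pair_at_decomp:
  assumes "1 \<le> p" "length u = p - 1" "length v = s"
  shows "pair_at (p, s) (u @ [c] @ v @ [d] @ w) \<longleftrightarrow> d = dual c"
    and "del_pair (p, s) (u @ [c] @ v @ [d] @ w) = u @ v @ w"
  using assms by (auto simp: pair_at_def del_pair_def nth_append)

lemma length_del_pair: "1 \<le> fst q \<Longrightarrow> fst q + snd q + 1 \<le> length y \<Longrightarrow> length (del_pair q y) = length y - 2"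
  by (auto simp: del_pair_def)

lemma length_del_pairs: "pair_list qs (length y) \<Longrightarrow> length (del_pairs qs y) = length y - 2 * length qs"
proof (induction qs arbitrary: y)
  case (Cons q qs)
  thus ?case using length_del_pair[of q y] by auto
qed auto

definition swap_at :: "nat \<Rightarrow> label list \<Rightarrow> label list"
  where "swap_at i y = y[i - 1 := y ! i, i := y ! (i - 1)]"

text \<open>The first letter acts first, because a target word enters a product of matrices at its
  leftmost factor.\<close>

primrec word_act :: "nat list \<Rightarrow> label list \<Rightarrow> label list" where
  "word_act [] y = y"
| "word_act (i # w) y = word_act w (swap_at i y)"

lemma swap_at_decomp: "1 \<le> i \<Longrightarrow> length u = i - 1 \<Longrightarrow> swap_at i (u @ [a, b] @ v) = u @ [b, a] @ v"
  by (cases i) (auto simp: swap_at_def nth_append list_update_append)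

lemma length_swap_at [simp]: "length (swap_at i y) = length y"
  by (simp add: swap_at_def)

lemma swap_decomp:
  assumes "1 \<le> i" "i + 1 \<le> length y"
  obtains u a b v where "y = u @ [a, b] @ v" "length u = i - 1"
  using word_decomp[of i 0 y] assms by (metis add.right_neutral append_Cons append_Nil length_0_conv)

section \<open>Matrices with at most one entry in a row or column\<close>

context label_model
begin

text \<open>Row \<open>y\<close> of the matrix of \<open>t\<close> has a single nonzero entry, in
  column \<open>y'\<close>, if \<open>P\<close> holds, and is zero otherwise. Stated as an action on
  arbitrary \<open>F\<close>, this passes through composites. Cups and crossings have such rows; a
  cap has only such columns, hence the second notion \<open>coacts\<close>.\<close>

definition acts :: "'k bexp \<Rightarrow> label list \<Rightarrow> bool \<Rightarrow> label list \<Rightarrow> bool"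
  where "acts t y P y' \<longleftrightarrow> (P \<longrightarrow> y' \<in> wd (bsrc t)) \<and>
    (\<exists>\<kappa>. \<kappa> \<noteq> 0 \<and> (\<forall>F. (\<Sum>z\<in>wd (bsrc t). M t y z * F z) = (if P then \<kappa> * F y' else 0)))"

definition coacts :: "'k bexp \<Rightarrow> label list \<Rightarrow> bool \<Rightarrow> label list \<Rightarrow> bool"
  where "coacts t x P x' \<longleftrightarrow> (P \<longrightarrow> x' \<in> wd (btgt t)) \<and>
    (\<exists>\<kappa>. \<kappa> \<noteq> 0 \<and> (\<forall>F. (\<Sum>z\<in>wd (btgt t). F z * M t z x) = (if P then \<kappa> * F x' else 0)))"

lemma acts_comp:
  assumes s: "acts s y P y'" and t: "P \<Longrightarrow> acts t y' Q y''" and "bsrc s = btgt t"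
  shows "acts (s \<circ>\<^sub>e t) y (P \<and> Q) y''"
proof -
  have sum: "(\<Sum>x\<in>wd (bsrc t). M (s \<circ>\<^sub>e t) y x * F x)
      = (\<Sum>z\<in>wd (bsrc s). M s y z * (\<Sum>x\<in>wd (bsrc t). M t z x * F x))" for F
  proof -
    have "(\<Sum>x\<in>wd (bsrc t). M (s \<circ>\<^sub>e t) y x * F x)
        = (\<Sum>x\<in>wd (bsrc t). \<Sum>z\<in>wd (bsrc s). M s y z * M t z x * F x)"
      using assms(3) by (simp add: sum_distrib_right)
    also have "\<dots> = (\<Sum>z\<in>wd (bsrc s). \<Sum>x\<in>wd (bsrc t). M s y z * M t z x * F x)" by (rule sum.swap)
    finally show ?thesis by (simp add: sum_distrib_left mult.assoc)
  qed
  obtain \<kappa> where \<kappa>: "\<kappa> \<noteq> 0" "\<And>F. (\<Sum>z\<in>wd (bsrc s). M s y z * F z) = (if P then \<kappa> * F y' else 0)"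
    using s by (auto simp: acts_def)
  show ?thesis
  proof (cases P)
    case True
    then obtain \<mu> where \<mu>: "\<mu> \<noteq> 0" "\<And>F. (\<Sum>z\<in>wd (bsrc t). M t y' z * F z) = (if Q then \<mu> * F y'' else 0)"
      using t by (auto simp: acts_def)
    have "(\<Sum>x\<in>wd (bsrc t). M (s \<circ>\<^sub>e t) y x * F x) = (if P \<and> Q then (\<kappa> * \<mu>) * F y'' else 0)" for F
      unfolding sum \<kappa>(2) \<mu>(2) using True by (simp add: mult.assoc)
    moreover have "Q \<longrightarrow> y'' \<in> wd (bsrc t)" using t True by (auto simp: acts_def)
    ultimately show ?thesis using True \<kappa>(1) \<mu>(1) unfolding acts_def by (auto intro!: exI[of _ "\<kappa> * \<mu>"] simp del: M.simps)
  next
    case False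
    thus ?thesis unfolding acts_def using sum \<kappa>(2) by (auto intro: exI[of _ 1])
  qed
qed

lemma coacts_comp:
  assumes t: "coacts t x Q x'" and s: "Q \<Longrightarrow> coacts s x' P x''" and "bsrc s = btgt t"
  shows "coacts (s \<circ>\<^sub>e t) x (Q \<and> P) x''"
proof -
  have sum: "(\<Sum>y\<in>wd (btgt s). F y * M (s \<circ>\<^sub>e t) y x)
      = (\<Sum>z\<in>wd (btgt t). (\<Sum>y\<in>wd (btgt s). F y * M s y z) * M t z x)" for F
  proof -
    have "(\<Sum>y\<in>wd (btgt s). F y * M (s \<circ>\<^sub>e t) y x)
        = (\<Sum>y\<in>wd (btgt s). \<Sum>z\<in>wd (btgt t). F y * M s y z * M t z x)"
      by (simp add: sum_distrib_left mult.assoc)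
    also have "\<dots> = (\<Sum>z\<in>wd (btgt t). \<Sum>y\<in>wd (btgt s). F y * M s y z * M t z x)" by (rule sum.swap)
    finally show ?thesis by (simp add: sum_distrib_right)
  qed
  obtain \<kappa> where \<kappa>: "\<kappa> \<noteq> 0" "\<And>F. (\<Sum>z\<in>wd (btgt t). F z * M t z x) = (if Q then \<kappa> * F x' else 0)"
    using t by (auto simp: coacts_def)
  show ?thesis
  proof (cases Q)
    case True
    then obtain \<mu> where \<mu>: "\<mu> \<noteq> 0" "\<And>F. (\<Sum>z\<in>wd (btgt s). F z * M s z x') = (if P then \<mu> * F x'' else 0)"
      using s by (auto simp: coacts_def)
    have "(\<Sum>y\<in>wd (btgt s). F y * M (s \<circ>\<^sub>e t) y x) = (if Q \<and> P then (\<kappa> * \<mu>) * F x'' else 0)" for F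
      unfolding sum \<kappa>(2) \<mu>(2) using True by (simp add: mult.assoc)
    moreover have "P \<longrightarrow> x'' \<in> wd (btgt s)" using s True by (auto simp: coacts_def)
    ultimately show ?thesis using True \<kappa>(1) \<mu>(1) unfolding coacts_def by (auto intro!: exI[of _ "\<kappa> * \<mu>"] simp del: M.simps)
  next
    case False
    thus ?thesis unfolding coacts_def using sum \<kappa>(2) by (auto intro: exI[of _ 1])
  qed
qed

lemma acts_M:
  assumes "acts t y P y'" "x \<in> wd (bsrc t)"
  shows "M t y x \<noteq> 0 \<longleftrightarrow> P \<and> y' = x"
proof -
  obtain \<kappa> where \<kappa>: "\<kappa> \<noteq> 0" "\<And>F. (\<Sum>z\<in>wd (bsrc t). M t y z * F z) = (if P then \<kappa> * F y' else 0)"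
    using assms by (auto simp: acts_def)
  have "M t y z * (if z = x then 1 else 0) = (if z = x then M t y x else 0)" for z by simp
  hence "M t y x = (\<Sum>z\<in>wd (bsrc t). M t y z * (if z = x then 1 else 0))" using assms by simp
  thus ?thesis unfolding \<kappa>(2) using \<kappa>(1) by simp
qed

lemma coacts_M:
  assumes "coacts t x P x'" "y \<in> wd (btgt t)"
  shows "M t y x \<noteq> 0 \<longleftrightarrow> P \<and> x' = y"
proof -
  obtain \<kappa> where \<kappa>: "\<kappa> \<noteq> 0" "\<And>F. (\<Sum>z\<in>wd (btgt t). F z * M t z x) = (if P then \<kappa> * F x' else 0)"
    using assms by (auto simp: coacts_def)
  have "(if z = y then 1 else 0) * M t z x = (if z = y then M t y x else 0)" for z by simp
  hence "M t y x = (\<Sum>z\<in>wd (btgt t). (if z = y then 1 else 0) * M t z x)" using assms by simp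
  thus ?thesis unfolding \<kappa>(2) using \<kappa>(1) by simp
qed

lemma acts_Ident: "y \<in> wd n \<Longrightarrow> acts (Ident n) y True y"
proof -
  assume "y \<in> wd n"
  have "(if y = z then 1 else 0) * F z = (if z = y then F y else 0)" for z and F :: "label list \<Rightarrow> 'k" by simp
  thus ?thesis using \<open>y \<in> wd n\<close> unfolding acts_def by (auto intro!: exI[of _ 1])
qed

lemma coacts_Ident: "x \<in> wd n \<Longrightarrow> coacts (Ident n) x True x"
proof -
  assume "x \<in> wd n"
  have "F z * (if z = x then 1 else 0) = (if z = x then F x else 0)" for z and F :: "label list \<Rightarrow> 'k" by simp
  thus ?thesis using \<open>x \<in> wd n\<close> unfolding coacts_def by (auto intro!: exI[of _ 1])
qed

lemma hh_nz: "hh a b \<noteq> 0" and uu_nz: "uu a \<noteq> 0" and aa_nz: "aa a \<noteq> 0"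
  by (auto simp: hh_def uu_def aa_def)

lemma acts_S:
  assumes "1 \<le> i" "i + 1 \<le> n" "y \<in> wd n"
  shows "acts (s_exp n i) y True (swap_at i y)"
proof -
  obtain u a b v where y: "y = u @ [a, b] @ v" "length u = i - 1"
    by (rule swap_decomp[of i y]) (use assms in \<open>auto simp: wd_def\<close>)
  have wd: "u \<in> wd (i - 1)" "a \<in> L" "b \<in> L" "v \<in> wd (n - (i + 1))"
    using assms y by (auto simp: wd_def)
  have src: "bsrc (s_exp n i :: 'k bexp) = i - 1 + (2 + (n - (i + 1)))" by (simp add: s_exp_def)
  have sw: "swap_at i y = u @ [b, a] @ v" using swap_at_decomp assms y by simp
  have "u @ [b, a] @ v \<in> wd (bsrc (s_exp n i :: 'k bexp))" using wd y src by (auto simp: wd_def)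
  thus ?thesis unfolding acts_def src sw
    using H_left[OF wd] hh_nz[of b a] y by (auto simp: s_exp_def lay_def simp del: M.simps)
qed

lemma acts_U:
  assumes "1 \<le> i" "i \<le> n + 1" "y \<in> wd (n + 2)"
  shows "acts (u_exp n i) y (pair_at (i, 0) y) (del_pair (i, 0) y)"
proof -
  obtain u a e b v where "y = u @ [a] @ e @ [b] @ v" "length u = i - 1" "length e = 0"
    by (rule word_decomp[of i 0 y]) (use assms in \<open>auto simp: wd_def\<close>)
  hence y: "y = u @ [a] @ [] @ [b] @ v" "length u = i - 1" by auto
  have wd: "u \<in> wd (i - 1)" "a \<in> L" "b \<in> L" "v \<in> wd (n + 1 - i)"
    using assms y by (auto simp: wd_def)
  have src: "bsrc (u_exp n i :: 'k bexp) = i - 1 + (0 + (n + 1 - i))" by (simp add: u_exp_def)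
  have pd: "pair_at (i, 0) y \<longleftrightarrow> b = dual a" "del_pair (i, 0) y = u @ v"
    using pair_at_decomp[of i u "[]" 0 a b v] assms y by auto
  have "u @ v \<in> wd (bsrc (u_exp n i :: 'k bexp))" using wd y src by (auto simp: wd_def)
  thus ?thesis unfolding acts_def src pd
    using U_left[OF wd] uu_nz[of a] y
    by (auto simp: u_exp_def lay_def simp del: M.simps intro!: exI[of _ "koszul (par u) \<pi> * uu a"])
qed

lemma coacts_S:
  assumes "1 \<le> i" "i + 1 \<le> n" "x \<in> wd n"
  shows "coacts (s_exp n i) x True (swap_at i x)"
proof -
  obtain u a b v where x: "x = u @ [a, b] @ v" "length u = i - 1"
    by (rule swap_decomp[of i x]) (use assms in \<open>auto simp: wd_def\<close>)
  have tgt: "btgt (s_exp n i :: 'k bexp) = n" using assms by (simp add: s_exp_def)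
  have sw: "swap_at i x = u @ [b, a] @ v" using swap_at_decomp assms x by simp
  have "F z * M (s_exp n i) z x = (if z = u @ [b, a] @ v then hh a b * F (u @ [b, a] @ v) else 0)"
    if z: "z \<in> wd n" for z F
  proof -
    obtain u' a' b' v' where z': "z = u' @ [a', b'] @ v'" "length u' = i - 1"
      by (rule swap_decomp[of i z]) (use assms z in \<open>auto simp: wd_def\<close>)
    have "M (lay (i - 1) GenH (n - (i + 1))) (u' @ [a', b'] @ v') (u @ [a, b] @ v)
      = (if u' = u \<and> v' = v then koszul (par u') (par [a', b'] + par [a, b]) * M GenH [a', b'] [a, b] else 0)"
      using x z' by (intro M_lay) auto
    moreover have "koszul (par u') (par [b, a] + par [a, b]) = (1::'k)"
      by (simp add: add.commute bit_add_self)
    ultimately have "M (lay (i - 1) GenH (n - (i + 1))) (u' @ [a', b'] @ v') (u @ [a, b] @ v)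
      = (if u' = u \<and> v' = v \<and> a' = b \<and> b' = a then hh a b else 0)"
      by (auto simp: M_gens simp del: par.simps)
    thus ?thesis unfolding z' x using z'(2) x(2) by (auto simp: s_exp_def lay_def simp del: M.simps)
  qed
  moreover have uv: "u @ [b, a] @ v \<in> wd n" using assms x by (auto simp: wd_def)
  ultimately have "(\<Sum>z\<in>wd n. F z * M (s_exp n i) z x) = (if True then hh a b * F (u @ [b, a] @ v) else 0)" for F
    by (simp cong: sum.cong)
  thus ?thesis unfolding coacts_def tgt sw using uv hh_nz by blast
qed

lemma coacts_A:
  assumes "1 \<le> i" "i \<le> n + 1" "x \<in> wd (n + 2)"
  shows "coacts (a_exp n i) x (pair_at (i, 0) x) (del_pair (i, 0) x)"
proof -
  obtain u a e b v where "x = u @ [a] @ e @ [b] @ v" "length u = i - 1" "length e = 0"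
    by (rule word_decomp[of i 0 x]) (use assms in \<open>auto simp: wd_def\<close>)
  hence x: "x = u @ [a] @ [] @ [b] @ v" "length u = i - 1" by auto
  have tgt: "btgt (a_exp n i :: 'k bexp) = n" using assms by (simp add: a_exp_def)
  have pd: "pair_at (i, 0) x \<longleftrightarrow> b = dual a" "del_pair (i, 0) x = u @ v"
    using pair_at_decomp[of i u "[]" 0 a b v] assms x by auto
  let ?\<kappa> = "koszul (par u) \<pi> * aa a"
  have "F z * M (a_exp n i) z x = (if z = u @ v then if b = dual a then ?\<kappa> * F (u @ v) else 0 else 0)"
    if z: "z \<in> wd n" for z F
  proof -
    define u' v' where "u' = take (i - 1) z" "v' = drop (i - 1) z"
    have z': "z = u' @ v'" "length u' = i - 1" using z assms by (auto simp: u'_v'_def wd_def)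
    have "M (lay (i - 1) GenA (n + 1 - i)) (u' @ [] @ v') (u @ [a, b] @ v)
      = (if u' = u \<and> v' = v then koszul (par u') (par [] + par [a, b]) * M GenA [] [a, b] else 0)"
      using x z' by (intro M_lay) auto
    also have "\<dots> = (if u' = u \<and> v' = v then if b = dual a then ?\<kappa> else 0 else 0)"
      using par_dual[of a] by (auto simp: M_gens simp del: par.simps(2))
    finally show ?thesis unfolding z' x using z'(2) x(2) by (auto simp: a_exp_def lay_def simp del: M.simps)
  qed
  moreover have uv: "u @ v \<in> wd n" using assms x by (auto simp: wd_def)
  ultimately have "(\<Sum>z\<in>wd n. F z * M (a_exp n i) z x) = (if b = dual a then ?\<kappa> * F (u @ v) else 0)" for F
    by (simp cong: sum.cong)
  thus ?thesis unfolding coacts_def tgt pd using uv aa_nz[of a] by (auto intro!: exI[of _ ?\<kappa>])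
qed

end

text \<open>The outermost crossing in \<open>I_exp\<close> moves the right end of the arc by one
  point, so swapping the labels there makes the pair one step shorter.\<close>

lemma swap_pair:
  assumes "1 \<le> p" "p + s + 2 \<le> length y"
  shows "pair_at (p, s) (swap_at (p + s + 1) y) \<longleftrightarrow> pair_at (p, Suc s) y"
    and "del_pair (p, s) (swap_at (p + s + 1) y) = del_pair (p, Suc s) y"
proof -
  obtain u c v' d w where "y = u @ [c] @ v' @ [d] @ w" "length u = p - 1" "length v' = Suc s"
    by (rule word_decomp[of p "Suc s" y]) (use assms in auto)
  moreover then obtain v e where "v' = v @ [e]" by (cases v' rule: rev_cases) auto
  ultimately have y: "y = u @ [c] @ (v @ [e]) @ [d] @ w" "length u = p - 1" "length v = s"
    by auto
  have "swap_at (p + s + 1) ((u @ [c] @ v) @ [e, d] @ w) = (u @ [c] @ v) @ [d, e] @ w"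
    by (rule swap_at_decomp) (use y assms in auto)
  hence sw: "swap_at (p + s + 1) y = u @ [c] @ v @ [d] @ (e # w)" using y by simp
  show "pair_at (p, s) (swap_at (p + s + 1) y) \<longleftrightarrow> pair_at (p, Suc s) y"
    unfolding sw unfolding y(1)
    using pair_at_decomp(1)[of p u v s c d "e # w"] pair_at_decomp(1)[of p u "v @ [e]" "Suc s" c d w] y assms
    by simp
  show "del_pair (p, s) (swap_at (p + s + 1) y) = del_pair (p, Suc s) y"
    unfolding sw unfolding y(1)
    using pair_at_decomp(2)[of p u v s c d "e # w"] pair_at_decomp(2)[of p u "v @ [e]" "Suc s" c d w] y assms
    by simp
qed

lemma I_exp_0: "I_exp n (p, 0) = u_exp n p \<circ>\<^sub>e Ident n"
  by (simp add: I_exp_def prod_exp_def)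

lemma I_exp_Suc: "I_exp n (p, Suc s) = s_exp (n + 2) (p + s + 1) \<circ>\<^sub>e I_exp n (p, s)"
  by (simp add: I_exp_def prod_exp_def)

lemma I_exp_type:
  "1 \<le> p \<Longrightarrow> p + s \<le> n + 1 \<Longrightarrow>
    bwt (I_exp n (p, s) :: 'k bexp) \<and> bsrc (I_exp n (p, s) :: 'k bexp) = n \<and> btgt (I_exp n (p, s) :: 'k bexp) = n + 2"
proof (induction s)
  case 0
  thus ?case unfolding I_exp_0 by (simp add: u_exp_def)
next
  case (Suc s)
  thus ?case unfolding I_exp_Suc by (simp add: s_exp_def)
qed

text \<open>In \<open>J_exp\<close> the crossings stand to the right of the cap, so raising
  \<open>s\<close> changes the innermost factor. The free tail \<open>t\<close> takes up the new
  crossing and makes induction on \<open>s\<close> possible.\<close>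

definition J_tail :: "nat \<Rightarrow> nat \<Rightarrow> nat \<Rightarrow> 'k bexp \<Rightarrow> 'k bexp"
  where "J_tail n p s t = foldr Comp (a_exp n p # map (s_exp (n + 2)) [p + 1..<p + s + 1]) t"

lemma J_exp_tail: "J_exp n (p, s) = J_tail n p s (Ident (n + 2))"
  by (simp add: J_exp_def prod_exp_def J_tail_def)

lemma J_tail_0: "J_tail n p 0 t = a_exp n p \<circ>\<^sub>e t"
  by (simp add: J_tail_def)

lemma J_tail_Suc: "J_tail n p (Suc s) t = J_tail n p s (s_exp (n + 2) (p + s + 1) \<circ>\<^sub>e t)"
  by (simp add: J_tail_def)

lemma J_tail_type:
  assumes "1 \<le> p" "p + s \<le> n + 1" "bwt (t :: 'k bexp)" "btgt t = n + 2"
  shows "bwt (J_tail n p s t) \<and> bsrc (J_tail n p s t) = bsrc t \<and> btgt (J_tail n p s t) = n"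
  using assms
proof (induction s arbitrary: t)
  case 0
  thus ?case unfolding J_tail_0 by (simp add: a_exp_def)
next
  case (Suc s)
  show ?case unfolding J_tail_Suc
    using Suc.IH[of "s_exp (n + 2) (p + s + 1) \<circ>\<^sub>e t"] Suc.prems by (simp add: s_exp_def)
qed

lemma J_exp_type:
  "1 \<le> p \<Longrightarrow> p + s \<le> n + 1 \<Longrightarrow>
    bwt (J_exp n (p, s) :: 'k bexp) \<and> bsrc (J_exp n (p, s) :: 'k bexp) = n + 2 \<and> btgt (J_exp n (p, s) :: 'k bexp) = n"
  unfolding J_exp_tail using J_tail_type[of p s n "Ident (n + 2) :: 'k bexp"] by simp

lemma pair_list_snoc:
  "pair_list (qs @ [q]) n \<longleftrightarrow> pair_list qs n \<and> 1 \<le> fst q \<and> fst q + snd q + 1 \<le> n - 2 * length qs"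
  by (induction qs arbitrary: n) (auto simp: algebra_simps)

lemma pairs_at_snoc: "pairs_at (qs @ [q]) y \<longleftrightarrow> pairs_at qs y \<and> pair_at q (del_pairs qs y)"
  by (induction qs arbitrary: y) auto

lemma del_pairs_snoc: "del_pairs (qs @ [q]) y = del_pair q (del_pairs qs y)"
  by (induction qs arbitrary: y) auto

lemma I_prod_type:
  "pair_list qs (r + 2 * length qs) \<Longrightarrow>
    bwt (I_prod r qs :: 'k bexp) \<and> bsrc (I_prod r qs :: 'k bexp) = r \<and> btgt (I_prod r qs :: 'k bexp) = r + 2 * length qs"
proof (induction qs)
  case (Cons q qs)
  show ?case using Cons I_exp_type[of "fst q" "snd q" "r + 2 * length qs", where 'k = 'k] by auto
qed auto

lemma J_prod_type:
  "pair_list (rev qs) (r + 2 * length qs) \<Longrightarrow>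
    bwt (J_prod r qs :: 'k bexp) \<and> bsrc (J_prod r qs :: 'k bexp) = r + 2 * length qs \<and> btgt (J_prod r qs :: 'k bexp) = r"
proof (induction qs arbitrary: r)
  case (Cons q qs)
  show ?case using Cons.IH[of "r + 2"] Cons.prems J_exp_type[of "fst q" "snd q" r, where 'k = 'k]
    by (auto simp: pair_list_snoc)
qed auto

lemma word_type:
  "set w \<subseteq> {1..<r} \<Longrightarrow> bwt (prod_exp r (map (s_exp r) w) :: 'k bexp)
    \<and> bsrc (prod_exp r (map (s_exp r) w) :: 'k bexp) = r \<and> btgt (prod_exp r (map (s_exp r) w) :: 'k bexp) = r"
  by (induction w) (auto simp: prod_exp_def s_exp_def)

lemma length_word_act [simp]: "length (word_act w y) = length y"
  by (induction w arbitrary: y) auto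

lemma word_perm_Cons: "word_perm (i # w) = transpose i (i + 1) \<circ> word_perm w"
  by (simp add: word_perm_def)

lemma word_perm_permutes: "set w \<subseteq> {1..<r} \<Longrightarrow> word_perm w permutes {1..r}"
proof (induction w)
  case Nil
  show ?case using permutes_id by (simp add: word_perm_def id_def)
next
  case (Cons i w)
  have "transpose i (i + 1) permutes {1..r}" using Cons.prems by (intro permutes_swap_id) auto
  thus ?case unfolding word_perm_Cons using Cons by (intro permutes_compose) auto
qed

lemma swap_at_nth:
  "1 \<le> i \<Longrightarrow> i + 1 \<le> length y \<Longrightarrow> 1 \<le> k \<Longrightarrow> k \<le> length y \<Longrightarrow> swap_at i y ! (k - 1) = y ! (transpose i (i + 1) k - 1)"
  by (auto simp: swap_at_def transpose_def nth_list_update)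

lemma word_act_nth:
  "set w \<subseteq> {1..<length y} \<Longrightarrow> k \<in> {1..length y} \<Longrightarrow> word_act w y ! (k - 1) = y ! (word_perm w k - 1)"
proof (induction w arbitrary: y)
  case Nil
  thus ?case by (simp add: word_perm_def)
next
  case (Cons i w)
  have "word_perm w k \<in> {1..length y}"
    using word_perm_permutes[of w "length y"] Cons.prems permutes_in_image by fastforce
  thus ?case using Cons swap_at_nth[of i y "word_perm w k"] by (simp add: word_perm_Cons)
qed

context label_model
begin

lemma swap_at_wd: "1 \<le> i \<Longrightarrow> i + 1 \<le> n \<Longrightarrow> y \<in> wd n \<Longrightarrow> swap_at i y \<in> wd n"
proof -
  assume i: "1 \<le> i" "i + 1 \<le> n" and y: "y \<in> wd n"
  have "y ! i \<in> set y" "y ! (i - 1) \<in> set y" using i y by (auto simp: wd_def)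
  thus ?thesis unfolding swap_at_def wd_def using y
    by (auto simp: wd_def dest!: set_update_subset_insert[THEN subsetD])
qed

lemma acts_I_exp:
  "1 \<le> p \<Longrightarrow> p + s \<le> n + 1 \<Longrightarrow> y \<in> wd (n + 2) \<Longrightarrow>
    acts (I_exp n (p, s)) y (pair_at (p, s) y) (del_pair (p, s) y)"
proof (induction s arbitrary: y)
  case 0
  have 1: "acts (u_exp n p) y (pair_at (p, 0) y) (del_pair (p, 0) y)" using 0 by (intro acts_U) auto
  have src: "bsrc (u_exp n p :: 'k bexp) = n" using 0 by (simp add: u_exp_def)
  have "acts (u_exp n p \<circ>\<^sub>e Ident n) y (pair_at (p, 0) y \<and> True) (del_pair (p, 0) y)"
    by (rule acts_comp[OF 1 acts_Ident]) (use 1 src in \<open>auto simp: acts_def\<close>)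
  thus ?case unfolding I_exp_0 by simp
next
  case (Suc s)
  let ?y = "swap_at (p + s + 1) y"
  have 1: "acts (s_exp (n + 2) (p + s + 1)) y True ?y" using Suc.prems by (intro acts_S) auto
  have 2: "acts (I_exp n (p, s)) ?y (pair_at (p, s) ?y) (del_pair (p, s) ?y)"
    using Suc.prems by (intro Suc.IH swap_at_wd) auto
  have "acts (s_exp (n + 2) (p + s + 1) \<circ>\<^sub>e I_exp n (p, s)) y (True \<and> pair_at (p, s) ?y) (del_pair (p, s) ?y)"
    by (rule acts_comp[OF 1 2]) (use Suc.prems I_exp_type[of p s n, where 'k = 'k] in \<open>simp add: s_exp_def\<close>)
  thus ?case unfolding I_exp_Suc using swap_pair[of p s y] Suc.prems by (simp add: wd_def)
qed

lemma coacts_J_tail: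
  "1 \<le> p \<Longrightarrow> p + s \<le> n + 1 \<Longrightarrow> coacts t x Q x' \<Longrightarrow> btgt t = n + 2 \<Longrightarrow>
    coacts (J_tail n p s t) x (Q \<and> pair_at (p, s) x') (del_pair (p, s) x')"
proof (induction s arbitrary: t x')
  case 0
  have x': "x' \<in> wd (n + 2)" if Q using 0 that by (auto simp: coacts_def)
  have "coacts (a_exp n p \<circ>\<^sub>e t) x (Q \<and> pair_at (p, 0) x') (del_pair (p, 0) x')"
    by (rule coacts_comp[OF 0(3) coacts_A]) (use 0 x' in \<open>auto simp: a_exp_def\<close>)
  thus ?case unfolding J_tail_0 .
next
  case (Suc s)
  have x': "x' \<in> wd (n + 2)" if Q using Suc.prems that by (auto simp: coacts_def)
  let ?x = "swap_at (p + s + 1) x'"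
  have "coacts (s_exp (n + 2) (p + s + 1) \<circ>\<^sub>e t) x (Q \<and> True) ?x"
    by (rule coacts_comp[OF Suc.prems(3) coacts_S]) (use Suc.prems x' in \<open>auto simp: s_exp_def\<close>)
  hence "coacts (J_tail n p s (s_exp (n + 2) (p + s + 1) \<circ>\<^sub>e t)) x (Q \<and> pair_at (p, s) ?x) (del_pair (p, s) ?x)"
    using Suc.prems by (intro Suc.IH) (auto simp: s_exp_def)
  thus ?case unfolding J_tail_Suc
    using swap_pair[of p s x'] Suc.prems x' by (cases Q) (auto simp: wd_def coacts_def)
qed

lemma del_pair_wd: "1 \<le> fst q \<Longrightarrow> fst q + snd q + 1 \<le> n \<Longrightarrow> y \<in> wd n \<Longrightarrow> del_pair q y \<in> wd (n - 2)"
  using length_del_pair[of q y]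
  by (auto simp: wd_def del_pair_def dest!: in_set_takeD in_set_dropD)

lemma acts_I_prod:
  "pair_list qs (r + 2 * length qs) \<Longrightarrow> y \<in> wd (r + 2 * length qs) \<Longrightarrow>
    acts (I_prod r qs) y (pairs_at qs y) (del_pairs qs y)"
proof (induction qs arbitrary: y)
  case Nil
  thus ?case using acts_Ident by simp
next
  case (Cons q qs)
  have 1: "acts (I_exp (r + 2 * length qs) q) y (pair_at q y) (del_pair q y)"
    using acts_I_exp[of "fst q" "snd q" "r + 2 * length qs" y] Cons.prems by simp
  have 2: "acts (I_prod r qs) (del_pair q y) (pairs_at qs (del_pair q y)) (del_pairs qs (del_pair q y))"
    using Cons del_pair_wd[of q "Suc (Suc (r + 2 * length qs))" y] by auto
  have "acts (I_exp (r + 2 * length qs) q \<circ>\<^sub>e I_prod r qs) y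
      (pair_at q y \<and> pairs_at qs (del_pair q y)) (del_pairs qs (del_pair q y))"
    by (rule acts_comp[OF 1 2])
      (use Cons.prems I_exp_type[of "fst q" "snd q" "r + 2 * length qs", where 'k = 'k]
        I_prod_type[of qs r, where 'k = 'k] in auto)
  thus ?case by simp
qed

text \<open>A source word meets the last factor of the product first, hence the reversed
  list.\<close>

lemma coacts_J_prod:
  "pair_list (rev qs) (r + 2 * length qs) \<Longrightarrow> x \<in> wd (r + 2 * length qs) \<Longrightarrow>
    coacts (J_prod r qs) x (pairs_at (rev qs) x) (del_pairs (rev qs) x)"
proof (induction qs arbitrary: r)
  case Nil
  thus ?case using coacts_Ident by simp
next
  case (Cons q qs)
  have q: "1 \<le> fst q" "fst q + snd q \<le> r + 1" using Cons.prems by (auto simp: pair_list_snoc)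
  have qs: "pair_list (rev qs) (r + 2 + 2 * length qs)" using Cons.prems by (auto simp: pair_list_snoc)
  have 1: "coacts (J_prod (r + 2) qs) x (pairs_at (rev qs) x) (del_pairs (rev qs) x)"
    using Cons qs by auto
  have 2: "coacts (J_exp r q) x' (pair_at q x') (del_pair q x')" if "x' \<in> wd (r + 2)" for x'
    using coacts_J_tail[OF q coacts_Ident[OF that]] by (cases q) (simp add: J_exp_tail)
  have "coacts (J_exp r q \<circ>\<^sub>e J_prod (r + 2) qs) x
      (pairs_at (rev qs) x \<and> pair_at q (del_pairs (rev qs) x)) (del_pair q (del_pairs (rev qs) x))"
    by (rule coacts_comp[OF 1 2])
      (use 1 q J_exp_type[of "fst q" "snd q" r, where 'k = 'k]
        J_prod_type[OF qs, where 'k = 'k] in \<open>auto simp: coacts_def\<close>)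
  thus ?case by (simp add: pairs_at_snoc del_pairs_snoc)
qed

lemma acts_word:
  "set w \<subseteq> {1..<r} \<Longrightarrow> y \<in> wd r \<Longrightarrow> acts (prod_exp r (map (s_exp r) w)) y True (word_act w y)"
proof (induction w arbitrary: y)
  case Nil
  thus ?case using acts_Ident by (simp add: prod_exp_def)
next
  case (Cons i w)
  have 1: "acts (s_exp r i) y True (swap_at i y)" using Cons.prems by (intro acts_S) auto
  have 2: "acts (prod_exp r (map (s_exp r) w)) (swap_at i y) True (word_act w (swap_at i y))"
    using Cons swap_at_wd[of i r y] by auto
  have "acts (s_exp r i \<circ>\<^sub>e prod_exp r (map (s_exp r) w)) y (True \<and> True) (word_act w (swap_at i y))"
    by (rule acts_comp[OF 1 2]) (use Cons.prems word_type[of w r, where 'k = 'k] in \<open>auto simp: s_exp_def\<close>)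
  thus ?case by (simp add: prod_exp_def)
qed

text \<open>Cups and crossings are followed along the row of \<open>y\<close>, caps along the column
  of \<open>x\<close>. The two meet in words of length \<open>r\<close>, and the entry is nonzero
  iff neither side vanishes and the two words agree.\<close>

lemma M_standard:
  assumes ds: "pair_list ds n" "n = r + 2 * length ds" and es: "pair_list es m" "m = r + 2 * length es"
    and w: "set w \<subseteq> {1..<r}" and y: "y \<in> wd n" and x: "x \<in> wd m"
  shows "M (I_prod r ds \<circ>\<^sub>e prod_exp r (map (s_exp r) w) \<circ>\<^sub>e J_prod r (rev es)) y x \<noteq> 0
    \<longleftrightarrow> pairs_at ds y \<and> pairs_at es x \<and> word_act w (del_pairs ds y) = del_pairs es x"
proof -
  let ?W = "prod_exp r (map (s_exp r) w) :: 'k bexp" and ?J = "J_prod r (rev es) :: 'k bexp"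
  have y': "del_pairs ds y \<in> wd r" if "pairs_at ds y"
    using acts_I_prod[of ds r y] that ds y I_prod_type[of ds r, where 'k = 'k] by (auto simp: acts_def)
  have J: "coacts ?J x (pairs_at es x) (del_pairs es x)"
    using coacts_J_prod[of "rev es" r x] es x by simp
  have Jt: "btgt ?J = r" "bsrc ?J = m" using J_prod_type[of "rev es" r, where 'k = 'k] es by auto
  have Wt: "btgt ?W = r" "bsrc ?W = r" using word_type[OF w, where 'k = 'k] by auto
  have It: "bsrc (I_prod r ds :: 'k bexp) = r" using I_prod_type[of ds r, where 'k = 'k] ds by auto
  have 1: "acts (I_prod r ds \<circ>\<^sub>e ?W) y (pairs_at ds y \<and> True) (word_act w (del_pairs ds y))"
    by (rule acts_comp[OF acts_I_prod acts_word]) (use ds y y' w Wt It in auto)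
  obtain \<kappa> where \<kappa>: "\<kappa> \<noteq> 0" "\<And>F. (\<Sum>z\<in>wd r. M (I_prod r ds \<circ>\<^sub>e ?W) y z * F z)
      = (if pairs_at ds y then \<kappa> * F (word_act w (del_pairs ds y)) else 0)"
    using 1 Wt by (auto simp: acts_def simp del: M.simps)
  have "M (I_prod r ds \<circ>\<^sub>e ?W \<circ>\<^sub>e ?J) y x = M ((I_prod r ds \<circ>\<^sub>e ?W) \<circ>\<^sub>e ?J) y x"
    by (rule M_comp_assoc[symmetric])
  also have "\<dots> = (if pairs_at ds y then \<kappa> * M ?J (word_act w (del_pairs ds y)) x else 0)"
    using \<kappa>(2)[of "\<lambda>z. M ?J z x"] Jt by (simp only: M.simps(8))
  also have "\<dots> \<noteq> 0 \<longleftrightarrow> pairs_at ds y \<and> M ?J (word_act w (del_pairs ds y)) x \<noteq> 0"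
    using \<kappa>(1) by simp
  also have "\<dots> \<longleftrightarrow> pairs_at ds y \<and> pairs_at es x \<and> word_act w (del_pairs ds y) = del_pairs es x"
    using coacts_M[OF J, of "word_act w (del_pairs ds y)"] 1 Wt Jt by (auto simp: acts_def simp del: M.simps)
  finally show ?thesis .
qed

lemma acts_cup: "q \<le> n \<Longrightarrow> y \<in> wd (n + 2) \<Longrightarrow> acts (cup n q) y (pair_at (1, q) y) (del_pair (1, q) y)"
proof (induction q arbitrary: y)
  case 0
  thus ?case using acts_U[of 1 n y] by (simp add: u_exp_def lay_def)
next
  case (Suc q)
  let ?y = "swap_at (1 + q + 1) y"
  have "s_exp (n + 2) (1 + q + 1) = (lay (Suc q) GenH (n - Suc q) :: 'k bexp)"
    by (simp add: s_exp_def lay_def)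
  hence 1: "acts (lay (Suc q) GenH (n - Suc q)) y True ?y"
    using acts_S[of "1 + q + 1" "n + 2" y] Suc.prems by simp
  have 2: "acts (cup n q) ?y (pair_at (1, q) ?y) (del_pair (1, q) ?y)"
    using Suc.prems by (intro Suc.IH swap_at_wd) auto
  have "acts (lay (Suc q) GenH (n - Suc q) \<circ>\<^sub>e cup n q) y (True \<and> pair_at (1, q) ?y) (del_pair (1, q) ?y)"
    by (rule acts_comp[OF 1 2]) (use Suc.prems in auto)
  thus ?case using swap_pair[of 1 q y] Suc.prems by (simp add: wd_def)
qed

lemma M_cups:
  "cup_list qs \<Longrightarrow> y \<in> wd (2 * length qs) \<Longrightarrow> M (cups qs) y [] \<noteq> 0 \<longleftrightarrow> pairs_at (map (Pair 1) qs) y"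
proof -
  assume qs: "cup_list qs" and y: "y \<in> wd (2 * length qs)"
  have "acts (cups qs) y (pairs_at (map (Pair 1) qs) y) (del_pairs (map (Pair 1) qs) y)"
    using qs y
  proof (induction qs arbitrary: y)
    case Nil
    thus ?case using acts_Ident[of "[]" 0] by simp
  next
    case (Cons q qs)
    have 1: "acts (cup (2 * length qs) q) y (pair_at (1, q) y) (del_pair (1, q) y)"
      using Cons.prems by (intro acts_cup) auto
    have "acts (cup (2 * length qs) q \<circ>\<^sub>e cups qs) y (pair_at (1, q) y \<and> pairs_at (map (Pair 1) qs) (del_pair (1, q) y))
        (del_pairs (map (Pair 1) qs) (del_pair (1, q) y))"
      by (rule acts_comp[OF 1 Cons.IH]) (use Cons.prems 1 in \<open>auto simp: acts_def\<close>)
    thus ?case by simp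
  qed
  hence "M (cups qs) y [] \<noteq> 0 \<longleftrightarrow> pairs_at (map (Pair 1) qs) y \<and> del_pairs (map (Pair 1) qs) y = []"
    by (rule acts_M) (use qs in simp)
  moreover have "pair_list (map (Pair 1) qs) (2 * length qs)"
    using qs by (induction qs) auto
  hence "del_pairs (map (Pair 1) qs) y = []" using length_del_pairs[of "map (Pair 1) qs" y] wd_length[OF y] by simp
  ultimately show ?thesis by simp
qed

text \<open>The added cup joins the last source point of \<open>t\<close> with the new last target
  point, and \<open>GenU\<close> vanishes unless their labels are dual. So only the summand with
  last source label \<open>dual c\<close> survives, with a nonzero weight.\<close>

lemma M_bend1:
  assumes t: "t \<in> bexps (Suc m) n" and y: "y \<in> wd n" and x: "x \<in> wd m" and c: "c \<in> L"
  shows "M (bend1 m t) (y @ [c]) x \<noteq> 0 \<longleftrightarrow> M t y (x @ [dual c]) \<noteq> 0"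
proof -
  have tt: "bsrc t = Suc m" "btgt t = n" using t by (auto simp: bexps_def)
  let ?\<kappa> = "koszul (par (x @ [dual c])) (par [c] + par [c]) * koszul (par x) (par [dual c, c]) * uu (dual c)"
  have *: "M (t \<otimes>\<^sub>e Ident 1) (y @ [c]) z * M (Ident m \<otimes>\<^sub>e GenU) z x
      = (if z = x @ [dual c, c] then ?\<kappa> * M t y (x @ [dual c]) else 0)"
    if "z \<in> wd (m + 2)" for z
  proof -
    obtain z1 z2 where z: "z = z1 @ z2" "z1 \<in> wd m" "z2 \<in> wd 2" using wd_split \<open>z \<in> wd (m + 2)\<close> by blast
    then obtain a b where ab: "z2 = [a, b]" using wd_expand(2) by blast
    have "M (t \<otimes>\<^sub>e Ident 1) (y @ [c]) ((z1 @ [a]) @ [b])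
        = koszul (par (z1 @ [a])) (par [c] + par [b]) * M t y (z1 @ [a]) * M (Ident 1) [c] [b]"
      by (rule M_tens) (use y z tt in \<open>auto simp: wd_def\<close>)
    moreover have "M (Ident m \<otimes>\<^sub>e GenU) (z1 @ [a, b]) (x @ [])
        = koszul (par x) (par [a, b] + par []) * M (Ident m) z1 x * M GenU [a, b] []"
      by (rule M_tens) (use x z in \<open>auto simp: wd_def\<close>)
    ultimately show ?thesis using z ab x
      by (auto simp: M_gens wd_def simp del: par.simps(2) par_append)
  qed
  have xc: "x @ [dual c, c] \<in> wd (m + 2)" using x c by (auto simp: wd_def)
  have "M (bend1 m t) (y @ [c]) x = (\<Sum>z\<in>wd (m + 2). M (t \<otimes>\<^sub>e Ident 1) (y @ [c]) z * M (Ident m \<otimes>\<^sub>e GenU) z x)"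
    by (simp add: bend1_def)
  also have "\<dots> = (\<Sum>z\<in>wd (m + 2). if z = x @ [dual c, c] then ?\<kappa> * M t y (x @ [dual c]) else 0)"
    by (rule sum.cong[OF HOL.refl *])
  also have "\<dots> = ?\<kappa> * M t y (x @ [dual c])"
    using xc by (simp del: par.simps par_append)
  finally show ?thesis using uu_nz by (simp del: par.simps par_append)
qed

lemma M_bend:
  "t \<in> bexps m n \<Longrightarrow> y \<in> wd n \<Longrightarrow> x \<in> wd m \<Longrightarrow> M (bend m t) (y @ map dual (rev x)) [] \<noteq> 0 \<longleftrightarrow> M t y x \<noteq> 0"
proof (induction m arbitrary: t n y x)
  case (Suc m)
  obtain x' c where x: "x = x' @ [c]" using Suc.prems by (cases x rule: rev_cases) auto
  hence wd: "x' \<in> wd m" "c \<in> L" using Suc.prems by (auto simp: wd_def)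
  have "M (bend m (bend1 m t)) ((y @ [dual c]) @ map dual (rev x')) [] \<noteq> 0
      \<longleftrightarrow> M (bend1 m t) (y @ [dual c]) x' \<noteq> 0"
    by (rule Suc.IH[of _ "Suc n"]) (use Suc.prems wd bend1_bexps in \<open>auto simp: wd_def\<close>)
  also have "\<dots> \<longleftrightarrow> M t y (x' @ [dual (dual c)]) \<noteq> 0"
    by (rule M_bend1) (use Suc.prems wd in auto)
  finally show ?case using x by simp
qed (auto simp: wd_def)

end

section \<open>Arcs read off from words with distinct labels\<close>

definition pairfree :: "label list \<Rightarrow> bool"
  where "pairfree y \<longleftrightarrow> (\<forall>c \<in> set y. dual c \<notin> set y)"

text \<open>If the second pair started further right, both its labels would lie to the right of
  \<open>c\<close>. Neither is \<open>dual c\<close>, since the partner of that label is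
  \<open>c\<close>, which does not occur there; so they would form a dual pair in
  \<open>v @ w\<close>.\<close>

lemma pair_not_left:
  assumes eq: "u @ [c] @ v @ [dual c] @ w = u' @ [c'] @ v' @ [dual c'] @ w'" (is "?y = ?y'")
    and "distinct (u @ [c] @ v @ [dual c] @ w)" "pairfree (v @ w)"
  shows "\<not> length u < length u'"
proof
  assume l: "length u < length u'"
  let ?z = "v @ [dual c] @ w"
  have "drop (Suc (length u)) ?y = drop (Suc (length u)) ?y'" using eq by simp
  hence zeq: "?z = drop (Suc (length u)) u' @ [c'] @ v' @ [dual c'] @ w'" using l by simp
  have z: "c' \<in> set ?z" "dual c' \<in> set ?z" unfolding zeq by simp_all
  have "c \<notin> set ?z" using assms(2) by simp
  hence "c' \<noteq> dual c" "dual c' \<noteq> dual c" using z by auto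
  hence "c' \<in> set (v @ w)" "dual c' \<in> set (v @ w)" using z by auto
  thus False using assms(3) by (auto simp: pairfree_def)
qed

lemma left_pair_unique:
  assumes eq: "u @ [c] @ v @ [dual c] @ w = u' @ [c'] @ v' @ [dual c'] @ w'" (is "?y = ?y'")
    and d: "distinct (u @ [c] @ v @ [dual c] @ w)" and "pairfree (v @ w)" "pairfree (v' @ w')"
  shows "u = u' \<and> c = c' \<and> v = v' \<and> w = w'"
proof -
  have "length u = length u'"
    using pair_not_left[OF eq] pair_not_left[OF eq[symmetric]] d assms(3,4) unfolding eq by (metis linorder_neqE_nat)
  hence 1: "u = u'" "c = c'" "v @ dual c # w = v' @ dual c # w'" using eq by auto
  have "dual c \<notin> set v" "dual c \<notin> set w" using d by auto
  hence "v = v' \<and> w = w'" using 1(3) by (auto simp: append_Cons_eq_iff)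
  thus ?thesis using 1 by simp
qed

lemma pair_list_decomp:
  assumes "1 \<le> fst q" "fst q + snd q + 1 \<le> length y" "pair_at q y"
  obtains u c v w where "y = u @ [c] @ v @ [dual c] @ w" "length u = fst q - 1" "length v = snd q"
    "del_pair q y = u @ v @ w"
proof -
  obtain u c v d w where y: "y = u @ [c] @ v @ [d] @ w" "length u = fst q - 1" "length v = snd q"
    by (rule word_decomp[of "fst q" "snd q" y]) (use assms in auto)
  moreover have "d = dual c" "del_pair q y = u @ v @ w"
    using pair_at_decomp[of "fst q" u v "snd q" c d w] y assms by auto
  ultimately show ?thesis using that by blast
qed

text \<open>Left ends decrease along the list, so \<open>q\<close> has the rightmost one. By
  induction no dual pair lies to the right of the left end of the next pair once its own labels are
  removed, and that region contains what is to the right of \<open>q\<close>.\<close>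

lemma leftmost_pair:
  assumes "pair_list (q # qs) (length y)" "sorted_wrt (>) (map fst (q # qs))" "distinct y"
    "pairs_at (q # qs) y" "pairfree (del_pairs (q # qs) y)"
  shows "\<exists>u c v w. y = u @ [c] @ v @ [dual c] @ w \<and> length u = fst q - 1 \<and> length v = snd q
    \<and> del_pair q y = u @ v @ w \<and> pairfree (v @ w)"
  using assms
proof (induction qs arbitrary: q y)
  case Nil
  obtain u c v w where "y = u @ [c] @ v @ [dual c] @ w" "length u = fst q - 1" "length v = snd q"
    "del_pair q y = u @ v @ w"
    by (rule pair_list_decomp[of q y]) (use Nil in auto)
  moreover hence "pairfree (v @ w)" using Nil by (auto simp: pairfree_def)
  ultimately show ?case by blast
next
  case (Cons q2 qs)
  obtain u c v w where y: "y = u @ [c] @ v @ [dual c] @ w" "length u = fst q - 1" "length v = snd q"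
    "del_pair q y = u @ v @ w"
    by (rule pair_list_decomp[of q y]) (use Cons.prems in auto)
  let ?y = "u @ v @ w"
  have "\<exists>u2 c2 v2 w2. ?y = u2 @ [c2] @ v2 @ [dual c2] @ w2 \<and> length u2 = fst q2 - 1
      \<and> length v2 = snd q2 \<and> del_pair q2 ?y = u2 @ v2 @ w2 \<and> pairfree (v2 @ w2)"
  proof (rule Cons.IH)
    have "length ?y = length y - 2" using y(1) by simp
    moreover have "pair_list (q2 # qs) (length y - 2)" using Cons.prems(1) by simp
    ultimately show "pair_list (q2 # qs) (length ?y)" by metis
  qed (use Cons.prems y in auto)
  then obtain u2 c2 v2 w2 where y2: "?y = u2 @ [c2] @ v2 @ [dual c2] @ w2" "length u2 = fst q2 - 1"
    "pairfree (v2 @ w2)" by blast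
  have "length u2 < length u" using Cons.prems y y2 by auto
  then obtain k where "length u = Suc (length u2 + k)" using less_iff_Suc_add by auto
  hence "drop (length u) ?y = drop k (v2 @ [dual c2] @ w2)" unfolding y2(1) by simp
  \<comment> \<open>The next pair starts further left, so what follows its left end includes
    everything that followed the left end of \<open>q\<close>.\<close>
  hence sub: "set (v @ w) \<subseteq> set (v2 @ [dual c2] @ w2)"
    using set_drop_subset[of k "v2 @ [dual c2] @ w2"] by simp
  have "distinct ?y" using Cons.prems(3) y by auto
  hence c2: "c2 \<notin> set (v @ w)" using sub unfolding y2(1) by auto
  have "dual d \<notin> set (v @ w)" if d: "d \<in> set (v @ w)" for d
  proof
    assume dd: "dual d \<in> set (v @ w)"
    hence "d \<noteq> dual c2" "dual d \<noteq> dual c2" using c2 d by auto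
    hence "d \<in> set (v2 @ w2)" "dual d \<in> set (v2 @ w2)" using d dd sub by auto
    thus False using y2(3) by (auto simp: pairfree_def)
  qed
  hence "pairfree (v @ w)" by (simp add: pairfree_def)
  thus ?case using y by blast
qed

lemma distinct_del_pair:
  assumes "pair_list (q # qs) (length y)" "pair_at q y" "distinct y"
  shows "distinct (del_pair q y)" "length (del_pair q y) = length y - 2"
proof -
  obtain u c v w where "y = u @ [c] @ v @ [dual c] @ w" "del_pair q y = u @ v @ w"
    by (rule pair_list_decomp[of q y]) (use assms in auto)
  thus "distinct (del_pair q y)" "length (del_pair q y) = length y - 2" using assms by auto
qed

text \<open>Both lists must begin with the pair whose left end is rightmost, and this pair is
  determined by the word; after deleting it the rest agrees by induction.\<close>

lemma pairs_unique:
  assumes "distinct y"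
    and "pair_list qs (length y)" "sorted_wrt (>) (map fst qs)" "pairs_at qs y" "pairfree (del_pairs qs y)"
    and "pair_list es (length y)" "sorted_wrt (>) (map fst es)" "pairs_at es y" "pairfree (del_pairs es y)"
  shows "qs = es"
  using assms
proof (induction qs arbitrary: es y)
  case Nil
  show ?case
  proof (cases es)
    case (Cons e es')
    obtain u c v w where "y = u @ [c] @ v @ [dual c] @ w"
      using leftmost_pair[of e es' y] Nil Cons by blast
    thus ?thesis using Nil by (auto simp: pairfree_def)
  qed simp
next
  case (Cons q qs)
  obtain u c v w where y: "y = u @ [c] @ v @ [dual c] @ w" "length u = fst q - 1" "length v = snd q"
    "del_pair q y = u @ v @ w" "pairfree (v @ w)" using leftmost_pair[of q qs y] Cons.prems by blast
  show ?case
  proof (cases es)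
    case Nil
    thus ?thesis using Cons.prems y by (auto simp: pairfree_def)
  next
    case e: (Cons e es')
    obtain u' c' v' w' where y': "y = u' @ [c'] @ v' @ [dual c'] @ w'" "length u' = fst e - 1" "length v' = snd e"
      "del_pair e y = u' @ v' @ w'" "pairfree (v' @ w')" using leftmost_pair[of e es' y] Cons.prems e by blast
    have "u = u' \<and> c = c' \<and> v = v' \<and> w = w'"
      by (rule left_pair_unique) (use y y' Cons.prems(1) in auto)
    moreover have "1 \<le> fst q" "1 \<le> fst e" using Cons.prems e by auto
    ultimately have qe: "q = e" using y(2,3) y'(2,3) by (simp add: prod_eq_iff)
    have "qs = es'"
      by (rule Cons.IH[of "del_pair q y"])
        (use Cons.prems e qe distinct_del_pair[of q qs y] in auto)
    thus ?thesis using qe e by simp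
  qed
qed

lemma split_pair:
  assumes "d \<in> set l" "dual d \<in> set l"
  shows "\<exists>r1 a r2 r3. l = r1 @ [a] @ r2 @ [dual a] @ r3"
proof -
  obtain x z where l: "l = x @ d # z" using assms split_list by metis
  consider "dual d \<in> set z" | "dual d \<in> set x" using assms l by auto
  thus ?thesis
  proof cases
    case 1
    then obtain r2 r3 where "z = r2 @ dual d # r3" using split_list by metis
    hence "l = x @ [d] @ r2 @ [dual d] @ r3" using l by simp
    thus ?thesis by blast
  next
    case 2
    then obtain r1 r2 where "x = r1 @ dual d # r2" using split_list by metis
    hence "l = r1 @ [dual d] @ r2 @ [dual (dual d)] @ z" using l by simp
    thus ?thesis by blast
  qed
qed

text \<open>Always removing the dual pair with the rightmost left end produces decreasing left
  ends.\<close>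

lemma pairs_exist:
  "distinct y \<Longrightarrow> \<exists>qs. pair_list qs (length y) \<and> sorted_wrt (>) (map fst qs) \<and> pairs_at qs y
    \<and> pairfree (del_pairs qs y)"
proof (induction y rule: length_induct)
  case (1 y)
  show ?case
  proof (cases "pairfree y")
    case True
    thus ?thesis by (intro exI[of _ "[]"]) simp
  next
    case False
    \<comment> \<open>\<open>P\<close> holds of the left ends of dual pairs in \<open>y\<close>,
      counted from 0; its greatest element gives the first pair of the list.\<close>
    define P where "P k \<longleftrightarrow> (\<exists>u c v w. y = u @ [c] @ v @ [dual c] @ w \<and> length u = k)" for k
    have "\<exists>k. P k" using False split_pair unfolding P_def pairfree_def by metis
    moreover have bd: "k \<le> length y" if "P k" for k using that by (auto simp: P_def)
    ultimately have "P (Greatest P)" using GreatestI_nat[of P] by blast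
    then obtain u c v w where y: "y = u @ [c] @ v @ [dual c] @ w" and u: "length u = Greatest P"
      by (auto simp: P_def)
    have max: "k \<le> length u" if "P k" for k using Greatest_le_nat[of P k "length y"] that bd u by simp
    have pf: "pairfree (v @ w)"
    proof (rule ccontr)
      assume "\<not> pairfree (v @ w)"
      then obtain d where "d \<in> set (v @ w)" "dual d \<in> set (v @ w)" by (auto simp: pairfree_def)
      hence "d \<in> set (v @ [dual c] @ w)" "dual d \<in> set (v @ [dual c] @ w)" by auto
      then obtain r1 a r2 r3 where "v @ [dual c] @ w = r1 @ [a] @ r2 @ [dual a] @ r3"
        using split_pair by blast
      hence "y = (u @ [c] @ r1) @ [a] @ r2 @ [dual a] @ r3" using y by simp
      hence "P (length (u @ [c] @ r1))" unfolding P_def by blast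
      thus False using max by fastforce
    qed
    let ?y = "u @ v @ w" and ?q = "(Suc (length u), length v)"
    have "length ?y < length y" "distinct ?y" using y 1(2) by auto
    then obtain qs where qs: "pair_list qs (length ?y)" "sorted_wrt (>) (map fst qs)" "pairs_at qs ?y"
      "pairfree (del_pairs qs ?y)" using 1(1) by blast
    have del: "pair_at ?q y" "del_pair ?q y = ?y"
      using pair_at_decomp[of "Suc (length u)" u v "length v" c "dual c" w] y by auto
    \<comment> \<open>No dual pair lies in \<open>v @ w\<close>, so every later pair must start
      within \<open>u\<close>.\<close>
    have "fst q < Suc (length u)" if q: "q \<in> set qs" for q
    proof -
      obtain q2 qs' where q2: "qs = q2 # qs'" using q by (cases qs) auto
      obtain u2 c2 v2 w2 where y2: "?y = u2 @ [c2] @ v2 @ [dual c2] @ w2" "length u2 = fst q2 - 1"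
        using leftmost_pair[of q2 qs' ?y] qs q2 \<open>distinct ?y\<close> by blast
      have "length u2 < length u"
      proof (rule ccontr)
        assume "\<not> length u2 < length u"
        hence "drop (length u) ?y = drop (length u) u2 @ [c2] @ v2 @ [dual c2] @ w2" unfolding y2(1) by simp
        hence vw: "v @ w = drop (length u) u2 @ [c2] @ v2 @ [dual c2] @ w2" by simp
        have "c2 \<in> set (v @ w)" "dual c2 \<in> set (v @ w)" unfolding vw by simp_all
        thus False using pf by (auto simp: pairfree_def)
      qed
      hence "fst q2 \<le> length u" using y2 by simp
      moreover have "fst q \<le> fst q2" using qs(2) q q2 by auto
      ultimately show ?thesis by simp
    qed
    hence "sorted_wrt (>) (map fst (?q # qs))" using qs(2) by auto
    moreover have "pair_list (?q # qs) (length y)" using qs(1) y by simp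
    moreover have "pairs_at (?q # qs) y" "pairfree (del_pairs (?q # qs) y)" using qs del by auto
    ultimately show ?thesis by blast
  qed
qed

lemma del_pairs_props:
  assumes "pair_list qs (length y)" "distinct y" "pairs_at qs y"
  shows "distinct (del_pairs qs y)" "set (del_pairs qs y) \<subseteq> set y"
    and "c \<in> set y \<Longrightarrow> c \<notin> set (del_pairs qs y) \<Longrightarrow> dual c \<in> set y \<and> dual c \<notin> set (del_pairs qs y)"
proof -
  have "distinct (del_pairs qs y) \<and> set (del_pairs qs y) \<subseteq> set y
    \<and> (\<forall>c \<in> set y. c \<notin> set (del_pairs qs y) \<longrightarrow> dual c \<in> set y \<and> dual c \<notin> set (del_pairs qs y))"
    using assms
  proof (induction qs arbitrary: y)
    case (Cons q qs)
    obtain u c v w where y: "y = u @ [c] @ v @ [dual c] @ w" "del_pair q y = u @ v @ w"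
      by (rule pair_list_decomp[of q y]) (use Cons.prems in auto)
    let ?y = "u @ v @ w"
    have IH: "distinct (del_pairs qs ?y) \<and> set (del_pairs qs ?y) \<subseteq> set ?y
      \<and> (\<forall>c \<in> set ?y. c \<notin> set (del_pairs qs ?y) \<longrightarrow> dual c \<in> set ?y \<and> dual c \<notin> set (del_pairs qs ?y))"
    proof (rule Cons.IH)
      have "length ?y = length y - 2" using y(1) by simp
      moreover have "pair_list qs (length y - 2)" using Cons.prems(1) by simp
      ultimately show "pair_list qs (length ?y)" by metis
      show "distinct ?y" using Cons.prems(2) y(1) by simp
      show "pairs_at qs ?y" using Cons.prems(3) y(2) by simp
    qed
    have c: "c \<notin> set ?y" "dual c \<notin> set ?y" using Cons.prems(2) unfolding y(1) by simp_all
    have sy: "set y = {c, dual c} \<union> set ?y" unfolding y(1) by auto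
    have sub: "set (del_pairs qs ?y) \<subseteq> set ?y" using IH by simp
    have "dual d \<in> set y \<and> dual d \<notin> set (del_pairs qs ?y)"
      if d: "d \<in> set y" "d \<notin> set (del_pairs qs ?y)" for d
    proof (cases "d \<in> set ?y")
      case True
      hence "dual d \<in> set ?y \<and> dual d \<notin> set (del_pairs qs ?y)" using IH d(2) by simp
      thus ?thesis unfolding sy by blast
    next
      case False
      hence "d = c \<or> d = dual c" using d(1) unfolding sy by blast
      hence dd: "dual d = c \<or> dual d = dual c" by auto
      hence "dual d \<notin> set ?y" using c by metis
      thus ?thesis using dd sub unfolding sy by blast
    qed
    moreover have "set (del_pairs qs ?y) \<subseteq> set y" using sub unfolding sy by blast
    ultimately show ?case using IH unfolding del_pairs.simps y(2) by simp
  qed auto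
  thus "distinct (del_pairs qs y)" "set (del_pairs qs y) \<subseteq> set y"
    "c \<in> set y \<Longrightarrow> c \<notin> set (del_pairs qs y) \<Longrightarrow> dual c \<in> set y \<and> dual c \<notin> set (del_pairs qs y)"
    by simp_all
qed

text \<open>The converse of deleting pairs. Every admissible list is realised by a word with
  distinct labels, the inserted pairs being numbered from \<open>K\<close> on so that they are
  fresh.\<close>

lemma insert_pairs:
  assumes "pair_list qs (r + 2 * length qs)" "length y' = r" "distinct y'" "\<forall>c \<in> set y'. fst c < K"
  shows "\<exists>y. length y = r + 2 * length qs \<and> pairs_at qs y \<and> del_pairs qs y = y' \<and> distinct y
    \<and> set y = set y' \<union> {c. K \<le> fst c \<and> fst c < K + length qs}"
  using assms(1)
proof (induction qs)
  case Nil
  thus ?case using assms by auto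
next
  case (Cons q qs)
  then obtain y1 where y1: "length y1 = r + 2 * length qs" "pairs_at qs y1" "del_pairs qs y1 = y'" "distinct y1"
    "set y1 = set y' \<union> {c. K \<le> fst c \<and> fst c < K + length qs}" by auto
  define c :: label where "c = (K + length qs, False)"
  define u v w where "u = take (fst q - 1) y1" and "v = take (snd q) (drop (fst q - 1) y1)"
    and "w = drop (snd q) (drop (fst q - 1) y1)"
  have uvw: "y1 = u @ v @ w" unfolding u_def v_def w_def by (simp only: append_take_drop_id)
  have q: "1 \<le> fst q" "fst q + snd q \<le> length y1 + 1" using Cons.prems y1(1) by auto
  hence len: "length u = fst q - 1" "length v = snd q" by (auto simp: u_def v_def)
  let ?y = "u @ [c] @ v @ [dual c] @ w"
  have del: "pair_at q ?y" "del_pair q ?y = y1"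
    using pair_at_decomp[of "fst q" u v "snd q" c "dual c" w] q len uvw by auto
  have c: "c \<notin> set y1" "dual c \<notin> set y1"
    using y1(5) assms(4) by (auto simp: c_def)
  have "{d. K \<le> fst d \<and> fst d < K + length (q # qs)} = {d. K \<le> fst d \<and> fst d < K + length qs} \<union> {c, dual c}"
    by (auto simp: c_def prod_eq_iff less_Suc_eq)
  hence "set ?y = set y' \<union> {d. K \<le> fst d \<and> fst d < K + length (q # qs)}"
    using y1(5) uvw by auto
  moreover have "distinct ?y" using c y1(4) uvw by auto
  moreover have "length ?y = r + 2 * length (q # qs)" using y1(1) uvw by simp
  ultimately show ?case using del y1 by (intro exI[of _ ?y]) auto
qed

lemma pair_list_nth:
  "pair_list qs n \<longleftrightarrow> (\<forall>j < length qs. 1 \<le> fst (qs ! j) \<and> fst (qs ! j) + snd (qs ! j) + 1 \<le> n - 2 * j)"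
proof (induction qs arbitrary: n)
  case (Cons q qs)
  show ?case by (simp add: Cons.IH All_less_Suc2)
qed simp

lemma pair_list_nth':
  "n = r + 2 * length qs \<Longrightarrow> pair_list qs n \<longleftrightarrow>
    (\<forall>j < length qs. 1 \<le> fst (qs ! j) \<and> fst (qs ! j) + snd (qs ! j) \<le> (n - 2 - 2 * j) + 1)"
  unfolding pair_list_nth by (intro all_cong) auto

lemma I_set_eq:
  "I_set r n = {I_prod r qs | qs. n = r + 2 * length qs \<and> pair_list qs n \<and> sorted_wrt (>) (map fst qs)}"
  unfolding I_set_def using pair_list_nth' by blast

lemma pair_list_rev:
  assumes "n = r + 2 * length qs"
  shows "pair_list (rev qs) n \<longleftrightarrow>
    (\<forall>j < length qs. 1 \<le> fst (qs ! j) \<and> fst (qs ! j) + snd (qs ! j) \<le> (r + 2 * j) + 1)"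
    (is "_ \<longleftrightarrow> (\<forall>j < _. ?P j)")
proof -
  have eq: "1 \<le> fst (rev qs ! j) \<and> fst (rev qs ! j) + snd (rev qs ! j) + 1 \<le> n - 2 * j \<longleftrightarrow> ?P (length qs - Suc j)"
    if "j < length qs" for j
    using that assms by (auto simp: rev_nth)
  have "pair_list (rev qs) n \<longleftrightarrow> (\<forall>j < length qs. ?P (length qs - Suc j))"
    unfolding pair_list_nth using eq by auto
  also have "\<dots> \<longleftrightarrow> (\<forall>j < length qs. ?P j)"
  proof (intro iffI allI impI)
    fix j assume *: "\<forall>j < length qs. ?P (length qs - Suc j)" and j: "j < length qs"
    have "?P (length qs - Suc (length qs - Suc j))" using * j by (metis diff_Suc_less length_greater_0_conv list.size(3) not_less0)
    thus "?P j" using j by simp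
  next
    fix j assume *: "\<forall>j < length qs. ?P j" and "j < length qs"
    thus "?P (length qs - Suc j)" by (metis diff_Suc_less length_greater_0_conv list.size(3) not_less0)
  qed
  finally show ?thesis .
qed

text \<open>In \<open>J_set\<close> left ends and superscripts grow along the list; read backwards
  it obeys the conditions of \<open>I_set\<close>, so \<open>pair_list\<close> describes cups and
  caps alike.\<close>

lemma J_set_eq:
  "J_set n r = {J_prod r (rev qs) | qs. n = r + 2 * length qs \<and> pair_list qs n \<and> sorted_wrt (>) (map fst qs)}"
proof -
  have s: "sorted_wrt (<) (map fst qs) \<longleftrightarrow> sorted_wrt (>) (map fst (rev qs))" for qs :: "(nat \<times> nat) list"
    by (simp add: rev_map[symmetric] sorted_wrt_rev)
  have "J_set n r = {J_prod r qs | qs. n = r + 2 * length qs \<and> pair_list (rev qs) n \<and> sorted_wrt (>) (map fst (rev qs))}"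
    unfolding J_set_def s using pair_list_rev by blast
  also have "\<dots> = {J_prod r (rev qs) | qs. n = r + 2 * length qs \<and> pair_list qs n \<and> sorted_wrt (>) (map fst qs)}"
    (is "?A = ?B")
  proof (intro Set.set_eqI iffI)
    fix t assume "t \<in> ?A"
    then obtain qs where "t = J_prod r qs \<and> n = r + 2 * length qs \<and> pair_list (rev qs) n
      \<and> sorted_wrt (>) (map fst (rev qs))" by blast
    thus "t \<in> ?B" by (intro CollectI exI[of _ "rev qs"]) auto
  next
    fix t assume "t \<in> ?B"
    then obtain qs where "t = J_prod r (rev qs) \<and> n = r + 2 * length qs \<and> pair_list qs n
      \<and> sorted_wrt (>) (map fst qs)" by blast
    thus "t \<in> ?A" by (intro CollectI exI[of _ "rev qs"]) auto
  qed
  finally show ?thesis .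
qed

definition is_index ::
    "(nat \<Rightarrow> nat list set) \<Rightarrow> nat \<Rightarrow> nat \<Rightarrow> nat \<times> (nat \<times> nat) list \<times> nat list \<times> (nat \<times> nat) list \<Rightarrow> bool"
  where "is_index W m n = (\<lambda>(r, ds, w, es).
    n = r + 2 * length ds \<and> pair_list ds n \<and> sorted_wrt (>) (map fst ds) \<and> w \<in> W r
    \<and> m = r + 2 * length es \<and> pair_list es m \<and> sorted_wrt (>) (map fst es))"

definition std_exp :: "nat \<times> (nat \<times> nat) list \<times> nat list \<times> (nat \<times> nat) list \<Rightarrow> 'k bexp"
  where "std_exp = (\<lambda>(r, ds, w, es).
    I_prod r ds \<circ>\<^sub>e prod_exp r (map (s_exp r) w) \<circ>\<^sub>e J_prod r (rev es))"

lemma standard_exps_eq: "standard_exps W m n = std_exp ` {i. is_index W m n i}"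
  unfolding standard_exps_def I_set_eq J_set_eq std_exp_def is_index_def
  by (auto simp: image_def; blast)

lemma set_swap_at: "1 \<le> i \<Longrightarrow> i < length y \<Longrightarrow> set (swap_at i y) = set y"
  unfolding swap_at_def by (rule set_swap) auto

lemma set_word_act: "set w \<subseteq> {1..<length y} \<Longrightarrow> set (word_act w y) = set y"
  by (induction w arbitrary: y) (auto simp: set_swap_at)

lemma distinct_swap_at: "1 \<le> i \<Longrightarrow> i < length y \<Longrightarrow> distinct (swap_at i y) = distinct y"
  unfolding swap_at_def by (rule distinct_swap) auto

lemma distinct_word_act: "set w \<subseteq> {1..<length y} \<Longrightarrow> distinct (word_act w y) = distinct y"
  by (induction w arbitrary: y) (auto simp: distinct_swap_at)

locale word_system =
  fixes W :: "nat \<Rightarrow> nat list set"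
  assumes W: "word_choice W"
begin

lemma W_set: "w \<in> W r \<Longrightarrow> set w \<subseteq> {1..<r}"
  using W by (auto simp: word_choice_def reduced_word_def)

text \<open>On a word with distinct labels the action determines the permutation, and
  \<open>W\<close> contains exactly one word for each permutation.\<close>

lemma W_unique:
  assumes "w \<in> W (length y)" "w' \<in> W (length y)" "distinct y" "word_act w y = word_act w' y"
  shows "w = w'"
proof -
  let ?r = "length y"
  have p: "word_perm w permutes {1..?r}" "word_perm w' permutes {1..?r}"
    using assms W_set word_perm_permutes by blast+
  have "word_perm w k = word_perm w' k" for k
  proof (cases "k \<in> {1..?r}")
    case True
    have in1: "word_perm w k \<in> {1..?r}" "word_perm w' k \<in> {1..?r}"
      using p True permutes_in_image by metis+
    have "y ! (word_perm w k - 1) = y ! (word_perm w' k - 1)"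
      using word_act_nth[of w y k] word_act_nth[of w' y k] assms W_set True by metis
    hence "word_perm w k - 1 = word_perm w' k - 1"
      using assms(3) in1 by (subst (asm) nth_eq_iff_index_eq) auto
    thus ?thesis using in1 by auto
  next
    case False
    thus ?thesis using p by (simp add: permutes_def)
  qed
  hence "word_perm w = word_perm w'" by auto
  moreover have "\<exists>!v. v \<in> W ?r \<and> word_perm v = word_perm w" using W p(1) by (auto simp: word_choice_def)
  ultimately show ?thesis using assms by auto
qed

lemma W_exists:
  assumes "distinct y" "distinct x" "set y = set x"
  shows "\<exists>w \<in> W (length y). word_act w y = x"
proof -
  let ?r = "length y"
  have len: "length x = ?r" using assms by (metis distinct_card)
  have "\<exists>j. j < ?r \<and> y ! j = x ! i" if "i < ?r" for i
    using that assms(3) len by (metis in_set_conv_nth)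
  then obtain g where g: "\<And>i. i < ?r \<Longrightarrow> g i < ?r \<and> y ! g i = x ! i" by metis
  define \<sigma> where "\<sigma> k = (if k \<in> {1..?r} then g (k - 1) + 1 else k)" for k
  have inj: "inj_on \<sigma> {1..?r}"
  proof (rule inj_onI)
    fix j k assume jk: "j \<in> {1..?r}" "k \<in> {1..?r}" "\<sigma> j = \<sigma> k"
    hence "x ! (j - 1) = x ! (k - 1)" using g[of "j - 1"] g[of "k - 1"] by (auto simp: \<sigma>_def)
    hence "j - 1 = k - 1" using assms(2) jk len by (subst (asm) nth_eq_iff_index_eq) auto
    thus "j = k" using jk by auto
  qed
  have "\<sigma> k \<in> {1..?r}" if "k \<in> {1..?r}" for k
    using g[of "k - 1"] that by (auto simp: \<sigma>_def Suc_le_eq)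
  hence "\<sigma> ` {1..?r} \<subseteq> {1..?r}" by blast
  hence "bij_betw \<sigma> {1..?r} {1..?r}"
    using inj endo_inj_surj[of "{1..?r}" \<sigma>] by (auto simp: bij_betw_def)
  hence "\<sigma> permutes {1..?r}" by (rule bij_imp_permutes) (auto simp: \<sigma>_def)
  then obtain w where w: "w \<in> W ?r" "word_perm w = \<sigma>" using W by (auto simp: word_choice_def) metis
  have "word_act w y ! i = x ! i" if "i < ?r" for i
    using word_act_nth[of w y "Suc i"] W_set[OF w(1)] w(2) g[OF that] that by (simp add: \<sigma>_def)
  hence "word_act w y = x" using len by (intro nth_equalityI) auto
  thus ?thesis using w by blast
qed

end

section \<open>Generic words detect single standard expressions\<close>

locale model_words = label_model \<epsilon> lam sig e N + word_system W
  for \<epsilon> lam sig e :: "'k::field" and N and W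
begin

text \<open>The word obtained by bending \<open>x\<close> to the target carries each label at most
  once, so that dual labels determine the arcs of a diagram.\<close>

definition generic :: "nat \<Rightarrow> nat \<Rightarrow> label list \<Rightarrow> label list \<Rightarrow> bool"
  where "generic m n y x \<longleftrightarrow> y \<in> wd n \<and> x \<in> wd m \<and> distinct (y @ map dual (rev x))"

lemma M_std:
  assumes "is_index W m n (r, ds, w, es)" "y \<in> wd n" "x \<in> wd m"
  shows "M (std_exp (r, ds, w, es)) y x \<noteq> 0
    \<longleftrightarrow> pairs_at ds y \<and> pairs_at es x \<and> word_act w (del_pairs ds y) = del_pairs es x"
  unfolding std_exp_def prod.case
  by (rule M_standard) (use assms W_set in \<open>auto simp: is_index_def\<close>)

text \<open>The words left over by \<open>ds\<close> and \<open>es\<close> carry the same labels. A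
  dual pair among them would give a label that occurs both in \<open>y\<close> and among the duals
  of \<open>x\<close>, which genericity excludes; so the leftovers are free of pairs, and
  \<open>pairs_unique\<close> and \<open>W_unique\<close> apply.\<close>

lemma index_unique:
  assumes g: "generic m n y x" and i: "is_index W m n i" "M (std_exp i) y x \<noteq> 0"
    and j: "is_index W m n j" "M (std_exp j) y x \<noteq> 0"
  shows "i = j"
proof -
  have y: "y \<in> wd n" "length y = n" "distinct y" and x: "x \<in> wd m" "length x = m" "distinct x"
    and d: "distinct (y @ map dual (rev x))"
    using g by (auto simp: generic_def wd_def distinct_map)
  have key: "pairfree (del_pairs ds y) \<and> pairfree (del_pairs es x) \<and> w \<in> W (length (del_pairs ds y))
      \<and> r = length (del_pairs ds y) \<and> pairs_at ds y \<and> pairs_at es x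
      \<and> word_act w (del_pairs ds y) = del_pairs es x \<and> distinct (del_pairs ds y)"
    if ind: "is_index W m n (r, ds, w, es)" and M: "M (std_exp (r, ds, w, es)) y x \<noteq> 0" for r ds w es
  proof -
    have at: "pairs_at ds y" "pairs_at es x" "word_act w (del_pairs ds y) = del_pairs es x"
      using M_std[OF ind y(1) x(1)] M by auto
    have pl: "pair_list ds (length y)" "pair_list es (length x)" using ind y x by (auto simp: is_index_def)
    have r: "r = length (del_pairs ds y)" using length_del_pairs[OF pl(1)] ind y by (auto simp: is_index_def)
    have w: "w \<in> W (length (del_pairs ds y))" using ind r by (simp add: is_index_def)
    have set: "set (del_pairs ds y) = set (del_pairs es x)"
      using set_word_act[OF W_set[OF w]] at(3) by simp
    note sub = del_pairs_props(2)[OF pl(1) y(3) at(1)] del_pairs_props(2)[OF pl(2) x(3) at(2)]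
    have "dual c \<notin> set (del_pairs ds y)" if "c \<in> set (del_pairs ds y)" for c
    proof
      assume "dual c \<in> set (del_pairs ds y)"
      hence "dual c \<in> set y" "dual c \<in> dual ` set x" using that sub set by auto
      thus False using d by auto
    qed
    hence "pairfree (del_pairs ds y)" by (simp add: pairfree_def)
    moreover from this have "pairfree (del_pairs es x)" using set by (simp add: pairfree_def)
    ultimately show ?thesis using at r w del_pairs_props(1)[OF pl(1) y(3) at(1)] by blast
  qed
  obtain r ds w es where i': "i = (r, ds, w, es)" by (cases i) auto
  obtain r' ds' w' es' where j': "j = (r', ds', w', es')" by (cases j) auto
  note k = key[OF i[unfolded i']] key[OF j[unfolded j']]
  have ds: "ds = ds'"
    by (rule pairs_unique[OF y(3)]) (use k i j i' j' y in \<open>auto simp: is_index_def\<close>)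
  have es: "es = es'"
    by (rule pairs_unique[OF x(3)]) (use k i j i' j' x in \<open>auto simp: is_index_def\<close>)
  have "w = w'" by (rule W_unique[of _ "del_pairs ds y"]) (use k ds es in auto)
  thus ?thesis using ds es k i' j' by auto
qed

text \<open>A label left over in \<open>y\<close> has no partner in \<open>y\<close>, so its dual
  comes from bending \<open>x\<close>, which puts the label itself into \<open>x\<close>; there it
  has no partner either. The converse is similar, so both leftovers carry the same labels and a word
  in \<open>W\<close> matches them.\<close>

lemma index_exists:
  assumes g: "generic m n y x" and closed: "\<forall>c \<in> set (y @ map dual (rev x)). dual c \<in> set (y @ map dual (rev x))"
  shows "\<exists>i. is_index W m n i \<and> M (std_exp i) y x \<noteq> 0"
proof -
  have y: "y \<in> wd n" "length y = n" "distinct y" and x: "x \<in> wd m" "length x = m" "distinct x"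
    and d: "distinct (y @ map dual (rev x))"
    using g by (auto simp: generic_def wd_def distinct_map)
  have disj: "c \<in> set y \<Longrightarrow> c \<notin> dual ` set x" for c using d by auto
  have cl: "dual c \<in> set y \<or> dual c \<in> dual ` set x" if "c \<in> set y \<or> c \<in> dual ` set x" for c
    using closed that by auto
  obtain ds where ds: "pair_list ds (length y)" "sorted_wrt (>) (map fst ds)" "pairs_at ds y"
    "pairfree (del_pairs ds y)" using pairs_exist[OF y(3)] by blast
  obtain es where es: "pair_list es (length x)" "sorted_wrt (>) (map fst es)" "pairs_at es x"
    "pairfree (del_pairs es x)" using pairs_exist[OF x(3)] by blast
  note py = del_pairs_props[OF ds(1) y(3) ds(3)] and px = del_pairs_props[OF es(1) x(3) es(3)]
  have "c \<in> set (del_pairs es x)" if c: "c \<in> set (del_pairs ds y)" for c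
  proof (rule ccontr)
    assume n: "c \<notin> set (del_pairs es x)"
    have cy: "c \<in> set y" using c py(2) by blast
    have "dual c \<notin> set y"
    proof
      assume "dual c \<in> set y"
      moreover have "dual c \<notin> set (del_pairs ds y)" using c ds(4) by (simp add: pairfree_def)
      ultimately have "dual (dual c) \<notin> set (del_pairs ds y)" using py(3) by blast
      thus False using c by simp
    qed
    hence "dual c \<in> dual ` set x" using cl cy by blast
    hence "c \<in> set x" by (auto simp: image_iff)
    hence "dual c \<in> set x" using px(3) n by blast
    hence "c \<in> dual ` set x" by (metis dual_dual imageI)
    thus False using disj cy by blast
  qed
  moreover have "c \<in> set (del_pairs ds y)" if c: "c \<in> set (del_pairs es x)" for c
  proof (rule ccontr)
    assume n: "c \<notin> set (del_pairs ds y)"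
    have cx: "c \<in> set x" using c px(2) by blast
    have "dual c \<notin> set x"
    proof
      assume "dual c \<in> set x"
      moreover have "dual c \<notin> set (del_pairs es x)" using c es(4) by (simp add: pairfree_def)
      ultimately have "dual (dual c) \<notin> set (del_pairs es x)" using px(3) by blast
      thus False using c by simp
    qed
    hence "c \<notin> dual ` set x" by (metis dual_dual imageE)
    moreover have "dual c \<in> dual ` set x" using cx by blast
    hence "c \<in> set y \<or> c \<in> dual ` set x" using cl[of "dual c"] by simp
    ultimately have cy: "c \<in> set y" by blast
    hence "dual c \<in> set y" using py(3) n by blast
    thus False using disj[of "dual c"] cx by blast
  qed
  ultimately have set: "set (del_pairs ds y) = set (del_pairs es x)" by blast
  have len: "length (del_pairs ds y) = length (del_pairs es x)"
    using set py(1) px(1) by (metis distinct_card)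
  obtain w where w: "w \<in> W (length (del_pairs ds y))" "word_act w (del_pairs ds y) = del_pairs es x"
    using W_exists[OF py(1) px(1) set] by blast
  let ?i = "(length (del_pairs ds y), ds, w, es)"
  have "is_index W m n ?i"
    unfolding is_index_def using ds es w y x length_del_pairs[OF ds(1)] length_del_pairs[OF es(1)] len
      pair_list_length[OF ds(1)] pair_list_length[OF es(1)] by auto
  moreover from this have "M (std_exp ?i) y x \<noteq> 0" using M_std y x ds es w by auto
  ultimately show ?thesis by blast
qed

lemma wd_bound: "length y = n \<Longrightarrow> \<forall>c \<in> set y. fst c < N \<Longrightarrow> y \<in> wd n"
  unfolding wd_def L_def by (auto simp: mem_Times_iff)

text \<open>The through strands receive the first \<open>r\<close> even labels, and each cup and
  each cap a fresh dual pair of its own. These numbers are all below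
  \<open>r + length ds + length es\<close>, which is at most \<open>m + n\<close>.\<close>

lemma generic_exists:
  assumes i: "is_index W m n i" and N: "m + n \<le> N"
  shows "\<exists>y x. generic m n y x \<and> M (std_exp i) y x \<noteq> 0"
proof -
  obtain r ds w es where i': "i = (r, ds, w, es)" by (cases i) auto
  have ind: "n = r + 2 * length ds" "pair_list ds n" "w \<in> W r" "m = r + 2 * length es" "pair_list es m"
    using i i' by (auto simp: is_index_def)
  define y' where "y' = map (\<lambda>k. (k, False)) [0..<r]"
  have y': "length y' = r" "distinct y'" "\<forall>c \<in> set y'. fst c < r" "\<forall>c \<in> set y'. \<not> snd c"
    by (auto simp: y'_def distinct_map inj_on_def)
  define x' where "x' = word_act w y'"
  have x': "length x' = r" "distinct x'" "set x' = set y'"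
    using y' W_set[OF ind(3)] by (auto simp: x'_def distinct_word_act set_word_act)
  obtain y where y: "length y = n" "pairs_at ds y" "del_pairs ds y = y'" "distinct y"
    "set y = set y' \<union> {c. r \<le> fst c \<and> fst c < r + length ds}"
    using insert_pairs[of ds r y' r] ind y' by auto
  obtain x where x: "length x = m" "pairs_at es x" "del_pairs es x = x'" "distinct x"
    "set x = set x' \<union> {c. r + length ds \<le> fst c \<and> fst c < r + length ds + length es}"
    using insert_pairs[of es r x' "r + length ds"] ind x' y' by force
  have fresh: "dual c \<notin> set y" if "c \<in> set x" for c
  proof
    assume "dual c \<in> set y"
    hence "dual c \<in> set y' \<or> r \<le> fst c \<and> fst c < r + length ds" unfolding y(5) by simp
    moreover have "c \<in> set y' \<or> r + length ds \<le> fst c" using that unfolding x(5) x'(3) by auto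
    ultimately show False
      using y'(3,4)[rule_format, of c] y'(3,4)[rule_format, of "dual c"] by auto
  qed
  have "\<forall>c \<in> set y. fst c < r + length ds" "\<forall>c \<in> set x. fst c < r + length ds + length es"
    using y'(3) unfolding y(5) x(5) x'(3) by fastforce+
  hence wd: "y \<in> wd n" "x \<in> wd m"
    using y(1) x(1) N ind(1,4) by (fastforce intro!: wd_bound)+
  have "distinct (y @ map dual (rev x))"
    using y(4) x(4) fresh by (auto simp: distinct_map inj_on_def)
  moreover have "M (std_exp i) y x \<noteq> 0"
    unfolding i' using M_std[OF i[unfolded i'] wd] y x x'_def by simp
  ultimately show ?thesis using wd unfolding generic_def by blast
qed

end

lemma monomial_I_exp: "monomial (I_exp n (p, s))"
  by (induction s) (simp_all add: I_exp_0 I_exp_Suc u_exp_def s_exp_def)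

lemma monomial_J_tail: "monomial t \<Longrightarrow> monomial (J_tail n p s t)"
  by (induction s arbitrary: t) (simp_all add: J_tail_0 J_tail_Suc a_exp_def s_exp_def)

lemma monomial_J_exp: "monomial (J_exp n (p, s))"
  by (simp add: J_exp_tail monomial_J_tail)

lemma monomial_I_prod: "monomial (I_prod r qs)"
proof (induction qs)
  case (Cons q qs)
  thus ?case using monomial_I_exp[of _ "fst q" "snd q"] by simp
qed simp

lemma monomial_J_prod: "monomial (J_prod r qs)"
proof (induction qs arbitrary: r)
  case (Cons q qs)
  thus ?case using monomial_J_exp[of _ "fst q" "snd q"] by simp
qed simp

lemma monomial_word: "monomial (prod_exp r (map (s_exp r) w))"
  by (induction w) (simp_all add: prod_exp_def s_exp_def)

lemma monomial_std_exp: "monomial (std_exp i)"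
  by (cases i) (simp add: std_exp_def monomial_I_prod monomial_J_prod monomial_word)

lemma (in word_system) std_exp_bexps:
  assumes "is_index W m n i"
  shows "(std_exp i :: 'k bexp) \<in> bexps m n"
proof -
  obtain r ds w es where i: "i = (r, ds, w, es)" by (cases i) auto
  hence ind: "n = r + 2 * length ds" "pair_list ds n" "w \<in> W r" "m = r + 2 * length es" "pair_list es m"
    using assms by (auto simp: is_index_def)
  show ?thesis unfolding i std_exp_def bexps_def
    using I_prod_type[of ds r, where 'k = 'k] J_prod_type[of "rev es" r, where 'k = 'k]
      word_type[OF W_set[OF ind(3)], where 'k = 'k] ind by simp
qed

text \<open>With distinct labels the partner of the first point is the position of its dual label;
  deleting this pair leaves a shorter instance.\<close>

lemma cup_list_unique:
  assumes "distinct y" "length y = 2 * length qs" "length ps = length qs" "cup_list qs" "cup_list ps"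
    "pairs_at (map (Pair 1) qs) y" "pairs_at (map (Pair 1) ps) y"
  shows "qs = ps"
  using assms
proof (induction qs arbitrary: ps y)
  case (Cons q qs)
  obtain p ps' where p: "ps = p # ps'" using Cons.prems by (cases ps) auto
  have "y ! Suc q = y ! Suc p" using Cons.prems p by (simp add: pair_at_def)
  hence qp: "q = p" using Cons.prems p by (subst (asm) nth_eq_iff_index_eq) auto
  have "qs = ps'"
  proof (rule Cons.IH[of "del_pair (1, q) y"])
    show "distinct (del_pair (1, q) y)" "length (del_pair (1, q) y) = 2 * length qs"
    proof -
      have a: "1 \<le> fst (1::nat, q)" "fst (1, q) + snd (1::nat, q) + 1 \<le> length y" "pair_at (1, q) y"
        using Cons.prems by auto
      obtain u c v w where "y = u @ [c] @ v @ [dual c] @ w" "del_pair (1, q) y = u @ v @ w"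
        using pair_list_decomp[OF a] by metis
      thus "distinct (del_pair (1, q) y)" "length (del_pair (1, q) y) = 2 * length qs"
        using Cons.prems by auto
    qed
  qed (use Cons.prems p qp in auto)
  thus ?case using p qp by simp
qed simp

section \<open>Spanning, independence and the basis theorem\<close>

locale cat00_words = cat00_params \<epsilon> lam sig e + word_system W
  for \<epsilon> lam sig e :: "'k::field" and W
begin

notation cong_exp (infix \<open>\<approx>\<close> 50) and below (infix \<open>\<sqsubseteq>\<close> 50)

text \<open>Given a normal form, a word \<open>z\<close> with distinct labels is made to fit its
  arcs, and \<open>index_exists\<close> finds a standard expression with a nonzero entry there. Its
  bending is a multiple of some \<open>cups ps\<close>; the entry at \<open>z\<close> shows that the
  factor is nonzero and that \<open>ps\<close> is the given list.\<close>

lemma lspan_standard: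
  assumes "t \<in> bexps m n"
  shows "lspan (standard_exps W m n) m n t"
proof (rule lspan_by_bending[OF _ assms])
  interpret M: model_words \<epsilon> lam sig e "m + n" W by unfold_locales
  fix qs assume qs: "cup_list qs" "2 * length qs = n + m"
  have pl: "pair_list (map (Pair 1) qs) (0 + 2 * length (map (Pair 1) qs))"
    using qs(1) by (induction qs) auto
  obtain z where z: "length z = n + m" "pairs_at (map (Pair 1) qs) z" "distinct z"
    "set z = {c. fst c < length qs}"
    using insert_pairs[OF pl, of "[]" 0] qs(2) by auto
  \<comment> \<open>The word \<open>z\<close> is cut after \<open>n\<close> letters and its tail is
    unbent, so that bending returns \<open>z\<close>.\<close>
  define y x where "y = take n z" and "x = map dual (rev (drop n z))"
  have yx: "y @ map dual (rev x) = z"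
    by (simp add: y_def x_def rev_map comp_def)
  have "M.generic m n y x"
  proof -
    have "fst c < m + n" if "c \<in> set z" for c
      using that z(4) qs(2) by simp
    hence "\<forall>c \<in> set y. fst c < m + n" "\<forall>c \<in> set x. fst c < m + n"
      unfolding y_def x_def by (auto dest!: in_set_takeD in_set_dropD)
    thus ?thesis unfolding M.generic_def yx using z
      by (intro conjI M.wd_bound) (simp_all add: y_def x_def)
  qed
  moreover have "\<forall>c \<in> set (y @ map dual (rev x)). dual c \<in> set (y @ map dual (rev x))"
    unfolding yx z(4) by simp
  ultimately obtain i where i: "is_index W m n i" "M.M (std_exp i) y x \<noteq> 0"
    using M.index_exists by blast
  let ?X = "std_exp i :: 'k bexp"
  have X: "?X \<in> bexps m n" using i by (intro std_exp_bexps)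
  have wd: "y \<in> M.wd n" "x \<in> M.wd m" using \<open>M.generic m n y x\<close> by (auto simp: M.generic_def)
  have zwd: "z \<in> M.wd (n + m)"
    using z(1,4) qs(2) by (intro M.wd_bound) auto
  have Mb: "M.M (bend m ?X) z [] \<noteq> 0" using M.M_bend[OF X wd] i yx by simp
  have b: "bend m ?X \<in> bexps 0 (n + m)" using X linear_bend[of m n] by (auto simp: linear_exp_def)
  obtain ps where ps: "cup_list ps" "2 * length ps = n + m" "bend m ?X \<sqsubseteq> cups ps"
    using monomial_below_cups[of "bend m ?X"] b monomial_bend[OF monomial_std_exp, of m i] by (auto simp: bexps_def)
  then obtain c where c: "bend m ?X \<approx> c *\<^sub>e cups ps" by (auto simp: below_def)
  have "M.M (bend m ?X) z [] = c * M.M (cups ps) z []"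
    using M.M_sound[OF c] zwd b by (auto simp: bexps_def)
  hence nz: "c \<noteq> 0" "M.M (cups ps) z [] \<noteq> 0" using Mb by auto
  have "pairs_at (map (Pair 1) ps) z" using M.M_cups[OF ps(1)] nz(2) zwd ps(2) by simp
  hence "qs = ps" using z qs ps by (intro cup_list_unique[of z]) auto
  hence "cups qs \<sqsubseteq> bend m ?X" using below_flip[OF c nz(1)] by simp
  moreover have "?X \<in> standard_exps W m n" unfolding standard_exps_eq using i by blast
  ultimately show "\<exists>X \<in> standard_exps W m n. X \<in> bexps m n \<and> cups qs \<sqsubseteq> bend m X" using X by blast
qed

lemma standard_inj:
  assumes "is_index W m n i" "is_index W m n j" "std_exp i \<approx> std_exp j"
  shows "i = j"
proof -
  interpret M: model_words \<epsilon> lam sig e "m + n" W by unfold_locales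
  obtain y x where g: "M.generic m n y x" "M.M (std_exp i) y x \<noteq> 0"
    using M.generic_exists[OF assms(1)] by auto
  have "M.M (std_exp i) y x = M.M (std_exp j) y x"
    using M.M_sound[OF assms(3)] g(1) std_exp_bexps[OF assms(1), where 'k = 'k]
    by (auto simp: M.generic_def bexps_def)
  thus ?thesis using M.index_unique[OF g(1) assms(1) g(2) assms(2)] g(2) by simp
qed

lemma basis_standard: "vectorspace.basis class_ring (Hom PC m n) (cls ` standard_exps W m n)"
proof -
  interpret M: model_words \<epsilon> lam sig e "m + n" W by unfold_locales
  interpret V: vectorspace class_ring "Hom PC m n" by (rule hom_vectorspace)
  let ?H = "Hom PC m n" and ?S = "standard_exps W m n :: 'k bexp set"
  have S: "?S \<subseteq> bexps m n" unfolding standard_exps_eq using std_exp_bexps by auto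
  have B: "cls ` ?S \<subseteq> carrier ?H" using S by (auto simp: carrier_cls)
  have "V.span (cls ` ?S) = carrier ?H"
  proof
    show "V.span (cls ` ?S) \<subseteq> carrier ?H" using V.span_is_subset2 B by blast
    have sub: "LinearCombinations.submodule class_ring (V.span (cls ` ?S)) ?H" using B by (rule V.span_is_submodule)
    have "cls t \<in> V.span (cls ` ?S)" if "lspan ?S m n t" for t
      using that
    proof (induction rule: lspan.induct)
      case null
      show ?case using sub unfolding LinearCombinations.submodule_def zero_cls by blast
    next
      case (base t)
      thus ?case using V.in_own_span[OF B] by blast
    next
      case (add s t)
      have "bwt (s +\<^sub>e t)" using lspan_bexps[OF add.hyps(1)] lspan_bexps[OF add.hyps(2)] by (auto simp: bexps_def)
      thus ?case using sub add.IH add_cls[of s t m n] unfolding LinearCombinations.submodule_def by metis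
    next
      case (scale t c)
      have "bwt t" using lspan_bexps[OF scale.hyps] by (auto simp: bexps_def)
      moreover have "c \<odot>\<^bsub>?H\<^esub> cls t \<in> V.span (cls ` ?S)"
        using sub scale.IH unfolding LinearCombinations.submodule_def by simp
      ultimately show ?case using smult_cls[of t m n c] by simp
    next
      case (congr t s)
      thus ?case using cls_eqI by metis
    qed
    thus "carrier ?H \<subseteq> V.span (cls ` ?S)" using lspan_standard by (auto simp: carrier_cls)
  qed
  moreover have "\<not> V.lin_dep (cls ` ?S)"
  proof
    assume "V.lin_dep (cls ` ?S)"
    then obtain A a v where A: "finite A" "A \<subseteq> cls ` ?S" "V.lincomb a A = \<zero>\<^bsub>?H\<^esub>" "v \<in> A" "a v \<noteq> (0::'k)"
      unfolding V.lin_dep_def by auto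
    obtain i where i: "is_index W m n i" "v = cls (std_exp i)" using A(2,4) unfolding standard_exps_eq by auto
    obtain y x where g: "M.generic m n y x" "M.M (std_exp i) y x \<noteq> 0"
      using M.generic_exists[OF i(1)] by auto
    \<comment> \<open>The matrix entry at the generic words of \<open>v\<close>, as a functional on
      classes. By \<open>M_sound\<close> it does not depend on the representative that is picked; it
      is nonzero on \<open>v\<close> and vanishes on all other standard classes.\<close>
    define ev where "ev F = M.M (SOME t. t \<in> F) y x" for F
    have ev: "ev (cls t) = M.M t y x" if "t \<in> bexps m n" for t
    proof -
      have "(SOME t'. t' \<in> cls t) \<in> cls t" using self_cls[of t] that by (intro someI) (auto simp: bexps_def)
      hence "t \<approx> (SOME t'. t' \<in> cls t)" by (simp add: mem_cls)
      thus ?thesis unfolding ev_def using M.M_sound g(1) that by (auto simp: M.generic_def bexps_def)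
    qed
    \<comment> \<open>A linear combination of classes is represented by one expression, whose entry
      is the same combination of the values of \<open>ev\<close>.\<close>
    have lin: "\<exists>t \<in> bexps m n. V.lincomb a C = cls t \<and> M.M t y x = (\<Sum>u\<in>C. a u * ev u)"
      if "finite C" "C \<subseteq> carrier ?H" for C
      using that
    proof (induction C rule: finite_induct)
      case empty
      show ?case by (intro bexI[of _ "Null m n"]) (auto simp: V.lincomb_def zero_cls bexps_def)
    next
      case (insert u C)
      obtain t where t: "t \<in> bexps m n" "V.lincomb a C = cls t" "M.M t y x = (\<Sum>u\<in>C. a u * ev u)"
        using insert by auto
      obtain s where s: "s \<in> bexps m n" "u = cls s" using insert.prems by (auto simp: carrier_cls)
      have "V.lincomb a (insert u C) = a u \<odot>\<^bsub>?H\<^esub> u \<oplus>\<^bsub>?H\<^esub> V.lincomb a C"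
        unfolding V.lincomb_def using insert by (intro V.finsum_insert) auto
      also have "\<dots> = cls (a u *\<^sub>e s +\<^sub>e t)"
        using s t by (simp add: smult_cls add_cls bexps_def)
      finally show ?case using s t ev[OF s(1)] insert.hyps
        by (intro bexI[of _ "a u *\<^sub>e s +\<^sub>e t"]) (auto simp: bexps_def)
    qed
    obtain t where t: "t \<in> bexps m n" "V.lincomb a A = cls t" "M.M t y x = (\<Sum>u\<in>A. a u * ev u)"
      using lin[OF A(1)] A(2) B by blast
    have "cls t = cls (Null m n)" using A(3) t(2) by (simp add: zero_cls)
    hence "t \<approx> Null m n" using cls_eq[of "Null m n" t] bcong.sym cls_eq t(1) by (auto simp: bexps_def)
    hence "M.M t y x = 0" using M.M_sound[of t "Null m n"] g(1) t(1) by (auto simp: M.generic_def bexps_def)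
    moreover have "ev u = 0" if u: "u \<in> A - {v}" for u
    proof -
      have "u \<in> cls ` standard_exps W m n" using u A(2) by blast
      then obtain j where j: "is_index W m n j" "u = cls (std_exp j)" unfolding standard_exps_eq by blast
      hence "j \<noteq> i" using u i by auto
      thus ?thesis using M.index_unique[OF g(1) j(1) _ i(1) g(2)] j ev[OF std_exp_bexps[OF j(1)]] by auto
    qed
    hence "(\<Sum>u\<in>A. a u * ev u) = a v * ev v"
      using A(1,4) by (subst sum.remove[of _ v]) auto
    ultimately have "a v * ev v = 0" using t(3) by simp
    thus False using A(5) i(2) ev[OF std_exp_bexps[OF i(1)]] g(2) by simp
  qed
  ultimately show ?thesis unfolding V.basis_def using B by blast
qed

theorem cat00_Brauer_type:
  "category_of_Brauer_type W \<epsilon> (cat00 \<epsilon> lam sig e) 1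
    (cat00_gen \<epsilon> lam sig e GenH) (cat00_gen \<epsilon> lam sig e GenA) (cat00_gen \<epsilon> lam sig e GenU)"
proof -
  have bv: "bval PC 1 (cls GenH) (cls GenA) (cls GenU) t = cls t" if "t \<in> bexps m n" for t m n
    using that bval_PC by (simp add: bexps_def)
  have S: "(standard_exps W m n :: 'k bexp set) \<subseteq> bexps m n" for m n
    unfolding standard_exps_eq using std_exp_bexps by auto
  have bvS: "bval PC 1 (cls GenH) (cls GenA) (cls GenU) t = cls t" if "t \<in> standard_exps W m n" for t m n
    using bv[of t m n] S that by blast
  \<comment> \<open>By \<open>rel_HH\<close> the square of H is \<open>lam\<^sup>2\<close>, which
    provides the inverse.\<close>
  let ?h' = "inverse (lam\<^sup>2) *\<^sub>e GenH"
  have h1: "GenH \<circ>\<^sub>e ?h' \<approx> Ident 2"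
  proof -
    have "GenH \<circ>\<^sub>e ?h' \<approx> inverse (lam\<^sup>2) *\<^sub>e (GenH \<circ>\<^sub>e GenH)" by (rule bcong.comp_scale_right) simp
    from scale_scale'[OF this rel_HH] have "GenH \<circ>\<^sub>e ?h' \<approx> 1 *\<^sub>e Ident 2" by simp
    thus ?thesis using bcong.scale_one[of "Ident 2"] bcong.trans by fastforce
  qed
  have h2: "?h' \<circ>\<^sub>e GenH \<approx> Ident 2"
  proof -
    have "?h' \<circ>\<^sub>e GenH \<approx> inverse (lam\<^sup>2) *\<^sub>e (GenH \<circ>\<^sub>e GenH)" by (rule bcong.comp_scale_left) simp
    from scale_scale'[OF this rel_HH] have "?h' \<circ>\<^sub>e GenH \<approx> 1 *\<^sub>e Ident 2" by simp
    thus ?thesis using bcong.scale_one[of "Ident 2"] bcong.trans by fastforce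
  qed
  have braid: "fst braid_relation \<approx> snd braid_relation"
    by (rule bcong.rel) (simp add: defining_relations_def)
  have inj: "inj_on cls (standard_exps W m n)" for m n
  proof (rule inj_onI)
    fix s t :: "'k bexp" assume st: "s \<in> standard_exps W m n" "t \<in> standard_exps W m n" "cls s = cls t"
    then obtain i j where ij: "s = std_exp i" "t = std_exp j" "is_index W m n i" "is_index W m n j"
      unfolding standard_exps_eq by auto
    have "s \<approx> t" using st cls_eq[of t s] S by (auto simp: bexps_def subset_iff)
    thus "s = t" using standard_inj ij by blast
  qed
  show ?thesis
    unfolding category_of_Brauer_type_def cat00_def cat00_gen_def
  proof (intro conjI allI)
    show "\<epsilon> \<in> {1, - 1}" by (rule eps)
    show "strict_monoidal_supercategory PC" by (rule presented_supercategory)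
    show "1 \<in> carrier (Ob PC)" by (simp add: Ob_PC)
    show "carrier (Ob PC) = range (\<lambda>n::nat. 1 [^]\<^bsub>Ob PC\<^esub> n)" by (simp only: pow_PC Ob_PC) simp
    show "cls GenH \<in> partn PC 1 0 2 2" "cls GenA \<in> partn PC 1 (gen_parity \<epsilon>) 2 0"
      "cls GenU \<in> partn PC 1 (gen_parity \<epsilon>) 0 2"
      unfolding partn_PC by (auto intro: cls_Part)
    show "carrier (homn PC 1 m n) = bval PC 1 (cls GenH) (cls GenA) (cls GenU) ` bexps m n" for m n
      unfolding homn_PC carrier_cls using bv by (intro image_cong) auto
    show "\<exists>h' \<in> carrier (homn PC 1 2 2).
          cls GenH \<cdot>\<^bsub>PC\<^esub> h' = Idn PC (1 [^]\<^bsub>Ob PC\<^esub> (2::nat)) \<and> h' \<cdot>\<^bsub>PC\<^esub> cls GenH = Idn PC (1 [^]\<^bsub>Ob PC\<^esub> (2::nat))"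
      unfolding homn_PC pow_PC Idn_cls
      by (intro bexI[of _ "cls ?h'"] conjI) (use h1 h2 in \<open>auto simp: Cmp_cls cls_eqI intro: cls_carrier\<close>)
    show "bval PC 1 (cls GenH) (cls GenA) (cls GenU) (fst braid_relation)
        = bval PC 1 (cls GenH) (cls GenA) (cls GenU) (snd braid_relation)"
      using bcong_typed[OF braid] cls_eqI[OF braid] by (simp only: bval_PC)
    show "inj_on (bval PC 1 (cls GenH) (cls GenA) (cls GenU)) (standard_exps W m n)" for m n
    proof (rule inj_onI)
      fix s t :: "'k bexp" assume st: "s \<in> standard_exps W m n" "t \<in> standard_exps W m n"
        and "bval PC 1 (cls GenH) (cls GenA) (cls GenU) s = bval PC 1 (cls GenH) (cls GenA) (cls GenU) t"
      hence "cls s = cls t" using bvS by metis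
      thus "s = t" using inj_onD[OF inj] st by blast
    qed
    have "bval PC 1 (cls GenH) (cls GenA) (cls GenU) ` standard_exps W m n = cls ` standard_exps W m n" for m n
      using bvS by (intro image_cong) auto
    thus "vectorspace.basis class_ring (homn PC 1 m n)
        (bval PC 1 (cls GenH) (cls GenA) (cls GenU) ` standard_exps W m n)" for m n
      unfolding homn_PC using basis_standard by simp
  qed
qed

end

section \<open>Evaluation in an arbitrary supercategory\<close>

lemma linear_map_closed: "linear_map K V W T \<Longrightarrow> x \<in> carrier V \<Longrightarrow> T x \<in> carrier W"
  and linear_map_add:
    "linear_map K V W T \<Longrightarrow> x \<in> carrier V \<Longrightarrow> y \<in> carrier V \<Longrightarrow> T (x \<oplus>\<^bsub>V\<^esub> y) = T x \<oplus>\<^bsub>W\<^esub> T y"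
  and linear_map_smult:
    "linear_map K V W T \<Longrightarrow> c \<in> carrier K \<Longrightarrow> x \<in> carrier V \<Longrightarrow> T (c \<odot>\<^bsub>V\<^esub> x) = c \<odot>\<^bsub>W\<^esub> T x"
  unfolding linear_map_def mod_hom_def mod_hom_axioms_def LinearCombinations.module_hom_def by auto

locale brauer_valuation = strict_monoidal_supercategory C
  for C :: "('o, 'm, 'k::field) supercat" (structure) +
  fixes X :: 'o and h a u :: 'm and \<pi> :: bit
  assumes X: "X \<in> carrier (Ob C)"
    and h: "h \<in> partn C X 0 2 2" and a: "a \<in> partn C X \<pi> 2 0" and u: "u \<in> partn C X \<pi> 0 2"
begin

abbreviation val where "val \<equiv> bval C X h a u"

lemma pow_ob [simp]: "X [^]\<^bsub>Ob C\<^esub> (n::nat) \<in> carrier (Ob C)"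
  using X ob_monoid by (simp add: monoid.nat_pow_closed)

lemma pow_add: "X [^]\<^bsub>Ob C\<^esub> (m::nat) \<otimes>\<^bsub>Ob C\<^esub> X [^]\<^bsub>Ob C\<^esub> n = X [^]\<^bsub>Ob C\<^esub> (m + n)"
  using X ob_monoid by (simp add: monoid.nat_pow_mult)

lemma pow_0: "X [^]\<^bsub>Ob C\<^esub> (0::nat) = \<one>\<^bsub>Ob C\<^esub>"
  using ob_monoid by (simp add: monoid.nat_pow_0)

lemma homn_vectorspace: "vectorspace class_ring (homn C X m n)"
  unfolding homn_def by (simp add: hom_vectorspace)

lemma homn_module: "module class_ring (homn C X m n)"
  using homn_vectorspace by (simp add: vectorspace_def)

lemma homn_abelian_group: "abelian_group (homn C X m n)"
  using homn_module by (simp add: Module.module_def)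

lemma partn_subspace: "LinearCombinations.submodule class_ring (partn C X p m n) (homn C X m n)"
  using part_subspace[of "X [^]\<^bsub>Ob C\<^esub> m" "X [^]\<^bsub>Ob C\<^esub> n" p]
  by (simp add: homn_def partn_def VectorSpace.subspace_def)

lemma partn_carrier: "f \<in> partn C X p m n \<Longrightarrow> f \<in> carrier (homn C X m n)"
  using partn_subspace[of p m n] by (auto simp: LinearCombinations.submodule_def)

lemma cmp_linear_left:
  "f \<in> carrier (homn C X m n) \<Longrightarrow> linear_map class_ring (homn C X n k) (homn C X m k) (\<lambda>g. g \<cdot> f)"
  unfolding homn_def by (intro comp_linear_left) auto

lemma cmp_linear_right:
  "g \<in> carrier (homn C X n k) \<Longrightarrow> linear_map class_ring (homn C X m n) (homn C X m k) (\<lambda>f. g \<cdot> f)"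
  unfolding homn_def by (intro comp_linear_right) auto

lemma tns_linear_left:
  "g \<in> carrier (homn C X m' n') \<Longrightarrow>
    linear_map class_ring (homn C X m n) (homn C X (m + m') (n + n')) (\<lambda>f. f \<boxtimes> g)"
  unfolding homn_def pow_add[symmetric] by (intro tensor_linear_left) auto

lemma tns_linear_right:
  "f \<in> carrier (homn C X m n) \<Longrightarrow>
    linear_map class_ring (homn C X m' n') (homn C X (m + m') (n + n')) (\<lambda>g. f \<boxtimes> g)"
  unfolding homn_def pow_add[symmetric] by (intro tensor_linear_right) auto

lemma val_carrier: "bwt t \<Longrightarrow> val t \<in> carrier (homn C X (bsrc t) (btgt t))"
proof (induction t)
  case (Ident n)
  have "Idn C (X [^]\<^bsub>Ob C\<^esub> n) \<in> partn C X 0 n n" unfolding partn_def by (simp add: id_part)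
  thus ?case by (simp add: partn_carrier)
next
  case (Null m n)
  show ?case using homn_abelian_group[of m n] by (simp add: abelian_group.axioms(1) abelian_monoid.zero_closed)
next
  case (Add s t)
  thus ?case using homn_abelian_group[of "bsrc s" "btgt s"]
    by (simp add: abelian_group.axioms(1) abelian_monoid.a_closed)
next
  case (Scale c t)
  thus ?case using homn_module[of "bsrc t" "btgt t"] by (simp add: module.smult_closed)
next
  case (Comp s t)
  thus ?case using linear_map_closed[OF cmp_linear_left] by fastforce
next
  case (Tens s t)
  thus ?case using linear_map_closed[OF tns_linear_left] by fastforce
qed (use h a u partn_carrier in auto)

lemma val_part: "bwt t \<Longrightarrow> bhomog \<pi> t p \<Longrightarrow> val t \<in> partn C X p (bsrc t) (btgt t)"
proof (induction t arbitrary: p)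
  case (Ident n)
  thus ?case unfolding partn_def by (simp add: id_part)
next
  case (Null m n)
  show ?case using partn_subspace[of p m n] by (simp add: LinearCombinations.submodule_def)
next
  case (Add s t)
  thus ?case using partn_subspace[of p "bsrc s" "btgt s"] by (simp add: LinearCombinations.submodule_def)
next
  case (Scale c t)
  thus ?case using partn_subspace[of p "bsrc t" "btgt t"] by (simp add: LinearCombinations.submodule_def)
next
  case (Comp s t)
  then obtain q r where pqr: "p = q + r" and "bhomog \<pi> s q" "bhomog \<pi> t r" by auto
  with Comp have "val s \<in> partn C X q (btgt t) (btgt s)" "val t \<in> partn C X r (bsrc t) (btgt t)"
    by auto
  thus ?case unfolding pqr partn_def
    using comp_part[of "X [^]\<^bsub>Ob C\<^esub> bsrc t" "X [^]\<^bsub>Ob C\<^esub> btgt t" "X [^]\<^bsub>Ob C\<^esub> btgt s" "val s" q "val t" r]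
    by simp
next
  case (Tens s t)
  then obtain q r where "p = q + r" "bhomog \<pi> s q" "bhomog \<pi> t r" by auto
  thus ?case
    using Tens tensor_part[of _ _ _ _ "val s" q "val t" r] by (simp add: partn_def pow_add[symmetric])
qed (use h a u in auto)

text \<open>Each rule of the congruence is an axiom of supercategories or follows from the module
  laws, so derivations with \<open>bcong\<close> become usable in an arbitrary category.\<close>

lemma val_sound:
  assumes "bcong \<pi> R s t"
    and typed: "\<And>s t. (s, t) \<in> R \<Longrightarrow> bwt s \<and> bwt t \<and> bsrc s = bsrc t \<and> btgt s = btgt t"
    and R: "\<And>s t. (s, t) \<in> R \<Longrightarrow> val s = val t"
  shows "val s = val t"
proof -
  interpret typed_relations \<pi> R using typed by unfold_locales
  note ty = bcong_typed
  from assms(1) show ?thesis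
  proof (induction rule: bcong.induct)
    case (add_cong s s' t t')
    thus ?case using ty by (metis bval.simps(6))
  next
    case (scale_cong t t' c)
    thus ?case using ty by (metis bval.simps(7))
  next
    case (add_assoc s t v)
    thus ?case using val_carrier[of s] val_carrier[of t] val_carrier[of v]
        homn_abelian_group[of "bsrc v" "btgt v"]
      by (auto simp: abelian_group.axioms(1) abelian_monoid.a_assoc)
  next
    case (add_comm s t)
    thus ?case using val_carrier[of s] val_carrier[of t] homn_abelian_group[of "bsrc t" "btgt t"]
      by (auto simp: abelian_group.axioms(1) abelian_monoid.a_comm)
  next
    case (add_null t)
    thus ?case using val_carrier[of t] homn_abelian_group[of "bsrc t" "btgt t"]
      by (auto simp: abelian_group.axioms(1) abelian_monoid.l_zero)
  next
    case (add_neg t)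
    let ?H = "homn C X (bsrc t) (btgt t)"
    interpret V: Module.module class_ring ?H by (rule homn_module)
    have c: "val t \<in> carrier ?H" using add_neg val_carrier by simp
    have "val t \<oplus>\<^bsub>?H\<^esub> (- 1) \<odot>\<^bsub>?H\<^esub> val t = (1 + (- 1)) \<odot>\<^bsub>?H\<^esub> val t"
      using c V.smult_l_distr[of 1 "- 1" "val t"] V.smult_one[of "val t"] by simp
    also have "\<dots> = \<zero>\<^bsub>?H\<^esub>" using c V.smult_l_null by simp
    finally show ?case by simp
  next
    case (scale_add s t c)
    interpret V: Module.module class_ring "homn C X (bsrc t) (btgt t)" by (rule homn_module)
    show ?case using scale_add val_carrier[of s] val_carrier[of t] by (simp add: V.smult_r_distr)
  next
    case (add_scale t c d)
    interpret V: Module.module class_ring "homn C X (bsrc t) (btgt t)" by (rule homn_module)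
    show ?case using add_scale val_carrier[of t] V.smult_l_distr[of c d "val t"] by simp
  next
    case (scale_scale t c d)
    interpret V: Module.module class_ring "homn C X (bsrc t) (btgt t)" by (rule homn_module)
    show ?case using scale_scale val_carrier[of t] V.smult_assoc1[of c d "val t"] by simp
  next
    case (scale_one t)
    interpret V: Module.module class_ring "homn C X (bsrc t) (btgt t)" by (rule homn_module)
    show ?case using scale_one val_carrier[of t] V.smult_one[of "val t"] by simp
  next
    case (comp_add_left s t v)
    thus ?case using val_carrier[of s] val_carrier[of t]
        linear_map_add[OF cmp_linear_left[OF val_carrier[of v], of "btgt t"]] by auto
  next
    case (comp_add_right v s t)
    thus ?case using val_carrier[of s] val_carrier[of t]
        linear_map_add[OF cmp_linear_right[of "val v" "btgt t" "btgt v" "bsrc t"]] val_carrier[of v] by auto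
  next
    case (comp_scale_left s t c)
    thus ?case using val_carrier[of s]
        linear_map_smult[OF cmp_linear_left[OF val_carrier[of t], of "btgt s"], of c "val s"] by auto
  next
    case (comp_scale_right s t c)
    thus ?case using val_carrier[of t] val_carrier[of s]
        linear_map_smult[OF cmp_linear_right[of "val s" "btgt t" "btgt s" "bsrc t"], of c "val t"] by auto
  next
    case (tens_add_left s t v)
    thus ?case using val_carrier[of s] val_carrier[of t]
        linear_map_add[OF tns_linear_left[OF val_carrier[of v], of "bsrc t" "btgt t"]] by auto
  next
    case (tens_add_right v s t)
    thus ?case using val_carrier[of s] val_carrier[of t]
        linear_map_add[OF tns_linear_right[OF val_carrier[of v], of "bsrc t" "btgt t"]] by auto
  next
    case (tens_scale_left s t c)
    thus ?case using val_carrier[of s]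
        linear_map_smult[OF tns_linear_left[OF val_carrier[of t], of "bsrc s" "btgt s"], of c "val s"] by auto
  next
    case (tens_scale_right s t c)
    thus ?case using val_carrier[of t]
        linear_map_smult[OF tns_linear_right[OF val_carrier[of s], of "bsrc t" "btgt t"], of c "val t"] by auto
  next
    case (comp_assoc s t v)
    thus ?case using val_carrier[of s] val_carrier[of t] val_carrier[of v]
        strict_monoidal_supercategory.comp_assoc[OF strict_monoidal_supercategory_axioms, of
          "X [^]\<^bsub>Ob C\<^esub> bsrc v" "X [^]\<^bsub>Ob C\<^esub> btgt v" "X [^]\<^bsub>Ob C\<^esub> btgt t" "X [^]\<^bsub>Ob C\<^esub> btgt s" "val s" "val t" "val v"]
      by (simp add: homn_def)
  next
    case (comp_id_left t)
    thus ?case using val_carrier[of t]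
        strict_monoidal_supercategory.comp_id_left[OF strict_monoidal_supercategory_axioms, of
          "X [^]\<^bsub>Ob C\<^esub> bsrc t" "X [^]\<^bsub>Ob C\<^esub> btgt t" "val t"]
      by (simp add: homn_def)
  next
    case (comp_id_right t)
    thus ?case using val_carrier[of t]
        strict_monoidal_supercategory.comp_id_right[OF strict_monoidal_supercategory_axioms, of
          "X [^]\<^bsub>Ob C\<^esub> bsrc t" "X [^]\<^bsub>Ob C\<^esub> btgt t" "val t"]
      by (simp add: homn_def)
  next
    case (tens_assoc s t v)
    thus ?case using val_carrier[of s] val_carrier[of t] val_carrier[of v]
        strict_monoidal_supercategory.tensor_assoc[OF strict_monoidal_supercategory_axioms, of
          "X [^]\<^bsub>Ob C\<^esub> bsrc s" "X [^]\<^bsub>Ob C\<^esub> btgt s" "X [^]\<^bsub>Ob C\<^esub> bsrc t" "X [^]\<^bsub>Ob C\<^esub> btgt t"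
          "X [^]\<^bsub>Ob C\<^esub> bsrc v" "X [^]\<^bsub>Ob C\<^esub> btgt v" "val s" "val t" "val v"]
      by (simp add: homn_def)
  next
    case (tens_unit_left t)
    thus ?case using val_carrier[of t]
        tensor_unit_left[of "X [^]\<^bsub>Ob C\<^esub> bsrc t" "X [^]\<^bsub>Ob C\<^esub> btgt t" "val t"]
      by (simp add: homn_def pow_0)
  next
    case (tens_unit_right t)
    thus ?case using val_carrier[of t]
        tensor_unit_right[of "X [^]\<^bsub>Ob C\<^esub> bsrc t" "X [^]\<^bsub>Ob C\<^esub> btgt t" "val t"]
      by (simp add: homn_def pow_0)
  next
    case (tens_id m n)
    show ?case using tensor_id[of "X [^]\<^bsub>Ob C\<^esub> m" "X [^]\<^bsub>Ob C\<^esub> n"] by (simp add: pow_add)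
  next
    case (interchange f h' g k p q)
    thus ?case using val_carrier[of f] val_carrier[of k] val_part[of g p] val_part[of h' q]
        super_interchange[of "X [^]\<^bsub>Ob C\<^esub> bsrc h'" "X [^]\<^bsub>Ob C\<^esub> btgt h'" "X [^]\<^bsub>Ob C\<^esub> btgt f"
          "X [^]\<^bsub>Ob C\<^esub> bsrc k" "X [^]\<^bsub>Ob C\<^esub> btgt k" "X [^]\<^bsub>Ob C\<^esub> btgt g" "val f" "val g" p "val h'" q "val k"]
      by (simp add: homn_def partn_def pow_add)
  qed (auto simp: R)
qed

end

section \<open>Comparison of coefficients\<close>

text \<open>Hom(1,3), Hom(3,1) and Hom(2,2) each have three standard expressions, so comparisons
  there are between combinations of three terms.\<close>

abbreviation lin3 :: "'k::field \<Rightarrow> 'k \<Rightarrow> 'k \<Rightarrow> 'k bexp \<Rightarrow> 'k bexp \<Rightarrow> 'k bexp \<Rightarrow> 'k bexp"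
  where "lin3 a b c x y z \<equiv> a *\<^sub>e x +\<^sub>e b *\<^sub>e y +\<^sub>e c *\<^sub>e z"

context typed_relations
begin

lemma cls_lin3:
  assumes "bwt (lin3 a b c x y z)" "bsrc x = m" "btgt x = n"
  shows "cls (lin3 a b c x y z) = a \<odot>\<^bsub>Hom PC m n\<^esub> cls x \<oplus>\<^bsub>Hom PC m n\<^esub> b \<odot>\<^bsub>Hom PC m n\<^esub> cls y
    \<oplus>\<^bsub>Hom PC m n\<^esub> c \<odot>\<^bsub>Hom PC m n\<^esub> cls z"
  using assms by (simp add: add_cls smult_cls)

text \<open>A row of coefficients is multiplied by a 3 by 3 matrix. The substitution is done in the
  module of classes, where sums can be rearranged freely.\<close>

lemma lin3_sum:
  assumes t: "t \<approx> lin3 a b c x y z"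
    and x: "x \<approx> lin3 x1 x2 x3 u v w" and y: "y \<approx> lin3 y1 y2 y3 u v w" and z: "z \<approx> lin3 z1 z2 z3 u v w"
  shows "t \<approx> lin3 (a * x1 + b * y1 + c * z1) (a * x2 + b * y2 + c * z2) (a * x3 + b * y3 + c * z3) u v w"
proof -
  define m n where "m = bsrc u" "n = btgt u"
  note ty = bcong_typed[OF t] bcong_typed[OF x] bcong_typed[OF y] bcong_typed[OF z]
  have wt: "bwt u" "bwt v" "bwt w" "bwt x" "bwt y" "bwt z" using ty by simp_all
  have src: "bsrc u = m" "bsrc v = m" "bsrc w = m" "bsrc x = m" "bsrc y = m" "bsrc z = m"
    using ty by (simp_all add: m_n_def)
  have tgt: "btgt u = n" "btgt v = n" "btgt w = n" "btgt x = n" "btgt y = n" "btgt z = n"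
    using ty by (simp_all add: m_n_def)
  note types = wt src tgt
  let ?V = "Hom PC m n"
  interpret V: Module.module class_ring ?V by (rule hom_module)
  have car: "cls u \<in> carrier ?V" "cls v \<in> carrier ?V" "cls w \<in> carrier ?V"
    by (simp_all add: types cls_carrier)
  have eq: "cls (lin3 r1 r2 r3 p1 p2 p3)
      = r1 \<odot>\<^bsub>?V\<^esub> cls p1 \<oplus>\<^bsub>?V\<^esub> r2 \<odot>\<^bsub>?V\<^esub> cls p2 \<oplus>\<^bsub>?V\<^esub> r3 \<odot>\<^bsub>?V\<^esub> cls p3"
    if "bwt p1" "bwt p2" "bwt p3" "bsrc p1 = m" "bsrc p2 = m" "bsrc p3 = m"
      "btgt p1 = n" "btgt p2 = n" "btgt p3 = n" for r1 r2 r3 p1 p2 p3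
    using that by (intro cls_lin3) simp_all
  note eqs = cls_eqI[OF x] cls_eqI[OF y] cls_eqI[OF z]
  have dist: "(r + s) \<odot>\<^bsub>?V\<^esub> q = r \<odot>\<^bsub>?V\<^esub> q \<oplus>\<^bsub>?V\<^esub> s \<odot>\<^bsub>?V\<^esub> q"
    "(r * s) \<odot>\<^bsub>?V\<^esub> q = r \<odot>\<^bsub>?V\<^esub> (s \<odot>\<^bsub>?V\<^esub> q)"
    "r \<odot>\<^bsub>?V\<^esub> q \<in> carrier ?V"
    if "q \<in> carrier ?V" for q r s
    using that V.smult_l_distr[of r s q] V.smult_assoc1[of r s q] V.smult_closed[of r q] by simp_all
  have distr: "r \<odot>\<^bsub>?V\<^esub> (p \<oplus>\<^bsub>?V\<^esub> q) = r \<odot>\<^bsub>?V\<^esub> p \<oplus>\<^bsub>?V\<^esub> r \<odot>\<^bsub>?V\<^esub> q"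
    if "p \<in> carrier ?V" "q \<in> carrier ?V" for p q r
    using that V.smult_r_distr[of r p q] by simp
  let ?r = "lin3 (a * x1 + b * y1 + c * z1) (a * x2 + b * y2 + c * z2) (a * x3 + b * y3 + c * z3) u v w"
  have "cls t = cls (lin3 a b c x y z)" by (rule cls_eqI[OF t])
  also have "\<dots> = cls ?r"
    by (simp only: eq types eqs) (simp add: car dist distr V.a_ac)
  finally show ?thesis using cls_eq[of ?r t] types by simp
qed

lemma scale_lin3:
  assumes "t \<approx> a *\<^sub>e u" "bwt v" "bwt w" "bsrc v = bsrc u" "bsrc w = bsrc u" "btgt v = btgt u" "btgt w = btgt u"
  shows "t \<approx> lin3 a 0 0 u v w" "t \<approx> lin3 0 a 0 v u w" "t \<approx> lin3 0 0 a v w u"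
proof -
  define m n where "m = bsrc u" "n = btgt u"
  have types: "bwt u" "bwt v" "bwt w" "bsrc u = m" "bsrc v = m" "bsrc w = m"
    "btgt u = n" "btgt v = n" "btgt w = n"
    using bcong_typed[OF assms(1)] assms(2-) by (simp_all add: m_n_def)
  let ?V = "Hom PC m n"
  interpret V: Module.module class_ring ?V by (rule hom_module)
  have car: "cls u \<in> carrier ?V" "cls v \<in> carrier ?V" "cls w \<in> carrier ?V"
    by (simp_all add: types cls_carrier)
  have z: "0 \<odot>\<^bsub>?V\<^esub> q = \<zero>\<^bsub>?V\<^esub>" "r \<odot>\<^bsub>?V\<^esub> q \<in> carrier ?V" if "q \<in> carrier ?V" for q r
    using that V.smult_l_null[of q] V.smult_closed[of r q] by simp_all
  have t: "cls t = a \<odot>\<^bsub>?V\<^esub> cls u" using cls_eqI[OF assms(1)] types by (simp add: smult_cls)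
  have "cls t = cls (lin3 a 0 0 u v w)" "cls t = cls (lin3 0 a 0 v u w)" "cls t = cls (lin3 0 0 a v w u)"
    unfolding t by (subst cls_lin3[where m = m and n = n]; simp add: types car z)+
  thus "t \<approx> lin3 a 0 0 u v w" "t \<approx> lin3 0 a 0 v u w" "t \<approx> lin3 0 0 a v w u"
    by (intro iffD1[OF cls_eq]; simp add: types)+
qed

lemma lin3_same:
  assumes t: "t \<approx> lin3 a b c u u u"
  shows "t \<approx> (a + b + c) *\<^sub>e u"
proof -
  note ty = bcong_typed[OF t]
  note t
  also have "lin3 a b c u u u \<approx> (a + b) *\<^sub>e u +\<^sub>e c *\<^sub>e u"
    using ty by (intro bcong.add_cong bcong.sym[OF bcong.add_scale] bcong.refl) auto
  also have "\<dots> \<approx> (a + b + c) *\<^sub>e u" using ty by (intro bcong.sym[OF bcong.add_scale]) auto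
  finally show ?thesis .
qed

lemma lin3_scale:
  assumes t: "t \<approx> lin3 a b c x y z" and x: "x \<approx> x1 *\<^sub>e u" and y: "y \<approx> y1 *\<^sub>e u" and z: "z \<approx> z1 *\<^sub>e u"
  shows "t \<approx> (a * x1 + b * y1 + c * z1) *\<^sub>e u"
proof -
  note ty = bcong_typed[OF x]
  show ?thesis
    using lin3_same[OF lin3_sum[OF t scale_lin3(1)[OF x] scale_lin3(1)[OF y] scale_lin3(1)[OF z], of u u]] ty
    by simp
qed

lemma comp_lin3:
  assumes t: "t \<approx> lin3 a b c x y z" and s: "bwt (s \<circ>\<^sub>e t)"
  shows "s \<circ>\<^sub>e t \<approx> lin3 a b c (s \<circ>\<^sub>e x) (s \<circ>\<^sub>e y) (s \<circ>\<^sub>e z)"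
proof -
  note ty = bcong_typed[OF t]
  have "s \<circ>\<^sub>e t \<approx> s \<circ>\<^sub>e lin3 a b c x y z" by (rule comp_left[OF t s])
  also have "\<dots> \<approx> s \<circ>\<^sub>e (a *\<^sub>e x +\<^sub>e b *\<^sub>e y) +\<^sub>e s \<circ>\<^sub>e (c *\<^sub>e z)"
    using ty s by (intro bcong.comp_add_right) auto
  also have "\<dots> \<approx> (s \<circ>\<^sub>e (a *\<^sub>e x) +\<^sub>e s \<circ>\<^sub>e (b *\<^sub>e y)) +\<^sub>e s \<circ>\<^sub>e (c *\<^sub>e z)"
    using ty s by (intro bcong.add_cong bcong.comp_add_right bcong.refl) auto
  also have "\<dots> \<approx> lin3 a b c (s \<circ>\<^sub>e x) (s \<circ>\<^sub>e y) (s \<circ>\<^sub>e z)"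
    using ty s by (intro bcong.add_cong bcong.comp_scale_right) auto
  finally show ?thesis .
qed

lemma lin3_comp:
  assumes s: "s \<approx> lin3 a b c x y z" and t: "bwt (s \<circ>\<^sub>e t)"
  shows "s \<circ>\<^sub>e t \<approx> lin3 a b c (x \<circ>\<^sub>e t) (y \<circ>\<^sub>e t) (z \<circ>\<^sub>e t)"
proof -
  note ty = bcong_typed[OF s]
  have "s \<circ>\<^sub>e t \<approx> lin3 a b c x y z \<circ>\<^sub>e t" by (rule comp_right[OF s t])
  also have "\<dots> \<approx> (a *\<^sub>e x +\<^sub>e b *\<^sub>e y) \<circ>\<^sub>e t +\<^sub>e (c *\<^sub>e z) \<circ>\<^sub>e t"
    using ty t by (intro bcong.comp_add_left) auto
  also have "\<dots> \<approx> ((a *\<^sub>e x) \<circ>\<^sub>e t +\<^sub>e (b *\<^sub>e y) \<circ>\<^sub>e t) +\<^sub>e (c *\<^sub>e z) \<circ>\<^sub>e t"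
    using ty t by (intro bcong.add_cong bcong.comp_add_left bcong.refl) auto
  also have "\<dots> \<approx> lin3 a b c (x \<circ>\<^sub>e t) (y \<circ>\<^sub>e t) (z \<circ>\<^sub>e t)"
    using ty t by (intro bcong.add_cong bcong.comp_scale_left) auto
  finally show ?thesis .
qed

lemma lay_lin3:
  assumes t: "t \<approx> lin3 a b c x y z"
  shows "lay i t k \<approx> lin3 a b c (lay i x k) (lay i y k) (lay i z k)"
proof -
  note ty = bcong_typed[OF t]
  have "lay i t k \<approx> lay i (lin3 a b c x y z) k" by (rule lay_cong[OF t])
  also have "\<dots> \<approx> lay i (a *\<^sub>e x +\<^sub>e b *\<^sub>e y) k +\<^sub>e lay i (c *\<^sub>e z) k"
    using ty by (intro lay_add) auto
  also have "\<dots> \<approx> (lay i (a *\<^sub>e x) k +\<^sub>e lay i (b *\<^sub>e y) k) +\<^sub>e lay i (c *\<^sub>e z) k"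
    using ty by (intro bcong.add_cong lay_add bcong.refl) auto
  also have "\<dots> \<approx> lin3 a b c (lay i x k) (lay i y k) (lay i z k)"
    using ty by (intro bcong.add_cong lay_scale) auto
  finally show ?thesis .
qed

lemma lin3_cong:
  assumes "t \<approx> lin3 a b c x y z" "x \<approx> x'" "y \<approx> y'" "z \<approx> z'"
  shows "t \<approx> lin3 a b c x' y' z'"
proof -
  note ty = bcong_typed[OF assms(1)]
  note assms(1)
  also have "lin3 a b c x y z \<approx> lin3 a b c x' y' z'"
    using ty assms by (intro bcong.add_cong bcong.scale_cong) auto
  finally show ?thesis .
qed

lemma comp_scale:
  assumes "t \<approx> c *\<^sub>e v" "bwt (s \<circ>\<^sub>e t)" "s \<circ>\<^sub>e v \<approx> d *\<^sub>e w"
  shows "s \<circ>\<^sub>e t \<approx> (c * d) *\<^sub>e w"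
proof -
  have "s \<circ>\<^sub>e t \<approx> s \<circ>\<^sub>e (c *\<^sub>e v)" by (rule comp_left[OF assms(1,2)])
  also have "\<dots> \<approx> c *\<^sub>e (s \<circ>\<^sub>e v)"
    using bcong_typed[OF assms(3)] by (intro bcong.comp_scale_right) simp
  finally show ?thesis using assms(3) by (rule scale_scale')
qed

lemma scale_comp:
  assumes "s \<approx> c *\<^sub>e v" "bwt (s \<circ>\<^sub>e t)" "v \<circ>\<^sub>e t \<approx> d *\<^sub>e w"
  shows "s \<circ>\<^sub>e t \<approx> (c * d) *\<^sub>e w"
proof -
  have "s \<circ>\<^sub>e t \<approx> (c *\<^sub>e v) \<circ>\<^sub>e t" by (rule comp_right[OF assms(1,2)])
  also have "\<dots> \<approx> c *\<^sub>e (v \<circ>\<^sub>e t)"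
    using bcong_typed[OF assms(3)] by (intro bcong.comp_scale_left) simp
  finally show ?thesis using assms(3) by (rule scale_scale')
qed

lemma comp_Ident: "bwt t \<Longrightarrow> btgt t = n \<Longrightarrow> Ident n \<circ>\<^sub>e t \<approx> t" "bwt t \<Longrightarrow> bsrc t = n \<Longrightarrow> t \<circ>\<^sub>e Ident n \<approx> t"
  using bcong.comp_id_left[of t] bcong.comp_id_right[of t] by auto

lemma scale_tens_Ident:
  assumes "s \<circ>\<^sub>e t \<approx> c *\<^sub>e v"
  shows "(s \<otimes>\<^sub>e Ident k) \<circ>\<^sub>e (t \<otimes>\<^sub>e Ident k) \<approx> c *\<^sub>e (v \<otimes>\<^sub>e Ident k)"
proof -
  note ty = bcong_typed[OF assms]
  have "(s \<otimes>\<^sub>e Ident k) \<circ>\<^sub>e (t \<otimes>\<^sub>e Ident k) \<approx> (s \<circ>\<^sub>e t) \<otimes>\<^sub>e Ident k"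
    using ty by (intro bcong.sym[OF tens_Ident_comp]) auto
  also have "\<dots> \<approx> (c *\<^sub>e v) \<otimes>\<^sub>e Ident k" by (intro tens_right assms) auto
  also have "\<dots> \<approx> c *\<^sub>e (v \<otimes>\<^sub>e Ident k)" using ty by (intro bcong.tens_scale_left) auto
  finally show ?thesis .
qed

lemma scale_Ident_tens:
  assumes "s \<circ>\<^sub>e t \<approx> c *\<^sub>e v"
  shows "(Ident k \<otimes>\<^sub>e s) \<circ>\<^sub>e (Ident k \<otimes>\<^sub>e t) \<approx> c *\<^sub>e (Ident k \<otimes>\<^sub>e v)"
proof -
  note ty = bcong_typed[OF assms]
  have "(Ident k \<otimes>\<^sub>e s) \<circ>\<^sub>e (Ident k \<otimes>\<^sub>e t) \<approx> Ident k \<otimes>\<^sub>e (s \<circ>\<^sub>e t)"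
    using ty by (intro bcong.sym[OF Ident_tens_comp]) auto
  also have "\<dots> \<approx> Ident k \<otimes>\<^sub>e (c *\<^sub>e v)" by (intro tens_left assms) auto
  also have "\<dots> \<approx> c *\<^sub>e (Ident k \<otimes>\<^sub>e v)" using ty by (intro bcong.tens_scale_right) auto
  finally show ?thesis .
qed

lemma lay_prod:
  assumes "s \<circ>\<^sub>e t \<approx> v" "lay i s k \<approx> s'" "lay i t k \<approx> t'" "lay i v k \<approx> v'"
  shows "s' \<circ>\<^sub>e t' \<approx> v'"
proof -
  note ty = bcong_typed[OF assms(1)] bcong_typed[OF assms(2)] bcong_typed[OF assms(3)]
  have "s' \<circ>\<^sub>e t' \<approx> lay i (s \<circ>\<^sub>e t) k" using ty assms by (intro bcong.sym[OF lay_comp_I]) auto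
  also have "\<dots> \<approx> lay i v k" by (rule lay_cong[OF assms(1)])
  also note assms(4)
  finally show ?thesis .
qed

end

text \<open>What the first part takes from a category of Brauer type: the relations and an inverse
  of H hold up to congruence, and \<open>free1\<close>, \<open>free3\<close> are the linear
  independence of the few standard expressions whose coefficients are compared.\<close>

locale brauer_relations = typed_relations \<pi> R
  for \<pi> :: bit and R :: "('k::field bexp \<times> 'k bexp) set" +
  fixes P :: "'k brauer_params" and \<epsilon> :: 'k
  assumes sign: "koszul \<pi> \<pi> = \<epsilon>"
    and relations: "\<And>s t. (s, t) \<in> defining_relations P \<Longrightarrow> s \<approx> t"
    and invertible: "\<exists>g. g \<circ>\<^sub>e GenH \<approx> Ident 2 \<and> GenH \<circ>\<^sub>e g \<approx> Ident 2"
    and free1: "\<And>t c d. t \<in> {Ident 0, Ident 1, GenU, GenA} \<Longrightarrow> c *\<^sub>e t \<approx> d *\<^sub>e t \<Longrightarrow> c = d"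
    and free3: "\<And>x y z a b c a' b' c'.
      (x, y, z) \<in> {(UI, IH \<circ>\<^sub>e UI, IU), (AI, AI \<circ>\<^sub>e IH, IA), (Ident 2, GenH, GenU \<circ>\<^sub>e GenA)}
        \<Longrightarrow> lin3 a b c x y z \<approx> lin3 a' b' c' x y z \<Longrightarrow> a = a' \<and> b = b' \<and> c = c'"
    and f: "par_f P = 0" "par_f' P = 0"
    and lambda_neq: "par_lambda' P \<noteq> par_lambda P"
    and sigma: "par_sigma P \<noteq> 0"
begin

abbreviation "la \<equiv> par_lambda P" abbreviation "la' \<equiv> par_lambda' P"
abbreviation "de \<equiv> par_delta P"
abbreviation "si \<equiv> par_sigma P" abbreviation "si' \<equiv> par_sigma' P"
abbreviation "ro \<equiv> par_rho P"
abbreviation "a \<equiv> par_a P" abbreviation "b \<equiv> par_b P" abbreviation "c \<equiv> par_c P"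
abbreviation "d \<equiv> par_d P" abbreviation "e \<equiv> par_e P"
abbreviation "d' \<equiv> par_d' P" abbreviation "e' \<equiv> par_e' P"
abbreviation "D \<equiv> par_D P" abbreviation "E \<equiv> par_E P" abbreviation "F \<equiv> par_F P"
abbreviation "D' \<equiv> par_D' P" abbreviation "E' \<equiv> par_E' P" abbreviation "F' \<equiv> par_F' P"

lemma rel:
  "GenH \<circ>\<^sub>e GenU \<approx> la *\<^sub>e GenU" "GenA \<circ>\<^sub>e GenH \<approx> la' *\<^sub>e GenA" "GenA \<circ>\<^sub>e GenU \<approx> de *\<^sub>e Ident 0"
  "AI \<circ>\<^sub>e IU \<approx> si *\<^sub>e Ident 1" "IA \<circ>\<^sub>e UI \<approx> si' *\<^sub>e Ident 1"
  "AI \<circ>\<^sub>e (IH \<circ>\<^sub>e UI) \<approx> ro *\<^sub>e Ident 1"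
  "GenH \<circ>\<^sub>e GenH \<approx> lin3 a b c (Ident 2) GenH (GenU \<circ>\<^sub>e GenA)"
  "HI \<circ>\<^sub>e IU \<approx> lin3 d e 0 UI (IH \<circ>\<^sub>e UI) IU"
  "HI \<circ>\<^sub>e (IH \<circ>\<^sub>e UI) \<approx> lin3 D E F UI (IH \<circ>\<^sub>e UI) IU"
  "IA \<circ>\<^sub>e HI \<approx> lin3 d' e' 0 AI (AI \<circ>\<^sub>e IH) IA"
  "AI \<circ>\<^sub>e (IH \<circ>\<^sub>e HI) \<approx> lin3 D' E' F' AI (AI \<circ>\<^sub>e IH) IA"
  "HI \<circ>\<^sub>e (IH \<circ>\<^sub>e HI) \<approx> IH \<circ>\<^sub>e (HI \<circ>\<^sub>e IH)"
  by (rule relations, simp add: defining_relations_def parameter_relations_def braid_relation_def f)+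

lemma Ident_tens: "Ident m \<otimes>\<^sub>e Ident n \<approx> Ident (m + n)"
  by (rule bcong.tens_id)

lemma scale_to: "t \<approx> r *\<^sub>e v \<Longrightarrow> v \<approx> w \<Longrightarrow> t \<approx> r *\<^sub>e w"
  by (meson bcong.scale_cong bcong.trans)

lemma rel3:
  "HI \<circ>\<^sub>e UI \<approx> la *\<^sub>e UI" "AI \<circ>\<^sub>e HI \<approx> la' *\<^sub>e AI" "AI \<circ>\<^sub>e UI \<approx> de *\<^sub>e Ident 1"
  "IH \<circ>\<^sub>e IU \<approx> la *\<^sub>e IU" "IA \<circ>\<^sub>e IH \<approx> la' *\<^sub>e IA" "IA \<circ>\<^sub>e IU \<approx> de *\<^sub>e Ident 1"
proof -
  show "AI \<circ>\<^sub>e UI \<approx> de *\<^sub>e Ident 1"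
    using scale_to[OF scale_tens_Ident[OF rel(3), of 1] Ident_tens] by simp
  show "IA \<circ>\<^sub>e IU \<approx> de *\<^sub>e Ident 1"
    using scale_to[OF scale_Ident_tens[OF rel(3), of 1] Ident_tens] by simp
qed (rule scale_tens_Ident scale_Ident_tens, rule rel)+

lemma HH3:
  "HI \<circ>\<^sub>e HI \<approx> lin3 a b c (Ident 3) HI (UI \<circ>\<^sub>e AI)"
  "IH \<circ>\<^sub>e IH \<approx> lin3 a b c (Ident 3) IH (IU \<circ>\<^sub>e IA)"
proof -
  have 1: "lay 0 t 1 \<approx> t \<otimes>\<^sub>e Ident 1" "lay 1 t 0 \<approx> Ident 1 \<otimes>\<^sub>e t" if "bwt t" for t
    using that by (auto intro: bcong.sym[OF tens_Ident_lay] bcong.sym[OF Ident_tens_lay])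
  have "lay 0 (GenH \<circ>\<^sub>e GenH) 1 \<approx> HI \<circ>\<^sub>e HI" "lay 0 (GenU \<circ>\<^sub>e GenA) 1 \<approx> UI \<circ>\<^sub>e AI"
    by (intro lay_comp_I 1; simp)+
  note hh = this
  have "lay 0 (Ident 2) 1 \<approx> Ident 3" using lay_Ident[of 0 2 1] by (simp add: numeral_3_eq_3)
  from lin3_cong[OF lay_lin3[OF rel(7)] this 1(1) hh(2)] show "HI \<circ>\<^sub>e HI \<approx> lin3 a b c (Ident 3) HI (UI \<circ>\<^sub>e AI)"
    by (intro cong_trans[OF bcong.sym[OF hh(1)]]) simp
  have "lay 1 (GenH \<circ>\<^sub>e GenH) 0 \<approx> IH \<circ>\<^sub>e IH" "lay 1 (GenU \<circ>\<^sub>e GenA) 0 \<approx> IU \<circ>\<^sub>e IA"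
    by (intro lay_comp_I 1; simp)+
  note hh = this
  have "lay 1 (Ident 2) 0 \<approx> Ident 3" using lay_Ident[of 1 2 0] by (simp add: numeral_3_eq_3)
  from lin3_cong[OF lay_lin3[OF rel(7)] this 1(2) hh(2)] show "IH \<circ>\<^sub>e IH \<approx> lin3 a b c (Ident 3) IH (IU \<circ>\<^sub>e IA)"
    by (intro cong_trans[OF bcong.sym[OF hh(1)]]) simp
qed

lemma assoc_eq:
  assumes "s \<circ>\<^sub>e (t \<circ>\<^sub>e v) \<approx> x" "(s \<circ>\<^sub>e t) \<circ>\<^sub>e v \<approx> y"
  shows "x \<approx> y"
proof -
  note ty = bcong_typed[OF assms(2)]
  have "x \<approx> s \<circ>\<^sub>e (t \<circ>\<^sub>e v)" by (rule bcong.sym[OF assms(1)])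
  also have "\<dots> \<approx> (s \<circ>\<^sub>e t) \<circ>\<^sub>e v" using ty by (intro comp_assoc') simp
  also note assms(2)
  finally show ?thesis .
qed

lemma unit1: "bwt t \<Longrightarrow> t \<approx> 1 *\<^sub>e t"
  by (rule scale_one'[OF bcong.refl])

text \<open>If \<lambda> were 0, then H U would be null, and applying the inverse of H would make U
  null against freeness; likewise for \<lambda>' and A.\<close>

lemma la_nonzero: "la \<noteq> 0" "la' \<noteq> 0"
proof -
  obtain g where g: "g \<circ>\<^sub>e GenH \<approx> Ident 2" "GenH \<circ>\<^sub>e g \<approx> Ident 2" using invertible by blast
  note ty = bcong_typed[OF g(1)] bcong_typed[OF g(2)]
  show "la \<noteq> 0"
  proof
    assume "la = 0"
    hence "GenH \<circ>\<^sub>e GenU \<approx> 0 *\<^sub>e GenU" using rel(1) by simp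
    also have "\<dots> \<approx> Null 0 2" using scale_zero[of GenU] by simp
    finally have z: "GenH \<circ>\<^sub>e GenU \<approx> Null 0 2" .
    have "g \<circ>\<^sub>e (GenH \<circ>\<^sub>e GenU) \<approx> g \<circ>\<^sub>e Null 0 2" using ty by (intro comp_left[OF z]) simp
    also have "\<dots> \<approx> Null 0 2" using ty comp_null_right[of g 2 0] by simp
    also have "\<dots> \<approx> 0 *\<^sub>e GenU" using bcong.sym[OF scale_zero[of GenU]] by simp
    finally have 1: "g \<circ>\<^sub>e (GenH \<circ>\<^sub>e GenU) \<approx> 0 *\<^sub>e GenU" .
    have "(g \<circ>\<^sub>e GenH) \<circ>\<^sub>e GenU \<approx> Ident 2 \<circ>\<^sub>e GenU" using ty by (intro comp_right[OF g(1)]) simp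
    also have "\<dots> \<approx> 1 *\<^sub>e GenU" by (rule scale_one'[OF comp_Ident(1)]) simp_all
    finally show False using free1[OF _ assoc_eq[OF 1]] by fastforce
  qed
  show "la' \<noteq> 0"
  proof
    assume "la' = 0"
    hence "GenA \<circ>\<^sub>e GenH \<approx> 0 *\<^sub>e GenA" using rel(2) by simp
    also have "\<dots> \<approx> Null 2 0" using scale_zero[of GenA] by simp
    finally have z: "GenA \<circ>\<^sub>e GenH \<approx> Null 2 0" .
    have "(GenA \<circ>\<^sub>e GenH) \<circ>\<^sub>e g \<approx> Null 2 0 \<circ>\<^sub>e g" using ty by (intro comp_right[OF z]) simp
    also have "\<dots> \<approx> Null 2 0" using ty comp_null_left[of g 2 0] by simp
    also have "\<dots> \<approx> 0 *\<^sub>e GenA" using bcong.sym[OF scale_zero[of GenA]] by simp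
    finally have 1: "(GenA \<circ>\<^sub>e GenH) \<circ>\<^sub>e g \<approx> 0 *\<^sub>e GenA" .
    have "GenA \<circ>\<^sub>e (GenH \<circ>\<^sub>e g) \<approx> GenA \<circ>\<^sub>e Ident 2" using ty by (intro comp_left[OF g(2)]) simp
    also have "\<dots> \<approx> 1 *\<^sub>e GenA" by (rule scale_one'[OF comp_Ident(2)]) simp_all
    finally show False using free1[OF _ assoc_eq[OF _ 1]] by fastforce
  qed
qed

text \<open>The word A H U equals both \<lambda> \<delta> and \<lambda>' \<delta>.\<close>

lemma de_zero: "de = 0"
proof -
  have "GenA \<circ>\<^sub>e (GenH \<circ>\<^sub>e GenU) \<approx> (la * de) *\<^sub>e Ident 0"
    by (rule comp_scale[OF rel(1) _ rel(3)]) simp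
  moreover have "(GenA \<circ>\<^sub>e GenH) \<circ>\<^sub>e GenU \<approx> (la' * de) *\<^sub>e Ident 0"
    by (rule scale_comp[OF rel(2) _ rel(3)]) simp
  ultimately have "la * de = la' * de" by (intro free1[OF _ assoc_eq]) auto
  thus ?thesis using lambda_neq by simp
qed

lemma UA_comp: "(GenU \<circ>\<^sub>e GenA) \<circ>\<^sub>e GenU \<approx> 0 *\<^sub>e GenU" "GenA \<circ>\<^sub>e (GenU \<circ>\<^sub>e GenA) \<approx> 0 *\<^sub>e GenA"
proof -
  have "GenU \<circ>\<^sub>e (GenA \<circ>\<^sub>e GenU) \<approx> (de * 1) *\<^sub>e GenU"
    by (rule comp_scale[OF rel(3) _ scale_one'[OF comp_Ident(2)]]) simp_all
  from cong_trans[OF bcong.comp_assoc this] show "(GenU \<circ>\<^sub>e GenA) \<circ>\<^sub>e GenU \<approx> 0 *\<^sub>e GenU"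
    by (simp add: de_zero)
  have "(GenA \<circ>\<^sub>e GenU) \<circ>\<^sub>e GenA \<approx> (de * 1) *\<^sub>e GenA"
    by (rule scale_comp[OF rel(3) _ scale_one'[OF comp_Ident(1)]]) simp_all
  from cong_trans[OF comp_assoc' this] show "GenA \<circ>\<^sub>e (GenU \<circ>\<^sub>e GenA) \<approx> 0 *\<^sub>e GenA"
    by (simp add: de_zero)
qed

text \<open>The quadratic relation is multiplied by U on one side and by A on the other. Its third
  term yields a multiple of \<delta> = 0, so \<lambda> and \<lambda>' are roots of the same
  polynomial.\<close>

lemma quadratic: "la\<^sup>2 = a + b * la" "la'\<^sup>2 = a + b * la'"
proof -
  have "GenH \<circ>\<^sub>e (GenH \<circ>\<^sub>e GenU) \<approx> (la * la) *\<^sub>e GenU"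
    by (rule comp_scale[OF rel(1) _ rel(1)]) simp
  moreover have "(GenH \<circ>\<^sub>e GenH) \<circ>\<^sub>e GenU \<approx> (a * 1 + b * la + c * 0) *\<^sub>e GenU"
    by (rule lin3_scale[OF lin3_comp[OF rel(7)] scale_one'[OF comp_Ident(1)] rel(1) UA_comp(1)]) simp_all
  ultimately have "la * la = a * 1 + b * la + c * 0" by (intro free1[OF _ assoc_eq]) auto
  thus "la\<^sup>2 = a + b * la" by (simp add: power2_eq_square)
  have "(GenA \<circ>\<^sub>e GenH) \<circ>\<^sub>e GenH \<approx> (la' * la') *\<^sub>e GenA"
    by (rule scale_comp[OF rel(2) _ rel(2)]) simp
  moreover have "GenA \<circ>\<^sub>e (GenH \<circ>\<^sub>e GenH) \<approx> (a * 1 + b * la' + c * 0) *\<^sub>e GenA"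
    by (rule lin3_scale[OF comp_lin3[OF rel(7)] scale_one'[OF comp_Ident(2)] rel(2) UA_comp(2)]) simp_all
  ultimately have "a * 1 + b * la' + c * 0 = la' * la'" by (intro free1[OF _ assoc_eq]) auto
  thus "la'\<^sup>2 = a + b * la'" by (simp add: power2_eq_square)
qed

text \<open>From the words \<open>AI\<close>, \<open>HI\<close>, \<open>IU\<close> and
  \<open>IA\<close>, \<open>HI\<close>, \<open>UI\<close>: the terms with d and d' carry the factor
  \<delta> = 0 and those with f and f' are absent, so only \<rho> remains.\<close>

lemma rho_eqs: "la' * si = e * ro" "la * si' = e' * ro"
proof -
  have "(AI \<circ>\<^sub>e HI) \<circ>\<^sub>e IU \<approx> (la' * si) *\<^sub>e Ident 1"
    by (rule scale_comp[OF rel3(2) _ rel(4)]) simp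
  moreover have "AI \<circ>\<^sub>e (HI \<circ>\<^sub>e IU) \<approx> (d * de + e * ro + 0 * si) *\<^sub>e Ident 1"
    by (rule lin3_scale[OF comp_lin3[OF rel(8)] rel3(3) rel(6) rel(4)]) simp
  ultimately have "d * de + e * ro + 0 * si = la' * si" by (intro free1[OF _ assoc_eq]) auto
  thus "la' * si = e * ro" by (simp add: de_zero)
  have 1: "(AI \<circ>\<^sub>e IH) \<circ>\<^sub>e UI \<approx> ro *\<^sub>e Ident 1" by (rule cong_trans[OF bcong.comp_assoc rel(6)]) simp
  have "IA \<circ>\<^sub>e (HI \<circ>\<^sub>e UI) \<approx> (la * si') *\<^sub>e Ident 1"
    by (rule comp_scale[OF rel3(1) _ rel(5)]) simp
  moreover have "(IA \<circ>\<^sub>e HI) \<circ>\<^sub>e UI \<approx> (d' * de + e' * ro + 0 * si') *\<^sub>e Ident 1"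
    by (rule lin3_scale[OF lin3_comp[OF rel(10)] rel3(3) 1 rel(5)]) simp
  ultimately have "la * si' = d' * de + e' * ro + 0 * si'" by (intro free1[OF _ assoc_eq]) auto
  thus "la * si' = e' * ro" by (simp add: de_zero)
qed

lemma cup_cap3:
  "(UI \<circ>\<^sub>e AI) \<circ>\<^sub>e IU \<approx> si *\<^sub>e UI" "IA \<circ>\<^sub>e (UI \<circ>\<^sub>e AI) \<approx> si' *\<^sub>e AI"
  "(IU \<circ>\<^sub>e IA) \<circ>\<^sub>e UI \<approx> si' *\<^sub>e IU"
proof -
  have "UI \<circ>\<^sub>e (AI \<circ>\<^sub>e IU) \<approx> (si * 1) *\<^sub>e UI"
    by (rule comp_scale[OF rel(4) _ scale_one'[OF comp_Ident(2)]]) simp_all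
  from cong_trans[OF bcong.comp_assoc this] show "(UI \<circ>\<^sub>e AI) \<circ>\<^sub>e IU \<approx> si *\<^sub>e UI" by simp
  have "(IA \<circ>\<^sub>e UI) \<circ>\<^sub>e AI \<approx> (si' * 1) *\<^sub>e AI"
    by (rule scale_comp[OF rel(5) _ scale_one'[OF comp_Ident(1)]]) simp_all
  from cong_trans[OF comp_assoc' this] show "IA \<circ>\<^sub>e (UI \<circ>\<^sub>e AI) \<approx> si' *\<^sub>e AI" by simp
  have "IU \<circ>\<^sub>e (IA \<circ>\<^sub>e UI) \<approx> (si' * 1) *\<^sub>e IU"
    by (rule comp_scale[OF rel(5) _ scale_one'[OF comp_Ident(2)]]) simp_all
  from cong_trans[OF bcong.comp_assoc this] show "(IU \<circ>\<^sub>e IA) \<circ>\<^sub>e UI \<approx> si' *\<^sub>e IU" by simp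
qed

lemma HHU_eqs: "d * la + e * D = b * d + c * si" "e * E = b * e" "e * F = a"
proof -
  have "HI \<circ>\<^sub>e UI \<approx> lin3 la 0 0 UI (IH \<circ>\<^sub>e UI) IU" by (rule scale_lin3(1)[OF rel3(1)]) simp_all
  from lin3_sum[OF comp_lin3[OF rel(8)] this rel(9) rel(8)]
  have 1: "HI \<circ>\<^sub>e (HI \<circ>\<^sub>e IU) \<approx> lin3 (d * la + e * D + 0 * d) (d * 0 + e * E + 0 * e) (d * 0 + e * F + 0 * 0)
      UI (IH \<circ>\<^sub>e UI) IU" by simp
  have x: "Ident 3 \<circ>\<^sub>e IU \<approx> lin3 0 0 1 UI (IH \<circ>\<^sub>e UI) IU"
    by (rule scale_lin3(3)[OF scale_one'[OF comp_Ident(1)]]) simp_all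
  have z: "(UI \<circ>\<^sub>e AI) \<circ>\<^sub>e IU \<approx> lin3 si 0 0 UI (IH \<circ>\<^sub>e UI) IU"
    by (rule scale_lin3(1)[OF cup_cap3(1)]) simp_all
  from lin3_sum[OF lin3_comp[OF HH3(1)] x rel(8) z]
  have 2: "(HI \<circ>\<^sub>e HI) \<circ>\<^sub>e IU \<approx> lin3 (a * 0 + b * d + c * si) (a * 0 + b * e + c * 0) (a * 1 + b * 0 + c * 0)
      UI (IH \<circ>\<^sub>e UI) IU" by simp
  from free3[OF _ assoc_eq[OF 1 2]]
  show "d * la + e * D = b * d + c * si" "e * E = b * e" "e * F = a" by simp_all
qed

lemma AHH_eqs: "d' * la' + e' * D' = b * d' + c * si'" "e' * E' = b * e'" "e' * F' = a"
proof -
  have x: "AI \<circ>\<^sub>e HI \<approx> lin3 la' 0 0 AI (AI \<circ>\<^sub>e IH) IA" by (rule scale_lin3(1)[OF rel3(2)]) simp_all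
  have y: "(AI \<circ>\<^sub>e IH) \<circ>\<^sub>e HI \<approx> lin3 D' E' F' AI (AI \<circ>\<^sub>e IH) IA"
    by (rule cong_trans[OF bcong.comp_assoc rel(11)]) simp
  from lin3_sum[OF lin3_comp[OF rel(10)] x y rel(10)]
  have 1: "(IA \<circ>\<^sub>e HI) \<circ>\<^sub>e HI \<approx> lin3 (d' * la' + e' * D' + 0 * d') (d' * 0 + e' * E' + 0 * e') (d' * 0 + e' * F' + 0 * 0)
      AI (AI \<circ>\<^sub>e IH) IA" by simp
  have x: "IA \<circ>\<^sub>e Ident 3 \<approx> lin3 0 0 1 AI (AI \<circ>\<^sub>e IH) IA"
    by (rule scale_lin3(3)[OF scale_one'[OF comp_Ident(2)]]) simp_all
  have z: "IA \<circ>\<^sub>e (UI \<circ>\<^sub>e AI) \<approx> lin3 si' 0 0 AI (AI \<circ>\<^sub>e IH) IA"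
    by (rule scale_lin3(1)[OF cup_cap3(2)]) simp_all
  from lin3_sum[OF comp_lin3[OF HH3(1)] x rel(10) z]
  have 2: "IA \<circ>\<^sub>e (HI \<circ>\<^sub>e HI) \<approx> lin3 (a * 0 + b * d' + c * si') (a * 0 + b * e' + c * 0) (a * 1 + b * 0 + c * 0)
      AI (AI \<circ>\<^sub>e IH) IA" by simp
  from free3[OF _ assoc_eq[OF 2 1]]
  show "d' * la' + e' * D' = b * d' + c * si'" "e' * E' = b * e'" "e' * F' = a" by auto
qed

text \<open>By the braid relation \<open>IH\<close>, \<open>HI\<close>, \<open>IH\<close>,
  \<open>UI\<close> compose to \<lambda> times \<open>HI\<close>, \<open>IH\<close>,
  \<open>UI\<close>. The first equation compares coefficients of \<open>UI\<close>; in those of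
  \<open>IU\<close> the terms with F cancel, which leaves the second.\<close>

lemma braid_eqs: "la * D = E * a" "E * (c * si') = 0"
proof -
  have x: "IH \<circ>\<^sub>e UI \<approx> lin3 0 1 0 UI (IH \<circ>\<^sub>e UI) IU" by (rule scale_lin3(2)[OF unit1]) simp_all
  have "Ident 3 \<circ>\<^sub>e UI \<approx> lin3 1 0 0 UI (IH \<circ>\<^sub>e UI) IU"
    by (rule scale_lin3(1)[OF scale_one'[OF comp_Ident(1)]]) simp_all
  note u = this
  have w: "(IU \<circ>\<^sub>e IA) \<circ>\<^sub>e UI \<approx> lin3 0 0 si' UI (IH \<circ>\<^sub>e UI) IU"
    by (rule scale_lin3(3)[OF cup_cap3(3)]) simp_all
  from lin3_sum[OF lin3_comp[OF HH3(2)] u x w]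
  have "(IH \<circ>\<^sub>e IH) \<circ>\<^sub>e UI \<approx> lin3 (a * 1 + b * 0 + c * 0) (a * 0 + b * 1 + c * 0) (a * 0 + b * 0 + c * si')
      UI (IH \<circ>\<^sub>e UI) IU" by simp
  from cong_trans[OF comp_assoc' this]
  have y: "IH \<circ>\<^sub>e (IH \<circ>\<^sub>e UI) \<approx> lin3 (a * 1 + b * 0 + c * 0) (a * 0 + b * 1 + c * 0) (a * 0 + b * 0 + c * si')
      UI (IH \<circ>\<^sub>e UI) IU" by simp
  have z: "IH \<circ>\<^sub>e IU \<approx> lin3 0 0 la UI (IH \<circ>\<^sub>e UI) IU" by (rule scale_lin3(3)[OF rel3(4)]) simp_all
  from lin3_sum[OF comp_lin3[OF rel(9)] x y z]
  have "IH \<circ>\<^sub>e (HI \<circ>\<^sub>e (IH \<circ>\<^sub>e UI)) \<approx> lin3 (D * 0 + E * (a * 1 + b * 0 + c * 0) + F * 0)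
      (D * 1 + E * (a * 0 + b * 1 + c * 0) + F * 0) (D * 0 + E * (a * 0 + b * 0 + c * si') + F * la)
      UI (IH \<circ>\<^sub>e UI) IU" by simp
  hence 1: "IH \<circ>\<^sub>e (HI \<circ>\<^sub>e (IH \<circ>\<^sub>e UI)) \<approx> lin3 (E * a) (D + E * b) (E * (c * si') + F * la) UI (IH \<circ>\<^sub>e UI) IU"
    by simp
  have "IH \<circ>\<^sub>e (HI \<circ>\<^sub>e (IH \<circ>\<^sub>e UI)) \<approx> IH \<circ>\<^sub>e ((HI \<circ>\<^sub>e IH) \<circ>\<^sub>e UI)"
    by (intro comp_left comp_assoc') simp_all
  also have "\<dots> \<approx> (IH \<circ>\<^sub>e (HI \<circ>\<^sub>e IH)) \<circ>\<^sub>e UI" by (intro comp_assoc') simp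
  also have "\<dots> \<approx> (HI \<circ>\<^sub>e (IH \<circ>\<^sub>e HI)) \<circ>\<^sub>e UI" by (intro comp_right bcong.sym[OF rel(12)]) simp
  also have "\<dots> \<approx> HI \<circ>\<^sub>e ((IH \<circ>\<^sub>e HI) \<circ>\<^sub>e UI)" by (intro bcong.comp_assoc) simp
  also have "\<dots> \<approx> HI \<circ>\<^sub>e (IH \<circ>\<^sub>e (HI \<circ>\<^sub>e UI))" by (intro comp_left bcong.comp_assoc) simp_all
  also have "\<dots> \<approx> (la * 1) *\<^sub>e (HI \<circ>\<^sub>e (IH \<circ>\<^sub>e UI))"
  proof (rule comp_scale)
    have "IH \<circ>\<^sub>e (HI \<circ>\<^sub>e UI) \<approx> (la * 1) *\<^sub>e (IH \<circ>\<^sub>e UI)"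
      by (rule comp_scale[OF rel3(1) _ unit1]) simp_all
    thus "IH \<circ>\<^sub>e (HI \<circ>\<^sub>e UI) \<approx> la *\<^sub>e (IH \<circ>\<^sub>e UI)" by simp
  qed (simp_all add: unit1)
  finally have "IH \<circ>\<^sub>e (HI \<circ>\<^sub>e (IH \<circ>\<^sub>e UI)) \<approx> la *\<^sub>e (HI \<circ>\<^sub>e (IH \<circ>\<^sub>e UI))" by simp
  from scale_lin3(1)[OF this, of "HI \<circ>\<^sub>e (IH \<circ>\<^sub>e UI)" "HI \<circ>\<^sub>e (IH \<circ>\<^sub>e UI)"]
  have "IH \<circ>\<^sub>e (HI \<circ>\<^sub>e (IH \<circ>\<^sub>e UI)) \<approx> lin3 la 0 0 (HI \<circ>\<^sub>e (IH \<circ>\<^sub>e UI)) (HI \<circ>\<^sub>e (IH \<circ>\<^sub>e UI)) (HI \<circ>\<^sub>e (IH \<circ>\<^sub>e UI))"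
    by simp
  from lin3_sum[OF this rel(9) rel(9) rel(9)]
  have 2: "IH \<circ>\<^sub>e (HI \<circ>\<^sub>e (IH \<circ>\<^sub>e UI)) \<approx> lin3 (la * D) (la * E) (la * F) UI (IH \<circ>\<^sub>e UI) IU" by simp
  from free3[OF _ cong_trans[OF bcong.sym[OF 1] 2]]
  show "la * D = E * a" "E * (c * si') = 0" by (simp_all add: mult.commute)
qed

lemma scale_lay_Ident: "lay i (r *\<^sub>e Ident n) k \<approx> r *\<^sub>e Ident (i + n + k)"
  by (rule scale_to[OF lay_scale lay_Ident]) simp

text \<open>On four strands the outer caps \<open>lay 0 GenA 2\<close> and
  \<open>lay 2 GenA 0\<close>, each followed by A, differ by the factor \<epsilon>. Composed with
  the cup in the middle they straighten to \<varsigma> A and \<varsigma>' A.\<close>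

lemma sigma_eq: "si' = \<epsilon> * si"
proof -
  have T: "lay 0 GenA 0 \<approx> GenA" by (rule lay_0_0) simp
  have AU: "lay 0 GenA 2 \<circ>\<^sub>e lay 1 GenU 1 \<approx> si *\<^sub>e Ident 2"
  proof (rule lay_prod[OF rel(4)])
    show "lay 0 AI 1 \<approx> lay 0 GenA 2" "lay 0 IU 1 \<approx> lay 1 GenU 1"
      using lay_three(5)[of 0 1] lay_three(4)[of 0 1] by (simp_all add: numeral_2_eq_2)
    show "lay 0 (si *\<^sub>e Ident 1) 1 \<approx> si *\<^sub>e Ident 2"
      using scale_lay_Ident[of 0 si 1 1] by (simp add: numeral_2_eq_2)
  qed
  have AU': "lay 2 GenA 0 \<circ>\<^sub>e lay 1 GenU 1 \<approx> si' *\<^sub>e Ident 2"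
  proof (rule lay_prod[OF rel(5)])
    show "lay 1 IA 0 \<approx> lay 2 GenA 0" "lay 1 UI 0 \<approx> lay 1 GenU 1"
      using lay_three(6)[of 1 0] lay_three(3)[of 1 0] by (simp_all add: numeral_2_eq_2)
    show "lay 1 (si' *\<^sub>e Ident 1) 0 \<approx> si' *\<^sub>e Ident 2"
      using scale_lay_Ident[of 1 si' 1 0] by (simp add: numeral_2_eq_2)
  qed
  let ?AA = "lay 0 (GenA \<otimes>\<^sub>e (Ident 0 \<otimes>\<^sub>e GenA)) 0"
  have "GenA \<circ>\<^sub>e lay 2 GenA 0 \<approx> lay 0 GenA 0 \<circ>\<^sub>e lay 2 GenA 0"
    by (intro comp_right bcong.sym[OF T]) simp
  also have "\<dots> \<approx> ?AA" using lay_far1[of GenA GenA 2 0 0 0 0] by (simp add: numeral_2_eq_2)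
  finally have 1: "GenA \<circ>\<^sub>e lay 2 GenA 0 \<approx> ?AA" .
  have "GenA \<circ>\<^sub>e lay 0 GenA 2 \<approx> lay 0 GenA 0 \<circ>\<^sub>e lay 0 GenA 2"
    by (intro comp_right bcong.sym[OF T]) simp
  also have "\<dots> \<approx> \<epsilon> *\<^sub>e ?AA" using lay_far2[of GenA GenA 0 2 \<pi> \<pi> 0 0 0] sign by (simp add: numeral_2_eq_2)
  also have "\<dots> \<approx> \<epsilon> *\<^sub>e (GenA \<circ>\<^sub>e lay 2 GenA 0)" by (intro bcong.scale_cong bcong.sym[OF 1])
  finally have swap: "GenA \<circ>\<^sub>e lay 0 GenA 2 \<approx> \<epsilon> *\<^sub>e (GenA \<circ>\<^sub>e lay 2 GenA 0)" .
  have "GenA \<circ>\<^sub>e (lay 2 GenA 0 \<circ>\<^sub>e lay 1 GenU 1) \<approx> (si' * 1) *\<^sub>e GenA"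
    by (rule comp_scale[OF AU' _ scale_one'[OF comp_Ident(2)]]) simp_all
  hence "(GenA \<circ>\<^sub>e lay 2 GenA 0) \<circ>\<^sub>e lay 1 GenU 1 \<approx> si' *\<^sub>e GenA"
    using cong_trans[OF bcong.comp_assoc] by simp
  hence 2: "(GenA \<circ>\<^sub>e lay 0 GenA 2) \<circ>\<^sub>e lay 1 GenU 1 \<approx> (\<epsilon> * si') *\<^sub>e GenA"
    by (intro scale_comp[OF swap]) simp_all
  have 3: "GenA \<circ>\<^sub>e (lay 0 GenA 2 \<circ>\<^sub>e lay 1 GenU 1) \<approx> (si * 1) *\<^sub>e GenA"
    by (rule comp_scale[OF AU _ scale_one'[OF comp_Ident(2)]]) simp_all
  have "si * 1 = \<epsilon> * si'" by (rule free1[OF _ assoc_eq[OF 3 2]]) simp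
  moreover have "\<epsilon> * \<epsilon> = 1" using koszul_sq[of \<pi> \<pi>, where 'a = 'k] by (simp add: sign)
  ultimately show ?thesis by (metis mult.assoc mult_1_left mult_1_right)
qed

lemma four_strands:
  "lay 0 GenA 2 \<circ>\<^sub>e lay 1 GenU 1 \<approx> si *\<^sub>e Ident 2"
  "lay 1 GenA 1 \<circ>\<^sub>e lay 2 GenU 0 \<approx> si *\<^sub>e Ident 2"
  "lay 1 GenH 1 \<circ>\<^sub>e lay 2 GenU 0 \<approx> lin3 d e 0 (lay 1 GenU 1) (lay 2 GenH 0 \<circ>\<^sub>e lay 1 GenU 1) (lay 2 GenU 0)"
  "lay 1 GenA 1 \<circ>\<^sub>e lay 0 GenH 2 \<approx> lin3 d' e' 0 (lay 0 GenA 2) (lay 0 GenA 2 \<circ>\<^sub>e lay 1 GenH 1) (lay 1 GenA 1)"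
proof -
  have l0: "lay 0 AI 1 \<approx> lay 0 GenA 2" "lay 0 IA 1 \<approx> lay 1 GenA 1" "lay 0 IU 1 \<approx> lay 1 GenU 1"
    "lay 0 HI 1 \<approx> lay 0 GenH 2" "lay 0 IH 1 \<approx> lay 1 GenH 1"
    using lay_three[of 0 1] by (simp_all add: numeral_2_eq_2)
  have l1: "lay 1 AI 0 \<approx> lay 1 GenA 1" "lay 1 IU 0 \<approx> lay 2 GenU 0" "lay 1 UI 0 \<approx> lay 1 GenU 1"
    "lay 1 HI 0 \<approx> lay 1 GenH 1" "lay 1 IH 0 \<approx> lay 2 GenH 0"
    using lay_three[of 1 0] by (simp_all add: numeral_2_eq_2)
  show "lay 0 GenA 2 \<circ>\<^sub>e lay 1 GenU 1 \<approx> si *\<^sub>e Ident 2"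
    by (rule lay_prod[OF rel(4) l0(1,3)]) (use scale_lay_Ident[of 0 si 1 1] in \<open>simp add: numeral_2_eq_2\<close>)
  show "lay 1 GenA 1 \<circ>\<^sub>e lay 2 GenU 0 \<approx> si *\<^sub>e Ident 2"
    by (rule lay_prod[OF rel(4) l1(1,2)]) (use scale_lay_Ident[of 1 si 1 0] in \<open>simp add: numeral_2_eq_2\<close>)
  have hu: "lay 1 (IH \<circ>\<^sub>e UI) 0 \<approx> lay 2 GenH 0 \<circ>\<^sub>e lay 1 GenU 1"
    by (rule lay_comp_I[OF l1(5,3)]) simp
  have "lay 1 GenH 1 \<circ>\<^sub>e lay 2 GenU 0 \<approx> lay 1 (HI \<circ>\<^sub>e IU) 0"
    by (rule bcong.sym[OF lay_comp_I[OF l1(4,2)]]) simp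
  from cong_trans[OF this lin3_cong[OF lay_lin3[OF rel(8)] l1(3) hu l1(2)]]
  show "lay 1 GenH 1 \<circ>\<^sub>e lay 2 GenU 0
    \<approx> lin3 d e 0 (lay 1 GenU 1) (lay 2 GenH 0 \<circ>\<^sub>e lay 1 GenU 1) (lay 2 GenU 0)" .
  have ah: "lay 0 (AI \<circ>\<^sub>e IH) 1 \<approx> lay 0 GenA 2 \<circ>\<^sub>e lay 1 GenH 1"
    by (rule lay_comp_I[OF l0(1,5)]) simp
  have "lay 1 GenA 1 \<circ>\<^sub>e lay 0 GenH 2 \<approx> lay 0 (IA \<circ>\<^sub>e HI) 1"
    by (rule bcong.sym[OF lay_comp_I[OF l0(2,4)]]) simp
  from cong_trans[OF this lin3_cong[OF lay_lin3[OF rel(10)] l0(1) ah l0(2)]]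
  show "lay 1 GenA 1 \<circ>\<^sub>e lay 0 GenH 2
    \<approx> lin3 d' e' 0 (lay 0 GenA 2) (lay 0 GenA 2 \<circ>\<^sub>e lay 1 GenH 1) (lay 1 GenA 1)" .
qed

lemma far_four_strands:
  "lay 0 GenA 2 \<circ>\<^sub>e lay 2 GenH 0 \<approx> GenH \<circ>\<^sub>e lay 0 GenA 2"
  "lay 0 GenH 2 \<circ>\<^sub>e lay 2 GenU 0 \<approx> lay 2 GenU 0 \<circ>\<^sub>e GenH"
  "lay 0 GenA 2 \<circ>\<^sub>e lay 2 GenU 0 \<approx> \<epsilon> *\<^sub>e (GenU \<circ>\<^sub>e GenA)"
proof -
  have triv: "t \<approx> v" if "t \<approx> w" "s \<approx> 1 *\<^sub>e w" "s \<approx> v" for s t v w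
    using that bcong_typed[OF that(1)] by (meson bcong.trans bcong.sym bcong.scale_one)
  show "lay 0 GenA 2 \<circ>\<^sub>e lay 2 GenH 0 \<approx> GenH \<circ>\<^sub>e lay 0 GenA 2"
  proof (rule triv)
    show "lay 0 GenA 2 \<circ>\<^sub>e lay 2 GenH 0 \<approx> lay 0 (GenA \<otimes>\<^sub>e (Ident 0 \<otimes>\<^sub>e GenH)) 0"
      using lay_far1[of GenA GenH 2 2 0 0 0] by (simp add: numeral_2_eq_2)
    show "lay 0 GenH 0 \<circ>\<^sub>e lay 0 GenA 2 \<approx> 1 *\<^sub>e lay 0 (GenA \<otimes>\<^sub>e (Ident 0 \<otimes>\<^sub>e GenH)) 0"
      using lay_far2[of GenA GenH 0 2 \<pi> 0 0 0 0] by (simp add: numeral_2_eq_2)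
    show "lay 0 GenH 0 \<circ>\<^sub>e lay 0 GenA 2 \<approx> GenH \<circ>\<^sub>e lay 0 GenA 2"
      by (intro comp_right lay_0_0) simp_all
  qed
  show "lay 0 GenH 2 \<circ>\<^sub>e lay 2 GenU 0 \<approx> lay 2 GenU 0 \<circ>\<^sub>e GenH"
  proof (rule triv)
    show "lay 0 GenH 2 \<circ>\<^sub>e lay 2 GenU 0 \<approx> lay 0 (GenH \<otimes>\<^sub>e (Ident 0 \<otimes>\<^sub>e GenU)) 0"
      using lay_far1[of GenH GenU 2 2 0 0 0] by (simp add: numeral_2_eq_2)
    show "lay 2 GenU 0 \<circ>\<^sub>e lay 0 GenH 0 \<approx> 1 *\<^sub>e lay 0 (GenH \<otimes>\<^sub>e (Ident 0 \<otimes>\<^sub>e GenU)) 0"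
      using lay_far2[of GenH GenU 2 0 0 \<pi> 0 0 0] by (simp add: numeral_2_eq_2)
    show "lay 2 GenU 0 \<circ>\<^sub>e lay 0 GenH 0 \<approx> lay 2 GenU 0 \<circ>\<^sub>e GenH"
      by (intro comp_left lay_0_0) simp_all
  qed
  let ?w = "lay 0 (GenA \<otimes>\<^sub>e (Ident 0 \<otimes>\<^sub>e GenU)) 0"
  have "GenU \<circ>\<^sub>e GenA \<approx> lay 0 GenU 0 \<circ>\<^sub>e lay 0 GenA 0"
    by (intro bcong.comp_cong bcong.sym[OF lay_0_0]) simp_all
  also have "\<dots> \<approx> \<epsilon> *\<^sub>e ?w"
    using lay_far2[of GenA GenU 0 0 \<pi> \<pi> 0 0 0] sign by simp
  finally have "\<epsilon> *\<^sub>e (GenU \<circ>\<^sub>e GenA) \<approx> (\<epsilon> * \<epsilon>) *\<^sub>e ?w"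
    by (intro scale_scale'[OF bcong.refl]) simp
  moreover have "\<epsilon> * \<epsilon> = 1" using koszul_sq[of \<pi> \<pi>, where 'a = 'k] by (simp add: sign)
  ultimately have 1: "\<epsilon> *\<^sub>e (GenU \<circ>\<^sub>e GenA) \<approx> 1 *\<^sub>e ?w" by simp
  show "lay 0 GenA 2 \<circ>\<^sub>e lay 2 GenU 0 \<approx> \<epsilon> *\<^sub>e (GenU \<circ>\<^sub>e GenA)"
  proof (rule triv[OF _ 1 bcong.refl])
    show "lay 0 GenA 2 \<circ>\<^sub>e lay 2 GenU 0 \<approx> ?w"
      using lay_far1[of GenA GenU 2 2 0 0 0] by (simp add: numeral_2_eq_2)
  qed simp
qed

text \<open>Both reductions of the composite \<open>A\<^sub>2 H\<^sub>1 U\<^sub>3\<close> are written in terms of \<open>1\<close>, \<open>H\<close> and \<open>UA\<close>.\<close>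

lemma AHU_eqs: "d = 0" "d' = 0" "e * e' = 1"
proof -
  let ?L = "\<lambda>x y z. lin3 x y z (Ident 2) GenH (GenU \<circ>\<^sub>e GenA)"
  let ?A1 = "lay 0 GenA 2" and ?A2 = "lay 1 GenA 1" and ?H1 = "lay 0 GenH 2" and ?H2 = "lay 1 GenH 1"
    and ?H3 = "lay 2 GenH 0" and ?U2 = "lay 1 GenU 1" and ?U3 = "lay 2 GenU 0"
  have A1U2: "?A1 \<circ>\<^sub>e ?U2 \<approx> ?L si 0 0" by (rule scale_lin3(1)[OF four_strands(1)]) simp_all
  have A2U3: "?A2 \<circ>\<^sub>e ?U3 \<approx> ?L si 0 0" by (rule scale_lin3(1)[OF four_strands(2)]) simp_all
  have A1U3: "?A1 \<circ>\<^sub>e ?U3 \<approx> ?L 0 0 \<epsilon>" by (rule scale_lin3(3)[OF far_four_strands(3)]) simp_all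
  have "?A1 \<circ>\<^sub>e (?H3 \<circ>\<^sub>e ?U2) \<approx> (?A1 \<circ>\<^sub>e ?H3) \<circ>\<^sub>e ?U2" by (rule comp_assoc') simp
  also have "\<dots> \<approx> (GenH \<circ>\<^sub>e ?A1) \<circ>\<^sub>e ?U2" by (rule comp_right[OF far_four_strands(1)]) simp
  also have "\<dots> \<approx> GenH \<circ>\<^sub>e (?A1 \<circ>\<^sub>e ?U2)" by (rule bcong.comp_assoc) simp
  also have "\<dots> \<approx> (si * 1) *\<^sub>e GenH"
    by (rule comp_scale[OF four_strands(1) _ scale_one'[OF comp_Ident(2)]]) simp_all
  finally have "?A1 \<circ>\<^sub>e (?H3 \<circ>\<^sub>e ?U2) \<approx> si *\<^sub>e GenH" by simp
  hence A1H3U2: "?A1 \<circ>\<^sub>e (?H3 \<circ>\<^sub>e ?U2) \<approx> ?L 0 si 0" by (rule scale_lin3(2)) simp_all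
  from lin3_sum[OF comp_lin3[OF four_strands(3)] A1U2 this A1U3]
  have "?A1 \<circ>\<^sub>e (?H2 \<circ>\<^sub>e ?U3) \<approx> ?L (d * si + e * 0 + 0 * 0) (d * 0 + e * si + 0 * 0) (d * 0 + e * 0 + 0 * \<epsilon>)"
    by simp
  from cong_trans[OF bcong.comp_assoc this]
  have A1H2U3: "(?A1 \<circ>\<^sub>e ?H2) \<circ>\<^sub>e ?U3 \<approx> ?L (d * si) (e * si) 0" by simp
  from lin3_sum[OF lin3_comp[OF four_strands(4)] A1U3 this A2U3]
  have 1: "(?A2 \<circ>\<^sub>e ?H1) \<circ>\<^sub>e ?U3 \<approx> ?L (d' * 0 + e' * (d * si) + 0 * si) (d' * 0 + e' * (e * si) + 0 * 0) (d' * \<epsilon> + e' * 0 + 0 * 0)"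
    by simp
  have "?A2 \<circ>\<^sub>e (?H1 \<circ>\<^sub>e ?U3) \<approx> ?A2 \<circ>\<^sub>e (?U3 \<circ>\<^sub>e GenH)" by (rule comp_left[OF far_four_strands(2)]) simp
  also have "\<dots> \<approx> (?A2 \<circ>\<^sub>e ?U3) \<circ>\<^sub>e GenH" by (rule comp_assoc') simp
  also have "\<dots> \<approx> (si * 1) *\<^sub>e GenH"
    by (rule scale_comp[OF four_strands(2) _ scale_one'[OF comp_Ident(1)]]) simp_all
  finally have "?A2 \<circ>\<^sub>e (?H1 \<circ>\<^sub>e ?U3) \<approx> si *\<^sub>e GenH" by simp
  hence 2: "?A2 \<circ>\<^sub>e (?H1 \<circ>\<^sub>e ?U3) \<approx> ?L 0 si 0" by (rule scale_lin3(2)) simp_all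
  have eqs: "0 = e' * (d * si)" "si = e' * (e * si)" "0 = d' * \<epsilon>"
    using free3[OF _ assoc_eq[OF 2 1]] by auto
  show "e * e' = 1" using eqs(2) sigma by (simp add: field_simps)
  hence "e' \<noteq> 0" by auto
  thus "d = 0" using eqs(1) sigma by simp
  show "d' = 0" using eqs(3) sign koszul_nonzero[of \<pi> \<pi>, where 'a = 'k] by simp
qed

theorem parameters:
  "e\<^sup>2 = - \<epsilon>" "la' = - la" "de = 0" "a = la\<^sup>2" "b = 0" "c = 0" "si' = \<epsilon> * si" "ro = \<epsilon> * si * e * la"
  "e' = - \<epsilon> * e" "d = 0" "d' = 0" "D = 0" "E = 0" "D' = 0" "E' = 0" "F = - \<epsilon> * e * la\<^sup>2" "F' = e * la\<^sup>2"
proof -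
  have eps: "\<epsilon> * \<epsilon> = 1" using koszul_sq[of \<pi> \<pi>, where 'a = 'k] by (simp add: sign)
  hence eps0: "\<epsilon> \<noteq> 0" by auto
  show "de = 0" "d = 0" "d' = 0" "si' = \<epsilon> * si" by (fact de_zero AHU_eqs sigma_eq)+
  note d = AHU_eqs(1,2)
  have e0: "e \<noteq> 0" "e' \<noteq> 0" using AHU_eqs(3) by auto
  \<comment> \<open>As \<lambda> and \<lambda>' are distinct roots of t^2 = a + b t, their sum is b
    and their product is -a.\<close>
  have "(la - la') * (la + la' - b) = 0" using quadratic by (simp add: algebra_simps power2_eq_square)
  hence b: "b = la + la'" using lambda_neq by simp
  hence a: "a = - la * la'" using quadratic(1) by (simp add: algebra_simps power2_eq_square eq_neg_iff_add_eq_0)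
  have E: "E = b" using HHU_eqs(2) e0 by simp
  \<comment> \<open>If b were nonzero, E = b would force c = 0, hence D = 0, hence E a = 0, although
    a = - \<lambda> \<lambda>' is nonzero.\<close>
  show b0: "b = 0"
  proof (rule ccontr)
    assume "b \<noteq> 0"
    hence "c = 0" using braid_eqs(2) E eps0 sigma by (simp add: sigma_eq)
    hence "D = 0" using HHU_eqs(1) d e0 by simp
    hence "E * a = 0" using braid_eqs(1) by simp
    thus False using E \<open>b \<noteq> 0\<close> a la_nonzero by simp
  qed
  show "E = 0" "E' = 0" using E b0 AHH_eqs(2) e0 by auto
  show D: "D = 0" using braid_eqs(1) \<open>E = 0\<close> la_nonzero by simp
  show c: "c = 0" using HHU_eqs(1) d D sigma by simp
  show "D' = 0" using AHH_eqs(1) d c e0 by simp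
  show l: "la' = - la" using b b0 by (simp add: eq_neg_iff_add_eq_0 add.commute)
  show a': "a = la\<^sup>2" using a l by (simp add: power2_eq_square)
  \<comment> \<open>Since e e' = 1, the second equation of \<open>rho_eqs\<close> can be solved for
    \<rho>.\<close>
  have "ro = (e * e') * ro" by (simp add: AHU_eqs(3))
  also have "\<dots> = e * (la * si')" by (simp only: rho_eqs(2) mult.assoc)
  finally show ro: "ro = \<epsilon> * si * e * la" by (simp add: sigma_eq mult_ac)
  \<comment> \<open>The other equation for \<rho>, with \<lambda>' = - \<lambda>, becomes \<epsilon>
    e^2 = -1 after cancelling \<varsigma> \<lambda>.\<close>
  have "e * (\<epsilon> * si * e * la) = - (la * si)" using rho_eqs(1) ro l by simp
  hence "e * (\<epsilon> * si * e * la) + la * si = 0" by simp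
  hence "(\<epsilon> * e\<^sup>2 + 1) * (si * la) = 0" by (simp add: algebra_simps power2_eq_square)
  hence "\<epsilon> * e\<^sup>2 = - 1" using sigma la_nonzero by (simp add: eq_neg_iff_add_eq_0)
  hence "\<epsilon> * (\<epsilon> * e\<^sup>2) = - \<epsilon>" by simp
  thus e2: "e\<^sup>2 = - \<epsilon>" using eps by (simp add: mult.assoc[symmetric])
  have "e * (- \<epsilon> * e) = 1" using e2 eps by (simp add: power2_eq_square mult_ac)
  hence "e * e' = e * (- \<epsilon> * e)" using AHU_eqs(3) by simp
  with e0(1) show e': "e' = - \<epsilon> * e" by (rule mult_left_cancel[THEN iffD1])
  have "e' * (e * F) = e' * la\<^sup>2" using HHU_eqs(3) a' by simp
  thus "F = - \<epsilon> * e * la\<^sup>2" using AHU_eqs(3) e' by (metis mult.assoc mult.commute mult_1_left)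
  have "e * (e' * F') = e * la\<^sup>2" using AHH_eqs(3) a' by simp
  thus "F' = e * la\<^sup>2" using AHU_eqs(3) by (metis mult.assoc mult_1_left)
qed

end

section \<open>Small standard expressions and their freeness\<close>

lemma reduced_word_min:
  "reduced_word r w \<Longrightarrow> set v \<subseteq> {1..<r} \<Longrightarrow> word_perm v = word_perm w \<Longrightarrow> length w \<le> length v"
  by (simp add: reduced_word_def)

context word_system
begin

lemma word_exists: "\<sigma> permutes {1..r} \<Longrightarrow> \<exists>w \<in> W r. word_perm w = \<sigma> \<and> reduced_word r w"
  using W unfolding word_choice_def by (metis (no_types, lifting))

text \<open>Whatever choice \<open>W\<close> makes, minimal length leaves only the empty word for
  the identity.\<close>

lemma Nil_in_W: "[] \<in> W r"
proof -
  obtain w where w: "w \<in> W r" "word_perm w = id" "reduced_word r w"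
    using word_exists[of id r] by (auto simp: permutes_id)
  have "length w \<le> length ([] :: nat list)" 
    by (rule reduced_word_min[OF w(3)]) (simp_all add: w(2), simp add: word_perm_def)
  thus ?thesis using w by simp
qed

text \<open>The transposition in S_2 has exactly one reduced word, so every admissible
  \<open>W\<close> contains it.\<close>

lemma swap_in_W: "[1] \<in> W 2"
proof -
  have "transpose 1 2 permutes {1..2::nat}" by (rule permutes_swap_id) auto
  then obtain w where w: "w \<in> W 2" "word_perm w = transpose 1 2" "reduced_word 2 w"
    using word_exists by blast
  have "word_perm [1] = transpose 1 (2::nat)" by (simp add: word_perm_def numeral_2_eq_2)
  hence "length w \<le> length [1::nat]" 
    by (intro reduced_word_min[OF w(3)]) (simp_all add: w(2))
  moreover have "w \<noteq> []"
  proof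
    assume "w = []"
    hence "word_perm w 1 = 1" by (simp add: word_perm_def)
    thus False by (simp add: w(2))
  qed
  ultimately obtain i where i: "w = [i]" by (cases w) auto
  moreover have "set w \<subseteq> {1..<2}" using w(3) by (simp add: reduced_word_def)
  ultimately show ?thesis using w(1) by (auto simp: numeral_2_eq_2)
qed

end

context typed_relations
begin

lemma comp_Ident_cong:
  "s \<approx> t \<Longrightarrow> bsrc t = k \<Longrightarrow> s \<circ>\<^sub>e Ident k \<approx> t" "s \<approx> t \<Longrightarrow> btgt t = k \<Longrightarrow> Ident k \<circ>\<^sub>e s \<approx> t"
proof -
  assume s: "s \<approx> t"
  note ty = bcong_typed[OF s]
  show "s \<circ>\<^sub>e Ident k \<approx> t" if "bsrc t = k" using ty that by (intro cong_trans[OF comp_Ident(2) s]) auto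
  show "Ident k \<circ>\<^sub>e s \<approx> t" if "btgt t = k" using ty that by (intro cong_trans[OF comp_Ident(1) s]) auto
qed

lemma Ident_Ident: "Ident k \<circ>\<^sub>e Ident k \<approx> Ident k"
  by (rule comp_Ident) simp_all

lemma std_exp_I:
  assumes "I_exp r q \<approx> v" "bsrc v = r"
  shows "std_exp (r, [q], [], []) \<approx> v"
proof -
  have "(I_exp r q \<circ>\<^sub>e Ident r) \<circ>\<^sub>e (Ident r \<circ>\<^sub>e Ident r) \<approx> v \<circ>\<^sub>e Ident r"
    using assms bcong_typed[OF assms(1)] by (intro bcong.comp_cong comp_Ident_cong Ident_Ident) auto
  also have "\<dots> \<approx> v" using assms bcong_typed[OF assms(1)] by (intro comp_Ident(2)) auto
  finally show ?thesis unfolding std_exp_def by (simp add: prod_exp_def)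
qed

lemma std_exp_J: "J_exp r q \<approx> v \<Longrightarrow> btgt v = r \<Longrightarrow> bsrc v = r + 2 \<Longrightarrow> std_exp (r, [], [], [q]) \<approx> v"
  unfolding std_exp_def by (simp add: prod_exp_def comp_Ident_cong)

lemma std_exp_W: "prod_exp r (map (s_exp r) w) \<approx> v \<Longrightarrow> bsrc v = r \<Longrightarrow> btgt v = r \<Longrightarrow> std_exp (r, [], w, []) \<approx> v"
  unfolding std_exp_def by (simp add: comp_Ident_cong)

lemma std_exp_IJ:
  assumes "I_exp 0 q \<approx> v" "J_exp 0 q' \<approx> v'" "bsrc v = 0" "btgt v' = 0" "bsrc v' = 2"
  shows "std_exp (0, [q], [], [q']) \<approx> v \<circ>\<^sub>e v'"
proof -
  have "(I_exp 0 q \<circ>\<^sub>e Ident 0) \<circ>\<^sub>e (Ident 0 \<circ>\<^sub>e (J_exp 0 q' \<circ>\<^sub>e Ident 2)) \<approx> v \<circ>\<^sub>e v'"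
    using assms bcong_typed[OF assms(1)] bcong_typed[OF assms(2)]
    by (intro bcong.comp_cong comp_Ident_cong) auto
  thus ?thesis unfolding std_exp_def by (simp add: prod_exp_def numeral_2_eq_2)
qed

lemma small_generators:
  "u_exp 0 1 \<approx> GenU" "u_exp 1 1 \<approx> UI" "u_exp 1 2 \<approx> IU" "a_exp 0 1 \<approx> GenA" "a_exp 1 1 \<approx> AI" "a_exp 1 2 \<approx> IA"
  "s_exp 2 1 \<approx> GenH" "s_exp 3 2 \<approx> IH"
  using lay_0_0[of GenU] lay_0_0[of GenA] lay_0_0[of GenH]
    bcong.sym[OF tens_Ident_lay[of GenU 1]] bcong.sym[OF tens_Ident_lay[of GenA 1]]
    bcong.sym[OF Ident_tens_lay[of GenU 1]] bcong.sym[OF Ident_tens_lay[of GenA 1]]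
    bcong.sym[OF Ident_tens_lay[of GenH 1]]
  by (simp_all add: u_exp_def a_exp_def s_exp_def lay_def numeral_2_eq_2 numeral_3_eq_3)

text \<open>Connects the standard expressions of the small Hom spaces in which coefficients are
  compared, up to congruence, with the terms that occur in the relations.\<close>

lemma small_std_exps:
  "std_exp (k, [], [], []) \<approx> Ident k"
  "std_exp (0, [(1, 0)], [], []) \<approx> GenU" "std_exp (0, [], [], [(1, 0)]) \<approx> GenA"
  "std_exp (1, [(1, 0)], [], []) \<approx> UI" "std_exp (1, [(1, 1)], [], []) \<approx> IH \<circ>\<^sub>e UI"
  "std_exp (1, [(2, 0)], [], []) \<approx> IU"
  "std_exp (1, [], [], [(1, 0)]) \<approx> AI" "std_exp (1, [], [], [(1, 1)]) \<approx> AI \<circ>\<^sub>e IH"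
  "std_exp (1, [], [], [(2, 0)]) \<approx> IA"
  "std_exp (2, [], [1], []) \<approx> GenH" "std_exp (0, [(1, 0)], [], [(1, 0)]) \<approx> GenU \<circ>\<^sub>e GenA"
proof -
  have I: "I_exp n (p, 0) \<approx> v" if "u_exp n p \<approx> v" "bsrc v = n" for n p v
    using that by (simp add: I_exp_def prod_exp_def comp_Ident_cong)
  have J: "J_exp n (p, 0) \<approx> v" if "a_exp n p \<approx> v" "bsrc v = n + 2" for n p v
    using comp_Ident_cong(1)[OF that] by (simp add: J_exp_def prod_exp_def)
  show "std_exp (k, [], [], []) \<approx> Ident k"
    by (rule std_exp_W) (simp_all add: prod_exp_def bcong.refl)
  show "std_exp (0, [(1, 0)], [], []) \<approx> GenU" "std_exp (1, [(1, 0)], [], []) \<approx> UI"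
    "std_exp (1, [(2, 0)], [], []) \<approx> IU"
    by (rule std_exp_I, rule I, rule small_generators, simp, simp)+
  show "std_exp (0, [], [], [(1, 0)]) \<approx> GenA" "std_exp (1, [], [], [(1, 0)]) \<approx> AI"
    "std_exp (1, [], [], [(2, 0)]) \<approx> IA"
    by (rule std_exp_J, rule J, rule small_generators, simp, simp, simp)+
  show "std_exp (0, [(1, 0)], [], [(1, 0)]) \<approx> GenU \<circ>\<^sub>e GenA"
    by (rule std_exp_IJ, rule I, rule small_generators, simp, rule J, rule small_generators) simp_all
  have "s_exp 3 2 \<circ>\<^sub>e (u_exp 1 1 \<circ>\<^sub>e Ident 1) \<approx> IH \<circ>\<^sub>e UI"
    by (intro bcong.comp_cong comp_Ident_cong small_generators) (simp_all add: s_exp_def u_exp_def)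
  hence "I_exp 1 (1, 1) \<approx> IH \<circ>\<^sub>e UI" by (simp add: I_exp_def prod_exp_def numeral_2_eq_2 numeral_3_eq_3)
  thus "std_exp (1, [(1, 1)], [], []) \<approx> IH \<circ>\<^sub>e UI" by (rule std_exp_I) simp
  have "a_exp 1 1 \<circ>\<^sub>e (s_exp 3 2 \<circ>\<^sub>e Ident 3) \<approx> AI \<circ>\<^sub>e IH"
    by (intro bcong.comp_cong comp_Ident_cong small_generators) (simp_all add: s_exp_def a_exp_def)
  hence "J_exp 1 (1, 1) \<approx> AI \<circ>\<^sub>e IH" by (simp add: J_exp_def prod_exp_def numeral_2_eq_2 numeral_3_eq_3)
  thus "std_exp (1, [], [], [(1, 1)]) \<approx> AI \<circ>\<^sub>e IH" by (rule std_exp_J) simp_all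
  have "s_exp 2 1 \<circ>\<^sub>e Ident 2 \<approx> GenH" by (intro comp_Ident_cong small_generators) simp
  thus "std_exp (2, [], [1], []) \<approx> GenH"
    by (intro std_exp_W) (simp_all add: prod_exp_def)
qed

text \<open>The difference of the left-hand side with itself is evaluated twice: as 0, and with the
  second occurrence replaced by the right-hand side.\<close>

lemma lin3_diff:
  assumes "lin3 a b c x y z \<approx> lin3 a' b' c' x y z"
  shows "lin3 (a - a') (b - b') (c - c') x y z \<approx> Null (bsrc x) (btgt x)"
proof -
  let ?L = "lin3 a b c x y z"
  let ?t = "lin3 1 (- 1) 0 ?L ?L ?L"
  note ty = bcong_typed[OF assms]
  have t: "?t \<approx> ?t" "?L \<approx> ?L" using ty by (auto intro!: bcong.refl)
  from lin3_sum[OF t(1) t(2) assms t(2)]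
  have "?t \<approx> lin3 (a - a') (b - b') (c - c') x y z" by simp
  moreover from lin3_same[OF t(1)] have "?t \<approx> 0 *\<^sub>e ?L" by simp
  moreover have "0 *\<^sub>e ?L \<approx> Null (bsrc x) (btgt x)" using ty scale_zero[of ?L] by simp
  ultimately show ?thesis by (meson bcong.trans bcong.sym)
qed

lemma scale_diff:
  assumes "a *\<^sub>e x \<approx> a' *\<^sub>e x"
  shows "(a - a') *\<^sub>e x \<approx> Null (bsrc x) (btgt x)"
proof -
  let ?L = "a *\<^sub>e x"
  let ?t = "lin3 1 (- 1) 0 ?L ?L ?L"
  note ty = bcong_typed[OF assms]
  have t: "?t \<approx> ?t" "?L \<approx> ?L" using ty by (auto intro!: bcong.refl)
  from lin3_scale[OF t(1) t(2) assms t(2)] have "?t \<approx> (a - a') *\<^sub>e x" by simp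
  moreover from lin3_same[OF t(1)] have "?t \<approx> 0 *\<^sub>e ?L" by simp
  moreover have "0 *\<^sub>e ?L \<approx> Null (bsrc x) (btgt x)" using ty scale_zero[of ?L] by simp
  ultimately show ?thesis by (meson bcong.trans bcong.sym)
qed

end

lemma (in vectorspace) lin_indpt_three:
  assumes "lin_indpt B" "x \<in> B" "y \<in> B" "z \<in> B" "distinct [x, y, z]" "B \<subseteq> carrier V"
    and "r \<in> carrier K" "s \<in> carrier K" "t \<in> carrier K"
    and "r \<odot>\<^bsub>V\<^esub> x \<oplus>\<^bsub>V\<^esub> s \<odot>\<^bsub>V\<^esub> y \<oplus>\<^bsub>V\<^esub> t \<odot>\<^bsub>V\<^esub> z = \<zero>\<^bsub>V\<^esub>"
  shows "r = \<zero>\<^bsub>K\<^esub> \<and> s = \<zero>\<^bsub>K\<^esub> \<and> t = \<zero>\<^bsub>K\<^esub>"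
proof -
  let ?f = "\<lambda>v. if v = x then r else if v = y then s else t"
  have car: "x \<in> carrier V" "y \<in> carrier V" "z \<in> carrier V" using assms by auto
  have smc: "q \<odot>\<^bsub>V\<^esub> v \<in> carrier V" if "q \<in> carrier K" "v \<in> carrier V" for q v using that by simp
  have "lincomb ?f {x, y, z} = r \<odot>\<^bsub>V\<^esub> x \<oplus>\<^bsub>V\<^esub> (s \<odot>\<^bsub>V\<^esub> y \<oplus>\<^bsub>V\<^esub> t \<odot>\<^bsub>V\<^esub> z)"
    unfolding lincomb_def using assms(5,7-9) car by (subst finsum_insert; auto)+
  also have "\<dots> = \<zero>\<^bsub>V\<^esub>" using assms(7-10) car by (simp add: a_assoc)
  finally have "?f \<in> {x, y, z} \<rightarrow> {\<zero>\<^bsub>K\<^esub>}"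
    using assms by (intro not_lindepD[OF assms(1)]) auto
  thus ?thesis using assms(5) by (auto simp: Pi_iff split: if_splits)
qed

lemma (in vectorspace) lin_indpt_one:
  assumes "lin_indpt B" "x \<in> B" "B \<subseteq> carrier V" "r \<in> carrier K" "r \<odot>\<^bsub>V\<^esub> x = \<zero>\<^bsub>V\<^esub>"
  shows "r = \<zero>\<^bsub>K\<^esub>"
proof -
  have "x \<in> carrier V" using assms by auto
  hence "lincomb (\<lambda>_. r) {x} = \<zero>\<^bsub>V\<^esub>"
    unfolding lincomb_def using assms(4,5) by (subst finsum_insert; auto)
  hence "(\<lambda>_. r) \<in> {x} \<rightarrow> {\<zero>\<^bsub>K\<^esub>}"
    using assms by (intro not_lindepD[OF assms(1)]) auto
  thus ?thesis by auto
qed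

locale brauer_category = brauer_valuation C X h a u "gen_parity \<epsilon>" + word_system W
  for C :: "('o, 'm, 'k::field) supercat" (structure) and X h a u and \<epsilon> :: 'k and W +
  assumes brauer: "category_of_Brauer_type W \<epsilon> C X h a u"
begin

text \<open>Presenting \<open>C\<close> by all its relations includes the invertibility of \<open>H\<close>.\<close>

definition kernel :: "('k bexp \<times> 'k bexp) set"
  where "kernel = {(s, t). bwt s \<and> bwt t \<and> bsrc s = bsrc t \<and> btgt s = btgt t \<and> val s = val t}"

lemma kernel_val: "bcong (gen_parity \<epsilon>) kernel s t \<Longrightarrow> val s = val t"
  by (erule val_sound) (auto simp: kernel_def)

lemma basis_val:
  "vectorspace.basis class_ring (homn C X m n) (val ` standard_exps W m n)"
  "inj_on val (standard_exps W m n)"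
  using brauer by (auto simp: category_of_Brauer_type_def)

lemma indep_val:
  shows "s \<in> standard_exps W m n \<Longrightarrow> bcong (gen_parity \<epsilon>) kernel (r *\<^sub>e s) (Null m n) \<Longrightarrow> r = 0"
    and "{x, y, z} \<subseteq> standard_exps W m n \<Longrightarrow> distinct [x, y, z] \<Longrightarrow>
      bcong (gen_parity \<epsilon>) kernel (lin3 r s' t x y z) (Null m n) \<Longrightarrow> r = 0 \<and> s' = 0 \<and> t = 0"
proof -
  interpret K: typed_relations "gen_parity \<epsilon>" kernel by unfold_locales (auto simp: kernel_def)
  interpret V: vectorspace class_ring "homn C X m n" by (rule homn_vectorspace)
  let ?B = "val ` standard_exps W m n"
  have B: "V.lin_indpt ?B" "?B \<subseteq> carrier (homn C X m n)"
    using basis_val(1)[of m n] unfolding V.basis_def by blast+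
  have ty: "bsrc s = m" "btgt s = n" if s: "s \<in> standard_exps W m n" for s :: "'k bexp"
  proof -
    obtain i where "s = std_exp i" "is_index W m n i" using s unfolding standard_exps_eq by blast
    thus "bsrc s = m" "btgt s = n" using std_exp_bexps[of m n i, where 'k = 'k] by (auto simp: bexps_def)
  qed
  show "r = 0" if "s \<in> standard_exps W m n" "bcong (gen_parity \<epsilon>) kernel (r *\<^sub>e s) (Null m n)"
    using V.lin_indpt_one[OF B(1) _ B(2), of "val s" r] that kernel_val[OF that(2)] by (simp add: ty)
  show "r = 0 \<and> s' = 0 \<and> t = 0" if "{x, y, z} \<subseteq> standard_exps W m n" "distinct [x, y, z]"
    "bcong (gen_parity \<epsilon>) kernel (lin3 r s' t x y z) (Null m n)"
  proof -
    have "distinct [val x, val y, val z]" using that basis_val(2)[of m n] by (auto dest: inj_onD)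
    thus ?thesis
      using V.lin_indpt_three[OF B(1) _ _ _ _ B(2), of "val x" "val y" "val z" r s' t] that kernel_val[OF that(3)]
      by (simp add: ty)
  qed
qed

text \<open>A congruence modulo \<open>kernel\<close> between combinations of small standard
  expressions becomes a linear relation between basis vectors of \<open>C\<close>; this yields
  \<open>free1\<close> and \<open>free3\<close>.\<close>

lemma brauer_relations:
  assumes par: "has_parameters C X h a u P" and f: "par_f P = 0" "par_f' P = 0"
    and "par_lambda' P \<noteq> par_lambda P" "par_sigma P \<noteq> 0"
  shows "brauer_relations (gen_parity \<epsilon>) kernel P \<epsilon>"
proof -
  interpret K: typed_relations "gen_parity \<epsilon>" kernel by unfold_locales (auto simp: kernel_def)
  have kerI: "K.cong_exp s t"
    if "bwt s" "bwt t" "bsrc s = bsrc t" "btgt s = btgt t" "val s = val t" for s t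
    using that by (intro bcong.rel) (simp add: kernel_def)
  have eps: "\<epsilon> \<in> {1, - 1}" using brauer by (simp add: category_of_Brauer_type_def)
  show ?thesis
  proof (unfold_locales)
    show "koszul (gen_parity \<epsilon>) (gen_parity \<epsilon>) = \<epsilon>"
      using eps by (auto simp: koszul_def gen_parity_def)
    show "K.cong_exp s t" if "(s, t) \<in> defining_relations P" for s t
    proof (rule kerI)
      show "bwt s" "bwt t" "bsrc s = bsrc t" "btgt s = btgt t"
        using that by (auto simp: defining_relations_def parameter_relations_def braid_relation_def)
      have braid: "val (fst braid_relation) = val (snd braid_relation)"
        using brauer unfolding category_of_Brauer_type_def by blast
      from that consider "braid_relation = (s, t)" | "(s, t) \<in> parameter_relations P"
        unfolding defining_relations_def by auto
      thus "val s = val t"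
      proof cases
        case 1
        show ?thesis using braid unfolding 1 fst_conv snd_conv .
      next
        case 2
        thus ?thesis using par unfolding has_parameters_def by blast
      qed
    qed
    show "\<exists>g. K.cong_exp (g \<circ>\<^sub>e GenH) (Ident 2) \<and> K.cong_exp (GenH \<circ>\<^sub>e g) (Ident 2)"
    proof -
      obtain h' where h': "h' \<in> carrier (homn C X 2 2)"
        "h \<cdot> h' = Idn C (X [^]\<^bsub>Ob C\<^esub> (2::nat))" "h' \<cdot> h = Idn C (X [^]\<^bsub>Ob C\<^esub> (2::nat))"
        using brauer unfolding category_of_Brauer_type_def by blast
      moreover have "carrier (homn C X 2 2) = val ` bexps 2 2"
        using brauer unfolding category_of_Brauer_type_def by blast
      ultimately obtain g where g: "g \<in> bexps 2 2" "val g = h'" by auto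
      thus ?thesis using h' by (intro exI[of _ g] conjI kerI) (auto simp: bexps_def)
    qed
    have idx: "std_exp (r, ds, w, es) \<in> standard_exps W m n" if "is_index W m n (r, ds, w, es)" for r ds w es m n
      using that unfolding standard_exps_eq by blast
    note mem = idx is_index_def Nil_in_W swap_in_W
    show "c = d" if "t \<in> {Ident 0, Ident 1, GenU, GenA}" "K.cong_exp (c *\<^sub>e t) (d *\<^sub>e t)" for t c d
    proof -
      have "\<exists>i. is_index W (bsrc t) (btgt t) i \<and> K.cong_exp (std_exp i) t"
      proof -
        have "is_index W 0 0 (0, [], [], [])" "is_index W 1 1 (1, [], [], [])"
          "is_index W 0 2 (0, [(1, 0)], [], [])" "is_index W 2 0 (0, [], [], [(1, 0)])"
          by (simp_all add: is_index_def Nil_in_W)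
        thus ?thesis using that(1) K.small_std_exps(1)[of 0] K.small_std_exps(1)[of 1] K.small_std_exps(2,3)
          by fastforce
      qed
      then obtain i where i: "is_index W (bsrc t) (btgt t) i" "K.cong_exp (std_exp i) t" by blast
      have "K.cong_exp ((c - d) *\<^sub>e std_exp i) ((c - d) *\<^sub>e t)" by (intro bcong.scale_cong i)
      also have "K.cong_exp \<dots> (Null (bsrc t) (btgt t))" by (rule K.scale_diff[OF that(2)])
      finally have "c - d = 0" using i(1) by (intro indep_val(1)) (auto simp: standard_exps_eq)
      thus ?thesis by simp
    qed
    have three: "c1 = d1 \<and> c2 = d2 \<and> c3 = d3"
      if "K.cong_exp (lin3 c1 c2 c3 x y z) (lin3 d1 d2 d3 x y z)"
        "is_index W (bsrc x) (btgt x) i" "is_index W (bsrc x) (btgt x) j" "is_index W (bsrc x) (btgt x) k"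
        "K.cong_exp (std_exp i) x" "K.cong_exp (std_exp j) y" "K.cong_exp (std_exp k) z"
        "distinct [std_exp i, std_exp j, std_exp k :: 'k bexp]"
      for c1 c2 c3 d1 d2 d3 x y z i j k
    proof -
      note ty = K.bcong_typed[OF that(1)] K.bcong_typed[OF that(5)] K.bcong_typed[OF that(6)] K.bcong_typed[OF that(7)]
      have "K.cong_exp (lin3 (c1 - d1) (c2 - d2) (c3 - d3) (std_exp i) (std_exp j) (std_exp k))
          (lin3 (c1 - d1) (c2 - d2) (c3 - d3) x y z)"
        using that ty by (intro bcong.add_cong bcong.scale_cong) auto
      also have "K.cong_exp \<dots> (Null (bsrc x) (btgt x))" by (rule K.lin3_diff[OF that(1)])
      finally have "c1 - d1 = 0 \<and> c2 - d2 = 0 \<and> c3 - d3 = 0"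
        using that by (intro indep_val(2)) (auto simp: standard_exps_eq)
      thus ?thesis by simp
    qed
    show "c1 = d1 \<and> c2 = d2 \<and> c3 = d3"
      if m: "(x, y, z) \<in> {(UI, IH \<circ>\<^sub>e UI, IU), (AI, AI \<circ>\<^sub>e IH, IA), (Ident 2, GenH, GenU \<circ>\<^sub>e GenA)}"
        and L: "K.cong_exp (lin3 c1 c2 c3 x y z) (lin3 d1 d2 d3 x y z)"
      for x y z c1 c2 c3 d1 d2 d3
    proof -
      consider "x = UI" "y = IH \<circ>\<^sub>e UI" "z = IU" | "x = AI" "y = AI \<circ>\<^sub>e IH" "z = IA"
        | "x = Ident 2" "y = GenH" "z = GenU \<circ>\<^sub>e GenA" using m by auto
      thus ?thesis
      proof cases
        case 1
        show ?thesis
          by (rule three[OF L, of "(1, [(1, 0)], [], [])" "(1, [(1, 1)], [], [])" "(1, [(2, 0)], [], [])"])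
            (use K.small_std_exps in \<open>simp_all add: 1 is_index_def Nil_in_W std_exp_def I_exp_def prod_exp_def u_exp_def s_exp_def\<close>)
      next
        case 2
        show ?thesis
          by (rule three[OF L, of "(1, [], [], [(1, 0)])" "(1, [], [], [(1, 1)])" "(1, [], [], [(2, 0)])"])
            (use K.small_std_exps in \<open>simp_all add: 2 is_index_def Nil_in_W std_exp_def J_exp_def prod_exp_def a_exp_def s_exp_def\<close>)
      next
        case 3
        show ?thesis
          by (rule three[OF L, of "(2, [], [], [])" "(2, [], [1], [])" "(0, [(1, 0)], [], [(1, 0)])"])
            (use K.small_std_exps swap_in_W in \<open>simp_all add: 3 is_index_def Nil_in_W std_exp_def prod_exp_def s_exp_def\<close>)
      qed
    qed
  qed (use f assms in auto)
qed

end

theorem proposition7p2: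
  fixes W :: "nat \<Rightarrow> nat list set" and \<epsilon> :: "'k::field"
  assumes "(2::'k) \<noteq> 0" and "\<epsilon> \<in> {1, - 1}" and "word_choice W"
  shows "(\<forall>(C :: ('o, 'm, 'k) supercat) X H A U P.
      category_of_Brauer_type W \<epsilon> C X H A U \<and> has_parameters C X H A U P
      \<and> par_f P = 0 \<and> par_f' P = 0 \<and> par_lambda' P \<noteq> par_lambda P \<and> par_sigma P \<noteq> 0
      \<longrightarrow> (par_e P)\<^sup>2 = - \<epsilon>
        \<and> par_lambda' P = - par_lambda P
        \<and> par_delta P = 0
        \<and> par_a P = (par_lambda P)\<^sup>2
        \<and> par_b P = 0
        \<and> par_c P = 0
        \<and> par_sigma' P = \<epsilon> * par_sigma P
        \<and> par_rho P = \<epsilon> * par_sigma P * par_e P * par_lambda P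
        \<and> par_e' P = - \<epsilon> * par_e P
        \<and> par_d P = 0 \<and> par_d' P = 0 \<and> par_f P = 0 \<and> par_f' P = 0
        \<and> par_D P = 0 \<and> par_E P = 0 \<and> par_D' P = 0 \<and> par_E' P = 0
        \<and> par_F P = - \<epsilon> * par_e P * (par_lambda P)\<^sup>2
        \<and> par_F' P = par_e P * (par_lambda P)\<^sup>2)
    \<and> (\<forall>lam sig e :: 'k. lam \<noteq> 0 \<and> sig \<noteq> 0 \<and> e\<^sup>2 = - \<epsilon>
      \<longrightarrow> category_of_Brauer_type W \<epsilon> (cat00 \<epsilon> lam sig e) 1
            (cat00_gen \<epsilon> lam sig e GenH) (cat00_gen \<epsilon> lam sig e GenA) (cat00_gen \<epsilon> lam sig e GenU))"
proof (rule conjI; intro allI impI)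
  fix C :: "('o, 'm, 'k) supercat" and X H A U and P :: "'k brauer_params"
  assume *: "category_of_Brauer_type W \<epsilon> C X H A U \<and> has_parameters C X H A U P
      \<and> par_f P = 0 \<and> par_f' P = 0 \<and> par_lambda' P \<noteq> par_lambda P \<and> par_sigma P \<noteq> 0"
  interpret strict_monoidal_supercategory C using * by (simp add: category_of_Brauer_type_def)
  interpret brauer_category C X H A U \<epsilon> W
    by unfold_locales (use * assms in \<open>auto simp: category_of_Brauer_type_def\<close>)
  interpret B: brauer_relations "gen_parity \<epsilon>" kernel P \<epsilon>
    by (rule brauer_relations) (use * in auto)
  show "(par_e P)\<^sup>2 = - \<epsilon>
        \<and> par_lambda' P = - par_lambda P
        \<and> par_delta P = 0
        \<and> par_a P = (par_lambda P)\<^sup>2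
        \<and> par_b P = 0
        \<and> par_c P = 0
        \<and> par_sigma' P = \<epsilon> * par_sigma P
        \<and> par_rho P = \<epsilon> * par_sigma P * par_e P * par_lambda P
        \<and> par_e' P = - \<epsilon> * par_e P
        \<and> par_d P = 0 \<and> par_d' P = 0 \<and> par_f P = 0 \<and> par_f' P = 0
        \<and> par_D P = 0 \<and> par_E P = 0 \<and> par_D' P = 0 \<and> par_E' P = 0
        \<and> par_F P = - \<epsilon> * par_e P * (par_lambda P)\<^sup>2
        \<and> par_F' P = par_e P * (par_lambda P)\<^sup>2"
    by (intro conjI B.parameters B.f)
next
  fix lam sig e :: 'k assume *: "lam \<noteq> 0 \<and> sig \<noteq> 0 \<and> e\<^sup>2 = - \<epsilon>"
  interpret cat00_words \<epsilon> lam sig e W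
    by unfold_locales (use * assms in auto)
  show "category_of_Brauer_type W \<epsilon> (cat00 \<epsilon> lam sig e) 1
      (cat00_gen \<epsilon> lam sig e GenH) (cat00_gen \<epsilon> lam sig e GenA) (cat00_gen \<epsilon> lam sig e GenU)"
    by (rule cat00_Brauer_type)
qed

end
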